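(* Let $\Gamma$ be a non-uniform lattice in $\operatorname{PSL}(2,\mathbb R)$. Then there exists a constant $\gamma_0>0$ such that for any $0<\gamma<\gamma_0$, any one-parameter unipotent subgroup $\{u(t)\}_{t\in\mathbb R}$ of $\operatorname{PSL}(2,\mathbb R)$ and any $p\in\operatorname{PSL}(2,\mathbb R)/\Gamma$ which is not $\{u(t)\}_{t\in\mathbb R}$-periodic, the set $\{u(n^{1+\gamma})p:n\in\mathbb N\}$ is dense in $\operatorname{PSL}(2,\mathbb R)/\Gamma$.
   Context: A one-parameter unipotent subgroup $\{u(t)\}_{t\in\mathbb R}$ is a one-parameter subgroup of $\operatorname{PSL}(2,\mathbb R)$ such that $u(t)$ is unipotent (its only eigenvalue is $1$) for every $t$. A point $p\in\operatorname{PSL}(2,\mathbb R)/\Gamma$ is $\{u(t)\}$-periodic if $u(t)p=p$ for some $t\neq 0$. *)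

theory Defs
  imports "HOL-Analysis.Analysis"
begin

text \<open>SL(2,R) as a subset of the real 2x2 matrices. PSL(2,R) = SL(2,R)/{I,-I} is encoded
  through SL(2,R): a subgroup of PSL(2,R) corresponds to its preimage, a subgroup of SL(2,R)
  containing -I, and PSL(2,R)/Gamma is then literally the coset space SL(2,R)/preimage.\<close>

definition SL2 :: "(real^2^2) set" where
  "SL2 = {A. det A = 1}"

definition SL2_subgroup :: "(real^2^2) set \<Rightarrow> bool" where
  "SL2_subgroup \<Gamma> \<longleftrightarrow> \<Gamma> \<subseteq> SL2 \<and> mat 1 \<in> \<Gamma> \<and>
     (\<forall>a\<in>\<Gamma>. \<forall>b\<in>\<Gamma>. a ** b \<in> \<Gamma>) \<and> (\<forall>a\<in>\<Gamma>. matrix_inv a \<in> \<Gamma>)"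

definition lcoset :: "real^2^2 \<Rightarrow> (real^2^2) set \<Rightarrow> (real^2^2) set" where
  "lcoset g \<Gamma> = (\<lambda>x. g ** x) ` \<Gamma>"

definition cosets :: "(real^2^2) set \<Rightarrow> (real^2^2) set set" where
  "cosets \<Gamma> = {lcoset g \<Gamma> | g. g \<in> SL2}"

definition act :: "real^2^2 \<Rightarrow> (real^2^2) set \<Rightarrow> (real^2^2) set" where
  "act A p = (\<lambda>x. A ** x) ` p"

definition coset_top :: "(real^2^2) set \<Rightarrow> (real^2^2) set topology" where
  "coset_top \<Gamma> = topology (\<lambda>U. U \<subseteq> cosets \<Gamma> \<and>
      openin (top_of_set SL2) {g \<in> SL2. lcoset g \<Gamma> \<in> U})"

text \<open>Haar measure on SL(2,R), realised as the Lebesgue measure (on R^4) of the cone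
  {c A | 0 < c <= 1, A in E}; this is a bi-invariant Haar measure on SL(2,R).\<close>
definition haar_SL2 :: "(real^2^2) set \<Rightarrow> ennreal" where
  "haar_SL2 E = emeasure lborel {c *\<^sub>R A | c A. 0 < c \<and> c \<le> 1 \<and> A \<in> E}"

definition discrete_subgroup :: "(real^2^2) set \<Rightarrow> bool" where
  "discrete_subgroup \<Gamma> \<longleftrightarrow> SL2_subgroup \<Gamma> \<and>
     (\<forall>a\<in>\<Gamma>. \<exists>e>0. \<forall>b\<in>\<Gamma>. b \<noteq> a \<longrightarrow> e \<le> dist a b)"

definition lattice_SL2 :: "(real^2^2) set \<Rightarrow> bool" where
  "lattice_SL2 \<Gamma> \<longleftrightarrow> discrete_subgroup \<Gamma> \<and>
     (\<exists>F \<in> sets borel. F \<subseteq> SL2 \<and> (\<forall>g\<in>SL2. \<exists>f\<in>F. \<exists>\<gamma>\<in>\<Gamma>. g = f ** \<gamma>) \<and>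
        haar_SL2 F < \<infinity>)"

text \<open>A non-uniform lattice of PSL(2,R), given through its preimage in SL(2,R).\<close>
definition nonuniform_lattice_PSL2 :: "(real^2^2) set \<Rightarrow> bool" where
  "nonuniform_lattice_PSL2 \<Gamma> \<longleftrightarrow> lattice_SL2 \<Gamma> \<and> - mat 1 \<in> \<Gamma> \<and>
     \<not> compact_space (coset_top \<Gamma>)"

definition unipotent :: "real^2^2 \<Rightarrow> bool" where
  "unipotent A \<longleftrightarrow> (\<forall>z::complex.
     det ((\<chi> i j. (if i = j then z else 0) - complex_of_real (A $ i $ j)) :: complex^2^2) = 0
       \<longrightarrow> z = 1)"

text \<open>One-parameter unipotent subgroup (lifted from PSL(2,R) to SL(2,R)).\<close>
definition one_param_unipotent :: "(real \<Rightarrow> real^2^2) \<Rightarrow> bool" where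
  "one_param_unipotent u \<longleftrightarrow> continuous_on UNIV u \<and> (\<forall>t. u t \<in> SL2) \<and>
     (\<forall>s t. u (s + t) = u s ** u t) \<and> (\<forall>t. unipotent (u t))"

definition periodic_pt :: "(real \<Rightarrow> real^2^2) \<Rightarrow> (real^2^2) set \<Rightarrow> bool" where
  "periodic_pt u p \<longleftrightarrow> (\<exists>t. t \<noteq> 0 \<and> act (u t) p = p)"

end

theory Submission
  imports Defs
begin

text \<open>Everything happens in \<open>SL2\<close>, on right \<open>\<Gamma>\<close>-invariant sets; conjugation turns the unipotent
  subgroup into \<open>t \<mapsto> u(\<plusminus>t)\<close>, \<open>u\<close> upper triangular. Zassenhaus-type commutation shows that a
  nonperiodic \<open>g\<close> has arbitrarily large \<open>R\<close> for which \<open>diag(R\<^sup>-\<^sup>1\<^sup>/\<^sup>2, R\<^sup>1\<^sup>/\<^sup>2) g\<close> stays in a fixed thick part. By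
  nondivergence the time interval \<open>[0, R]\<close> then contains a window of length \<open>S\<^sup>4\<^sup>0\<close>, \<open>S \<approx> R\<^sup>\<gamma>\<^sup>/\<^sup>(\<^sup>1\<^sup>+\<^sup>\<gamma>\<^sup>)\<close>,
  that starts at a thick point after renormalisation and in which the times \<open>n\<^sup>1\<^sup>+\<^sup>\<gamma>\<close> are \<open>o(1)\<close>-close to an
  arithmetic progression of step \<open>s \<approx> S\<close>.

  Cut this window into \<open>S\<^sup>3\<^sup>0\<close> pieces of length \<open>L = S\<^sup>1\<^sup>0\<close>. By pigeonhole many pieces start at
  renormalised points that differ by matrices near 1 with lower left entry at most \<open>S\<^sup>-\<^sup>2\<^sup>0\<close>. Seen from
  one of these pieces, the progression in piece \<open>k\<close> becomes a progression of step \<open>s q\<^sub>k\<^sup>2\<close> on the same orbit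
  segment of length \<open>L\<close>, where \<open>q\<^sub>k\<close> is a diagonal entry. Counting elements of the discrete group shows
  that few pairs have nearly equal \<open>q\<^sub>k\<close>, so the progressions are nearly pairwise independent and, by a
  second moment estimate, small neighbourhoods of them fill almost all of the segment. But by ergodicity
  the segment spends a positive proportion of its time in a given open set, so one of the
  progressions hits that set.\<close>

section \<open>Two by two matrices\<close>

text \<open>No rate of mixing is used. Ergodicity only says that orbit segments spend a positive
  proportion of time in an open set, while one progression of step about S occupies a proportion
  about 1/S of a segment and could miss every visit. Hence many progressions are superposed on one
  segment: a set of positive proportion cannot avoid the union of enough nearly independent ones.
  Two progressions are nearly independent if their steps differ enough for the phase to drift
  through many periods along the segment, so everything rests on bounding the number of pairs with
  nearly equal steps, and there discreteness enters. The exponents: a frame error S^-20 costs S^-10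
  over a piece of length S^10; steps that differ by S^-7 drift by S^2 over S^9 terms, that is,
  through about S periods; S^22 classes leave at least about S^38 pairs inside classes, against S^36
  close ones, and the surplus S^2 beats the loss of a factor S that a correlated pair may cause. The
  curvature of n^(1+\<gamma>) over a window of length S^40 is harmless once n is of order at least
  S^200; as S is about n^\<gamma>, this is why \<gamma> must be small.\<close>

definition mat2 :: "real \<Rightarrow> real \<Rightarrow> real \<Rightarrow> real \<Rightarrow> real^2^2" where
  "mat2 a b c d = (\<chi> i j. if i = 1 then (if j = 1 then a else b) else (if j = 1 then c else d))"

lemma mat2_nth [simp]:
  "mat2 a b c d $ 1 $ 1 = a" "mat2 a b c d $ 1 $ 2 = b"
  "mat2 a b c d $ 2 $ 1 = c" "mat2 a b c d $ 2 $ 2 = d"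
  by (auto simp: mat2_def)

lemma mat2_eqI: "A $ 1 $ 1 = B $ 1 $ 1 \<Longrightarrow> A $ 1 $ 2 = B $ 1 $ 2 \<Longrightarrow> A $ 2 $ 1 = B $ 2 $ 1 \<Longrightarrow>
   A $ 2 $ 2 = B $ 2 $ 2 \<Longrightarrow> A = (B :: real^2^2)"
  by (auto simp: vec_eq_iff forall_2)

lemma mat2_collapse: "mat2 (A $ 1 $ 1) (A $ 1 $ 2) (A $ 2 $ 1) (A $ 2 $ 2) = A"
  by (rule mat2_eqI) auto

lemma mat2_cases: obtains a b c d where "A = mat2 a b c d"
  using mat2_collapse by metis

lemma mat2_inject [simp]: "mat2 a b c d = mat2 a' b' c' d' \<longleftrightarrow> a = a' \<and> b = b' \<and> c = c' \<and> d = d'"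
  by (metis mat2_nth)

lemma mult_nth [simp]:
  "(A ** B) $ 1 $ 1 = A $ 1 $ 1 * B $ 1 $ 1 + A $ 1 $ 2 * B $ 2 $ 1"
  "(A ** B) $ 1 $ 2 = A $ 1 $ 1 * B $ 1 $ 2 + A $ 1 $ 2 * B $ 2 $ 2"
  "(A ** B) $ 2 $ 1 = A $ 2 $ 1 * B $ 1 $ 1 + A $ 2 $ 2 * B $ 2 $ 1"
  "(A ** B) $ 2 $ 2 = A $ 2 $ 1 * B $ 1 $ 2 + A $ 2 $ 2 * B $ 2 $ 2"
  for A B :: "real^2^2"
  by (auto simp: matrix_matrix_mult_def sum_2)

lemma mat2_mult [simp]: "mat2 a b c d ** mat2 a' b' c' d' =
    mat2 (a*a' + b*c') (a*b' + b*d') (c*a' + d*c') (c*b' + d*d')"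
  by (rule mat2_eqI) auto

lemma mat_1_mat2: "mat 1 = mat2 1 0 0 1"
  by (rule mat2_eqI) (auto simp: mat_def)

lemma mat2_minus [simp]: "- mat2 a b c d = mat2 (-a) (-b) (-c) (-d)"
  by (rule mat2_eqI) auto

lemma mat2_diff [simp]: "mat2 a b c d - mat2 a' b' c' d' = mat2 (a-a') (b-b') (c-c') (d-d')"
  by (rule mat2_eqI) auto

lemma mat2_scaleR [simp]: "r *\<^sub>R mat2 a b c d = mat2 (r*a) (r*b) (r*c) (r*d)"
  by (rule mat2_eqI) auto

lemma det_mat2 [simp]: "det (mat2 a b c d) = a*d - b*c"
  by (simp add: det_2)

lemma mat2_in_SL2 [simp]: "mat2 a b c d \<in> SL2 \<longleftrightarrow> a*d - b*c = 1"
  by (simp add: SL2_def)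

lemma SL2_cases: assumes "A \<in> SL2" obtains a b c d where "A = mat2 a b c d" "a*d - b*c = 1"
  using assms mat2_in_SL2 mat2_cases by metis

lemma SL2_nth: "A \<in> SL2 \<longleftrightarrow> A $ 1 $ 1 * A $ 2 $ 2 - A $ 1 $ 2 * A $ 2 $ 1 = 1"
  by (simp add: SL2_def det_2)

lemma SL2_mult [simp]: "A \<in> SL2 \<Longrightarrow> B \<in> SL2 \<Longrightarrow> A ** B \<in> SL2"
  by (simp add: SL2_def det_mul)

lemma SL2_one [simp]: "mat 1 \<in> SL2"
  by (simp add: SL2_def)

text \<open>The adjugate. It is the inverse on \<open>SL2\<close>, and being polynomial in the
  entries it is continuous and reverses products without any side condition.\<close>

definition iv :: "real^2^2 \<Rightarrow> real^2^2" where
  "iv A = mat2 (A $ 2 $ 2) (- (A $ 1 $ 2)) (- (A $ 2 $ 1)) (A $ 1 $ 1)"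

lemma iv_mat2 [simp]: "iv (mat2 a b c d) = mat2 d (-b) (-c) a"
  by (simp add: iv_def)

lemma iv_nth [simp]:
  "iv A $ 1 $ 1 = A $ 2 $ 2" "iv A $ 1 $ 2 = - (A $ 1 $ 2)"
  "iv A $ 2 $ 1 = - (A $ 2 $ 1)" "iv A $ 2 $ 2 = A $ 1 $ 1"
  by (auto simp: iv_def)

lemma iv_SL2 [simp]: "A \<in> SL2 \<Longrightarrow> iv A \<in> SL2"
  by (simp add: SL2_nth algebra_simps)

lemma iv_right [simp]: "A \<in> SL2 \<Longrightarrow> A ** iv A = mat 1"
  by (elim SL2_cases) (simp add: mat_1_mat2 algebra_simps)

lemma iv_left [simp]: "A \<in> SL2 \<Longrightarrow> iv A ** A = mat 1"
  by (elim SL2_cases) (simp add: mat_1_mat2 algebra_simps)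

lemma iv_iv [simp]: "iv (iv A) = A"
  by (rule mat2_eqI) auto

lemma iv_mult: "iv (A ** B) = iv B ** iv A"
  by (rule mat2_eqI) (auto simp: algebra_simps)

lemma iv_left_assoc [simp]: "A \<in> SL2 \<Longrightarrow> iv A ** (A ** B) = B"
  by (metis iv_left matrix_mul_assoc matrix_mul_lid)

lemma iv_right_assoc [simp]: "A \<in> SL2 \<Longrightarrow> A ** (iv A ** B) = B"
  by (metis iv_right matrix_mul_assoc matrix_mul_lid)

lemma mult_iv_cancel [simp]: "A \<in> SL2 \<Longrightarrow> B ** A ** iv A = B"
  by (metis iv_right matrix_mul_assoc matrix_mul_rid)

lemma mult_iv_cancel' [simp]: "A \<in> SL2 \<Longrightarrow> B ** iv A ** A = B"
  by (metis iv_left matrix_mul_assoc matrix_mul_rid)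

lemma matrix_inv_SL2: "A \<in> SL2 \<Longrightarrow> matrix_inv A = iv A"
proof -
  assume A: "A \<in> SL2"
  have "A ** matrix_inv A = mat 1 \<and> matrix_inv A ** A = mat 1"
    unfolding matrix_inv_def
    by (rule someI[of "\<lambda>B. A ** B = mat 1 \<and> B ** A = mat 1" "iv A"]) (use A in auto)
  moreover have "iv A ** (A ** matrix_inv A) = matrix_inv A" using A by simp
  ultimately show ?thesis by (metis matrix_mul_rid)
qed

definition uu :: "real \<Rightarrow> real^2^2" where "uu t = mat2 1 t 0 1"
definition vv :: "real \<Rightarrow> real^2^2" where "vv t = mat2 1 0 t 1"
definition dg :: "real \<Rightarrow> real^2^2" where "dg l = mat2 l 0 0 (1/l)"

lemma uu_SL2 [simp]: "uu t \<in> SL2" and vv_SL2 [simp]: "vv t \<in> SL2"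
  and dg_SL2: "l \<noteq> 0 \<Longrightarrow> dg l \<in> SL2"
  by (auto simp: uu_def vv_def dg_def)

lemma uu_add: "uu s ** uu t = uu (s + t)" and vv_add: "vv s ** vv t = vv (s + t)"
  by (auto simp: uu_def vv_def algebra_simps)

lemma iv_uu [simp]: "iv (uu t) = uu (-t)" and iv_vv [simp]: "iv (vv t) = vv (-t)"
  by (auto simp: uu_def vv_def)

lemma uu_0 [simp]: "uu 0 = mat 1" and vv_0 [simp]: "vv 0 = mat 1" and dg_1 [simp]: "dg 1 = mat 1"
  by (auto simp: uu_def vv_def dg_def mat_1_mat2)

lemma dg_mult: "dg k ** dg l = dg (k * l)"
  by (auto simp: dg_def)

lemma iv_dg [simp]: "iv (dg l) = dg (1 / l)"
  by (auto simp: dg_def)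

lemma dg_uu: "l \<noteq> 0 \<Longrightarrow> dg l ** uu t = uu (l\<^sup>2 * t) ** dg l"
  by (auto simp: dg_def uu_def power2_eq_square)

lemma dg_vv: "l \<noteq> 0 \<Longrightarrow> dg l ** vv t = vv (t / l\<^sup>2) ** dg l"
  by (auto simp: dg_def vv_def power2_eq_square)

text \<open>Elimination with the nonzero lower left entry as pivot: the outer shears match the two
  diagonal entries, and the determinant then settles the upper right one.\<close>

lemma SL2_uvu:
  assumes "A \<in> SL2" "A $ 2 $ 1 \<noteq> 0"
  shows "A = uu ((A $ 1 $ 1 - 1) / A $ 2 $ 1) ** (vv (A $ 2 $ 1) ** uu ((A $ 2 $ 2 - 1) / A $ 2 $ 1))"
  using assms(1)
proof (cases rule: SL2_cases)
  case (1 a b c d)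
  with assms have "c \<noteq> 0" by simp
  moreover have "b = (a * d - 1) / c" using 1 \<open>c \<noteq> 0\<close> by (simp add: field_simps)
  ultimately show ?thesis using 1 by (simp add: uu_def vv_def field_simps)
qed

text \<open>Reduces properties of \<open>SL2\<close> to the two shear subgroups. If the lower left
  entry vanishes, \<open>SL2_uvu\<close> has no pivot; a factor \<open>vv 1\<close> creates one and
  is undone at the end.\<close>

lemma SL2_induct [consumes 1, case_names one uu vv]:
  assumes "A \<in> SL2" "P (mat 1)"
    "\<And>A t. A \<in> SL2 \<Longrightarrow> P A \<Longrightarrow> P (uu t ** A)" "\<And>A t. A \<in> SL2 \<Longrightarrow> P A \<Longrightarrow> P (vv t ** A)"
  shows "P A"
proof -
  have 1: "P A" if "A \<in> SL2" "A $ 2 $ 1 \<noteq> 0" for A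
  proof -
    have "P (uu t)" for t using assms(3)[of "mat 1" t] assms(2) by simp
    hence "P (uu s ** (vv c ** uu t))" for s c t using assms(3,4) by simp
    from this[of "(A $ 1 $ 1 - 1) / A $ 2 $ 1" "A $ 2 $ 1" "(A $ 2 $ 2 - 1) / A $ 2 $ 1"]
    show ?thesis by (simp only: SL2_uvu[OF that, symmetric])
  qed
  show ?thesis
  proof (cases "A $ 2 $ 1 = 0")
    case True
    have "A $ 1 $ 1 \<noteq> 0" using assms(1) True by (auto simp: SL2_nth)
    hence "(vv 1 ** A) $ 2 $ 1 \<noteq> 0" using True by (simp add: vv_def)
    hence "P (vv 1 ** A)" using assms(1) by (intro 1) auto
    hence "P (vv (-1) ** (vv 1 ** A))" using assms(4)[of "vv 1 ** A" "-1"] assms(1) by simp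
    thus ?thesis by (simp add: matrix_mul_assoc vv_add)
  next
    case False
    show ?thesis by (rule 1[OF assms(1) False])
  qed
qed

section \<open>Continuity, entrywise size and size modulo scalars\<close>

lemma continuous_on_mat2 [continuous_intros]:
  assumes "continuous_on S a" "continuous_on S b" "continuous_on S c" "continuous_on S d"
  shows "continuous_on S (\<lambda>x. mat2 (a x) (b x) (c x) (d x))"
proof -
  have "(\<lambda>x. mat2 (a x) (b x) (c x) (d x)) = (\<lambda>x. a x *\<^sub>R mat2 1 0 0 0 + b x *\<^sub>R mat2 0 1 0 0 +
     c x *\<^sub>R mat2 0 0 1 0 + d x *\<^sub>R mat2 0 0 0 1)"
    by (rule ext, rule mat2_eqI) auto
  thus ?thesis using assms by (elim ssubst) (intro continuous_intros)
qed

lemma continuous_on_matrix_mult [continuous_intros]: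
  fixes f g :: "'a::topological_space \<Rightarrow> real^2^2"
  assumes "continuous_on S f" "continuous_on S g"
  shows "continuous_on S (\<lambda>x. f x ** g x :: real^2^2)"
proof -
  have "f x ** g x = mat2 (f x $ 1 $ 1 * g x $ 1 $ 1 + f x $ 1 $ 2 * g x $ 2 $ 1)
    (f x $ 1 $ 1 * g x $ 1 $ 2 + f x $ 1 $ 2 * g x $ 2 $ 2)
    (f x $ 2 $ 1 * g x $ 1 $ 1 + f x $ 2 $ 2 * g x $ 2 $ 1)
    (f x $ 2 $ 1 * g x $ 1 $ 2 + f x $ 2 $ 2 * g x $ 2 $ 2)" for x
    by (rule mat2_eqI) auto
  thus ?thesis using assms by (simp only:) (intro continuous_intros)
qed

lemma continuous_on_iv [continuous_intros]:
  "continuous_on S f \<Longrightarrow> continuous_on S (\<lambda>x. iv (f x))"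
  unfolding iv_def by (intro continuous_intros)

lemma closed_SL2: "closed SL2"
proof -
  have "SL2 = {A. A $ 1 $ 1 * A $ 2 $ 2 - A $ 1 $ 2 * A $ 2 $ 1 = 1}"
    by (auto simp: SL2_nth)
  also have "closed \<dots>" by (intro closed_Collect_eq continuous_intros)
  finally show ?thesis .
qed

definition ent :: "real \<Rightarrow> real^2^2 \<Rightarrow> bool" where
  "ent m A \<longleftrightarrow> (\<forall>i j. \<bar>A $ i $ j\<bar> \<le> m)"

lemma ent_iff: "ent m A \<longleftrightarrow> \<bar>A $ 1 $ 1\<bar> \<le> m \<and> \<bar>A $ 1 $ 2\<bar> \<le> m \<and> \<bar>A $ 2 $ 1\<bar> \<le> m \<and> \<bar>A $ 2 $ 2\<bar> \<le> m"
  by (auto simp: ent_def forall_2)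

lemma ent_mat2: "ent m (mat2 a b c d) \<longleftrightarrow> \<bar>a\<bar> \<le> m \<and> \<bar>b\<bar> \<le> m \<and> \<bar>c\<bar> \<le> m \<and> \<bar>d\<bar> \<le> m"
  by (simp add: ent_iff)

lemma ent_mult: assumes "ent m A" "ent n B" shows "ent (2 * m * n) (A ** B)"
proof -
  have "\<bar>x * y + z * w\<bar> \<le> 2 * m * n" if "\<bar>x\<bar> \<le> m" "\<bar>z\<bar> \<le> m" "\<bar>y\<bar> \<le> n" "\<bar>w\<bar> \<le> n" for x y z w
  proof -
    have "0 \<le> m" using that(1) by linarith
    hence "\<bar>x\<bar> * \<bar>y\<bar> \<le> m * n" "\<bar>z\<bar> * \<bar>w\<bar> \<le> m * n"
      using mult_mono[OF that(1,3)] mult_mono[OF that(2,4)] by auto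
    thus ?thesis using abs_triangle_ineq[of "x * y" "z * w"] by (simp add: abs_mult)
  qed
  thus ?thesis using assms unfolding ent_iff mult_nth by blast
qed

lemma ent_iv: "ent m (iv A) \<longleftrightarrow> ent m A"
  by (auto simp: ent_iff)

lemma ent_mono: "ent m A \<Longrightarrow> m \<le> n \<Longrightarrow> ent n A"
  by (auto simp: ent_iff)

lemma norm_le_ent: assumes "ent m A" shows "norm A \<le> 4 * m"
proof -
  have "norm A \<le> (\<Sum>i\<in>UNIV. norm (A $ i))"
    unfolding norm_vec_def by (rule L2_set_le_sum) simp
  also have "\<dots> \<le> (\<Sum>i\<in>UNIV. \<Sum>j\<in>UNIV. \<bar>A $ i $ j\<bar>)"
    by (intro sum_mono norm_le_l1_cart)
  also have "\<dots> \<le> 4 * m" using assms by (simp add: sum_2 ent_iff)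
  finally show ?thesis .
qed

lemma ent_norm: "ent (norm A) A"
proof -
  have "\<bar>A $ i $ j\<bar> \<le> norm A" for i j
    using component_le_norm_cart[of "A $ i" j] Finite_Cartesian_Product.norm_nth_le[of A i] by linarith
  thus ?thesis by (simp add: ent_def)
qed

text \<open>Measures \<open>A\<close> modulo scalar matrices; in particular it does not distinguish \<open>A\<close> from \<open>- A\<close>.\<close>

definition nX :: "real^2^2 \<Rightarrow> real" where
  "nX A = max \<bar>A $ 1 $ 1 - A $ 2 $ 2\<bar> (max \<bar>A $ 1 $ 2\<bar> \<bar>A $ 2 $ 1\<bar>)"

lemma nX_mat2 [simp]: "nX (mat2 a b c d) = max \<bar>a - d\<bar> (max \<bar>b\<bar> \<bar>c\<bar>)"
  by (simp add: nX_def)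

lemma nX_nonneg: "nX A \<ge> 0"
  by (simp add: nX_def)

lemma nX_minus [simp]: "nX (- A) = nX A"
  by (cases A rule: mat2_cases) (auto simp: abs_minus_commute)

lemma nX_ent: assumes "ent m (A - mat 1)" shows "nX A \<le> 2 * m"
  using assms by (cases A rule: mat2_cases) (auto simp: ent_mat2 mat_1_mat2)

lemma continuous_on_nX [continuous_intros]:
  "continuous_on S f \<Longrightarrow> continuous_on S (\<lambda>x. nX (f x))"
  unfolding nX_def by (intro continuous_intros)

lemma SL2_nX_0: assumes "A \<in> SL2" "nX A = 0" shows "A = mat 1 \<or> A = - mat 1"
  using assms(1)
proof (cases rule: SL2_cases)
  case (1 a b c d)
  hence "a = d" "b = 0" "c = 0" using assms(2) by auto
  hence "a * a = 1" using 1 by simp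
  hence "a = 1 \<or> a = -1" using square_eq_1_iff by blast
  thus ?thesis using 1 \<open>a = d\<close> \<open>b = 0\<close> \<open>c = 0\<close> by (auto simp: mat_1_mat2)
qed

text \<open>Conjugation fixes the scalar part of A and acts on the rest by the adjoint
  representation, whose coefficients are quadratic in the entries of h. The scalar part cancels in
  every coordinate, so only \<open>nX A\<close> enters.\<close>

lemma nX_conj:
  assumes "h \<in> SL2" "ent m h" "m \<ge> 0"
  shows "nX (h ** A ** iv h) \<le> 8 * m\<^sup>2 * nX A"
proof -
  obtain p q r w where h: "h = mat2 p q r w" "p*w - q*r = 1" using assms(1) SL2_cases by blast
  obtain a b c d where A: "A = mat2 a b c d" by (rule mat2_cases)
  define n where "n = nX A"
  have n: "\<bar>a - d\<bar> \<le> n" "\<bar>b\<bar> \<le> n" "\<bar>c\<bar> \<le> n" by (auto simp: n_def A)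
  have m: "\<bar>p\<bar> \<le> m" "\<bar>q\<bar> \<le> m" "\<bar>r\<bar> \<le> m" "\<bar>w\<bar> \<le> m" using assms(2) by (auto simp: h ent_mat2)
  have "\<bar>x * y * z\<bar> \<le> m\<^sup>2 * n" if "\<bar>x\<bar> \<le> m" "\<bar>y\<bar> \<le> m" "\<bar>z\<bar> \<le> n" for x y z
    unfolding abs_mult power2_eq_square using that assms(3) by (intro mult_mono mult_nonneg_nonneg; simp)
  hence t: "x * y * z \<le> m\<^sup>2 * n" "- (x * y * z) \<le> m\<^sup>2 * n"
    if "\<bar>x\<bar> \<le> m" "\<bar>y\<bar> \<le> m" "\<bar>z\<bar> \<le> n" for x y z
    using that by (meson abs_le_D1 abs_le_D2)+
  have e: "h ** A ** iv h = mat2 ((p*a + q*c)*w - (p*b + q*d)*r) (- (p*a + q*c)*q + (p*b+q*d)*p)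
     ((r*a + w*c)*w - (r*b+w*d)*r) (-(r*a+w*c)*q + (r*b+w*d)*p)"
    by (simp add: h A algebra_simps)
  have e1: "((p*a + q*c)*w - (p*b + q*d)*r) - (-(r*a+w*c)*q + (r*b+w*d)*p)
     = p*w*(a-d) + q*r*(a-d) + 2 * (q*w*c) - 2 * (p*r*b)" by (simp add: algebra_simps)
  have e2: "- (p*a + q*c)*q + (p*b+q*d)*p = p*p*b - q*q*c - p*q*(a-d)" by (simp add: algebra_simps)
  have e3: "(r*a + w*c)*w - (r*b+w*d)*r = w*w*c - r*r*b + r*w*(a-d)" by (simp add: algebra_simps)
  have p: "0 \<le> m\<^sup>2 * n" using nX_nonneg[of A] by (simp add: n_def)
  have b1: "\<bar>p*w*(a-d) + q*r*(a-d) + 2 * (q*w*c) - 2 * (p*r*b)\<bar> \<le> 8 * m\<^sup>2 * n"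
    by (rule abs_leI; insert p t[OF m(1,4) n(1)] t[OF m(2,3) n(1)] t[OF m(2,4) n(3)] t[OF m(1,3) n(2)]; linarith)
  have b2: "\<bar>p*p*b - q*q*c - p*q*(a-d)\<bar> \<le> 8 * m\<^sup>2 * n"
    by (rule abs_leI; insert p t[OF m(1,1) n(2)] t[OF m(2,2) n(3)] t[OF m(1,2) n(1)]; linarith)
  have b3: "\<bar>w*w*c - r*r*b + r*w*(a-d)\<bar> \<le> 8 * m\<^sup>2 * n"
    by (rule abs_leI; insert p t[OF m(4,4) n(3)] t[OF m(3,3) n(2)] t[OF m(3,4) n(1)]; linarith)
  show ?thesis unfolding e nX_mat2 e1 e2 e3 n_def[symmetric] using b1 b2 b3 by simp
qed

section \<open>Haar measure\<close>

lemma Basis_mat2: "(Basis :: (real^2^2) set) = {mat2 1 0 0 0, mat2 0 1 0 0, mat2 0 0 1 0, mat2 0 0 0 1}"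
proof -
  have "axis 1 (axis 1 1) = mat2 1 0 0 0" "axis 1 (axis 2 1) = mat2 0 1 0 0"
    "axis 2 (axis 1 1) = mat2 0 0 1 0" "axis 2 (axis 2 1) = mat2 0 0 0 1"
    by (auto intro!: mat2_eqI simp: axis_def)
  thus ?thesis unfolding Basis_vec_def UNIV_2 by auto
qed

lemma inner_mat2: "M \<bullet> mat2 a b c d = M $ 1 $ 1 * a + M $ 1 $ 2 * b + M $ 2 $ 1 * c + M $ 2 $ 2 * d"
  by (simp add: inner_vec_def sum_2)

text \<open>Left multiplication mixes the rows of a matrix, right multiplication its columns. Read
  through \<open>of_rows\<close> or \<open>of_cols\<close>, multiplication by \<open>uu t\<close> or
  \<open>vv t\<close> becomes a shear of a product of two planes, to which Fubini applies.\<close>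

definition of_rows :: "(real \<times> real) \<times> (real \<times> real) \<Rightarrow> real^2^2" where
  "of_rows x = mat2 (fst (fst x)) (snd (fst x)) (fst (snd x)) (snd (snd x))"

definition of_cols :: "(real \<times> real) \<times> (real \<times> real) \<Rightarrow> real^2^2" where
  "of_cols x = mat2 (fst (fst x)) (fst (snd x)) (snd (fst x)) (snd (snd x))"

lemma of_rows_measurable [measurable]: "of_rows \<in> borel_measurable borel"
  and of_cols_measurable [measurable]: "of_cols \<in> borel_measurable borel"
  unfolding of_rows_def of_cols_def
  by (intro borel_measurable_continuous_onI continuous_intros)+

lemma Basis_4: "(Basis :: ((real \<times> real) \<times> (real \<times> real)) set) = {((1,0),0), ((0,1),0), (0,(1,0)), (0,(0,1))}"
  by (auto simp: Basis_prod_def zero_prod_def)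

lemma distr_of_rows: "distr lborel borel of_rows = lborel"
proof (rule lborel_eqI[symmetric])
  fix l u :: "real^2^2" assume lu: "\<And>b. b \<in> Basis \<Longrightarrow> l \<bullet> b \<le> u \<bullet> b"
  have "of_rows -` box l u = box ((l$1$1, l$1$2), (l$2$1, l$2$2)) ((u$1$1, u$1$2), (u$2$1, u$2$2))"
    by (auto simp: box_def Basis_mat2 Basis_4 inner_mat2 of_rows_def zero_prod_def)
  moreover have "l$1$1 \<le> u$1$1" "l$1$2 \<le> u$1$2" "l$2$1 \<le> u$2$1" "l$2$2 \<le> u$2$2"
    using lu unfolding Basis_mat2 by (force simp: inner_mat2)+
  ultimately show "emeasure (distr lborel borel of_rows) (box l u) = ennreal (\<Prod>b\<in>Basis. (u - l) \<bullet> b)"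
    by (simp add: emeasure_distr emeasure_lborel_box_eq Basis_4 Basis_mat2 inner_mat2
       zero_prod_def mult_ac)
qed simp

lemma distr_of_cols: "distr lborel borel of_cols = lborel"
proof (rule lborel_eqI[symmetric])
  fix l u :: "real^2^2" assume lu: "\<And>b. b \<in> Basis \<Longrightarrow> l \<bullet> b \<le> u \<bullet> b"
  have "of_cols -` box l u = box ((l$1$1, l$2$1), (l$1$2, l$2$2)) ((u$1$1, u$2$1), (u$1$2, u$2$2))"
    by (auto simp: box_def Basis_mat2 Basis_4 inner_mat2 of_cols_def zero_prod_def)
  moreover have "l$1$1 \<le> u$1$1" "l$1$2 \<le> u$1$2" "l$2$1 \<le> u$2$1" "l$2$2 \<le> u$2$2"
    using lu unfolding Basis_mat2 by (force simp: inner_mat2)+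
  ultimately show "emeasure (distr lborel borel of_cols) (box l u) = ennreal (\<Prod>b\<in>Basis. (u - l) \<bullet> b)"
    by (simp add: emeasure_distr emeasure_lborel_box_eq Basis_4 Basis_mat2 inner_mat2
       zero_prod_def mult_ac)
qed simp

lemma emeasure_lborel_translate:
  fixes c :: "'a::euclidean_space"
  assumes "B \<in> sets borel"
  shows "emeasure lborel {x. x + c \<in> B} = emeasure lborel B"
proof -
  have "emeasure lborel B = emeasure (distr lborel borel ((+) c)) B"
    by (simp add: lborel_distr_plus)
  also have "\<dots> = emeasure lborel {x. x + c \<in> B}"
    using assms by (subst emeasure_distr) (auto simp: add.commute vimage_def)
  finally show ?thesis ..
qed

text \<open>Fubini: with the second coordinate fixed, the map is a translation of the first.\<close>

lemma distr_shear1: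
  fixes t :: real
  shows "distr lborel borel (\<lambda>x::'a::euclidean_space \<times> 'a. (fst x + t *\<^sub>R snd x, snd x)) = lborel"
proof (rule measure_eqI)
  fix A :: "('a \<times> 'a) set" assume "A \<in> sets (distr lborel borel (\<lambda>x. (fst x + t *\<^sub>R snd x, snd x)))"
  hence A: "A \<in> sets borel" by simp
  have m: "(\<lambda>x::'a \<times> 'a. (fst x + t *\<^sub>R snd x, snd x)) \<in> borel_measurable borel"
    by (intro borel_measurable_continuous_onI continuous_intros)
  have A1: "A \<in> sets (lborel \<Otimes>\<^sub>M lborel)" unfolding lborel_prod using A by simp
  have A2: "(\<lambda>x. (fst x + t *\<^sub>R snd x, snd x)) -` A \<in> sets (lborel \<Otimes>\<^sub>M lborel)"
    unfolding lborel_prod using measurable_sets[OF m A] by simp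
  have sec: "(\<lambda>x. (x, y)) -` A \<in> sets borel" for y
    using sets_Pair2[OF A1] by simp
  have "emeasure (distr lborel borel (\<lambda>x. (fst x + t *\<^sub>R snd x, snd x))) A
      = emeasure (lborel \<Otimes>\<^sub>M lborel) ((\<lambda>x. (fst x + t *\<^sub>R snd x, snd x)) -` A)"
    unfolding lborel_prod using A m by (subst emeasure_distr) auto
  also have "\<dots> = (\<integral>\<^sup>+y. emeasure lborel ((\<lambda>x. (x, y)) -` (\<lambda>x. (fst x + t *\<^sub>R snd x, snd x)) -` A) \<partial>lborel)"
    by (rule lborel_pair.emeasure_pair_measure_alt2[OF A2])
  also have "\<dots> = (\<integral>\<^sup>+y. emeasure lborel ((\<lambda>x. (x, y)) -` A) \<partial>lborel)"
  proof (rule nn_integral_cong)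
    fix y :: 'a
    show "emeasure lborel ((\<lambda>x. (x, y)) -` (\<lambda>x. (fst x + t *\<^sub>R snd x, snd x)) -` A) = emeasure lborel ((\<lambda>x. (x, y)) -` A)"
      using emeasure_lborel_translate[OF sec[of y], of "t *\<^sub>R y"] by (simp add: vimage_def)
  qed
  also have "\<dots> = emeasure (lborel \<Otimes>\<^sub>M lborel) A"
    by (rule lborel_pair.emeasure_pair_measure_alt2[OF A1, symmetric])
  finally show "emeasure (distr lborel borel (\<lambda>x. (fst x + t *\<^sub>R snd x, snd x))) A = emeasure lborel A"
    by (simp add: lborel_prod)
qed simp

lemma distr_shear2:
  fixes t :: real
  shows "distr lborel borel (\<lambda>x::'a::euclidean_space \<times> 'a. (fst x, snd x + t *\<^sub>R fst x)) = lborel"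
proof (rule measure_eqI)
  fix A :: "('a \<times> 'a) set" assume "A \<in> sets (distr lborel borel (\<lambda>x. (fst x, snd x + t *\<^sub>R fst x)))"
  hence A: "A \<in> sets borel" by simp
  have m: "(\<lambda>x::'a \<times> 'a. (fst x, snd x + t *\<^sub>R fst x)) \<in> borel_measurable borel"
    by (intro borel_measurable_continuous_onI continuous_intros)
  have A1: "A \<in> sets (lborel \<Otimes>\<^sub>M lborel)" unfolding lborel_prod using A by simp
  have A2: "(\<lambda>x. (fst x, snd x + t *\<^sub>R fst x)) -` A \<in> sets (lborel \<Otimes>\<^sub>M lborel)"
    unfolding lborel_prod using measurable_sets[OF m A] by simp
  have sec: "Pair y -` A \<in> sets borel" for y
    using sets_Pair1[OF A1] by simp
  have "emeasure (distr lborel borel (\<lambda>x. (fst x, snd x + t *\<^sub>R fst x))) A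
      = emeasure (lborel \<Otimes>\<^sub>M lborel) ((\<lambda>x. (fst x, snd x + t *\<^sub>R fst x)) -` A)"
    unfolding lborel_prod using A m by (subst emeasure_distr) auto
  also have "\<dots> = (\<integral>\<^sup>+y. emeasure lborel (Pair y -` (\<lambda>x. (fst x, snd x + t *\<^sub>R fst x)) -` A) \<partial>lborel)"
    by (rule lborel.emeasure_pair_measure_alt[OF A2])
  also have "\<dots> = (\<integral>\<^sup>+y. emeasure lborel (Pair y -` A) \<partial>lborel)"
  proof (rule nn_integral_cong)
    fix y :: 'a
    show "emeasure lborel (Pair y -` (\<lambda>x. (fst x, snd x + t *\<^sub>R fst x)) -` A) = emeasure lborel (Pair y -` A)"
      using emeasure_lborel_translate[OF sec[of y], of "t *\<^sub>R y"] by (simp add: vimage_def)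
  qed
  also have "\<dots> = emeasure (lborel \<Otimes>\<^sub>M lborel) A"
    by (rule lborel.emeasure_pair_measure_alt[OF A1, symmetric])
  finally show "emeasure (distr lborel borel (\<lambda>x. (fst x, snd x + t *\<^sub>R fst x))) A = emeasure lborel A"
    by (simp add: lborel_prod)
qed simp

lemma distr_lborel_conjugate:
  fixes S :: "'a::euclidean_space \<Rightarrow> 'a" and T :: "'a \<Rightarrow> 'b::euclidean_space"
  assumes "distr lborel borel T = lborel" "distr lborel borel S = lborel"
    "S \<in> borel_measurable borel" "T \<in> borel_measurable borel" "F \<in> borel_measurable borel"
    "\<And>x. F (T x) = T (S x)"
  shows "distr lborel borel F = lborel"
proof -
  have "distr lborel borel F = distr (distr lborel borel T) borel F" by (simp add: assms(1))
  also have "\<dots> = distr lborel borel (F \<circ> T)"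
    using assms by (intro distr_distr) auto
  also have "F \<circ> T = T \<circ> S" using assms(6) by auto
  also have "distr lborel borel (T \<circ> S) = distr (distr lborel borel S) borel T"
    using assms by (intro distr_distr[symmetric]) auto
  also have "\<dots> = lborel" by (simp add: assms)
  finally show ?thesis .
qed

lemma mult_left_measurable [measurable]: "(\<lambda>M::real^2^2. (A::real^2^2) ** M) \<in> borel_measurable borel"
  by (intro borel_measurable_continuous_onI continuous_intros)

lemma mult_right_measurable [measurable]: "(\<lambda>M::real^2^2. M ** (A::real^2^2)) \<in> borel_measurable borel"
  by (intro borel_measurable_continuous_onI continuous_intros)

lemma distr_lborel_uu_left: "distr lborel borel (\<lambda>M::real^2^2. uu t ** M) = lborel"
  by (rule distr_lborel_conjugate[OF distr_of_rows distr_shear1[of t] _ of_rows_measurable])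
     (auto simp: of_rows_def uu_def intro!: borel_measurable_continuous_onI continuous_intros)

lemma distr_lborel_vv_left: "distr lborel borel (\<lambda>M::real^2^2. vv t ** M) = lborel"
  by (rule distr_lborel_conjugate[OF distr_of_rows distr_shear2[of t] _ of_rows_measurable])
     (auto simp: of_rows_def vv_def intro!: borel_measurable_continuous_onI continuous_intros)

lemma distr_lborel_uu_right: "distr lborel borel (\<lambda>M::real^2^2. M ** uu t) = lborel"
  by (rule distr_lborel_conjugate[OF distr_of_cols distr_shear2[of t] _ of_cols_measurable])
     (auto simp: of_cols_def uu_def intro!: borel_measurable_continuous_onI continuous_intros)

lemma distr_lborel_vv_right: "distr lborel borel (\<lambda>M::real^2^2. M ** vv t) = lborel"
  by (rule distr_lborel_conjugate[OF distr_of_cols distr_shear1[of t] _ of_cols_measurable])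
     (auto simp: of_cols_def vv_def intro!: borel_measurable_continuous_onI continuous_intros)

lemma distr_lborel_comp:
  fixes F G :: "'a::euclidean_space \<Rightarrow> 'a"
  assumes "distr lborel borel F = lborel" "distr lborel borel G = lborel"
    "F \<in> borel_measurable borel" "G \<in> borel_measurable borel"
  shows "distr lborel borel (F \<circ> G) = lborel"
proof -
  have "distr lborel borel (F \<circ> G) = distr (distr lborel borel G) borel F"
    using assms by (intro distr_distr[symmetric]) auto
  thus ?thesis by (simp add: assms)
qed

lemma distr_lborel_SL2_left: "A \<in> SL2 \<Longrightarrow> distr lborel borel (\<lambda>M::real^2^2. A ** M) = lborel"
proof (induction rule: SL2_induct)
  case one
  have "(\<lambda>M. mat 1 ** M :: real^2^2) = (\<lambda>M. M)" by auto
  thus ?case by (simp add: distr_id2)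
next
  case (uu A t)
  have "(\<lambda>M::real^2^2. (uu t ** A) ** M) = (\<lambda>M. uu t ** M) \<circ> (\<lambda>M. A ** M)" by (auto simp: fun_eq_iff matrix_mul_assoc)
  thus ?case using distr_lborel_comp[OF distr_lborel_uu_left uu(2) mult_left_measurable mult_left_measurable] by (simp add: o_def)
next
  case (vv A t)
  have "(\<lambda>M::real^2^2. (vv t ** A) ** M) = (\<lambda>M. vv t ** M) \<circ> (\<lambda>M. A ** M)" by (auto simp: fun_eq_iff matrix_mul_assoc)
  thus ?case using distr_lborel_comp[OF distr_lborel_vv_left vv(2) mult_left_measurable mult_left_measurable] by (simp add: o_def)
qed

lemma distr_lborel_SL2_right: "A \<in> SL2 \<Longrightarrow> distr lborel borel (\<lambda>M::real^2^2. M ** A) = lborel"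
proof (induction rule: SL2_induct)
  case one
  have "(\<lambda>M. M ** mat 1 :: real^2^2) = (\<lambda>M. M)" by auto
  thus ?case by (simp add: distr_id2)
next
  case (uu A t)
  have "(\<lambda>M::real^2^2. M ** (uu t ** A)) = (\<lambda>M. M ** A) \<circ> (\<lambda>M. M ** uu t)" by (auto simp: fun_eq_iff matrix_mul_assoc)
  thus ?case using distr_lborel_comp[OF uu(2) distr_lborel_uu_right mult_right_measurable mult_right_measurable] by simp
next
  case (vv A t)
  have "(\<lambda>M::real^2^2. M ** (vv t ** A)) = (\<lambda>M. M ** A) \<circ> (\<lambda>M. M ** vv t)" by (auto simp: fun_eq_iff matrix_mul_assoc)
  thus ?case using distr_lborel_comp[OF vv(2) distr_lborel_vv_right mult_right_measurable mult_right_measurable] by simp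
qed

definition cone :: "(real^2^2) set" where "cone = {M. 0 < det M \<and> det M \<le> 1}"

text \<open>The set function \<open>haar_SL2\<close> as a genuine measure: Lebesgue measure on the
  cone, pushed along rays to \<open>SL2\<close>. It lives on all matrices but is concentrated on
  \<open>SL2\<close>, so that plain Borel sets can be used throughout.\<close>

definition haar :: "(real^2^2) measure" where
  "haar = distr (restrict_space lborel cone) borel (\<lambda>M. (1 / sqrt (det M)) *\<^sub>R M)"

lemma sets_haar [simp, measurable_cong]: "sets haar = sets borel"
  and space_haar [simp]: "space haar = UNIV"
  by (auto simp: haar_def)

lemma det_measurable [measurable]: "(det :: real^2^2 \<Rightarrow> real) \<in> borel_measurable borel"
  unfolding det_2 by (intro borel_measurable_continuous_onI continuous_intros)

lemma cone_sets [measurable]: "cone \<in> sets borel"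
  unfolding cone_def by measurable

lemma emeasure_haar: assumes "E \<in> sets borel"
  shows "emeasure haar E = emeasure lborel {M \<in> cone. (1 / sqrt (det M)) *\<^sub>R M \<in> E}"
proof -
  have "emeasure haar E = emeasure (restrict_space lborel cone)
     ((\<lambda>M. (1 / sqrt (det M)) *\<^sub>R M) -` E \<inter> cone)"
    unfolding haar_def using assms
    by (subst emeasure_distr) (auto simp: space_restrict_space intro!: measurable_restrict_space1)
  also have "\<dots> = emeasure lborel ((\<lambda>M. (1 / sqrt (det M)) *\<^sub>R M) -` E \<inter> cone)"
    by (subst emeasure_restrict_space) auto
  finally show ?thesis by (simp add: vimage_def Int_def conj_commute)
qed

lemma det_scaleR2: "det (c *\<^sub>R M) = c\<^sup>2 * det (M :: real^2^2)"
  by (simp add: det_2 power2_eq_square algebra_simps)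

lemma normalize_SL2: "M \<in> cone \<Longrightarrow> (1 / sqrt (det M)) *\<^sub>R M \<in> SL2"
  by (simp add: SL2_def det_scaleR2 cone_def power_divide)

text \<open>A matrix in the cone lies on the ray through exactly one element of \<open>SL2\<close>,
  at height \<open>sqrt (det M)\<close>, so the radial preimage of E is the cone over E.\<close>

lemma haar_SL2_eq: assumes "E \<in> sets borel" "E \<subseteq> SL2"
  shows "haar_SL2 E = emeasure haar E"
proof -
  have "{M \<in> cone. (1 / sqrt (det M)) *\<^sub>R M \<in> E} = {c *\<^sub>R A | c A. 0 < c \<and> c \<le> 1 \<and> A \<in> E}"
  proof safe
    fix M assume M: "M \<in> cone" "(1 / sqrt (det M)) *\<^sub>R M \<in> E"
    show "\<exists>c A. M = c *\<^sub>R A \<and> 0 < c \<and> c \<le> 1 \<and> A \<in> E"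
      using M by (intro exI[of _ "sqrt (det M)"] exI[of _ "(1 / sqrt (det M)) *\<^sub>R M"]) (auto simp: cone_def)
  next
    fix c :: real and A assume c: "0 < c" "c \<le> 1" and A: "A \<in> E"
    hence "det A = 1" using assms by (auto simp: SL2_def)
    hence d: "det (c *\<^sub>R A) = c\<^sup>2" by (simp add: det_scaleR2)
    show "c *\<^sub>R A \<in> cone" using c d by (auto simp: cone_def abs_square_le_1)
    show "(1 / sqrt (det (c *\<^sub>R A))) *\<^sub>R c *\<^sub>R A \<in> E" using c A unfolding d by simp
  qed
  thus ?thesis using assms by (simp add: emeasure_haar haar_SL2_def)
qed

lemma scaleR_mult_left: "(c *\<^sub>R A) ** B = c *\<^sub>R (A ** B)" for A B :: "real^2^2"
  by (cases A rule: mat2_cases, cases B rule: mat2_cases) (simp add: algebra_simps)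

lemma scaleR_mult_right: "A ** (c *\<^sub>R B) = c *\<^sub>R (A ** B)" for A B :: "real^2^2"
  by (cases A rule: mat2_cases, cases B rule: mat2_cases) (simp add: algebra_simps)

text \<open>Multiplication by g preserves determinants and commutes with rescaling, hence with the
  radial projection; what remains is the invariance of Lebesgue measure.\<close>

lemma emeasure_haar_left:
  assumes g: "g \<in> SL2" and E: "E \<in> sets borel"
  shows "emeasure haar {x. g ** x \<in> E} = emeasure haar E"
proof -
  let ?n = "\<lambda>M::real^2^2. (1 / sqrt (det M)) *\<^sub>R M"
  have E': "{x. g ** x \<in> E} \<in> sets borel"
    using measurable_sets[OF mult_left_measurable E, of g] by (simp add: vimage_def)
  have dg: "det (g ** M) = det M" for M using g by (simp add: det_mul SL2_def)
  have S: "{M \<in> cone. ?n M \<in> E} \<in> sets borel" using E by measurable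
  have "emeasure haar E = emeasure (distr lborel borel (\<lambda>M::real^2^2. g ** M)) {M \<in> cone. ?n M \<in> E}"
    using E by (simp add: emeasure_haar distr_lborel_SL2_left[OF g])
  also have "\<dots> = emeasure lborel {M \<in> cone. g ** ?n M \<in> E}"
    using S by (subst emeasure_distr) (auto simp: vimage_def cone_def dg scaleR_mult_right)
  finally show ?thesis using E' by (simp add: emeasure_haar)
qed

lemma emeasure_haar_right:
  assumes g: "g \<in> SL2" and E: "E \<in> sets borel"
  shows "emeasure haar {x. x ** g \<in> E} = emeasure haar E"
proof -
  let ?n = "\<lambda>M::real^2^2. (1 / sqrt (det M)) *\<^sub>R M"
  have E': "{x. x ** g \<in> E} \<in> sets borel"
    using measurable_sets[OF mult_right_measurable E, of g] by (simp add: vimage_def)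
  have dg: "det (M ** g) = det M" for M using g by (simp add: det_mul SL2_def)
  have S: "{M \<in> cone. ?n M \<in> E} \<in> sets borel" using E by measurable
  have "emeasure haar E = emeasure (distr lborel borel (\<lambda>M::real^2^2. M ** g)) {M \<in> cone. ?n M \<in> E}"
    using E by (simp add: emeasure_haar distr_lborel_SL2_right[OF g])
  also have "\<dots> = emeasure lborel {M \<in> cone. ?n M ** g \<in> E}"
    using S by (subst emeasure_distr) (auto simp: vimage_def cone_def dg scaleR_mult_left)
  finally show ?thesis using E' by (simp add: emeasure_haar)
qed

text \<open>Half of a point g of U in \<open>SL2\<close> has determinant 1/4 and so lies inside the
  cone. There the radial preimage of U is open, and nonempty open sets have positive Lebesgue
  measure.\<close>

lemma haar_open_pos:
  assumes "open U" "U \<inter> SL2 \<noteq> {}"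
  shows "emeasure haar U > 0"
proof -
  obtain g where g: "g \<in> U" "g \<in> SL2" using assms(2) by auto
  let ?n = "\<lambda>M::real^2^2. (1 / sqrt (det M)) *\<^sub>R M"
  define D where "D = {M::real^2^2. 0 < det M \<and> det M < 1}"
  have oD: "open D" unfolding D_def det_2
    by (intro open_Collect_conj open_Collect_less continuous_intros)
  have cn: "continuous_on D ?n"
  proof (intro continuous_intros)
    show "continuous_on D (det :: real^2^2 \<Rightarrow> real)" unfolding det_2 by (intro continuous_intros)
    show "\<forall>x\<in>D. sqrt (det x) \<noteq> 0" by (auto simp: D_def)
  qed
  have o: "open (D \<inter> ?n -` U)"
    by (rule continuous_open_preimage[OF cn oD assms(1)])
  have d: "det ((1/2) *\<^sub>R g) = 1/4" using g(2) by (simp add: det_scaleR2 SL2_def power2_eq_square)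
  have "?n ((1/2) *\<^sub>R g) \<in> U" unfolding d using g(1) by (simp add: real_sqrt_divide)
  moreover have "(1/2) *\<^sub>R g \<in> D" using d by (simp add: D_def)
  ultimately have "(1/2) *\<^sub>R g \<in> D \<inter> ?n -` U" by blast
  hence "\<not> negligible (D \<inter> ?n -` U)" using o open_not_negligible by blast
  hence "emeasure lebesgue (D \<inter> ?n -` U) \<noteq> 0"
    using o by (auto simp: negligible_iff_null_sets null_sets_def)
  hence "emeasure lborel (D \<inter> ?n -` U) \<noteq> 0" using o by simp
  moreover have U: "U \<in> sets borel" using assms(1) by simp
  have "emeasure lborel (D \<inter> ?n -` U) \<le> emeasure lborel {M \<in> cone. ?n M \<in> U}"
  proof (rule emeasure_mono)
    show "{M \<in> cone. ?n M \<in> U} \<in> sets lborel" using U by measurable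
  qed (auto simp: D_def cone_def)
  hence "emeasure lborel (D \<inter> ?n -` U) \<le> emeasure haar U" by (simp only: emeasure_haar[OF U])
  ultimately show ?thesis by (auto simp: zero_less_iff_neq_zero)
qed

text \<open>\<open>nX\<close> forgets the scalar part, but the determinant recovers it: ad = 1 + bc
  \<le> 2 together with a bounded difference a - d bounds both diagonal entries.\<close>

lemma nX_bound:
  assumes "A \<in> SL2" "nX A \<le> 1"
  shows "ent 3 A"
  using assms(1)
proof (cases rule: SL2_cases)
  case (1 a b c d)
  have h: "\<bar>a - d\<bar> \<le> 1" "\<bar>b\<bar> \<le> 1" "\<bar>c\<bar> \<le> 1" using assms(2) by (auto simp: 1)
  have "\<bar>b\<bar> * \<bar>c\<bar> \<le> 1" using h mult_mono[OF h(2,3)] by simp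
  hence "\<bar>b * c\<bar> \<le> 1" by (simp add: abs_mult)
  hence bc: "a * d \<le> 2" using 1 by linarith
  have "(a - d)\<^sup>2 \<le> 1" using h(1) by (simp add: abs_square_le_1)
  hence "a\<^sup>2 + d\<^sup>2 \<le> 9" using bc by (simp add: power2_diff)
  hence "a\<^sup>2 \<le> 9" "d\<^sup>2 \<le> 9"
    using zero_le_power2[of a] zero_le_power2[of d] by linarith+
  hence "a\<^sup>2 \<le> 3\<^sup>2" "d\<^sup>2 \<le> 3\<^sup>2" by simp_all
  hence "\<bar>a\<bar> \<le> 3" "\<bar>d\<bar> \<le> 3" using abs_le_square_iff[of _ 3] by (metis abs_numeral)+
  thus ?thesis using h 1 by (simp add: ent_mat2)
qed

lemma ent_diff_one: assumes "ent k (A - mat 1)" shows "ent (1 + k) A"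
proof -
  have "\<bar>x\<bar> \<le> 1 + k" if "\<bar>x - 1\<bar> \<le> k" for x :: real using that by linarith
  moreover have "\<bar>x\<bar> \<le> 1 + k" if "\<bar>x\<bar> \<le> k" for x :: real using that by linarith
  ultimately show ?thesis using assms by (cases A rule: mat2_cases) (simp add: ent_mat2 mat_1_mat2)
qed

lemma ent_triangle: assumes "ent m (A - C)" "ent n (B - C)" shows "ent (m + n) (A - B)"
proof -
  have "\<bar>x - y\<bar> \<le> m + n" if "\<bar>x - z\<bar> \<le> m" "\<bar>y - z\<bar> \<le> n" for x y z :: real
    using that by linarith
  thus ?thesis using assms unfolding ent_iff vector_minus_component by blast
qed

lemma matrix_diff_ldistrib2: "A ** (B - C) = A ** B - A ** C" for A B C :: "real^2^2"
  by (rule mat2_eqI) (auto simp: algebra_simps)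

lemma conj_iv: "g \<in> SL2 \<Longrightarrow> iv g ** (g ** A ** iv g) ** g = A"
  by (simp add: matrix_mul_assoc[symmetric])

section \<open>The quotient by a lattice\<close>

locale lattice =
  fixes \<Gamma> :: "(real^2^2) set"
  assumes lat: "lattice_SL2 \<Gamma>" and neg_one: "- mat 1 \<in> \<Gamma>"
begin

lemma \<Gamma>_SL2: "\<gamma> \<in> \<Gamma> \<Longrightarrow> \<gamma> \<in> SL2"
  and \<Gamma>_one: "mat 1 \<in> \<Gamma>"
  and \<Gamma>_mult: "a \<in> \<Gamma> \<Longrightarrow> b \<in> \<Gamma> \<Longrightarrow> a ** b \<in> \<Gamma>"
  using lat by (auto simp: lattice_SL2_def discrete_subgroup_def SL2_subgroup_def)

lemma \<Gamma>_iv: "a \<in> \<Gamma> \<Longrightarrow> iv a \<in> \<Gamma>"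
  using lat \<Gamma>_SL2 matrix_inv_SL2
  by (fastforce simp: lattice_SL2_def discrete_subgroup_def SL2_subgroup_def)

lemma \<Gamma>_uminus: "a \<in> \<Gamma> \<Longrightarrow> - a \<in> \<Gamma>"
proof -
  assume "a \<in> \<Gamma>"
  hence "(- mat 1) ** a \<in> \<Gamma>" using neg_one \<Gamma>_mult by blast
  moreover have "(- mat 1) ** a = - a" by (rule mat2_eqI) (auto simp: mat_1_mat2)
  ultimately show ?thesis by simp
qed

text \<open>Separation at the identity spreads: nearby a and b in a bounded set give an element
  \<open>iv a ** b\<close> near 1. So the separation is uniform on the set, and an infinite bounded
  set would accumulate.\<close>

lemma finite_\<Gamma>_ent: "finite {\<gamma> \<in> \<Gamma>. ent m \<gamma>}" (is "finite ?S")
proof (rule ccontr)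
  assume inf: "infinite ?S"
  hence m: "m \<ge> 0" by (metis (mono_tags, lifting) abs_ge_zero ent_iff empty_Collect_eq finite.emptyI order_trans)
  obtain e where e: "e > 0" "\<And>b. b \<in> \<Gamma> \<Longrightarrow> b \<noteq> mat 1 \<Longrightarrow> e \<le> dist (mat 1) b"
    using lat \<Gamma>_one by (auto simp: lattice_SL2_def discrete_subgroup_def)
  \<comment> \<open>The 8 m is the loss 4 times 2 m in \<open>norm_le_ent\<close> and
    \<open>ent_mult\<close>; the 1 keeps the denominator positive when m is 0.\<close>
  define \<delta> where "\<delta> = e / (8 * m + 1)"
  have \<delta>: "\<delta> > 0" using e m by (simp add: \<delta>_def)
  have sep: "\<delta> \<le> dist a b" if "a \<in> ?S" "b \<in> ?S" "a \<noteq> b" for a b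
  proof -
    have a: "a \<in> SL2" "b \<in> SL2" "ent m a" using that \<Gamma>_SL2 by auto
    have "iv a ** b \<noteq> mat 1"
    proof
      assume "iv a ** b = mat 1"
      hence "a ** (iv a ** b) = a" by simp
      thus False using a that by simp
    qed
    hence "e \<le> dist (mat 1) (iv a ** b)" using that \<Gamma>_iv \<Gamma>_mult e(2) by blast
    also have "iv a ** b - mat 1 = iv a ** (b - a)" using a
      by (simp add: matrix_diff_ldistrib2)
    hence "dist (mat 1) (iv a ** b) = norm (iv a ** (b - a))" by (metis dist_commute dist_norm)
    also have "\<dots> \<le> 4 * (2 * m * norm (b - a))"
      by (intro norm_le_ent ent_mult) (use a in \<open>auto simp: ent_iv ent_norm\<close>)
    also have "\<dots> \<le> (8 * m + 1) * norm (b - a)" by (simp add: algebra_simps)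
    finally show ?thesis using m by (simp add: \<delta>_def field_simps dist_norm norm_minus_commute)
  qed
  have "?S \<subseteq> cball 0 (4 * m)" using norm_le_ent by auto
  then obtain x where x: "x islimpt ?S"
    using Heine_Borel_imp_Bolzano_Weierstrass[OF compact_cball inf] by blast
  obtain y where y: "y \<in> ?S" "y \<noteq> x" "dist y x < \<delta> / 2"
    using x \<delta> unfolding islimpt_approachable by (meson half_gt_zero)
  obtain y' where y': "y' \<in> ?S" "y' \<noteq> x" "dist y' x < dist y x"
    using x y(2) unfolding islimpt_approachable by (meson zero_less_dist_iff)
  have "dist y y' < \<delta>" using dist_triangle[of y y' x] y y' by (simp add: dist_commute)
  moreover have "y \<noteq> y'" using y' by auto
  ultimately show False using sep[OF y(1) y'(1)] by linarith
qed

lemma countable_\<Gamma>: "countable \<Gamma>"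
proof -
  have "\<Gamma> = (\<Union>n::nat. {\<gamma> \<in> \<Gamma>. ent (real n) \<gamma>})"
    using ent_norm ent_mono by (auto, meson real_arch_simple)
  moreover have "countable (\<Union>n::nat. {\<gamma> \<in> \<Gamma>. ent (real n) \<gamma>})"
    by (rule countable_UN) (auto intro!: countable_finite finite_\<Gamma>_ent)
  ultimately show ?thesis by simp
qed

lemma finite_\<Gamma>_conj:
  assumes "g \<in> SL2" shows "finite {\<gamma> \<in> \<Gamma>. nX (g ** \<gamma> ** iv g) \<le> 1}"
proof -
  let ?m = "2 * (2 * norm g * 3) * norm g"
  have "ent ?m \<gamma>" if "\<gamma> \<in> \<Gamma>" "nX (g ** \<gamma> ** iv g) \<le> 1" for \<gamma>
  proof -
    have "ent 3 (g ** \<gamma> ** iv g)" using that assms \<Gamma>_SL2 by (intro nX_bound) auto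
    hence "ent ?m (iv g ** (g ** \<gamma> ** iv g) ** g)"
      by (intro ent_mult) (auto simp: ent_iv ent_norm)
    thus ?thesis using conj_iv[OF assms] by simp
  qed
  thus ?thesis by (intro finite_subset[OF _ finite_\<Gamma>_ent[of ?m]]) auto
qed

text \<open>A lower bound for the injectivity radius of \<open>PSL(2,\<real>)/\<Gamma>\<close> at the coset of \<open>g\<close>.\<close>

definition thick :: "real \<Rightarrow> real^2^2 \<Rightarrow> bool" where
  "thick \<rho> g \<longleftrightarrow> (\<forall>\<gamma>\<in>\<Gamma>. \<gamma> \<noteq> mat 1 \<longrightarrow> \<gamma> \<noteq> - mat 1 \<longrightarrow> \<rho> \<le> nX (g ** \<gamma> ** iv g))"

lemma thick_mono: "thick \<rho> g \<Longrightarrow> \<rho>' \<le> \<rho> \<Longrightarrow> thick \<rho>' g"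
  unfolding thick_def by (meson order_trans)

lemma conj_eq_cases:
  assumes "g \<in> SL2" "\<gamma> \<in> SL2" "nX (g ** \<gamma> ** iv g) = 0"
  shows "\<gamma> = mat 1 \<or> \<gamma> = - mat 1"
proof -
  have "g ** \<gamma> ** iv g = mat 1 \<or> g ** \<gamma> ** iv g = - mat 1"
    using assms by (intro SL2_nX_0) auto
  moreover have "iv g ** (- mat 1) ** g = - (iv g ** g)" by (rule mat2_eqI) (auto simp: mat_1_mat2)
  ultimately show ?thesis using conj_iv[OF assms(1), of \<gamma>] assms(1) by auto
qed

text \<open>Only finitely many conjugates have size at most 1, and apart from the two central
  elements none of these has size 0. The 1 inserted into the minimum covers the larger conjugates
  and the case of an empty list.\<close>

lemma thick_exists:
  assumes "g \<in> SL2" shows "\<exists>\<rho>>0. thick \<rho> g"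
proof -
  define S where "S = {\<gamma> \<in> \<Gamma>. nX (g ** \<gamma> ** iv g) \<le> 1} - {mat 1, - mat 1}"
  define \<rho> where "\<rho> = Min (insert 1 ((\<lambda>\<gamma>. nX (g ** \<gamma> ** iv g)) ` S))"
  have fin: "finite S" using finite_\<Gamma>_conj[OF assms] by (simp add: S_def)
  have "nX (g ** \<gamma> ** iv g) > 0" if "\<gamma> \<in> S" for \<gamma>
  proof -
    have "\<gamma> \<in> SL2" using that \<Gamma>_SL2 by (auto simp: S_def)
    hence "nX (g ** \<gamma> ** iv g) \<noteq> 0" using conj_eq_cases[OF assms] that by (auto simp: S_def)
    thus ?thesis using nX_nonneg[of "g ** \<gamma> ** iv g"] by simp
  qed
  hence "\<rho> > 0" unfolding \<rho>_def using fin by (subst Min_gr_iff) auto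
  moreover have "thick \<rho> g" unfolding thick_def
  proof (intro ballI impI)
    fix \<gamma> assume g: "\<gamma> \<in> \<Gamma>" "\<gamma> \<noteq> mat 1" "\<gamma> \<noteq> - mat 1"
    show "\<rho> \<le> nX (g ** \<gamma> ** iv g)"
    proof (cases "nX (g ** \<gamma> ** iv g) \<le> 1")
      case True
      hence "\<gamma> \<in> S" using g by (auto simp: S_def)
      thus ?thesis unfolding \<rho>_def using fin by (intro Min_le) auto
    next
      case False
      have "\<rho> \<le> 1" unfolding \<rho>_def using fin by (intro Min_le) auto
      thus ?thesis using False by linarith
    qed
  qed
  ultimately show ?thesis by blast
qed

lemma thick_conj:
  assumes "thick \<rho> g" "g \<in> SL2" "h \<in> SL2" "ent m h" "m > 0"
  shows "thick (\<rho> / (8 * m\<^sup>2)) (h ** g)"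
  unfolding thick_def
proof (intro ballI impI)
  fix \<gamma> assume g: "\<gamma> \<in> \<Gamma>" "\<gamma> \<noteq> mat 1" "\<gamma> \<noteq> - mat 1"
  let ?A = "h ** g ** \<gamma> ** iv (h ** g)"
  have e: "iv h ** ?A ** h = g ** \<gamma> ** iv g"
    using assms by (simp add: iv_mult matrix_mul_assoc[symmetric])
  have "\<rho> \<le> nX (g ** \<gamma> ** iv g)" using assms(1) g by (auto simp: thick_def)
  also have "\<dots> \<le> 8 * m\<^sup>2 * nX ?A"
    using nX_conj[of "iv h" m ?A] assms e by (simp add: ent_iv)
  finally show "\<rho> / (8 * m\<^sup>2) \<le> nX ?A" using assms(5) by (simp add: field_simps)
qed

lemma thick_rinv:
  assumes "thick \<rho> g" "\<gamma> \<in> \<Gamma>" "g \<in> SL2"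
  shows "thick \<rho> (g ** \<gamma>)"
  unfolding thick_def
proof (intro ballI impI)
  fix \<delta> assume d: "\<delta> \<in> \<Gamma>" "\<delta> \<noteq> mat 1" "\<delta> \<noteq> - mat 1"
  have \<gamma>: "\<gamma> \<in> SL2" using assms \<Gamma>_SL2 by auto
  have "\<gamma> ** \<delta> ** iv \<gamma> \<in> \<Gamma>" using assms d \<Gamma>_mult \<Gamma>_iv by auto
  moreover have e: "iv \<gamma> ** (\<gamma> ** \<delta> ** iv \<gamma>) ** \<gamma> = \<delta>" by (rule conj_iv[OF \<gamma>])
  have "\<gamma> ** \<delta> ** iv \<gamma> \<noteq> mat 1" using e d \<gamma> by auto
  moreover have "iv \<gamma> ** (- mat 1) ** \<gamma> = - (iv \<gamma> ** \<gamma>)" by (rule mat2_eqI) (auto simp: mat_1_mat2)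
  hence "\<gamma> ** \<delta> ** iv \<gamma> \<noteq> - mat 1" using e d \<gamma> by auto
  ultimately have "\<rho> \<le> nX (g ** (\<gamma> ** \<delta> ** iv \<gamma>) ** iv g)" using assms(1) by (auto simp: thick_def)
  thus "\<rho> \<le> nX (g ** \<gamma> ** \<delta> ** iv (g ** \<gamma>))" by (simp add: iv_mult matrix_mul_assoc)
qed

text \<open>The principle behind the injectivity and counting arguments below: b is the conjugate of
  \<gamma> by z, so thickness leaves only \<gamma> = \<plusminus>1, and m < 1 rules out -1.\<close>

lemma thick_small_eq:
  assumes "thick \<rho> z" "z \<in> SL2" "\<gamma> \<in> \<Gamma>" "b \<in> SL2" "ent m (b - mat 1)" "2 * m < \<rho>" "m < 1"
    "b ** z = z ** \<gamma>"
  shows "\<gamma> = mat 1 \<and> b = mat 1"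
proof -
  have b: "b = z ** \<gamma> ** iv z" using assms(8,2) by (metis mult_iv_cancel)
  have "nX b < \<rho>" using nX_ent[OF assms(5)] assms(6) by linarith
  hence "\<gamma> = mat 1 \<or> \<gamma> = - mat 1" using assms(1,3) b by (force simp: thick_def)
  moreover have "z ** (- mat 1) ** iv z = - (z ** iv z)" by (rule mat2_eqI) (auto simp: mat_1_mat2)
  hence "\<gamma> = - mat 1 \<Longrightarrow> b = - mat 1" using assms(2) b by simp
  hence "\<gamma> \<noteq> - mat 1" using assms(5,7) by (auto simp: ent_iff mat_1_mat2)
  ultimately show ?thesis using b assms(2) by auto
qed

text \<open>Right \<open>\<Gamma>\<close>-invariant sets stand for the subsets of \<open>PSL(2,\<real>)/\<Gamma>\<close>.\<close>

definition rinv :: "(real^2^2) set \<Rightarrow> bool" where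
  "rinv E \<longleftrightarrow> E \<subseteq> SL2 \<and> (\<forall>x\<in>E. \<forall>\<gamma>\<in>\<Gamma>. x ** \<gamma> \<in> E)"

lemma rinv_iff: "rinv E \<Longrightarrow> \<gamma> \<in> \<Gamma> \<Longrightarrow> x ** \<gamma> \<in> E \<longleftrightarrow> x \<in> E"
  unfolding rinv_def by (metis \<Gamma>_SL2 \<Gamma>_iv mult_iv_cancel)

text \<open>Borel sets that embed into the quotient. As -1 lies in \<Gamma>, such a set never
  contains both x and -x.\<close>

definition inj_dom :: "(real^2^2) set \<Rightarrow> bool" where
  "inj_dom S \<longleftrightarrow> S \<in> sets borel \<and> S \<subseteq> SL2 \<and> (\<forall>x \<gamma>. x \<in> S \<longrightarrow> \<gamma> \<in> \<Gamma> \<longrightarrow> x ** \<gamma> \<in> S \<longrightarrow> \<gamma> = mat 1)"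

lemma inj_dom_unique:
  assumes "inj_dom S" "\<gamma> \<in> \<Gamma>" "\<gamma>' \<in> \<Gamma>" "x ** \<gamma> \<in> S" "x ** \<gamma>' \<in> S"
  shows "\<gamma> = \<gamma>'"
proof -
  have g: "\<gamma> \<in> SL2" "\<gamma>' \<in> SL2" using assms \<Gamma>_SL2 by auto
  have "(x ** \<gamma>) ** (iv \<gamma> ** \<gamma>') = x ** \<gamma>'" using g by (simp add: matrix_mul_assoc)
  hence "iv \<gamma> ** \<gamma>' = mat 1" using assms \<Gamma>_mult \<Gamma>_iv unfolding inj_dom_def by metis
  hence "\<gamma> ** (iv \<gamma> ** \<gamma>') = \<gamma>" by simp
  thus ?thesis using g by simp
qed

lemma inj_dom_count_sum:
  assumes "inj_dom T" "S \<in> sets borel"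
  shows "emeasure haar {x \<in> S. \<exists>\<gamma>\<in>\<Gamma>. x ** \<gamma> \<in> T} = (\<integral>\<^sup>+\<gamma>. emeasure haar {x \<in> S. x ** \<gamma> \<in> T} \<partial>count_space \<Gamma>)"
proof -
  have T: "T \<in> sets borel" using assms by (auto simp: inj_dom_def)
  have m: "{x \<in> S. x ** \<gamma> \<in> T} \<in> sets borel" for \<gamma>
    using T assms(2) measurable_sets[OF mult_right_measurable T, of \<gamma>] by (auto simp: vimage_def Collect_conj_eq)
  have "{x \<in> S. \<exists>\<gamma>\<in>\<Gamma>. x ** \<gamma> \<in> T} = (\<Union>\<gamma>\<in>\<Gamma>. {x \<in> S. x ** \<gamma> \<in> T})" by auto
  also have "emeasure haar \<dots> = (\<integral>\<^sup>+\<gamma>. emeasure haar {x \<in> S. x ** \<gamma> \<in> T} \<partial>count_space \<Gamma>)"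
    using m inj_dom_unique[OF assms(1)]
    by (intro emeasure_UN_countable countable_\<Gamma>) (auto simp: disjoint_family_on_def)
  finally show ?thesis .
qed

text \<open>Unfolding: both sides are split over \<Gamma>, right translation by \<gamma> matches the
  \<gamma>-piece of one side with the piece of the other side for the inverse element, and inversion
  permutes \<Gamma>.\<close>

lemma inj_dom_swap:
  assumes "inj_dom T" "inj_dom S"
  shows "emeasure haar {x \<in> S. \<exists>\<gamma>\<in>\<Gamma>. x ** \<gamma> \<in> T} = emeasure haar {x \<in> T. \<exists>\<gamma>\<in>\<Gamma>. x ** \<gamma> \<in> S}"
proof -
  have S: "S \<in> sets borel" "T \<in> sets borel" using assms by (auto simp: inj_dom_def)
  have e: "emeasure haar {x \<in> S. x ** iv \<gamma> \<in> T} = emeasure haar {x \<in> T. x ** \<gamma> \<in> S}" if "\<gamma> \<in> \<Gamma>" for \<gamma>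
  proof -
    have g: "\<gamma> \<in> SL2" using that \<Gamma>_SL2 by auto
    have m: "{x \<in> S. x ** iv \<gamma> \<in> T} \<in> sets borel"
      using S measurable_sets[OF mult_right_measurable S(2), of "iv \<gamma>"] by (auto simp: vimage_def Collect_conj_eq)
    have "emeasure haar {x. x ** \<gamma> \<in> {x \<in> S. x ** iv \<gamma> \<in> T}} = emeasure haar {x \<in> S. x ** iv \<gamma> \<in> T}"
      by (rule emeasure_haar_right[OF g m])
    moreover have "{x. x ** \<gamma> \<in> {x \<in> S. x ** iv \<gamma> \<in> T}} = {x \<in> T. x ** \<gamma> \<in> S}" using g by auto
    ultimately show ?thesis by simp
  qed
  have "bij_betw iv \<Gamma> \<Gamma>"
    by (rule bij_betwI[where g = iv]) (auto simp: \<Gamma>_iv)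
  hence "(\<integral>\<^sup>+\<gamma>. emeasure haar {x \<in> S. x ** iv \<gamma> \<in> T} \<partial>count_space \<Gamma>) = (\<integral>\<^sup>+\<gamma>. emeasure haar {x \<in> S. x ** \<gamma> \<in> T} \<partial>count_space \<Gamma>)"
    by (rule nn_integral_bij_count_space)
  moreover have "(\<integral>\<^sup>+\<gamma>. emeasure haar {x \<in> S. x ** iv \<gamma> \<in> T} \<partial>count_space \<Gamma>) = (\<integral>\<^sup>+\<gamma>. emeasure haar {x \<in> T. x ** \<gamma> \<in> S} \<partial>count_space \<Gamma>)"
    using e by (intro nn_integral_cong) auto
  ultimately show ?thesis
    using inj_dom_count_sum[OF assms(1) S(1)] inj_dom_count_sum[OF assms(2) S(2)] by simp
qed

section \<open>Fundamental domains and the invariant measure\<close>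

definition fund_dom :: "(real^2^2) set \<Rightarrow> bool" where
  "fund_dom D \<longleftrightarrow> inj_dom D \<and> (\<forall>g\<in>SL2. \<exists>\<gamma>\<in>\<Gamma>. g ** \<gamma> \<in> D)"

text \<open>Every point has a neighbourhood that embeds into the quotient. Countably many of them
  suffice by Lindelof, and each is stripped of the cosets already met by its predecessors.\<close>

lemma fund_dom_exists: "\<exists>D. fund_dom D"
proof -
  define r where "r g = (SOME \<rho>. \<rho> > 0 \<and> thick \<rho> g)" for g
  have r: "r g > 0" "thick (r g) g" if "g \<in> SL2" for g
    using someI_ex[OF thick_exists[OF that, unfolded Bex_def]] by (auto simp: r_def)
  \<comment> \<open>Two points of \<open>V g\<close> differ by a matrix within 8 k of 1, and
    \<open>thick_small_eq\<close> then asks for 16 k < r and 8 k < 1.\<close>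
  define k where "k g = min (1/16) (r g / 24)" for g
  define V where "V g = {h. \<forall>i j. \<bar>(h ** iv g - mat 1) $ i $ j\<bar> < k g}" for g
  have oV: "open (V g)" for g
  proof -
    have "V g = (\<Inter>i\<in>UNIV. \<Inter>j\<in>UNIV. {h. \<bar>(h ** iv g - mat 1) $ i $ j\<bar> < k g})" by (auto simp: V_def)
    also have "open \<dots>"
      by (intro open_INT finite ballI open_Collect_less continuous_intros)
    finally show ?thesis .
  qed
  have inV: "g \<in> V g" if "g \<in> SL2" for g
    using r[OF that] that by (auto simp: V_def k_def)
  have injV: "\<gamma> = mat 1" if "g \<in> SL2" "h \<in> SL2" "h \<in> V g" "\<gamma> \<in> \<Gamma>" "h ** \<gamma> \<in> V g" for g h \<gamma>
  proof -
    have \<gamma>: "\<gamma> \<in> SL2" using that \<Gamma>_SL2 by auto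
    let ?b = "h ** iv g" and ?c = "h ** \<gamma> ** iv g"
    have b: "ent (k g) (?b - mat 1)" "ent (k g) (?c - mat 1)" using that by (auto simp: V_def ent_def less_imp_le)
    have k: "0 < k g" "k g \<le> 1/16" "k g \<le> r g / 24" using r[OF that(1)] by (auto simp: k_def)
    have "ent 2 ?b" using ent_diff_one[OF b(1)] k by (auto intro: ent_mono)
    have "ent (2 * k g) (?c - ?b)" using ent_triangle[OF b(2,1)] by simp
    hence "ent (2 * 2 * (2 * k g)) (iv ?b ** (?c - ?b))" using \<open>ent 2 ?b\<close> by (intro ent_mult) (auto simp: ent_iv)
    moreover have "iv ?b ** (?c - ?b) = iv ?b ** ?c - mat 1"
      using that by (simp add: matrix_diff_ldistrib2)
    ultimately have s: "ent (8 * k g) (iv ?b ** ?c - mat 1)" by simp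
    have e: "(iv ?b ** ?c) ** g = g ** \<gamma>"
      using that \<gamma> by (simp add: iv_mult matrix_mul_assoc[symmetric])
    have "2 * (8 * k g) < r g" "8 * k g < 1" using k r(1)[OF that(1)] by linarith+
    with thick_small_eq[OF r(2)[OF that(1)] that(1,4) _ s _ _ e] that(1,2) \<gamma>
    show ?thesis by simp
  qed
  obtain F' where F': "F' \<subseteq> V ` SL2" "countable F'" "\<Union>F' = \<Union>(V ` SL2)"
    using Lindelof[of "V ` SL2"] oV by auto
  have ne: "F' \<noteq> {}" using F'(3) inV SL2_one by fastforce
  define U where "U = from_nat_into F'"
  have rU: "range U = F'" using F'(2) ne by (simp add: U_def range_from_nat_into)
  define G where "G n = {h. \<exists>\<gamma>\<in>\<Gamma>. h ** \<gamma> \<in> U n}" for n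
  have UV: "\<exists>h\<in>SL2. U n = V h" for n
  proof -
    have "U n \<in> F'" unfolding rU[symmetric] by (rule rangeI)
    thus ?thesis using F'(1) by auto
  qed
  have oU: "open (U n)" for n using UV[of n] oV by auto
  have oG: "open (G n)" for n
  proof -
    have "G n = (\<Union>\<gamma>\<in>\<Gamma>. (\<lambda>h. h ** \<gamma>) -` U n)" by (auto simp: G_def)
    also have "open \<dots>" by (intro open_UN ballI open_vimage oU continuous_intros)
    finally show ?thesis .
  qed
  have GI: "h ** \<gamma> \<in> G n \<longleftrightarrow> h \<in> G n" if "\<gamma> \<in> \<Gamma>" for h \<gamma> n
    using that unfolding G_def
    by (smt (verit) \<Gamma>_SL2 \<Gamma>_iv \<Gamma>_mult matrix_mul_assoc mem_Collect_eq mult_iv_cancel)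
  \<comment> \<open>The saturations \<open>G m\<close> are removed, not just the sets
    \<open>U m\<close>, so that different pieces never meet the same coset.\<close>
  define D where "D = (\<Union>n. SL2 \<inter> (U n - (\<Union>m<n. G m)))"
  have "D \<in> sets borel" unfolding D_def using oU oG closed_SL2 by (intro sets.countable_UN sets.Int sets.Diff) auto
  moreover have "D \<subseteq> SL2" by (auto simp: D_def)
  moreover have "\<gamma> = mat 1" if x: "x \<in> D" and g: "\<gamma> \<in> \<Gamma>" and xg: "x ** \<gamma> \<in> D" for x \<gamma>
  proof -
    obtain n where n: "x \<in> SL2" "x \<in> U n" "\<And>m. m < n \<Longrightarrow> x \<notin> G m" using x by (auto simp: D_def)
    obtain n' where n': "x ** \<gamma> \<in> U n'" "\<And>m. m < n' \<Longrightarrow> x ** \<gamma> \<notin> G m" using xg by (auto simp: D_def)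
    have "x \<in> G n" using n(2) \<Gamma>_one by (auto simp: G_def intro!: bexI[of _ "mat 1"])
    moreover have "x \<in> G n'" using n'(1) g by (auto simp: G_def)
    ultimately have "n = n'" using n(3) n'(2) GI[OF g] by (metis linorder_neqE_nat)
    moreover obtain h where "h \<in> SL2" "U n = V h" using UV[of n] by auto
    ultimately show ?thesis using injV[of h x \<gamma>] n(1,2) n'(1) g by simp
  qed
  moreover have "\<exists>\<gamma>\<in>\<Gamma>. g ** \<gamma> \<in> D" if g: "g \<in> SL2" for g
  proof -
    have "\<exists>n. g \<in> G n"
    proof -
      have "g \<in> \<Union>F'" using inV[OF g] g F'(3) by auto
      then obtain n where "g \<in> U n" using rU by auto
      thus ?thesis using \<Gamma>_one by (auto simp: G_def intro!: exI[of _ n] bexI[of _ "mat 1"])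
    qed
    then obtain n where n: "g \<in> G n" "\<And>m. m < n \<Longrightarrow> g \<notin> G m" 
      using exists_least_iff[of "\<lambda>n. g \<in> G n"] by auto
    then obtain \<gamma> where "\<gamma> \<in> \<Gamma>" "g ** \<gamma> \<in> U n" by (auto simp: G_def)
    thus ?thesis using n(2) GI g \<Gamma>_SL2 by (intro bexI[of _ \<gamma>]) (auto simp: D_def)
  qed
  ultimately have "fund_dom D" unfolding fund_dom_def inj_dom_def by simp
  thus ?thesis by (rule exI)
qed

definition F0 :: "(real^2^2) set" where "F0 = (SOME D. fund_dom D)"

lemma fund_dom_F0: "fund_dom F0"
  unfolding F0_def using fund_dom_exists by (rule someI_ex)

lemma F0_sets [measurable]: "F0 \<in> sets borel" and F0_SL2: "F0 \<subseteq> SL2"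
  using fund_dom_F0 by (auto simp: fund_dom_def inj_dom_def)

text \<open>The set F supplied by the lattice property may cover the quotient several times.
  \<open>F0\<close> is cut into countably many pieces, each carried into F by its own element of
  \<Gamma>; the moved pieces stay disjoint because \<open>F0\<close> embeds into the quotient, so
  together they have at most the measure of F.\<close>

lemma emeasure_F0_finite: "emeasure haar F0 < \<infinity>"
proof -
  obtain F where F: "F \<in> sets borel" "F \<subseteq> SL2" "\<And>g. g \<in> SL2 \<Longrightarrow> \<exists>f\<in>F. \<exists>\<gamma>\<in>\<Gamma>. g = f ** \<gamma>" "haar_SL2 F < \<infinity>"
    using lat by (auto simp: lattice_SL2_def)
  define c where "c = from_nat_into \<Gamma>"
  have rc: "range c = \<Gamma>" using countable_\<Gamma> \<Gamma>_one unfolding c_def by (intro range_from_nat_into) auto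
  have c: "c n \<in> \<Gamma>" "c n \<in> SL2" for n using rc \<Gamma>_SL2 by auto
  define A where "A n = {y \<in> F0. y ** c n \<in> F}" for n
  have A: "A n \<in> sets borel" for n
    using F0_sets measurable_sets[OF mult_right_measurable F(1), of "c n"]
    by (auto simp: A_def vimage_def Collect_conj_eq)
  have "F0 = (\<Union>n. A n)"
  proof (intro equalityI subsetI)
    fix y assume y: "y \<in> F0"
    then obtain f \<gamma> where f: "f \<in> F" "\<gamma> \<in> \<Gamma>" "y = f ** \<gamma>" using F(3) F0_SL2 by blast
    obtain n where "c n = iv \<gamma>" using rc \<Gamma>_iv[OF f(2)] by (metis imageE)
    hence "y \<in> A n" using f y \<Gamma>_SL2 by (auto simp: A_def)
    thus "y \<in> (\<Union>n. A n)" by auto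
  qed (auto simp: A_def)
  also have "\<dots> = (\<Union>n. disjointed A n)" by (simp add: UN_disjointed_eq)
  finally have F0: "F0 = (\<Union>n. disjointed A n)" .
  have dm: "disjointed A n \<in> sets borel" for n
    using A sets.range_disjointed_sets'[of A borel] by auto
  have "emeasure haar F0 = (\<Sum>n. emeasure haar (disjointed A n))"
    unfolding F0 using dm by (intro suminf_emeasure[symmetric]) (auto simp: disjoint_family_disjointed)
  also have "\<dots> = (\<Sum>n. emeasure haar {x. x ** iv (c n) \<in> disjointed A n})"
    by (intro suminf_cong emeasure_haar_right[symmetric] iv_SL2 c dm)
  also have "\<dots> = emeasure haar (\<Union>n. {x. x ** iv (c n) \<in> disjointed A n})"
  proof (rule suminf_emeasure)
    show "range (\<lambda>n. {x. x ** iv (c n) \<in> disjointed A n}) \<subseteq> sets haar"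
      using measurable_sets[OF mult_right_measurable dm] by (auto simp: vimage_def)
    show "disjoint_family (\<lambda>n. {x. x ** iv (c n) \<in> disjointed A n})"
      unfolding disjoint_family_on_def
    proof (intro ballI impI, rule ccontr)
      fix m n :: nat assume mn: "m \<noteq> n" "{x. x ** iv (c m) \<in> disjointed A m} \<inter> {x. x ** iv (c n) \<in> disjointed A n} \<noteq> {}"
      then obtain x where x: "x ** iv (c m) \<in> disjointed A m" "x ** iv (c n) \<in> disjointed A n" by auto
      hence "x ** iv (c m) \<in> F0" "x ** iv (c n) \<in> F0" 
        using subsetD[OF disjointed_subset[of A]] by (auto simp: A_def)
      hence "iv (c m) = iv (c n)" using inj_dom_unique[of F0] fund_dom_F0 \<Gamma>_iv c by (auto simp: fund_dom_def)
      thus False using x disjoint_family_disjointed[of A] mn(1) by (auto simp: disjoint_family_on_def)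
    qed
  qed
  also have "\<dots> \<le> emeasure haar F"
  proof (rule emeasure_mono)
    show "(\<Union>n. {x. x ** iv (c n) \<in> disjointed A n}) \<subseteq> F"
    proof clarify
      fix x n assume "x ** iv (c n) \<in> disjointed A n"
      hence "x ** iv (c n) \<in> A n" by (rule subsetD[OF disjointed_subset])
      hence "x ** iv (c n) ** c n \<in> F" by (simp add: A_def)
      thus "x \<in> F" using c by simp
    qed
  qed (use F in simp)
  finally show ?thesis using F haar_SL2_eq by (metis le_less_trans)
qed

text \<open>On right \<open>\<Gamma>\<close>-invariant sets this is the invariant measure of the quotient.\<close>

definition \<mu> :: "(real^2^2) measure" where "\<mu> = density haar (indicator F0)"

lemma sets_\<mu> [simp, measurable_cong]: "sets \<mu> = sets borel" and space_\<mu> [simp]: "space \<mu> = UNIV"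
  by (auto simp: \<mu>_def)

lemma emeasure_\<mu>: "E \<in> sets borel \<Longrightarrow> emeasure \<mu> E = emeasure haar (F0 \<inter> E)"
  unfolding \<mu>_def by (subst emeasure_density) (auto simp: nn_integral_set_ennreal[symmetric] indicator_inter_arith[symmetric])

sublocale \<mu>: finite_measure \<mu>
  by (rule finite_measureI) (use emeasure_\<mu>[of UNIV] emeasure_F0_finite in auto)

lemma inj_dom_Int: "inj_dom S \<Longrightarrow> E \<in> sets borel \<Longrightarrow> inj_dom (S \<inter> E)"
  by (auto simp: inj_dom_def)

text \<open>Unfolding against \<open>F0\<close>: every point of the left set has a translate in
  \<open>F0\<close>, and that translate is again in E.\<close>

lemma emeasure_inj_dom_le:
  assumes "inj_dom S" "rinv E" "E \<in> sets borel"
  shows "emeasure haar (S \<inter> E) \<le> emeasure \<mu> E"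
proof -
  have "S \<inter> E = {x \<in> S \<inter> E. \<exists>\<gamma>\<in>\<Gamma>. x ** \<gamma> \<in> F0}"
    using fund_dom_F0 assms by (auto simp: fund_dom_def inj_dom_def)
  also have "emeasure haar \<dots> = emeasure haar {x \<in> F0. \<exists>\<gamma>\<in>\<Gamma>. x ** \<gamma> \<in> S \<inter> E}"
    by (rule inj_dom_swap) (use fund_dom_F0 assms inj_dom_Int in \<open>auto simp: fund_dom_def\<close>)
  also have "\<dots> \<le> emeasure haar (F0 \<inter> E)"
    by (rule emeasure_mono) (use assms rinv_iff in auto)
  finally show ?thesis using assms by (simp add: emeasure_\<mu>)
qed

lemma emeasure_fund_dom:
  assumes "fund_dom D" "rinv E" "E \<in> sets borel"
  shows "emeasure haar (D \<inter> E) = emeasure \<mu> E"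
proof -
  have "D \<inter> E = {x \<in> D \<inter> E. \<exists>\<gamma>\<in>\<Gamma>. x ** \<gamma> \<in> F0 \<inter> E}"
    using fund_dom_F0 assms rinv_iff by (auto simp: fund_dom_def rinv_def)
  also have "emeasure haar \<dots> = emeasure haar {x \<in> F0 \<inter> E. \<exists>\<gamma>\<in>\<Gamma>. x ** \<gamma> \<in> D \<inter> E}"
    by (rule inj_dom_swap) (use fund_dom_F0 assms inj_dom_Int in \<open>auto simp: fund_dom_def\<close>)
  also have "{x \<in> F0 \<inter> E. \<exists>\<gamma>\<in>\<Gamma>. x ** \<gamma> \<in> D \<inter> E} = F0 \<inter> E"
    using assms rinv_iff by (auto simp: fund_dom_def rinv_def)
  finally show ?thesis using assms by (simp add: emeasure_\<mu>)
qed

text \<open>A left translate of \<open>F0\<close> is again a fundamental domain, and all fundamental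
  domains give an invariant set the same measure. The restriction to \<open>rinv\<close> sets
  matters, since \<mu> is concentrated on \<open>F0\<close>.\<close>

lemma emeasure_\<mu>_left:
  assumes g: "g \<in> SL2" and E: "rinv E" "E \<in> sets borel"
  shows "emeasure \<mu> {x. g ** x \<in> E} = emeasure \<mu> E"
proof -
  define D where "D = {y. iv g ** y \<in> F0}"
  have D: "D \<in> sets borel"
    using measurable_sets[OF mult_left_measurable F0_sets, of "iv g"] by (simp add: D_def vimage_def)
  have mE: "{x. g ** x \<in> E} \<in> sets borel"
    using measurable_sets[OF mult_left_measurable E(2), of g] by (simp add: vimage_def)
  have "D \<subseteq> SL2"
  proof
    fix y assume "y \<in> D"
    hence "iv g ** y \<in> SL2" using F0_SL2 by (auto simp: D_def)
    hence "g ** (iv g ** y) \<in> SL2" by (rule SL2_mult[OF g])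
    thus "y \<in> SL2" using g by simp
  qed
  moreover have "\<gamma> = mat 1" if "x \<in> D" "\<gamma> \<in> \<Gamma>" "x ** \<gamma> \<in> D" for x \<gamma>
    using that fund_dom_F0 by (auto simp: D_def fund_dom_def inj_dom_def matrix_mul_assoc)
  moreover have "\<exists>\<gamma>\<in>\<Gamma>. h ** \<gamma> \<in> D" if "h \<in> SL2" for h
    using that fund_dom_F0 g by (auto simp: D_def fund_dom_def matrix_mul_assoc)
  ultimately have fD: "fund_dom D" using D by (auto simp: fund_dom_def inj_dom_def)
  have "emeasure \<mu> {x. g ** x \<in> E} = emeasure haar {x. g ** x \<in> D \<inter> E}"
    using g mE by (simp add: emeasure_\<mu> D_def Int_def)
  also have "\<dots> = emeasure haar (D \<inter> E)"
    using D E by (intro emeasure_haar_left g) auto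
  finally show ?thesis using emeasure_fund_dom[OF fD E] by simp
qed

section \<open>Ergodicity of the unipotent flow\<close>

lemma closed_mult_left: "closed E \<Longrightarrow> closed {x::real^2^2. (g::real^2^2) ** x \<in> E}"
  using closed_vimage[of E "\<lambda>x::real^2^2. g ** x"]
  by (simp add: vimage_def continuous_on_matrix_mult)

lemma closed_mult_right: "closed E \<Longrightarrow> closed {x::real^2^2. x ** (g::real^2^2) \<in> E}"
  using closed_vimage[of E "\<lambda>x::real^2^2. x ** g"]
  by (simp add: vimage_def continuous_on_matrix_mult)

lemma tendsto_mult_right: 
  fixes h x :: "real^2^2" and g :: "nat \<Rightarrow> real^2^2"
  assumes "g \<longlonglongrightarrow> h" shows "(\<lambda>n. g n ** x) \<longlonglongrightarrow> h ** x"
proof -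
  have "continuous_on UNIV (\<lambda>A::real^2^2. A ** x)" by (intro continuous_intros)
  thus ?thesis using assms by (rule continuous_on_tendsto_compose) auto
qed

lemma rinv_left: "g \<in> SL2 \<Longrightarrow> rinv E \<Longrightarrow> rinv {x. g ** x \<in> E}"
proof -
  assume g: "g \<in> SL2" and E: "rinv E"
  have "x \<in> SL2" if "g ** x \<in> E" for x
  proof -
    have "g ** x \<in> SL2" using E that by (auto simp: rinv_def)
    hence "iv g ** (g ** x) \<in> SL2" by (rule SL2_mult[OF iv_SL2[OF g]])
    thus ?thesis using g by simp
  qed
  thus ?thesis using E by (auto simp: rinv_def matrix_mul_assoc)
qed

lemma rinv_Int: "rinv E \<Longrightarrow> rinv F \<Longrightarrow> rinv (E \<inter> F)" and rinv_Un: "rinv E \<Longrightarrow> rinv F \<Longrightarrow> rinv (E \<union> F)"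
  and rinv_Diff: "rinv E \<Longrightarrow> rinv F \<Longrightarrow> rinv (E - F)"
  using rinv_iff by (auto simp: rinv_def)

lemma measure_\<mu>_left:
  "g \<in> SL2 \<Longrightarrow> rinv E \<Longrightarrow> E \<in> sets borel \<Longrightarrow> measure \<mu> {x. g ** x \<in> E} = measure \<mu> E"
  by (simp add: measure_def emeasure_\<mu>_left)

text \<open>A matrix coefficient: the inner product of the indicator of E with its translate in L2
  of the quotient. Full overlap means invariance, and the Mautner argument works with these numbers
  alone.\<close>

definition overlap :: "(real^2^2) set \<Rightarrow> real^2^2 \<Rightarrow> real" where
  "overlap E g = measure \<mu> (E \<inter> {x. g ** x \<in> E})"

definition ae_inv :: "(real^2^2) set \<Rightarrow> real^2^2 \<Rightarrow> bool" where
  "ae_inv E g \<longleftrightarrow> (AE x in \<mu>. g ** x \<in> E \<longleftrightarrow> x \<in> E)"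

lemma closed_left_sets [simp]: "closed E \<Longrightarrow> {x::real^2^2. (g::real^2^2) ** x \<in> E} \<in> sets borel"
  using closed_mult_left by (rule borel_closed)

text \<open>Continuity of the matrix coefficient at 1, elementary for closed E: a point outside E is
  eventually kept outside by \<open>g n\<close>, so the sets \<open>V k\<close> decrease to E, while
  the union of E and its preimage has measure 2 \<open>measure \<mu> E\<close> minus the
  overlap.\<close>

lemma overlap_tendsto_one:
  assumes E: "closed E" "rinv E" and g: "\<And>n. g n \<in> SL2" "g \<longlonglongrightarrow> mat 1"
  shows "(\<lambda>n. overlap E (g n)) \<longlonglongrightarrow> measure \<mu> E"
proof -
  have Eb: "E \<in> sets borel" using E by simp
  define V where "V k = (\<Union>n\<in>{k..}. E \<union> {x. g n ** x \<in> E})" for k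
  have V: "V k \<in> sets borel" for k unfolding V_def using E by (intro sets.countable_UN') auto
  have dV: "decseq V" unfolding decseq_def V_def by (intro allI impI UN_mono) auto
  have "(\<lambda>k. measure \<mu> (V k)) \<longlonglongrightarrow> measure \<mu> (\<Inter>k. V k)"
    using V dV by (intro \<mu>.finite_Lim_measure_decseq) auto
  also have "(\<Inter>k. V k) = E"
  proof (intro equalityI subsetI)
    fix x assume x: "x \<in> (\<Inter>k. V k)"
    show "x \<in> E"
    proof (rule ccontr)
      assume nx: "x \<notin> E"
      have "(\<lambda>n. g n ** x) \<longlonglongrightarrow> mat 1 ** x" by (rule tendsto_mult_right[OF g(2)])
      hence "\<forall>\<^sub>F n in sequentially. g n ** x \<in> - E"
        using nx E(1) by (intro topological_tendstoD) auto
      then obtain N where "\<And>n. n \<ge> N \<Longrightarrow> g n ** x \<notin> E" by (auto simp: eventually_sequentially)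
      hence "x \<notin> V N" using nx by (auto simp: V_def)
      thus False using x by auto
    qed
  qed (auto simp: V_def)
  finally have lim: "(\<lambda>k. measure \<mu> (V k)) \<longlonglongrightarrow> measure \<mu> E" .
  have up: "overlap E (g n) \<le> measure \<mu> E" for n unfolding overlap_def using E by (intro \<mu>.finite_measure_mono) auto
  have lo: "2 * measure \<mu> E - measure \<mu> (V n) \<le> overlap E (g n)" for n
  proof -
    have "measure \<mu> (E \<union> {x. g n ** x \<in> E}) = measure \<mu> E + measure \<mu> ({x. g n ** x \<in> E} - E)"
      using E by (intro \<mu>.finite_measure_Union'[of E, simplified]) auto
    moreover have "measure \<mu> {x. g n ** x \<in> E} = measure \<mu> ({x. g n ** x \<in> E} - E) + overlap E (g n)"
      unfolding overlap_def using E by (subst \<mu>.finite_measure_Union[symmetric]) (auto intro!: arg_cong[of _ _ "measure \<mu>"])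
    moreover have "measure \<mu> (E \<union> {x. g n ** x \<in> E}) \<le> measure \<mu> (V n)"
      using V by (intro \<mu>.finite_measure_mono) (auto simp: V_def)
    ultimately show ?thesis using measure_\<mu>_left[OF g(1) E(2) Eb, of n] by simp
  qed
  have "(\<lambda>n. 2 * measure \<mu> E - measure \<mu> (V n)) \<longlonglongrightarrow> 2 * measure \<mu> E - measure \<mu> E"
    by (intro tendsto_intros lim)
  hence "(\<lambda>n. 2 * measure \<mu> E - measure \<mu> (V n)) \<longlonglongrightarrow> measure \<mu> E" by simp
  thus ?thesis by (rule tendsto_sandwich[rotated 2, OF _ tendsto_const]) (use up lo in auto)
qed

text \<open>Upper semicontinuity, again from closedness: if \<open>g n\<close> maps a point into E
  for infinitely many n, then so does the limit.\<close>

lemma overlap_limit: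
  assumes E: "closed E" "rinv E" and g: "g \<longlonglongrightarrow> h" and lim: "(\<lambda>n. overlap E (g n)) \<longlonglongrightarrow> measure \<mu> E"
  shows "overlap E h = measure \<mu> E"
proof -
  define W where "W k = (\<Union>n\<in>{k..}. E \<inter> {x. g n ** x \<in> E})" for k
  have W: "W k \<in> sets borel" for k unfolding W_def using E by (intro sets.countable_UN') auto
  have dW: "decseq W" unfolding decseq_def W_def by (intro allI impI UN_mono) auto
  have "(\<lambda>k. measure \<mu> (W k)) \<longlonglongrightarrow> measure \<mu> (\<Inter>k. W k)"
    using W dW by (intro \<mu>.finite_Lim_measure_decseq) auto
  moreover have "overlap E (g k) \<le> measure \<mu> (W k)" for k
    unfolding overlap_def using W by (intro \<mu>.finite_measure_mono) (auto simp: W_def)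
  ultimately have "measure \<mu> E \<le> measure \<mu> (\<Inter>k. W k)"
    using lim by (intro LIMSEQ_le) auto
  also have "\<dots> \<le> overlap E h" unfolding overlap_def
  proof (rule \<mu>.finite_measure_mono)
    show "(\<Inter>k. W k) \<subseteq> E \<inter> {x. h ** x \<in> E}"
    proof
      fix x assume x: "x \<in> (\<Inter>k. W k)"
      have "h ** x \<in> E"
      proof (rule ccontr)
        assume nx: "h ** x \<notin> E"
        have "(\<lambda>n. g n ** x) \<longlonglongrightarrow> h ** x" by (rule tendsto_mult_right[OF g])
        hence "\<forall>\<^sub>F n in sequentially. g n ** x \<in> - E"
          using nx E(1) by (intro topological_tendstoD) auto
        then obtain N where "\<And>n. n \<ge> N \<Longrightarrow> g n ** x \<notin> E" by (auto simp: eventually_sequentially)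
        hence "x \<notin> W N" by (auto simp: W_def)
        thus False using x by auto
      qed
      thus "x \<in> E \<inter> {x. h ** x \<in> E}" using x by (auto simp: W_def)
    qed
  qed (use E in auto)
  finally show ?thesis using \<mu>.finite_measure_mono[of "E \<inter> {x. h ** x \<in> E}" E] E
    by (simp add: overlap_def)
qed

text \<open>E and its preimage have equal measure, so full overlap makes both of their differences
  null.\<close>

lemma ae_inv_iff_overlap:
  assumes E: "closed E" "rinv E" and g: "g \<in> SL2" and o: "overlap E g = measure \<mu> E"
  shows "ae_inv E g"
proof -
  have Eb: "E \<in> sets borel" using E by simp
  let ?G = "{x. g ** x \<in> E}"
  have G: "?G \<in> sets borel" using E by simp
  have "measure \<mu> (E - ?G) = measure \<mu> E - measure \<mu> (E \<inter> ?G)"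
    using E G by (intro \<mu>.finite_measure_Diff') auto
  hence 1: "measure \<mu> (E - ?G) = 0" using o by (simp add: overlap_def)
  have "measure \<mu> (?G - E) = measure \<mu> ?G - measure \<mu> (?G \<inter> E)"
    using E G by (intro \<mu>.finite_measure_Diff') auto
  hence 2: "measure \<mu> (?G - E) = 0" using o measure_\<mu>_left[OF g E(2) Eb]
    by (simp add: overlap_def Int_commute)
  have "AE x in \<mu>. x \<notin> E - ?G" "AE x in \<mu>. x \<notin> ?G - E"
    by (rule AE_not_in, use 1 2 sets.Diff[OF Eb G] sets.Diff[OF G Eb] in
        \<open>simp add: null_sets_def \<mu>.emeasure_eq_measure\<close>)+
  thus ?thesis unfolding ae_inv_def by eventually_elim auto
qed

text \<open>The exceptional set of h is right invariant, so \<open>emeasure_\<mu>_left\<close>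
  applies to it and its preimage under g is null too.\<close>

lemma ae_inv_translate:
  assumes E: "closed E" "rinv E" and h: "h \<in> SL2" and g: "g \<in> SL2" and a: "ae_inv E h"
  shows "AE x in \<mu>. h ** (g ** x) \<in> E \<longleftrightarrow> g ** x \<in> E"
proof -
  define N where "N = (E - {x. h ** x \<in> E}) \<union> ({x. h ** x \<in> E} - E)"
  have Eb: "E \<in> sets borel" "{x. h ** x \<in> E} \<in> sets borel" using E by simp_all
  have N: "N \<in> sets borel" "rinv N"
    unfolding N_def by (intro sets.Un sets.Diff Eb) (intro rinv_Un rinv_Diff rinv_left E h)
  have "AE x in \<mu>. x \<notin> N" using a unfolding ae_inv_def by eventually_elim (auto simp: N_def)
  hence "emeasure \<mu> N = 0"
    using AE_iff_measurable[of N \<mu> "\<lambda>x. x \<notin> N"] N(1) by simp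
  hence "emeasure \<mu> {x. g ** x \<in> N} = 0" using N g by (simp add: emeasure_\<mu>_left)
  moreover have "{x. g ** x \<in> N} \<in> sets borel"
    using measurable_sets[OF mult_left_measurable N(1), of g] by (simp add: vimage_def)
  ultimately have "AE x in \<mu>. x \<notin> {x. g ** x \<in> N}" by (intro AE_not_in) (auto simp: null_sets_def)
  thus ?thesis by eventually_elim (auto simp: N_def)
qed

lemma ae_inv_mult:
  assumes E: "closed E" "rinv E" and h: "h \<in> SL2" and g: "g \<in> SL2" and a: "ae_inv E h" "ae_inv E g"
  shows "ae_inv E (h ** g)"
  using ae_inv_translate[OF E h g a(1)] a(2) unfolding ae_inv_def
  by eventually_elim (simp add: matrix_mul_assoc[symmetric])

lemma ae_inv_iv:
  assumes E: "closed E" "rinv E" and h: "h \<in> SL2" and a: "ae_inv E h"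
  shows "ae_inv E (iv h)"
proof -
  have "AE x in \<mu>. h ** (iv h ** x) \<in> E \<longleftrightarrow> iv h ** x \<in> E" by (rule ae_inv_translate[OF E h iv_SL2[OF h] a])
  thus ?thesis using h by (simp add: ae_inv_def eq_commute)
qed

lemma overlap_bi_ae_inv:
  assumes E: "closed E" "rinv E" and h: "h \<in> SL2" "h' \<in> SL2" and g: "g \<in> SL2" and a: "ae_inv E h" "ae_inv E h'"
  shows "overlap E (h ** g ** h') = overlap E g"
proof -
  have m: "E \<inter> {x. g ** x \<in> E} \<in> sets borel" "rinv (E \<inter> {x. g ** x \<in> E})"
    using E g by (auto intro!: rinv_Int rinv_left sets.Int borel_closed closed_mult_left)
  have "overlap E (h ** g ** h') = measure \<mu> {x. h' ** x \<in> E \<inter> {x. g ** x \<in> E}}"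
    unfolding overlap_def
  proof (rule measure_eq_AE)
    show "AE x in \<mu>. (x \<in> E \<inter> {x. h ** g ** h' ** x \<in> E}) = (x \<in> {x. h' ** x \<in> E \<inter> {x. g ** x \<in> E}})"
      using a(2) ae_inv_translate[OF E h(1) SL2_mult[OF g h(2)] a(1)] unfolding ae_inv_def
      by eventually_elim (auto simp: matrix_mul_assoc)
    show "E \<inter> {x. h ** g ** h' ** x \<in> E} \<in> sets \<mu>"
      using E by (auto intro!: sets.Int borel_closed closed_mult_left)
    show "{x. h' ** x \<in> E \<inter> {x. g ** x \<in> E}} \<in> sets \<mu>"
      using measurable_sets[OF mult_left_measurable m(1), of h'] by (simp add: vimage_def)
  qed
  also have "\<dots> = overlap E g" using measure_\<mu>_left[OF h(2) m(2,1)] by (simp add: overlap_def)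
  finally show ?thesis .
qed

text \<open>Mautner phenomenon: suitable products \<open>uu s ** vv \<epsilon> ** uu t\<close> with \<open>\<epsilon> \<rightarrow> 0\<close> tend to diagonal matrices,
  while the overlap does not depend on \<open>s\<close> and \<open>t\<close>.\<close>

lemma ae_inv_SL2:
  assumes E: "closed E" "rinv E" and u: "\<And>t. ae_inv E (uu t)" and A: "A \<in> SL2"
  shows "ae_inv E A"
proof -
  have dgl: "ae_inv E (dg l)" if l: "l > 0" for l
  proof -
    define e where "e n = 1 / real (Suc n)" for n
    have e: "e n > 0" for n by (simp add: e_def)
    have e0: "e \<longlonglongrightarrow> 0" unfolding e_def by (rule LIMSEQ_Suc[OF lim_1_over_n])
    \<comment> \<open>These matrices tend to \<open>dg l\<close>. By elimination each is
      \<open>vv (e n)\<close> between two upper shears; the shear parameters blow up, but the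
      overlap does not see them.\<close>
    define h where "h n = mat2 l 0 (e n) (1/l)" for n
    have h: "h n = uu ((l - 1) / e n) ** vv (e n) ** uu ((1/l - 1) / e n)" for n
      using e[of n] l by (simp add: h_def uu_def vv_def field_simps)
    have "(\<lambda>n. vv (e n)) \<longlonglongrightarrow> vv 0"
    proof -
      have "continuous_on UNIV vv" unfolding vv_def by (intro continuous_intros)
      thus ?thesis using e0 by (rule continuous_on_tendsto_compose) auto
    qed
    hence "(\<lambda>n. overlap E (vv (e n))) \<longlonglongrightarrow> measure \<mu> E"
      by (intro overlap_tendsto_one E) auto
    moreover have "overlap E (h n) = overlap E (vv (e n))" for n
      unfolding h by (intro overlap_bi_ae_inv E u) auto
    ultimately have "(\<lambda>n. overlap E (h n)) \<longlonglongrightarrow> measure \<mu> E" by simp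
    moreover have "h \<longlonglongrightarrow> dg l"
    proof -
      have "continuous_on UNIV (\<lambda>c. mat2 l 0 c (1/l))" by (intro continuous_intros)
      hence "(\<lambda>n. mat2 l 0 (e n) (1/l)) \<longlonglongrightarrow> mat2 l 0 0 (1/l)"
        using e0 by (rule continuous_on_tendsto_compose) auto
      thus ?thesis unfolding dg_def h_def[abs_def] .
    qed
    ultimately have "overlap E (dg l) = measure \<mu> E" by (intro overlap_limit E)
    thus ?thesis using l by (intro ae_inv_iff_overlap E dg_SL2) auto
  qed
  \<comment> \<open>Conjugation by the diagonal matrices just obtained contracts \<open>vv s\<close>
    to 1 without changing its overlap, so the overlap is full already at
    \<open>vv s\<close>.\<close>
  have v: "ae_inv E (vv s)" for s
  proof -
    have "(\<lambda>n. s / (real (Suc n))\<^sup>2) \<longlonglongrightarrow> 0"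
    proof -
      have "(\<lambda>n. s * (1 / real (Suc n))\<^sup>2) \<longlonglongrightarrow> s * 0\<^sup>2"
        by (intro tendsto_intros LIMSEQ_Suc[OF lim_1_over_n])
      thus ?thesis by (simp add: power_divide)
    qed
    hence "(\<lambda>n. vv (s / (real (Suc n))\<^sup>2)) \<longlonglongrightarrow> vv 0"
    proof -
      have "continuous_on UNIV vv" unfolding vv_def by (intro continuous_intros)
      thus ?thesis using \<open>(\<lambda>n. s / (real (Suc n))\<^sup>2) \<longlonglongrightarrow> 0\<close> by (rule continuous_on_tendsto_compose) auto
    qed
    hence "(\<lambda>n. overlap E (vv (s / (real (Suc n))\<^sup>2))) \<longlonglongrightarrow> measure \<mu> E"
      by (intro overlap_tendsto_one E) auto
    moreover have "overlap E (vv (s / (real (Suc n))\<^sup>2)) = overlap E (vv s)" for n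
    proof -
      have "vv (s / (real (Suc n))\<^sup>2) = dg (real (Suc n)) ** vv s ** dg (1 / real (Suc n))"
        by (subst dg_vv) (auto simp: matrix_mul_assoc[symmetric] dg_mult)
      also have "overlap E \<dots> = overlap E (vv s)" by (intro overlap_bi_ae_inv E dgl dg_SL2) auto
      finally show ?thesis .
    qed
    ultimately have "(\<lambda>n. overlap E (vv s)) \<longlonglongrightarrow> measure \<mu> E" by simp
    hence "overlap E (vv s) = measure \<mu> E" by (rule LIMSEQ_unique[OF tendsto_const])
    thus ?thesis by (intro ae_inv_iff_overlap E) auto
  qed
  show ?thesis using A
  proof (induction rule: SL2_induct)
    case one thus ?case by (simp add: ae_inv_def)
  next
    case (uu A t) thus ?case by (intro ae_inv_mult E u) auto
  next
    case (vv A t) thus ?case by (intro ae_inv_mult E v) auto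
  qed
qed

text \<open>Almost every x obeys the invariance for a countable dense set of q at once. One such x
  in E has a dense part of its \<open>SL2\<close>-orbit in E, and closedness turns this into the
  whole of \<open>SL2\<close>, not only a conull part.\<close>

lemma uu_ergodic:
  assumes E: "closed E" "rinv E" and u: "\<And>t. ae_inv E (uu t)" and pos: "measure \<mu> E > 0"
  shows "E = SL2"
proof -
  obtain Q where Q: "countable Q" "Q \<subseteq> SL2" "SL2 \<subseteq> closure Q" by (rule separable)
  have "AE x in \<mu>. \<forall>q\<in>Q. q ** x \<in> E \<longleftrightarrow> x \<in> E"
    using Q ae_inv_SL2[OF E u] by (subst AE_ball_countable) (auto simp: ae_inv_def)
  hence "\<exists>x\<in>E. \<forall>q\<in>Q. q ** x \<in> E"
  proof (rule contrapos_pp)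
    assume n: "\<not> (\<exists>x\<in>E. \<forall>q\<in>Q. q ** x \<in> E)"
    show "\<not> (AE x in \<mu>. \<forall>q\<in>Q. q ** x \<in> E \<longleftrightarrow> x \<in> E)"
    proof
      assume "AE x in \<mu>. \<forall>q\<in>Q. q ** x \<in> E \<longleftrightarrow> x \<in> E"
      hence "AE x in \<mu>. x \<notin> E" by eventually_elim (use n in auto)
      hence "emeasure \<mu> E = 0"
        using AE_iff_measurable[of E \<mu> "\<lambda>x. x \<notin> E"] borel_closed[OF E(1)] by simp
      thus False using pos by (simp add: measure_def)
    qed
  qed
  then obtain x where x: "x \<in> E" "\<And>q. q \<in> Q \<Longrightarrow> q ** x \<in> E" by auto
  have xS: "x \<in> SL2" using x E by (auto simp: rinv_def)
  have "closed {A. A ** x \<in> E}" by (rule closed_mult_right[OF E(1)])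
  hence "closure Q \<subseteq> {A. A ** x \<in> E}" using x(2) by (intro closure_minimal) auto
  hence all: "A ** x \<in> E" if "A \<in> SL2" for A using Q that by auto
  have "y \<in> E" if "y \<in> SL2" for y
    using all[of "y ** iv x"] that xS by simp
  thus ?thesis using E by (auto simp: rinv_def)
qed

definition avoid :: "(real^2^2) set \<Rightarrow> real \<Rightarrow> (real^2^2) set" where
  "avoid U l = {g \<in> SL2. \<forall>t\<in>{0..l}. uu t ** g \<notin> U}"

lemma closed_avoid:
  assumes "open W" "U = SL2 \<inter> W" shows "closed (avoid U l)"
proof -
  have "avoid U l = SL2 \<inter> (\<Inter>t\<in>{0..l}. {g. uu t ** g \<in> - W})"
    using assms by (auto simp: avoid_def)
  also have "closed \<dots>" using assms(1) closed_SL2 by (intro closed_Int closed_INT ballI closed_mult_left) auto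
  finally show ?thesis .
qed

lemma rinv_avoid: "rinv U \<Longrightarrow> rinv (avoid U l)"
  using rinv_iff[of U] \<Gamma>_SL2 by (auto simp: rinv_def avoid_def matrix_mul_assoc)

text \<open>The points whose whole forward orbit avoids U form a closed set C that is contained in
  its preimage under \<open>uu t\<close> for t \<ge> 0. This is full overlap, so C is invariant
  under the flow and by ergodicity null or everything; the latter contradicts U \<noteq> {}.\<close>

lemma avoid_tendsto_0:
  assumes W: "open W" "U = SL2 \<inter> W" and U: "rinv U" "U \<noteq> {}"
  shows "(\<lambda>n. measure \<mu> (avoid U (real n))) \<longlonglongrightarrow> 0"
proof -
  define C where "C = (\<Inter>n. avoid U (real n))"
  have cl: "closed (avoid U l)" for l by (rule closed_avoid[OF W])
  have "closed C" unfolding C_def using cl by auto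
  moreover have "rinv C" unfolding rinv_def
  proof (intro conjI ballI)
    show "C \<subseteq> SL2" by (auto simp: C_def avoid_def)
    show "x ** \<gamma> \<in> C" if "x \<in> C" "\<gamma> \<in> \<Gamma>" for x \<gamma>
      using that rinv_avoid[OF U(1)] by (auto simp: C_def rinv_def)
  qed
  ultimately have C: "closed C" "rinv C" .
  have Ci: "g \<in> C \<longleftrightarrow> g \<in> SL2 \<and> (\<forall>t\<ge>0. uu t ** g \<notin> U)" for g
  proof
    assume "g \<in> SL2 \<and> (\<forall>t\<ge>0. uu t ** g \<notin> U)" thus "g \<in> C" by (auto simp: C_def avoid_def)
  next
    assume g: "g \<in> C"
    have "uu t ** g \<notin> U" if "t \<ge> 0" for t
    proof -
      obtain n where "t \<le> real n" using real_arch_simple by blast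
      moreover have "g \<in> avoid U (real n)" using g by (auto simp: C_def)
      ultimately show ?thesis using that by (auto simp: avoid_def)
    qed
    thus "g \<in> SL2 \<and> (\<forall>t\<ge>0. uu t ** g \<notin> U)" using g by (auto simp: C_def avoid_def)
  qed
  have pos: "ae_inv C (uu t)" if t: "t \<ge> 0" for t
  proof (rule ae_inv_iff_overlap[OF C])
    have "C \<inter> {x. uu t ** x \<in> C} = C"
      using t by (auto simp: Ci matrix_mul_assoc uu_add)
    thus "overlap C (uu t) = measure \<mu> C" by (simp add: overlap_def)
  qed auto
  have u: "ae_inv C (uu t)" for t
  proof (cases "t \<ge> 0")
    case False
    thus ?thesis using ae_inv_iv[OF C _ pos[of "-t"]] by simp
  qed (rule pos)
  have "measure \<mu> C = 0"
  proof (rule ccontr)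
    assume "measure \<mu> C \<noteq> 0"
    hence "measure \<mu> C > 0" using measure_nonneg[of \<mu> C] by linarith
    hence eq: "C = SL2" by (intro uu_ergodic C u)
    obtain g where g: "g \<in> U" using U by auto
    hence "g \<in> C" using eq W by auto
    hence "uu 0 ** g \<notin> U" unfolding Ci by blast
    thus False using g by simp
  qed
  moreover have "(\<lambda>n. measure \<mu> (avoid U (real n))) \<longlonglongrightarrow> measure \<mu> C" unfolding C_def
    using cl by (intro \<mu>.finite_Lim_measure_decseq) (auto simp: decseq_def avoid_def)
  ultimately show ?thesis by simp
qed

end

section \<open>Orbit segments and measure\<close>

lemma SL2_right_iff [simp]: "B \<in> SL2 \<Longrightarrow> A ** B \<in> SL2 \<longleftrightarrow> A \<in> SL2"
  and SL2_left_iff [simp]: "A \<in> SL2 \<Longrightarrow> A ** B \<in> SL2 \<longleftrightarrow> B \<in> SL2"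
  by (simp_all add: SL2_def det_mul)

lemma small_quotient:
  assumes "b \<in> SL2" "b' \<in> SL2" "ent k (b - mat 1)" "ent k (b' - mat 1)" "k \<le> 1"
  shows "ent (8 * k) (iv b ** b' - mat 1)"
proof -
  have "ent 2 b" using ent_diff_one[OF assms(3)] assms(5) by (auto intro: ent_mono)
  moreover have "ent (2 * k) (b' - b)" using ent_triangle[OF assms(4,3)] by simp
  ultimately have "ent (2 * 2 * (2 * k)) (iv b ** (b' - b))" by (intro ent_mult) (auto simp: ent_iv)
  thus ?thesis using assms(1) by (simp add: matrix_diff_ldistrib2)
qed

text \<open>For k < 1 these are the products \<open>vv r ** dg l ** uu \<tau>\<close> with |r| \<le>
  k, |l - 1| \<le> k and a \<le> \<tau> < b, expressed by entries: l is the upper left entry, l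
  \<tau> the upper right and r l the lower left one. The interval for \<tau> is half open so that
  cells tile.\<close>

definition cell :: "real \<Rightarrow> real \<Rightarrow> real \<Rightarrow> (real^2^2) set" where
  "cell k a b = {A \<in> SL2. \<bar>A $ 1 $ 1 - 1\<bar> \<le> k \<and> a * A $ 1 $ 1 \<le> A $ 1 $ 2 \<and> A $ 1 $ 2 < b * A $ 1 $ 1 \<and>
     \<bar>A $ 2 $ 1\<bar> \<le> k * A $ 1 $ 1}"

lemma cell_SL2: "cell k a b \<subseteq> SL2"
  by (auto simp: cell_def)

lemma cell_sets [measurable]: "cell k a b \<in> sets borel"
proof -
  have "cell k a b = SL2 \<inter> {A. \<bar>A $ 1 $ 1 - 1\<bar> \<le> k} \<inter> {A. a * A $ 1 $ 1 \<le> A $ 1 $ 2} \<inter>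
     {A. A $ 1 $ 2 < b * A $ 1 $ 1} \<inter> {A. \<bar>A $ 2 $ 1\<bar> \<le> k * A $ 1 $ 1}"
    by (auto simp: cell_def)
  also have "\<dots> \<in> sets borel"
    by (intro sets.Int borel_closed closed_SL2 closed_Collect_le borel_open open_Collect_less continuous_intros)
  finally show ?thesis .
qed

lemma cell_uu: "x ** uu s \<in> cell k (a + s) (b + s) \<longleftrightarrow> x \<in> cell k a b"
  by (auto simp: cell_def) (auto simp: uu_def algebra_simps)

lemma haar_cell_shift: "emeasure haar (cell k (a + s) (b + s)) = emeasure haar (cell k a b)"
  using emeasure_haar_right[of "uu s" "cell k (a + s) (b + s)"] by (simp add: cell_uu)

lemma cell_decomp:
  assumes "A \<in> cell k a b" "k < 1"
  shows "\<exists>r l t. A = vv r ** dg l ** uu t \<and> \<bar>r\<bar> \<le> k \<and> \<bar>l - 1\<bar> \<le> k \<and> a \<le> t \<and> t < b \<and> l > 0"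
proof -
  have "A \<in> SL2" using assms by (simp add: cell_def)
  then obtain p q r s where A: "A = mat2 p q r s" "p * s - q * r = 1" using SL2_cases by blast
  have c: "\<bar>p - 1\<bar> \<le> k" "a * p \<le> q" "q < b * p" "\<bar>r\<bar> \<le> k * p" using assms by (auto simp: cell_def A)
  have p: "p > 0" using c(1) assms(2) by linarith
  have s: "s = (1 + q * r) / p" using A(2) p by (simp add: field_simps)
  have "A = vv (r / p) ** dg p ** uu (q / p)"
    using p unfolding A(1) s by (simp add: vv_def dg_def uu_def field_simps)
  moreover have "\<bar>r / p\<bar> \<le> k" "a \<le> q / p" "q / p < b"
    using c p by (simp_all add: abs_divide pos_divide_le_eq pos_le_divide_eq pos_divide_less_eq)
  ultimately show ?thesis using c(1) p by blast
qed

lemma cell_ent: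
  assumes "A \<in> cell k 0 k" "k \<le> 1/4"
  shows "ent (4 * k) (A - mat 1)"
proof -
  have "A \<in> SL2" using assms by (simp add: cell_def)
  then obtain p q r s where A: "A = mat2 p q r s" "p * s - q * r = 1" using SL2_cases by blast
  have c: "\<bar>p - 1\<bar> \<le> k" "0 \<le> q" "q < k * p" "\<bar>r\<bar> \<le> k * p" using assms by (auto simp: cell_def A)
  have k: "k \<ge> 0" using c(1) by linarith
  have p: "p \<le> 1 + k" "p \<ge> 1 - k" using c(1) by linarith+
  have "k * p \<le> k * 2" using k p assms(2) by (intro mult_left_mono) auto
  hence q: "\<bar>q\<bar> \<le> 2 * k" "\<bar>r\<bar> \<le> 2 * k" using c by auto
  have "\<bar>q * r\<bar> \<le> k * p * (k * p)" unfolding abs_mult using c by (intro mult_mono) auto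
  also have "\<dots> = p * (k * (k * p))" by simp
  finally have qr: "\<bar>q * r\<bar> \<le> p * (k * (k * p))" .
  have p0: "p > 0" using p assms(2) by linarith
  have s: "s - 1 = (1 - p) / p + q * r / p" using A(2) p0 by (simp add: field_simps)
  have 0: "\<bar>q * r / p\<bar> \<le> k * (k * p)" using qr p0 by (simp add: abs_divide pos_divide_le_eq mult_ac)
  have "k * p \<le> 1" using \<open>k * p \<le> k * 2\<close> assms(2) by linarith
  hence "k * (k * p) \<le> k * 1" using k by (rule mult_left_mono)
  hence 1: "\<bar>q * r / p\<bar> \<le> k" using 0 by linarith
  have "\<bar>1 - p\<bar> \<le> 2 * k * p"
  proof -
    have "1 \<le> 2 * p" using p assms(2) by linarith
    hence "k * 1 \<le> k * (2 * p)" using k by (rule mult_left_mono)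
    thus ?thesis using c(1) by linarith
  qed
  hence "\<bar>(1 - p) / p\<bar> \<le> 2 * k" using p0 by (simp add: abs_divide pos_divide_le_eq mult_ac)
  hence "\<bar>s - 1\<bar> \<le> 4 * k" using 1 k unfolding s by linarith
  thus ?thesis using q c(1) k by (simp add: A ent_mat2 mat_1_mat2)
qed

lemma haar_cell_pos: assumes "0 < k" "k < 1" shows "emeasure haar (cell k 0 k) > 0"
proof -
  define U where "U = {A::real^2^2. \<bar>A $ 1 $ 1 - 1\<bar> < k} \<inter> {A. 0 < A $ 1 $ 2} \<inter>
     {A. A $ 1 $ 2 < k * A $ 1 $ 1} \<inter> {A. \<bar>A $ 2 $ 1\<bar> < k * A $ 1 $ 1}"
  have U: "open U" unfolding U_def by (intro open_Int open_Collect_less continuous_intros)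
  have "mat2 1 (k/2) 0 1 \<in> U \<inter> SL2" using assms by (auto simp: U_def)
  hence "0 < emeasure haar U" using U by (intro haar_open_pos) auto
  also have "emeasure haar U = emeasure haar (U \<inter> SL2)"
  proof -
    have "{M \<in> cone. (1 / sqrt (det M)) *\<^sub>R M \<in> U} = {M \<in> cone. (1 / sqrt (det M)) *\<^sub>R M \<in> U \<inter> SL2}"
      using normalize_SL2 by auto
    moreover have "U \<in> sets borel" "U \<inter> SL2 \<in> sets borel" using U closed_SL2 by auto
    ultimately show ?thesis by (simp add: emeasure_haar)
  qed
  also have "\<dots> \<le> emeasure haar (cell k 0 k)"
    by (rule emeasure_mono[rotated], simp) (use cell_sets in \<open>auto simp: U_def cell_def less_imp_le\<close>)
  finally show ?thesis .
qed

context lattice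
begin

text \<open>If x and x \<gamma> both lie in the small set around z, their quotient is a matrix near
  1 that carries z to z \<gamma>, and thickness makes \<gamma> trivial. The 8 k comes from
  \<open>small_quotient\<close>, the 16 k from \<open>thick_small_eq\<close>.\<close>

lemma inj_dom_translate:
  assumes z: "z \<in> SL2" "thick \<rho> z" and B: "B \<in> sets borel" "B \<subseteq> SL2" "\<And>b. b \<in> B \<Longrightarrow> ent k (b - mat 1)"
    and k: "k \<le> 1" "16 * k < \<rho>" "8 * k < 1"
  shows "inj_dom {x. x ** iv z \<in> B}"
proof -
  have S: "x \<in> SL2" if "x ** iv z \<in> B" for x
    using that B(2) z by (metis SL2_right_iff iv_SL2 subsetD)
  have "{x. x ** iv z \<in> B} \<in> sets borel"
    using measurable_sets[OF mult_right_measurable B(1), of "iv z"] by (simp add: vimage_def)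
  moreover have "\<gamma> = mat 1" if x: "x ** iv z \<in> B" "x ** \<gamma> ** iv z \<in> B" and g: "\<gamma> \<in> \<Gamma>" for x \<gamma>
  proof -
    let ?b = "x ** iv z" and ?c = "x ** \<gamma> ** iv z"
    have e: "ent (8 * k) (iv ?b ** ?c - mat 1)" using x B k by (intro small_quotient) auto
    have "(iv ?b ** ?c) ** z = z ** \<gamma>"
      using S[OF x(1)] z \<Gamma>_SL2[OF g] by (simp add: iv_mult matrix_mul_assoc[symmetric])
    moreover have "?b \<in> SL2" "?c \<in> SL2" using x B(2) by blast+
    hence "iv ?b ** ?c \<in> SL2" by (rule SL2_mult[OF iv_SL2])
    ultimately show ?thesis using thick_small_eq[OF z(2,1) g _ e] k by auto
  qed
  ultimately show ?thesis using S by (auto simp: inj_dom_def)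
qed

lemma rinv_SL2: "rinv SL2"
  using \<Gamma>_SL2 by (auto simp: rinv_def)

text \<open>The translates of a small cell that belong to separated times are disjoint modulo \<open>\<Gamma>\<close>, and all of them
  land in \<open>E'\<close>: a long orbit segment starting at a thick point is dominated by \<open>\<mu>\<close>.\<close>

lemma cell_count_aux:
  assumes z: "z \<in> SL2" "thick \<rho> z" and k: "0 < k" "k \<le> 1/100" "k \<le> \<rho> / 100"
    and T: "T > 0" and q: "q > 0" and Q: "finite Q" "Q \<subseteq> {0..k * T - q}"
    and sep: "\<And>s t. s \<in> Q \<Longrightarrow> t \<in> Q \<Longrightarrow> s < t \<Longrightarrow> s + q \<le> t"
    and E': "rinv E'" "E' \<in> sets borel"
    and E: "\<And>t. t \<in> Q \<Longrightarrow> uu t ** (dg (sqrt T) ** z) \<in> E"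
    and EE: "\<And>e r l \<theta>. e \<in> E \<Longrightarrow> \<bar>r\<bar> \<le> k / T \<Longrightarrow> \<bar>l - 1\<bar> \<le> k \<Longrightarrow> 0 \<le> \<theta> \<Longrightarrow> \<theta> < q \<Longrightarrow>
        vv r ** dg l ** uu \<theta> ** e \<in> E'"
  shows "of_nat (card Q) * emeasure haar (cell k 0 (q / T)) \<le> emeasure \<mu> E'"
proof -
  define X where "X t = {x. x ** iv z \<in> cell k (t / T) ((t + q) / T)}" for t
  define S where "S = {x. x ** iv z \<in> cell k 0 k}"
  have injS: "inj_dom S" unfolding S_def
    using k cell_SL2 cell_ent by (intro inj_dom_translate[OF z, where k="4*k"]) auto
  have Xm: "X t \<in> sets borel" for t
    using measurable_sets[OF mult_right_measurable cell_sets, of "iv z"] by (simp add: X_def vimage_def)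
  have sT: "sqrt T \<noteq> 0" "(sqrt T)\<^sup>2 = T" using T by auto
  have Xe: "emeasure haar (X t) = emeasure haar (cell k 0 (q / T))" for t
  proof -
    have "emeasure haar (X t) = emeasure haar (cell k (t / T) ((t + q) / T))"
      unfolding X_def using z by (intro emeasure_haar_right) auto
    also have "\<dots> = emeasure haar (cell k (0 + t / T) (q / T + t / T))" by (simp add: add_divide_distrib add.commute)
    finally show ?thesis by (simp only: haar_cell_shift)
  qed
  have XE: "dg (sqrt T) ** x \<in> E'" if t: "t \<in> Q" and x: "x \<in> X t" for x t
  proof -
    obtain r l \<tau> where d: "x ** iv z = vv r ** dg l ** uu \<tau>" "\<bar>r\<bar> \<le> k" "\<bar>l - 1\<bar> \<le> k" "t / T \<le> \<tau>" "\<tau> < (t + q) / T"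
      using cell_decomp[of "x ** iv z" k "t/T" "(t+q)/T"] x k by (fastforce simp: X_def)
    have "x = x ** iv z ** z" using z by simp
    hence "dg (sqrt T) ** x = dg (sqrt T) ** vv r ** dg l ** uu \<tau> ** z" unfolding d(1) by (simp add: matrix_mul_assoc)
    also have "\<dots> = vv (r / T) ** (dg (sqrt T) ** dg l) ** uu \<tau> ** z"
      using dg_vv[OF sT(1), of r] unfolding sT(2) by (simp add: matrix_mul_assoc)
    also have "dg (sqrt T) ** dg l = dg l ** dg (sqrt T)" by (simp add: dg_mult mult.commute)
    also have "vv (r / T) ** (dg l ** dg (sqrt T)) ** uu \<tau> ** z = vv (r / T) ** dg l ** (dg (sqrt T) ** uu \<tau>) ** z"
      by (simp add: matrix_mul_assoc)
    also have "dg (sqrt T) ** uu \<tau> = uu (T * \<tau>) ** dg (sqrt T)" using dg_uu[OF sT(1), of \<tau>] sT(2) by simp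
    also have "uu (T * \<tau>) = uu (T * \<tau> - t) ** uu t" by (simp add: uu_add)
    also have "vv (r / T) ** dg l ** (uu (T * \<tau> - t) ** uu t ** dg (sqrt T)) ** z =
        vv (r / T) ** dg l ** uu (T * \<tau> - t) ** (uu t ** (dg (sqrt T) ** z))" by (simp add: matrix_mul_assoc)
    also have "\<dots> \<in> E'"
    proof (rule EE[OF E[OF t]])
      show "\<bar>r / T\<bar> \<le> k / T" using d(2) T by (simp add: abs_divide divide_right_mono)
      show "0 \<le> T * \<tau> - t" using d(4) T by (simp add: pos_divide_le_eq mult.commute)
      show "T * \<tau> - t < q" using d(5) T by (simp add: pos_less_divide_eq mult.commute)
    qed (rule d(3))
    finally show ?thesis .
  qed
  have XS: "X t \<subseteq> S" if "t \<in> Q" for t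
  proof -
    have "0 \<le> t" "t + q \<le> k * T" using Q that by force+
    hence "t / T \<ge> 0" "(t + q) / T \<le> k" using T by (auto simp: field_simps)
    moreover have "p > 0" if "\<bar>p - 1\<bar> \<le> k" for p :: real using that k by linarith
    ultimately have "cell k (t / T) ((t + q) / T) \<subseteq> cell k 0 k"
      unfolding cell_def using k
      by (smt (verit, ccfv_SIG) Collect_mono mult_right_mono mult_nonneg_nonneg)
    thus ?thesis by (auto simp: X_def S_def)
  qed
  \<comment> \<open>The coordinates r, l, \<tau> of a matrix are unique, and the intervals for
    \<tau> do not overlap. Disjointness modulo \<Gamma> is inherited from the embedded set
    S.\<close>
  have dis: "disjoint_family_on X Q"
    unfolding disjoint_family_on_def
  proof (intro ballI impI)
    have *: "X s \<inter> X t = {}" if "s \<in> Q" "t \<in> Q" "s < t" for s t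
    proof -
      have "(s + q) / T \<le> t / T" using sep[OF that] T by (simp add: divide_right_mono)
      have False if xs: "x \<in> X s" "x \<in> X t" for x
      proof -
        obtain r l \<tau> where 1: "x ** iv z = vv r ** dg l ** uu \<tau>" "\<tau> < (s + q) / T" "l > 0"
          using cell_decomp[of "x ** iv z" k "s/T" "(s+q)/T"] xs(1) k unfolding X_def by auto
        obtain r' l' \<tau>' where 2: "x ** iv z = vv r' ** dg l' ** uu \<tau>'" "t / T \<le> \<tau>'" "l' > 0"
          using cell_decomp[of "x ** iv z" k "t/T" "(t+q)/T"] xs(2) k unfolding X_def by auto
        have "l = l' \<and> l * \<tau> = l' * \<tau>'" using 1(1) 2(1) unfolding vv_def dg_def uu_def by auto
        hence "\<tau> = \<tau>'" using 1(3) mult_left_cancel[of l \<tau> \<tau>'] by auto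
        thus False using 1(2) 2(2) \<open>(s + q) / T \<le> t / T\<close> by linarith
      qed
      thus ?thesis by blast
    qed
    fix s t assume "s \<in> Q" "t \<in> Q" "s \<noteq> t"
    thus "X s \<inter> X t = {}" using *[of s t] *[of t s] by (cases "s < t") auto
  qed
  have "of_nat (card Q) * emeasure haar (cell k 0 (q / T)) = (\<Sum>t\<in>Q. emeasure haar (X t))"
    by (simp add: Xe)
  also have "\<dots> = emeasure haar (\<Union>t\<in>Q. X t)"
    using Q(1) Xm dis by (intro sum_emeasure) auto
  also have "\<dots> \<le> emeasure haar (S \<inter> {x. dg (sqrt T) ** x \<in> E'})"
  proof (rule emeasure_mono)
    show "(\<Union>t\<in>Q. X t) \<subseteq> S \<inter> {x. dg (sqrt T) ** x \<in> E'}" using XS XE by auto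
    show "S \<inter> {x. dg (sqrt T) ** x \<in> E'} \<in> sets haar"
      using injS measurable_sets[OF mult_left_measurable E'(2), of "dg (sqrt T)"] by (auto simp: inj_dom_def vimage_def)
  qed
  also have "\<dots> \<le> emeasure \<mu> {x. dg (sqrt T) ** x \<in> E'}"
    using injS measurable_sets[OF mult_left_measurable E'(2), of "dg (sqrt T)"] E' sT
    by (intro emeasure_inj_dom_le rinv_left dg_SL2) (auto simp: vimage_def)
  also have "\<dots> = emeasure \<mu> E'" using E' sT by (intro emeasure_\<mu>_left dg_SL2) auto
  finally show ?thesis .
qed

text \<open>Shifts of the thin cell cover the fat one and all have the same Haar measure. This
  trades the thin cell of \<open>cell_count_aux\<close> for a constant that depends neither on T nor
  on q.\<close>

lemma cell_cover:
  assumes k: "0 < k" "k < 1" and T: "T > 0" and q: "q > 0"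
  shows "emeasure haar (cell k 0 k) \<le> of_nat (nat \<lceil>k * T / q\<rceil>) * emeasure haar (cell k 0 (q / T))"
proof -
  let ?n = "nat \<lceil>k * T / q\<rceil>"
  have "cell k 0 k \<subseteq> (\<Union>i<?n. cell k (real i * (q / T)) (q / T + real i * (q / T)))"
  proof
    fix A assume A: "A \<in> cell k 0 k"
    define p where "p = A $ 1 $ 1"
    define t where "t = A $ 1 $ 2 / p"
    have p: "p > 0" using A k by (auto simp: cell_def p_def)
    have t: "0 \<le> t" "t < k" "A $ 1 $ 2 = t * p" using A p by (auto simp: cell_def p_def[symmetric] t_def field_simps)
    define i where "i = nat \<lfloor>t * T / q\<rfloor>"
    have x0: "0 \<le> t * T / q" using t T q by simp
    have i: "real i \<le> t * T / q" "t * T / q < real i + 1"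
      using x0 unfolding i_def by linarith+
    have "t * T / q < k * T / q" using t T q by (simp add: divide_strict_right_mono)
    hence "real i < k * T / q" using i by linarith
    hence "i < ?n" using q T k by (simp add: less_ceiling_iff zless_nat_eq_int_zless)
    moreover have "real i * (q / T) \<le> t" "t < q / T + real i * (q / T)"
      using i T q by (auto simp: field_simps)
    hence "A \<in> cell k (real i * (q / T)) (q / T + real i * (q / T))"
      using A t(3) p mult_right_mono[of "real i * (q / T)" t p]
        mult_strict_right_mono[of t "q / T + real i * (q / T)" p]
      by (simp add: cell_def p_def)
    ultimately show "A \<in> (\<Union>i<?n. cell k (real i * (q / T)) (q / T + real i * (q / T)))" by auto
  qed
  hence "emeasure haar (cell k 0 k) \<le> emeasure haar (\<Union>i<?n. cell k (real i * (q / T)) (q / T + real i * (q / T)))"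
    by (intro emeasure_mono) auto
  also have "\<dots> \<le> (\<Sum>i<?n. emeasure haar (cell k (real i * (q / T)) (q / T + real i * (q / T))))"
    by (intro emeasure_subadditive_finite) auto
  also have "\<dots> = (\<Sum>i<?n. emeasure haar (cell k (0 + real i * (q / T)) (q / T + real i * (q / T))))" by simp
  also have "\<dots> = of_nat ?n * emeasure haar (cell k 0 (q / T))" by (simp only: haar_cell_shift) simp
  finally show ?thesis .
qed

definition cell_measure :: "real \<Rightarrow> real" where "cell_measure k = enn2real (emeasure haar (cell k 0 k))"

text \<open>A thick point embeds the cell into the quotient, whose volume is finite; so
  \<open>enn2real\<close> loses nothing.\<close>

lemma cell_measure:
  assumes z: "z \<in> SL2" "thick \<rho> z" and k: "0 < k" "k \<le> 1/100" "k \<le> \<rho> / 100"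
  shows "cell_measure k > 0" "emeasure haar (cell k 0 k) = ennreal (cell_measure k)"
proof -
  have "inj_dom {x. x ** iv z \<in> cell k 0 k}"
    using k cell_SL2 cell_ent by (intro inj_dom_translate[OF z, where k="4*k"]) auto
  hence "emeasure haar ({x. x ** iv z \<in> cell k 0 k} \<inter> SL2) \<le> emeasure \<mu> SL2"
    using closed_SL2 by (intro emeasure_inj_dom_le rinv_SL2) auto
  moreover have "{x. x ** iv z \<in> cell k 0 k} \<inter> SL2 = {x. x ** iv z \<in> cell k 0 k}"
    using \<open>inj_dom _\<close> by (auto simp: inj_dom_def)
  moreover have "emeasure haar {x. x ** iv z \<in> cell k 0 k} = emeasure haar (cell k 0 k)"
    using z by (intro emeasure_haar_right) auto
  ultimately have "emeasure haar (cell k 0 k) \<le> emeasure \<mu> SL2" by simp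
  also have "\<dots> < \<infinity>" using \<mu>.emeasure_finite[of SL2] by (simp add: less_top[symmetric])
  finally show "emeasure haar (cell k 0 k) = ennreal (cell_measure k)" by (simp add: cell_measure_def)
  note * = this
  have "emeasure haar (cell k 0 k) > 0" using k by (intro haar_cell_pos) auto
  thus "cell_measure k > 0" unfolding * by simp
qed

lemma cell_count:
  assumes z: "z \<in> SL2" "thick \<rho> z" and k: "0 < k" "k \<le> 1/100" "k \<le> \<rho> / 100"
    and T: "T > 0" and q: "q > 0" and Q: "finite Q" "Q \<subseteq> {0..k * T - q}"
    and sep: "\<And>s t. s \<in> Q \<Longrightarrow> t \<in> Q \<Longrightarrow> s < t \<Longrightarrow> s + q \<le> t"
    and E': "rinv E'" "E' \<in> sets borel"
    and E: "\<And>t. t \<in> Q \<Longrightarrow> uu t ** (dg (sqrt T) ** z) \<in> E"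
    and EE: "\<And>e r l \<theta>. e \<in> E \<Longrightarrow> \<bar>r\<bar> \<le> k / T \<Longrightarrow> \<bar>l - 1\<bar> \<le> k \<Longrightarrow> 0 \<le> \<theta> \<Longrightarrow> \<theta> < q \<Longrightarrow>
        vv r ** dg l ** uu \<theta> ** e \<in> E'"
  shows "real (card Q) * cell_measure k \<le> (T / q + 1) * measure \<mu> E'"
proof -
  let ?n = "nat \<lceil>k * T / q\<rceil>"
  have "ennreal (real (card Q) * cell_measure k) = of_nat (card Q) * emeasure haar (cell k 0 k)"
    using cell_measure[OF z k] by (simp add: ennreal_mult ennreal_of_nat_eq_real_of_nat)
  also have "\<dots> \<le> of_nat (card Q) * (of_nat ?n * emeasure haar (cell k 0 (q / T)))"
    using k T q by (intro mult_left_mono cell_cover) auto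
  also have "\<dots> = of_nat ?n * (of_nat (card Q) * emeasure haar (cell k 0 (q / T)))" by (simp add: mult_ac)
  also have "\<dots> \<le> of_nat ?n * emeasure \<mu> E'"
    by (intro mult_left_mono cell_count_aux[OF z k T q Q sep E' E EE]) auto
  also have "\<dots> = ennreal (real ?n * measure \<mu> E')"
    by (simp add: \<mu>.emeasure_eq_measure ennreal_mult ennreal_of_nat_eq_real_of_nat)
  finally have "real (card Q) * cell_measure k \<le> real ?n * measure \<mu> E'"
    by (subst (asm) ennreal_le_iff) auto
  also have "\<dots> \<le> (T / q + 1) * measure \<mu> E'"
  proof (rule mult_right_mono)
    have "k * T / q \<ge> 0" using k T q by simp
    hence "real ?n \<le> k * T / q + 1" by linarith
    also have "k * T / q \<le> 1 * T / q" using k T q by (intro divide_right_mono mult_right_mono) auto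
    finally show "real ?n \<le> T / q + 1" by simp
  qed simp
  finally show ?thesis .
qed

lemma thick_uu:
  assumes "z \<in> SL2" "thick \<rho> z" "0 \<le> s" "s \<le> 2" shows "thick (\<rho> / 32) (uu s ** z)"
proof -
  have "ent 2 (uu s)" using assms by (simp add: uu_def ent_mat2)
  thus ?thesis using thick_conj[OF assms(2,1) uu_SL2, of 2 s] by simp
qed

text \<open>\<open>cell_count\<close> sees only times up to k T. So [0, T] is cut into about 2 / k
  blocks of length k T / 2, each viewed from its own base point \<open>uu s ** z\<close> with
  bounded s, which is still thick with \<rho> / 32. If no point is that thick, the claim is
  vacuous.\<close>

lemma orbit_count:
  assumes \<rho>: "\<rho> > 0" and k: "0 < k" "k \<le> 1/100" "k \<le> \<rho> / 3200"
  shows "\<exists>C>0. \<forall>z T q Q E E'. z \<in> SL2 \<longrightarrow> thick \<rho> z \<longrightarrow> 0 < T \<longrightarrow> 0 < q \<longrightarrow> 2 * q \<le> k * T \<longrightarrow> finite Q \<longrightarrow>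
     Q \<subseteq> {0..T} \<longrightarrow> (\<forall>s\<in>Q. \<forall>t\<in>Q. s < t \<longrightarrow> s + q \<le> t) \<longrightarrow> rinv E' \<longrightarrow> E' \<in> sets borel \<longrightarrow>
     (\<forall>t\<in>Q. uu t ** (dg (sqrt T) ** z) \<in> E) \<longrightarrow>
     (\<forall>e r l \<theta>. e \<in> E \<longrightarrow> \<bar>r\<bar> \<le> k / T \<longrightarrow> \<bar>l - 1\<bar> \<le> k \<longrightarrow> 0 \<le> \<theta> \<longrightarrow> \<theta> < q \<longrightarrow>
        vv r ** dg l ** uu \<theta> ** e \<in> E') \<longrightarrow> real (card Q) \<le> C * (T / q + 1) * measure \<mu> E'"
proof (cases "\<exists>z\<in>SL2. thick (\<rho> / 32) z")
  case True
  then obtain z0 where z0: "z0 \<in> SL2" "thick (\<rho> / 32) z0" by auto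
  have k': "k \<le> \<rho> / 32 / 100" using k by simp
  have cm: "cell_measure k > 0" by (rule cell_measure[OF z0 k(1,2) k'])
  define m where "m = nat \<lceil>2 / k\<rceil> + 1"
  have m: "real m \<ge> 2 / k" using k by (simp add: m_def) linarith
  have mp: "m > 0" by (simp add: m_def)
  show ?thesis
  proof (intro exI[of _ "real m / cell_measure k"] conjI allI impI)
    fix z T q Q E E'
    assume z: "z \<in> SL2" "thick \<rho> z" and T: "0 < T" and q: "0 < (q::real)" "2 * q \<le> k * T" and Q: "finite Q" "Q \<subseteq> {0..T}"
      and sep: "\<forall>s\<in>Q. \<forall>t\<in>Q. s < t \<longrightarrow> s + q \<le> t" and E': "rinv E'" "E' \<in> sets borel"
      and E: "\<forall>t\<in>Q. uu t ** (dg (sqrt T) ** z) \<in> E"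
      and EE: "\<forall>e r l \<theta>. e \<in> E \<longrightarrow> \<bar>r\<bar> \<le> k / T \<longrightarrow> \<bar>l - 1\<bar> \<le> k \<longrightarrow> 0 \<le> \<theta> \<longrightarrow> \<theta> < q \<longrightarrow>
        vv r ** dg l ** uu \<theta> ** e \<in> E'"
    define w where "w = k * T / 2"
    have w: "w > 0" using k T by (simp add: w_def)
    define P where "P i = {t \<in> Q. real i * w \<le> t \<and> t < (real i + 1) * w}" for i :: nat
    have "Q \<subseteq> (\<Union>i<m. P i)"
    proof
      fix t assume t: "t \<in> Q"
      define i where "i = nat \<lfloor>t / w\<rfloor>"
      have t0: "0 \<le> t" "t \<le> T" using t Q by auto
      have "t / w \<ge> 0" using t0 w by simp
      hence i: "real i \<le> t / w" "t / w < real i + 1" unfolding i_def by linarith+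
      have "t / w \<le> 2 / k" using t0 k T by (simp add: w_def field_simps)
      moreover have "2 / k < real m" using k by (simp add: m_def) linarith
      ultimately have "i < m" using i by simp
      moreover have "t \<in> P i" using t i w by (auto simp: P_def field_simps)
      ultimately show "t \<in> (\<Union>i<m. P i)" by auto
    qed
    hence "card Q \<le> card (\<Union>i<m. P i)" using Q by (intro card_mono) (auto simp: P_def)
    also have "\<dots> \<le> (\<Sum>i<m. card (P i))" by (rule card_UN_le) simp
    finally have "real (card Q) \<le> (\<Sum>i<m. real (card (P i)))" by (metis of_nat_le_iff of_nat_sum)
    also have "\<dots> \<le> (\<Sum>i<m. (T / q + 1) * measure \<mu> E' / cell_measure k)"
    proof (rule sum_mono)
      fix i assume i: "i \<in> {..<m}"
      show "real (card (P i)) \<le> (T / q + 1) * measure \<mu> E' / cell_measure k"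
      proof (cases "P i = {}")
        case False
        then obtain t0 where "t0 \<in> P i" by auto
        hence iw: "real i * w \<le> T" using Q by (auto simp: P_def)
        define s where "s = real i * k / 2"
        have s: "0 \<le> s" "s \<le> 2" "T * s = real i * w" using iw k T by (auto simp: s_def w_def field_simps)
        define zi where "zi = uu s ** z"
        have zi: "zi \<in> SL2" "thick (\<rho> / 32) zi" using z s by (auto simp: zi_def intro!: thick_uu)
        have sT: "sqrt T \<noteq> 0" "(sqrt T)\<^sup>2 = T" using T by auto
        have yi: "dg (sqrt T) ** zi = uu (real i * w) ** (dg (sqrt T) ** z)"
          using dg_uu[OF sT(1), of s] s(3) sT(2) by (simp add: zi_def matrix_mul_assoc)
        define Qi where "Qi = (\<lambda>t. t - real i * w) ` P i"
        have "real (card Qi) * cell_measure k \<le> (T / q + 1) * measure \<mu> E'"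
        proof (rule cell_count[OF zi k(1,2) k' T q(1) _ _ _ E'])
          show "finite Qi" using Q by (auto simp: Qi_def P_def)
          show "Qi \<subseteq> {0..k * T - q}" using q w by (auto simp: Qi_def P_def w_def algebra_simps)
          show "s + q \<le> t" if "s \<in> Qi" "t \<in> Qi" "s < t" for s t
            using that sep by (auto simp: Qi_def P_def)
          show "uu t ** (dg (sqrt T) ** zi) \<in> E" if "t \<in> Qi" for t
            using that E unfolding yi by (auto simp: Qi_def P_def matrix_mul_assoc uu_add)
          show "vv r ** dg l ** uu \<theta> ** e \<in> E'" if "e \<in> E" "\<bar>r\<bar> \<le> k / T" "\<bar>l - 1\<bar> \<le> k" "0 \<le> \<theta>" "\<theta> < q" for e r l \<theta>
            using EE that by blast
        qed
        moreover have "card Qi = card (P i)" unfolding Qi_def by (intro card_image) (auto simp: inj_on_def)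
        ultimately show ?thesis using cm by (simp add: field_simps)
      qed (use cm T q in simp)
    qed
    also have "\<dots> = real m / cell_measure k * (T / q + 1) * measure \<mu> E'" by simp
    finally show "real (card Q) \<le> real m / cell_measure k * (T / q + 1) * measure \<mu> E'" .
  qed (use mp cm in simp)
next
  case False
  hence "\<not> thick \<rho> z" if "z \<in> SL2" for z
    using that thick_mono[of \<rho> z "\<rho>/32"] \<rho> by auto
  thus ?thesis by (intro exI[of _ 1]) auto
qed

end

section \<open>Nondivergence and visits to open sets\<close>

lemma tendsto_measure_decseq_0:
  assumes "finite_measure M" "\<And>n::nat. A n \<in> sets M" "decseq A" "(\<Inter>n. A n) = {}" "e > 0"
  shows "\<exists>n>0. measure M (A n) < e"
proof -
  have "(\<lambda>n. measure M (A n)) \<longlonglongrightarrow> measure M (\<Inter>n. A n)"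
    using assms by (intro finite_measure.finite_Lim_measure_decseq) auto
  hence "(\<lambda>n. measure M (A n)) \<longlonglongrightarrow> 0" using assms(4) by simp
  hence "\<forall>\<^sub>F n in sequentially. measure M (A n) < e" using assms(5) by (rule order_tendstoD)
  hence "\<forall>\<^sub>F n in sequentially. measure M (A n) < e \<and> n > 0" using eventually_gt_at_top[of 0] by (rule eventually_conj)
  thus ?thesis using eventually_happens[of _ sequentially] by auto
qed

context lattice
begin

lemma ent_vdu:
  assumes "\<bar>r\<bar> \<le> 1" "\<bar>l - 1\<bar> \<le> 1/2" "0 \<le> \<theta>" "\<theta> \<le> 1"
  shows "ent 4 (vv r ** dg l ** uu \<theta>)"
proof -
  have l: "1/2 \<le> l" "l \<le> 2" using assms(2) unfolding abs_le_iff by linarith+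
  have "\<bar>l * \<theta>\<bar> \<le> 2 * 1" unfolding abs_mult using l assms by (intro mult_mono) auto
  moreover have "\<bar>r * l\<bar> \<le> 1 * 2" unfolding abs_mult using l assms by (intro mult_mono) auto
  moreover have "\<bar>r * l * \<theta>\<bar> \<le> 2 * 1" unfolding abs_mult[of _ \<theta>]
    using calculation assms by (intro mult_mono) auto
  moreover have "0 \<le> 1 / l" "1 / l \<le> 2" using l by (auto simp: field_simps)
  moreover have "\<bar>r * l * \<theta> + 1 / l\<bar> \<le> \<bar>r * l * \<theta>\<bar> + \<bar>1 / l\<bar>" by (rule abs_triangle_ineq)
  ultimately show ?thesis using l by (simp add: vv_def dg_def uu_def ent_mat2)
qed

definition thin :: "real \<Rightarrow> (real^2^2) set" where "thin \<epsilon> = {g \<in> SL2. \<not> thick \<epsilon> g}"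

lemma rinv_thin: "rinv (thin \<epsilon>)"
  unfolding rinv_def thin_def
proof (intro conjI ballI)
  fix x \<gamma> assume x: "x \<in> {g \<in> SL2. \<not> thick \<epsilon> g}" and g: "\<gamma> \<in> \<Gamma>"
  have "\<not> thick \<epsilon> (x ** \<gamma>)"
    using thick_rinv[of \<epsilon> "x ** \<gamma>" "iv \<gamma>"] x g \<Gamma>_iv \<Gamma>_SL2 by auto
  thus "x ** \<gamma> \<in> {g \<in> SL2. \<not> thick \<epsilon> g}" using x g \<Gamma>_SL2 by auto
qed auto

lemma thin_sets: "thin \<epsilon> \<in> sets borel"
proof -
  have "thin \<epsilon> = SL2 - (\<Inter>\<gamma>\<in>\<Gamma> - {mat 1, - mat 1}. {g. \<epsilon> \<le> nX (g ** \<gamma> ** iv g)})"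
    by (auto simp: thin_def thick_def)
  also have "\<dots> \<in> sets borel"
    by (intro sets.Diff borel_closed closed_SL2 closed_INT ballI closed_Collect_le continuous_intros)
  finally show ?thesis .
qed

text \<open>The thin parts decrease to the empty set, so one of them has small measure, and
  \<open>orbit_count\<close> with q = 1 turns this into few integer times spent in a still thinner
  part.\<close>

lemma nondivergence:
  assumes \<rho>: "\<rho> > 0" and \<delta>: "\<delta> > 0"
  shows "\<exists>\<epsilon>>0. \<exists>T0>0. \<forall>z T. z \<in> SL2 \<longrightarrow> thick \<rho> z \<longrightarrow> T \<ge> T0 \<longrightarrow>
     real (card {k::nat. real k \<le> T \<and> \<not> thick \<epsilon> (uu (real k) ** (dg (sqrt T) ** z))}) \<le> \<delta> * T"
proof -
  define k where "k = min (1/100) (\<rho> / 3200)"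
  have k: "0 < k" "k \<le> 1/100" "k \<le> \<rho> / 3200" using \<rho> by (auto simp: k_def)
  obtain C where C: "C > 0" and cnt: "\<And>z T q Q E E'. z \<in> SL2 \<Longrightarrow> thick \<rho> z \<Longrightarrow> 0 < T \<Longrightarrow> 0 < q \<Longrightarrow> 2 * q \<le> k * T \<Longrightarrow> finite Q \<Longrightarrow>
     Q \<subseteq> {0..T} \<Longrightarrow> (\<forall>s\<in>Q. \<forall>t\<in>Q. s < t \<longrightarrow> s + q \<le> t) \<Longrightarrow> rinv E' \<Longrightarrow> E' \<in> sets borel \<Longrightarrow>
     (\<forall>t\<in>Q. uu t ** (dg (sqrt T) ** z) \<in> E) \<Longrightarrow>
     (\<forall>e r l \<theta>. e \<in> E \<longrightarrow> \<bar>r\<bar> \<le> k / T \<longrightarrow> \<bar>l - 1\<bar> \<le> k \<longrightarrow> 0 \<le> \<theta> \<longrightarrow> \<theta> < q \<longrightarrow>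
        vv r ** dg l ** uu \<theta> ** e \<in> E') \<Longrightarrow> real (card Q) \<le> C * (T / q + 1) * measure \<mu> E'"
    using orbit_count[OF \<rho> k] by auto
  have "\<exists>n>0. measure \<mu> (thin (1 / real (Suc n))) < \<delta> / (2 * C)"
  proof (rule tendsto_measure_decseq_0[OF \<mu>.finite_measure_axioms])
    show "thin (1 / real (Suc n)) \<in> sets \<mu>" for n using thin_sets by simp
  next
    have "\<exists>n. g \<notin> thin (1 / real (Suc n))" for g
    proof (cases "g \<in> SL2")
      case True
      then obtain r where r: "r > 0" "thick r g" using thick_exists by blast
      obtain n where "inverse (real (Suc n)) < r" using reals_Archimedean[OF r(1)] by blast
      hence "thick (1 / real (Suc n)) g" using thick_mono[OF r(2)] by (simp add: inverse_eq_divide)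
      thus ?thesis by (auto simp: thin_def)
    qed (auto simp: thin_def)
    thus "(\<Inter>n. thin (1 / real (Suc n))) = {}" by auto
  next
    show "decseq (\<lambda>n. thin (1 / real (Suc n)))"
      unfolding decseq_def
    proof (intro allI impI subsetI)
      fix m n :: nat and g assume mn: "m \<le> n" and g: "g \<in> thin (1 / real (Suc n))"
      have "1 / real (Suc n) \<le> 1 / real (Suc m)" using mn by (intro divide_left_mono) auto
      thus "g \<in> thin (1 / real (Suc m))" using g thick_mono unfolding thin_def by blast
    qed
  qed (use \<delta> C in simp)
  then obtain n where n: "n > 0" "measure \<mu> (thin (1 / real n)) < \<delta> / (2 * C)" by blast
  \<comment> \<open>128 = 8 * 4^2 is the loss in \<open>thick_conj\<close> for the perturbations
    bounded by \<open>ent_vdu\<close>.\<close>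
  define \<epsilon> where "\<epsilon> = 1 / real n / 128"
  have "real (card {k::nat. real k \<le> T \<and> \<not> thick \<epsilon> (uu (real k) ** (dg (sqrt T) ** z))}) \<le> \<delta> * T"
    if z: "z \<in> SL2" "thick \<rho> z" and T: "max 1 (2 / k) \<le> T" for z T
  proof -
    have "T \<ge> 1" "2 / k \<le> T" using T by auto
    hence T1: "T \<ge> 1" "2 \<le> k * T" using k by (simp_all add: pos_divide_le_eq mult.commute)
    define S where "S = {k::nat. real k \<le> T \<and> \<not> thick \<epsilon> (uu (real k) ** (dg (sqrt T) ** z))}"
    have fS: "finite S" by (rule finite_subset[of _ "{..nat \<lfloor>T\<rfloor>}"]) (auto simp: S_def le_nat_floor)
    have dgT: "dg (sqrt T) \<in> SL2" using T1 by (intro dg_SL2) auto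
    have "real (card (real ` S)) \<le> C * (T / 1 + 1) * measure \<mu> (thin (1 / real n))"
    proof (rule cnt[OF z])
      show "\<forall>t\<in>real ` S. uu t ** (dg (sqrt T) ** z) \<in> thin \<epsilon>"
        using z dgT by (auto simp: S_def thin_def)
      show "\<forall>e r l \<theta>. e \<in> thin \<epsilon> \<longrightarrow> \<bar>r\<bar> \<le> k / T \<longrightarrow> \<bar>l - 1\<bar> \<le> k \<longrightarrow> 0 \<le> \<theta> \<longrightarrow> \<theta> < 1 \<longrightarrow>
         vv r ** dg l ** uu \<theta> ** e \<in> thin (1 / real n)"
      proof (intro allI impI)
        fix e and r l \<theta> :: real assume e: "e \<in> thin \<epsilon>" and r: "\<bar>r\<bar> \<le> k / T" and l: "\<bar>l - 1\<bar> \<le> k" and \<theta>: "0 \<le> \<theta>" "\<theta> < 1"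
        let ?h = "vv r ** dg l ** uu \<theta>"
        have "k / T \<le> 1 / 1" using k T1 by (intro frac_le) auto
        hence r1: "\<bar>r\<bar> \<le> 1" using r by linarith
        have l1: "\<bar>l - 1\<bar> \<le> 1/2" using l k by linarith
        have "l \<noteq> 0" using l1 by auto
        hence h: "?h \<in> SL2" using dg_SL2 by simp
        have eS: "e \<in> SL2" "\<not> thick \<epsilon> e" using e by (auto simp: thin_def)
        have "\<not> thick (1 / real n) (?h ** e)"
        proof
          assume a: "thick (1 / real n) (?h ** e)"
          have "thick (1 / real n / (8 * 4\<^sup>2)) (iv ?h ** (?h ** e))"
            using ent_vdu[OF r1 l1] \<theta> h eS by (intro thick_conj[OF a]) (auto simp: ent_iv)
          thus False using eS h by (simp add: \<epsilon>_def)
        qed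
        thus "?h ** e \<in> thin (1 / real n)" using h eS by (simp add: thin_def)
      qed
    qed (use T1 k fS rinv_thin thin_sets in \<open>auto simp: S_def\<close>)
    also have "\<dots> \<le> C * (2 * T) * (\<delta> / (2 * C))"
      using n T1 C by (intro mult_mono) auto
    also have "\<dots> = \<delta> * T" using C by simp
    finally show ?thesis by (simp add: card_image S_def)
  qed
  moreover have "\<epsilon> > 0" using n by (simp add: \<epsilon>_def)
  moreover have "max 1 (2 / k) > 0" by simp
  ultimately show ?thesis by blast
qed

section \<open>Visits of orbit segments to open sets\<close>

lemma shrink_open:
  assumes W: "open W" "U = SL2 \<inter> W" and U: "rinv U" "U \<noteq> {}"
  obtains U1 W1 e where "open W1" "U1 = SL2 \<inter> W1" "rinv U1" "U1 \<noteq> {}" "0 < e" "e \<le> 1"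
    "\<And>b x. b \<in> SL2 \<Longrightarrow> ent e (b - mat 1) \<Longrightarrow> x \<in> U1 \<Longrightarrow> b ** x \<in> U"
proof -
  obtain g where g: "g \<in> U" using U by auto
  obtain d where d: "d > 0" "ball g d \<subseteq> W" using W g by (auto simp: open_contains_ball)
  define r where "r = d / 2"
  \<comment> \<open>A ball of half the radius, saturated under \<Gamma>. A matrix within e of 1
    moves its points by at most the other half; the 8 in e is the loss 4 times 2 in
    \<open>norm_le_ent\<close> and \<open>ent_mult\<close>.\<close>
  define W1 where "W1 = (\<Union>\<gamma>\<in>\<Gamma>. {x. dist (x ** \<gamma>) g < r})"
  define e where "e = min 1 (r / (8 * (norm g + r)))"
  have r: "r > 0" using d by (simp add: r_def)
  have gr: "norm g + r > 0" using r norm_ge_zero[of g] by linarith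
  have e: "0 < e" "e \<le> 1" "8 * e * (norm g + r) \<le> r"
  proof -
    show "0 < e" using r gr by (simp add: e_def)
    show "e \<le> 1" by (simp add: e_def)
    have "e \<le> r / (8 * (norm g + r))" by (simp add: e_def)
    thus "8 * e * (norm g + r) \<le> r" using gr by (simp add: pos_le_divide_eq mult_ac)
  qed
  show ?thesis
  proof (rule that[of W1 "SL2 \<inter> W1" e])
    show "open W1" unfolding W1_def by (intro open_UN ballI open_Collect_less continuous_intros)
    show "rinv (SL2 \<inter> W1)" unfolding rinv_def
    proof (intro conjI ballI)
      fix x \<gamma> assume x: "x \<in> SL2 \<inter> W1" and \<gamma>: "\<gamma> \<in> \<Gamma>"
      then obtain \<gamma>' where g': "\<gamma>' \<in> \<Gamma>" "dist (x ** \<gamma>') g < r" by (auto simp: W1_def)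
      have "x ** \<gamma> ** (iv \<gamma> ** \<gamma>') = x ** \<gamma>'" using \<Gamma>_SL2[OF \<gamma>] by (simp add: matrix_mul_assoc)
      hence "x ** \<gamma> \<in> W1" unfolding W1_def using g' \<gamma> \<Gamma>_mult \<Gamma>_iv by (intro UN_I[of "iv \<gamma> ** \<gamma>'"]) auto
      thus "x ** \<gamma> \<in> SL2 \<inter> W1" using x \<gamma> \<Gamma>_SL2 by auto
    qed auto
    have "g \<in> SL2 \<inter> W1" using g W r \<Gamma>_one by (auto simp: W1_def intro!: bexI[of _ "mat 1"])
    thus "SL2 \<inter> W1 \<noteq> {}" by auto
    fix b x assume b: "b \<in> SL2" "ent e (b - mat 1)" and x: "x \<in> SL2 \<inter> W1"
    then obtain \<gamma> where \<gamma>: "\<gamma> \<in> \<Gamma>" "dist (x ** \<gamma>) g < r" by (auto simp: W1_def)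
    let ?y = "x ** \<gamma>"
    have ny: "norm ?y \<le> norm g + r" using \<gamma>(2) norm_triangle_sub[of ?y g] by (simp add: dist_norm)
    have "norm ((b - mat 1) ** ?y) \<le> 4 * (2 * e * norm ?y)"
      by (intro norm_le_ent ent_mult b ent_norm)
    also have "\<dots> \<le> 8 * e * (norm g + r)" using ny e by simp
    also have "\<dots> \<le> r" by (rule e)
    also have "(b - mat 1) ** ?y = b ** ?y - ?y"
      by (rule mat2_eqI) (auto simp: mat_1_mat2 algebra_simps)
    finally have "dist (b ** ?y) ?y \<le> r" by (simp add: dist_norm)
    hence "dist (b ** ?y) g < 2 * r" using \<gamma>(2) dist_triangle[of "b ** ?y" g ?y] by linarith
    hence "b ** ?y \<in> W" using d by (auto simp: r_def dist_commute)
    hence "b ** x ** \<gamma> \<in> U" using W b x \<gamma> \<Gamma>_SL2 by (auto simp: matrix_mul_assoc)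
    thus "b ** x \<in> U" using rinv_iff[OF U(1) \<gamma>(1)] by simp
  qed (use e in auto)
qed

text \<open>Carries a perturbation through the flow: after time s it has become a lower triangular
  matrix, near 1 as long as s r is small, and the time is reparametrised.\<close>

lemma uu_vdu:
  assumes "1 + s * r \<noteq> 0" "l \<noteq> 0"
  shows "uu s ** (vv r ** dg l ** uu \<theta> ** e) =
    mat2 ((1 + s * r) * l) 0 (r * l) (1 / ((1 + s * r) * l)) ** (uu (s / ((1 + s * r) * l\<^sup>2) + \<theta>) ** e)"
proof -
  have "uu s ** (vv r ** dg l ** uu \<theta>) =
     mat2 ((1 + s * r) * l) 0 (r * l) (1 / ((1 + s * r) * l)) ** uu (s / ((1 + s * r) * l\<^sup>2) + \<theta>)"
  proof -
    define a where "a = 1 + s * r"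
    have a: "a \<noteq> 0" "s * r = a - 1" using assms by (auto simp: a_def)
    have "a * l * (s / (a * l\<^sup>2) + \<theta>) = s / l + a * l * \<theta>"
      using a(1) assms(2) by (simp add: field_simps power2_eq_square)
    moreover have "r * l * (s / (a * l\<^sup>2) + \<theta>) + 1 / (a * l) = (s * r + 1) / (a * l) + r * l * \<theta>"
      using a(1) assms(2) by (simp add: field_simps power2_eq_square)
    hence "r * l * (s / (a * l\<^sup>2) + \<theta>) + 1 / (a * l) = 1 / l + r * l * \<theta>" using a by simp
    moreover have "a * l = l + l * (r * s)" "\<theta> * (a * l) = \<theta> * l + \<theta> * (l * (r * s))"
      by (simp_all add: a_def algebra_simps)
    ultimately show ?thesis unfolding a_def[symmetric]
      by (simp add: uu_def vv_def dg_def algebra_simps)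
  qed
  thus ?thesis by (simp add: matrix_mul_assoc)
qed

text \<open>By \<open>uu_vdu\<close>, a time s \<le> q / 2 along the perturbed orbit corresponds to
  a time of at most 2 s + \<theta> \<le> 2 q along the original one, up to a matrix near 1, which
  the passage from U1 to U2 absorbs.\<close>

lemma avoid_thicken:
  assumes b: "\<And>b x. b \<in> SL2 \<Longrightarrow> ent e (b - mat 1) \<Longrightarrow> x \<in> U1 \<Longrightarrow> b ** x \<in> U2"
    and k: "0 < k" "k \<le> 1/100" "8 * k \<le> e" and T: "1 \<le> T" "q \<le> T" and q: "q > 0" and x: "x \<in> avoid U2 (2 * q)"
    and r: "\<bar>r\<bar> \<le> k / T" and l: "\<bar>l - 1\<bar> \<le> k" and \<theta>: "0 \<le> \<theta>" "\<theta> < q"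
  shows "vv r ** dg l ** uu \<theta> ** x \<in> avoid U1 (q / 2)"
proof -
  have l1: "1 - k \<le> l" "l \<le> 1 + k" using l unfolding abs_le_iff by linarith+
  have l0: "l > 0" using l1 k by linarith
  have xS: "x \<in> SL2" using x by (simp add: avoid_def)
  have False if s: "s \<in> {0..q/2}" and U1: "uu s ** (vv r ** dg l ** uu \<theta> ** x) \<in> U1" for s
  proof -
    define a where "a = 1 + s * r"
    have "\<bar>s * r\<bar> \<le> T * (k / T)" unfolding abs_mult using s r q T by (intro mult_mono) auto
    hence sr: "\<bar>s * r\<bar> \<le> k" using T by simp
    have a: "1 - k \<le> a" "a \<le> 1 + k" using sr unfolding a_def abs_le_iff by linarith+
    have a0: "a > 0" using a k by linarith
    have "k / T \<le> k / 1" using k T by (intro divide_left_mono) auto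
    hence rk: "\<bar>r\<bar> \<le> k" using r by simp
    have al: "a * l \<le> (1 + k) * (1 + k)" "(1 - k) * (1 - k) \<le> a * l"
      using mult_mono[OF a(2) l1(2)] mult_mono[OF a(1) l1(1)] a0 l0 k by auto
    have kk: "0 \<le> k * k" "k * k \<le> k * (1/100)" using k by (auto intro: mult_left_mono)
    have al': "a * l \<le> 1 + 3 * k" "1 - 2 * k \<le> a * l"
    proof -
      have "(1 + k) * (1 + k) = 1 + 2 * k + k * k" by (simp add: algebra_simps)
      also have "\<dots> \<le> 1 + 3 * k" using kk(2) k(1) by simp
      finally show "a * l \<le> 1 + 3 * k" using al(1) by (rule order_trans[rotated])
      have "1 - 2 * k \<le> 1 - 2 * k + k * k" using kk(1) by simp
      also have "\<dots> = (1 - k) * (1 - k)" by (simp add: algebra_simps)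
      finally show "1 - 2 * k \<le> a * l" using al(2) by (rule order_trans)
    qed
    have al0: "a * l > 0" using a0 l0 by simp
    have i1: "1 / (a * l) \<le> 1 + 3 * k"
    proof -
      have "6 * (k * k) \<le> k" using kk(2) k(1) by simp
      moreover have "(1 + 3 * k) * (1 - 2 * k) = 1 + (k - 6 * (k * k))" by (simp add: algebra_simps)
      ultimately have "1 \<le> (1 + 3 * k) * (1 - 2 * k)" by simp
      also have "\<dots> \<le> (1 + 3 * k) * (a * l)" using al' k by (intro mult_left_mono) auto
      finally show ?thesis using al0 by (simp add: pos_divide_le_eq)
    qed
    have i2: "1 - 3 * k \<le> 1 / (a * l)"
    proof -
      have "(1 - 3 * k) * (a * l) \<le> (1 - 3 * k) * (1 + 3 * k)" using al' k by (intro mult_left_mono) auto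
      also have "\<dots> \<le> 1" using kk by (simp add: algebra_simps)
      finally show ?thesis using al0 by (simp add: pos_le_divide_eq)
    qed
    have rl: "\<bar>r * l\<bar> \<le> k * 2" unfolding abs_mult using rk l1 l0 k by (intro mult_mono) auto
    let ?B = "mat2 (a * l) 0 (r * l) (1 / (a * l))"
    have B: "?B \<in> SL2" using a0 l0 by simp
    have eB: "ent e (iv ?B - mat 1)"
      using al' i1 i2 rl k by (auto simp: ent_mat2 mat_1_mat2 abs_le_iff)
    have eq: "uu s ** (vv r ** dg l ** uu \<theta> ** x) = ?B ** (uu (s / (a * l\<^sup>2) + \<theta>) ** x)"
      using uu_vdu[of s r l \<theta> x] a0 l0 by (simp add: a_def)
    have "iv ?B ** (?B ** (uu (s / (a * l\<^sup>2) + \<theta>) ** x)) \<in> U2"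
      using U1 unfolding eq by (intro b iv_SL2 B eB)
    hence "uu (s / (a * l\<^sup>2) + \<theta>) ** x \<in> U2" by (simp only: iv_left_assoc[OF B])
    moreover have "s / (a * l\<^sup>2) + \<theta> \<in> {0..2 * q}"
    proof -
      have "l \<ge> 99/100" using l1 k by linarith
      have "1/2 \<le> (1 - 2 * k) * (99/100)" using k by (simp add: algebra_simps)
      also have "\<dots> \<le> (a * l) * l" using al' \<open>l \<ge> 99/100\<close> k by (intro mult_mono) auto
      finally have d: "1/2 \<le> a * l\<^sup>2" by (simp add: power2_eq_square)
      have "s / (a * l\<^sup>2) \<le> s / (1/2)" using d s by (intro divide_left_mono) auto
      moreover have "0 \<le> s / (a * l\<^sup>2)" using s a0 by simp
      ultimately show ?thesis using s \<theta> by auto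
    qed
    ultimately show False using x by (auto simp: avoid_def)
  qed
  moreover have "vv r ** dg l ** uu \<theta> ** x \<in> SL2" using xS l0 dg_SL2[of l] by simp
  ultimately show ?thesis unfolding avoid_def by blast
qed

text \<open>Blocks that start with a long stay outside a smaller open set are few, because their
  perturbations fall into \<open>avoid U1 n\<close>, which has small measure. Every other block
  contributes a visit of duration \<open>ea\<close>. U is shrunk twice: once for the duration of a
  visit, once for the perturbations.\<close>

lemma orbit_hits:
  assumes W: "open W" "U = SL2 \<inter> W" and U: "rinv U" "U \<noteq> {}" and \<rho>: "\<rho> > 0"
  shows "\<exists>c>0. \<exists>T0>0. \<forall>z T. z \<in> SL2 \<longrightarrow> thick \<rho> z \<longrightarrow> T \<ge> T0 \<longrightarrow>
     c * T \<le> measure lborel {t \<in> {0..T}. uu t ** (dg (sqrt T) ** z) \<in> U}"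
proof -
  obtain U2 W2 ea where U2: "open W2" "U2 = SL2 \<inter> W2" "rinv U2" "U2 \<noteq> {}" and ea: "0 < ea" "ea \<le> 1"
    and sh2: "\<And>b x. b \<in> SL2 \<Longrightarrow> ent ea (b - mat 1) \<Longrightarrow> x \<in> U2 \<Longrightarrow> b ** x \<in> U"
    using shrink_open[OF W U] by metis
  obtain U1 W1 eb where U1: "open W1" "U1 = SL2 \<inter> W1" "rinv U1" "U1 \<noteq> {}" and eb: "0 < eb" "eb \<le> 1"
    and sh1: "\<And>b x. b \<in> SL2 \<Longrightarrow> ent eb (b - mat 1) \<Longrightarrow> x \<in> U1 \<Longrightarrow> b ** x \<in> U2"
    using shrink_open[OF U2] by metis
  define k where "k = min (min (1/100) (\<rho> / 3200)) (eb / 8)"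
  have k: "0 < k" "k \<le> 1/100" "k \<le> \<rho> / 3200" "8 * k \<le> eb" using \<rho> eb by (auto simp: k_def)
  obtain C where C: "C > 0" and cnt: "\<And>z T q Q E E'. z \<in> SL2 \<Longrightarrow> thick \<rho> z \<Longrightarrow> 0 < T \<Longrightarrow> 0 < q \<Longrightarrow> 2 * q \<le> k * T \<Longrightarrow> finite Q \<Longrightarrow>
     Q \<subseteq> {0..T} \<Longrightarrow> (\<forall>s\<in>Q. \<forall>t\<in>Q. s < t \<longrightarrow> s + q \<le> t) \<Longrightarrow> rinv E' \<Longrightarrow> E' \<in> sets borel \<Longrightarrow>
     (\<forall>t\<in>Q. uu t ** (dg (sqrt T) ** z) \<in> E) \<Longrightarrow>
     (\<forall>e r l \<theta>. e \<in> E \<longrightarrow> \<bar>r\<bar> \<le> k / T \<longrightarrow> \<bar>l - 1\<bar> \<le> k \<longrightarrow> 0 \<le> \<theta> \<longrightarrow> \<theta> < q \<longrightarrow>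
        vv r ** dg l ** uu \<theta> ** e \<in> E') \<Longrightarrow> real (card Q) \<le> C * (T / q + 1) * measure \<mu> E'"
    using orbit_count[OF \<rho> k(1-3)] by auto
  \<comment> \<open>Among K blocks at most 7 C K times this measure will be bad, hence fewer than
    half.\<close>
  have "\<forall>\<^sub>F n in sequentially. measure \<mu> (avoid U1 (real n)) < 1 / (20 * C)"
    by (rule order_tendstoD[OF avoid_tendsto_0[OF U1]]) (use C in simp)
  hence "\<forall>\<^sub>F n in sequentially. measure \<mu> (avoid U1 (real n)) < 1 / (20 * C) \<and> n > 0"
    using eventually_gt_at_top[of 0] by (rule eventually_conj)
  then obtain n where n: "measure \<mu> (avoid U1 (real n)) < 1 / (20 * C)" "n > 0"
    using eventually_happens[of _ sequentially] by auto
  \<comment> \<open>Then q / 2 = n is the time for which \<open>avoid_thicken\<close> delivers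
    avoidance.\<close>
  define q where "q = 2 * real n"
  have q: "q \<ge> 2" using n by (simp add: q_def)
  define T0 where "T0 = max (6 * q) (2 * q / k)"
  define c where "c = ea / (12 * q)"
  have "c * T \<le> measure lborel {t \<in> {0..T}. uu t ** (dg (sqrt T) ** z) \<in> U}"
    if z: "z \<in> SL2" "thick \<rho> z" and T: "T0 \<le> T" for z T
  proof -
    have T1: "T \<ge> 6 * q" "2 * q / k \<le> T" using T by (auto simp: T0_def)
    have T2: "2 * q \<le> k * T" using T1(2) k by (simp add: pos_divide_le_eq mult.commute)
    have Tp: "T > 0" "T \<ge> 1" "q \<le> T" using T1 q by linarith+
    define y where "y = dg (sqrt T) ** z"
    have yS: "y \<in> SL2" using Tp z by (simp add: y_def dg_SL2)
    define K where "K = nat \<lfloor>T / (3 * q)\<rfloor>"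
    have "T / (3 * q) \<ge> 0" using Tp q by simp
    hence K: "real K \<le> T / (3 * q)" "T / (3 * q) < real K + 1" unfolding K_def by linarith+
    have K3: "3 * q * real K \<le> T" "T < 3 * q * (real K + 1)" using K q by (simp_all add: field_simps)
    have K1: "K \<ge> 1" "T \<le> 6 * q * real K"
    proof -
      have "T / (3 * q) \<ge> 2" using T1 q by (simp add: field_simps)
      hence "real K > 1" using K by linarith
      thus "K \<ge> 1" by simp
      have "3 * q * 1 \<le> 3 * q * real K" using \<open>real K > 1\<close> q by (intro mult_left_mono) auto
      thus "T \<le> 6 * q * real K" using K3(2) by (simp add: algebra_simps)
    qed
    \<comment> \<open>The spacing 3 q has room for a visit that begins within 2 q and lasts for
      \<open>ea\<close> \<le> 1 < q, so visits of different blocks stay disjoint.\<close>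
    define t where "t i = 3 * q * real i" for i :: nat
    define bad where "bad = {i \<in> {..<K}. uu (t i) ** y \<in> avoid U2 (2 * q)}"
    have tinj: "inj_on t A" for A using q by (auto simp: inj_on_def t_def)
    have tT: "t i + 3 * q \<le> T" if "i < K" for i
    proof -
      have "real i + 1 \<le> real K" using that by simp
      hence "3 * q * (real i + 1) \<le> 3 * q * real K" using q by (intro mult_left_mono) auto
      thus ?thesis using K3 by (simp add: t_def algebra_simps)
    qed
    have tmono: "t i + 3 * q \<le> t j" if "i < j" for i j
    proof -
      have "real i + 1 \<le> real j" using that by simp
      hence "3 * q * (real i + 1) \<le> 3 * q * real j" using q by (intro mult_left_mono) auto
      thus ?thesis by (simp add: t_def algebra_simps)
    qed
    have "real (card (t ` bad)) \<le> C * (T / q + 1) * measure \<mu> (avoid U1 (real n))"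
    proof (rule cnt[OF z Tp(1) _ T2, of _ _ "avoid U2 (2 * q)"])
      show "finite (t ` bad)" by (simp add: bad_def)
      have "0 \<le> t i" for i using q by (simp add: t_def)
      thus "t ` bad \<subseteq> {0..T}" using tT q by (auto simp: bad_def) (smt (verit))
      show "\<forall>s\<in>t ` bad. \<forall>ta\<in>t ` bad. s < ta \<longrightarrow> s + q \<le> ta"
      proof (intro ballI impI, elim imageE)
        fix s s' i j assume h: "s < s'" "s = t i" "s' = t j"
        have "i < j" using h q by (auto simp: t_def)
        thus "s + q \<le> s'" using tmono[of i j] h q by linarith
      qed
      show "rinv (avoid U1 (real n))" by (rule rinv_avoid[OF U1(3)])
      show "avoid U1 (real n) \<in> sets borel" using closed_avoid[OF U1(1,2)] by simp
      show "\<forall>ta\<in>t ` bad. uu ta ** (dg (sqrt T) ** z) \<in> avoid U2 (2 * q)" by (auto simp: bad_def y_def)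
      show "\<forall>e r l \<theta>. e \<in> avoid U2 (2 * q) \<longrightarrow> \<bar>r\<bar> \<le> k / T \<longrightarrow> \<bar>l - 1\<bar> \<le> k \<longrightarrow> 0 \<le> \<theta> \<longrightarrow> \<theta> < q \<longrightarrow>
        vv r ** dg l ** uu \<theta> ** e \<in> avoid U1 (real n)"
        using avoid_thicken[OF sh1 k(1,2,4) Tp(2,3)] q by (auto simp: q_def)
    qed (use q in auto)
    also have "\<dots> \<le> C * (7 * real K) * (1 / (20 * C))"
    proof (intro mult_mono)
      have "T / q \<le> 6 * real K" using K1 q by (simp add: field_simps)
      thus "T / q + 1 \<le> 7 * real K" using K1 by linarith
    qed (use C n Tp q in auto)
    also have "\<dots> \<le> real K / 2" using C by simp
    finally have bad: "real (card bad) \<le> real K / 2" by (simp add: card_image[OF tinj])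
    define good where "good = {..<K} - bad"
    have fin: "finite good" "finite bad" by (auto simp: good_def bad_def)
    have "card good = K - card bad" unfolding good_def using fin by (subst card_Diff_subset) (auto simp: bad_def)
    hence good: "real (card good) \<ge> real K / 2" using bad by linarith
    have "\<exists>s\<in>{0..2 * q}. uu (t i + s) ** y \<in> U2" if "i \<in> good" for i
      using that yS unfolding good_def bad_def avoid_def by (auto simp: matrix_mul_assoc uu_add add.commute)
    then obtain s where s: "\<And>i. i \<in> good \<Longrightarrow> s i \<in> {0..2 * q} \<and> uu (t i + s i) ** y \<in> U2" by metis
    define J where "J i = {t i + s i..t i + s i + ea}" for i
    define A where "A = {t \<in> {0..T}. uu t ** y \<in> U}"
    have JA: "J i \<subseteq> A" if i: "i \<in> good" for i
    proof
      fix r assume r: "r \<in> J i"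
      have "uu (r - (t i + s i)) ** (uu (t i + s i) ** y) \<in> U"
        using s[OF i] r by (intro sh2) (auto simp: uu_def ent_mat2 mat_1_mat2 J_def)
      hence "uu r ** y \<in> U" by (simp add: matrix_mul_assoc uu_add)
      moreover have "0 \<le> t i" "i < K" using q i by (auto simp: t_def good_def)
      ultimately show "r \<in> A" using r s[OF i] tT[of i] ea q by (auto simp: A_def J_def)
    qed
    have dis: "disjoint_family_on J good"
      unfolding disjoint_family_on_def
    proof (intro ballI impI)
      have *: "J i \<inter> J j = {}" if "i < j" "i \<in> good" "j \<in> good" for i j
        using tmono[OF that(1)] s[OF that(2)] s[OF that(3)] ea q by (auto simp: J_def)
      fix i j assume "i \<in> good" "j \<in> good" "i \<noteq> j"
      thus "J i \<inter> J j = {}" using *[of i j] *[of j i] by (cases "i < j") auto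
    qed
    have Am: "A \<in> sets borel"
    proof -
      have "continuous_on UNIV (\<lambda>t. uu t ** y)" unfolding uu_def by (intro continuous_intros)
      hence "open ((\<lambda>t. uu t ** y) -` W)" using W by (simp add: continuous_on_open_vimage)
      moreover have "A = {0..T} \<inter> ((\<lambda>t. uu t ** y) -` W)" using W yS by (auto simp: A_def)
      ultimately show ?thesis by auto
    qed
    have "c * T \<le> real (card good) * ea"
    proof -
      have "c * T \<le> c * (6 * q * real K)" using K1 ea q by (intro mult_left_mono) (auto simp: c_def)
      also have "\<dots> = real K / 2 * ea" using q by (simp add: c_def)
      also have "\<dots> \<le> real (card good) * ea" using good ea by (intro mult_right_mono) auto
      finally show ?thesis .
    qed
    also have "\<dots> = (\<Sum>i\<in>good. measure lborel (J i))" using ea by (simp add: J_def)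
    also have "\<dots> = measure lborel (\<Union>i\<in>good. J i)"
    proof (rule measure_finite_Union[symmetric, OF fin(1) _ dis])
      show "J ` good \<subseteq> sets lborel" by (auto simp: J_def)
      show "emeasure lborel (J i) \<noteq> \<infinity>" for i using ea by (simp add: J_def)
    qed
    also have "\<dots> \<le> measure lborel A"
    proof (rule measure_mono_fmeasurable)
      show "(\<Union>i\<in>good. J i) \<subseteq> A" using JA by auto
      show "(\<Union>i\<in>good. J i) \<in> sets lborel" using fin by (auto simp: J_def)
      have "A \<subseteq> {0..T}" by (auto simp: A_def)
      hence "emeasure lborel A \<le> emeasure lborel {0..T}" by (intro emeasure_mono) auto
      also have "\<dots> < \<infinity>" by (simp add: emeasure_lborel_Icc_eq)
      finally show "A \<in> fmeasurable lborel" using Am by (simp add: fmeasurable_def)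
    qed
    finally show ?thesis by (simp add: A_def y_def)
  qed
  moreover have "c > 0" using ea q by (simp add: c_def)
  moreover have "T0 > 0" using q by (simp add: T0_def)
  ultimately show ?thesis by blast
qed

text \<open>Finite volume does the work of compactness: cells around thick points that are disjoint
  modulo \<Gamma> all have the same positive volume, so a largest such family exists, and by
  maximality the cell of any further thick point meets one of them modulo \<Gamma>.\<close>

lemma thick_cover:
  assumes \<rho>: "\<rho> > 0" and e: "e > 0"
  shows "\<exists>H. finite H \<and> H \<subseteq> SL2 \<and> (\<forall>g\<in>SL2. thick \<rho> g \<longrightarrow>
     (\<exists>h\<in>H. \<exists>\<gamma>\<in>\<Gamma>. \<exists>b\<in>SL2. ent e (b - mat 1) \<and> g = b ** h ** \<gamma>))"
proof -
  define k where "k = min (min (1/100) (\<rho> / 100)) (e / 40)"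
  have k: "0 < k" "k \<le> 1/100" "k \<le> \<rho> / 100" "40 * k \<le> e" using \<rho> e by (auto simp: k_def)
  define X where "X h = {x. x ** iv h \<in> cell k 0 k}" for h
  define P where "P H \<longleftrightarrow> finite H \<and> H \<subseteq> {h \<in> SL2. thick \<rho> h} \<and>
     (\<forall>h\<in>H. \<forall>h'\<in>H. h \<noteq> h' \<longrightarrow> (\<forall>x. \<forall>\<gamma>\<in>\<Gamma>. x \<in> X h \<longrightarrow> x ** \<gamma> \<notin> X h'))" for H
  have injX: "inj_dom (X h)" if "h \<in> SL2" "thick \<rho> h" for h
    unfolding X_def using k cell_SL2 cell_ent by (intro inj_dom_translate[OF that, where k="4*k"]) auto
  have bound: "real (card H) * cell_measure k \<le> measure \<mu> UNIV" if H: "P H" for H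
  proof (cases "H = {}")
    case False
    then obtain h0 where h0: "h0 \<in> SL2" "thick \<rho> h0" using H by (auto simp: P_def)
    note cm = cell_measure[OF h0 k(1-3)]
    have Xs: "X h \<in> sets borel" "X h \<subseteq> SL2" if "h \<in> H" for h
      using injX[of h] H that by (auto simp: P_def inj_dom_def)
    have fin: "finite H" using H by (simp add: P_def)
    have inj: "inj_dom (\<Union>h\<in>H. X h)" unfolding inj_dom_def
    proof (intro conjI allI impI)
      show "(\<Union>h\<in>H. X h) \<in> sets borel" using fin Xs by (intro sets.finite_UN) auto
      show "(\<Union>h\<in>H. X h) \<subseteq> SL2" using Xs by auto
      fix x \<gamma> assume a: "x \<in> (\<Union>h\<in>H. X h)" "\<gamma> \<in> \<Gamma>" "x ** \<gamma> \<in> (\<Union>h\<in>H. X h)"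
      then obtain h h' where h: "h \<in> H" "h' \<in> H" "x \<in> X h" "x ** \<gamma> \<in> X h'" by auto
      hence "h = h'" using H a(2) unfolding P_def by blast
      thus "\<gamma> = mat 1" using injX[of h] H h a(2) unfolding P_def inj_dom_def by blast
    qed
    have dis: "disjoint_family_on X H" unfolding disjoint_family_on_def
    proof (intro ballI impI)
      fix h h' assume h: "h \<in> H" "h' \<in> H" "h \<noteq> h'"
      have "x ** mat 1 \<notin> X h'" if "x \<in> X h" for x
        using H h that \<Gamma>_one unfolding P_def by blast
      thus "X h \<inter> X h' = {}" by auto
    qed
    have "ennreal (real (card H) * cell_measure k) = of_nat (card H) * emeasure haar (cell k 0 k)"
      using cm by (simp add: ennreal_mult ennreal_of_nat_eq_real_of_nat)
    also have "\<dots> = (\<Sum>h\<in>H. emeasure haar (X h))"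
    proof -
      have "emeasure haar (X h) = emeasure haar (cell k 0 k)" if "h \<in> H" for h
        unfolding X_def using H that by (intro emeasure_haar_right) (auto simp: P_def)
      thus ?thesis by simp
    qed
    also have "\<dots> = emeasure haar (\<Union>h\<in>H. X h)" using fin Xs dis by (intro sum_emeasure) auto
    also have "\<dots> = emeasure haar ((\<Union>h\<in>H. X h) \<inter> SL2)" using Xs by (simp add: Int_absorb2 UN_least)
    also have "\<dots> \<le> emeasure \<mu> SL2" using closed_SL2 by (intro emeasure_inj_dom_le inj rinv_SL2) auto
    also have "\<dots> \<le> emeasure \<mu> UNIV" by (intro emeasure_mono) auto
    also have "\<dots> = ennreal (measure \<mu> UNIV)" by (rule \<mu>.emeasure_eq_measure)
    finally show ?thesis by (subst (asm) ennreal_le_iff) auto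
  qed simp
  show ?thesis
  proof (cases "\<exists>h\<in>SL2. thick \<rho> h")
    case True
    then obtain h0 where h0: "h0 \<in> SL2" "thick \<rho> h0" by auto
    have cm: "cell_measure k > 0" by (rule cell_measure[OF h0 k(1-3)])
    have "\<exists>H. P H \<and> (\<forall>H'. P H' \<longrightarrow> card H' \<le> card H)"
    proof (rule ex_has_greatest_nat)
      show "P {}" by (simp add: P_def)
      show "\<forall>H. P H \<longrightarrow> card H < nat \<lceil>measure \<mu> UNIV / cell_measure k\<rceil> + 1"
      proof (intro allI impI)
        fix H assume "P H"
        hence "real (card H) \<le> measure \<mu> UNIV / cell_measure k" using bound cm by (simp add: pos_le_divide_eq)
        thus "card H < nat \<lceil>measure \<mu> UNIV / cell_measure k\<rceil> + 1" by linarith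
      qed
    qed
    then obtain H where H: "P H" "\<And>H'. P H' \<Longrightarrow> card H' \<le> card H" by auto
    show ?thesis
    proof (intro exI[of _ H] conjI ballI impI)
      show "finite H" "H \<subseteq> SL2" using H by (auto simp: P_def)
      fix g assume g: "g \<in> SL2" "thick \<rho> g"
      have "\<exists>h\<in>H. \<exists>x. \<exists>\<gamma>\<in>\<Gamma>. x \<in> X g \<and> x ** \<gamma> \<in> X h"
      proof (cases "g \<in> H")
        case True
        have "uu 0 \<in> cell k 0 k" using k by (simp add: cell_def uu_def)
        hence "g \<in> X g" using g by (simp add: X_def)
        hence "g ** mat 1 \<in> X g" by simp
        thus ?thesis using True \<Gamma>_one \<open>g \<in> X g\<close> by blast
      next
        case False
        have "finite H" using H(1) by (simp add: P_def)
        hence nP: "\<not> P (insert g H)" using H(2)[of "insert g H"] False by auto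
        have "\<exists>h\<in>H. (\<exists>x. \<exists>\<gamma>\<in>\<Gamma>. x \<in> X g \<and> x ** \<gamma> \<in> X h) \<or> (\<exists>x. \<exists>\<gamma>\<in>\<Gamma>. x \<in> X h \<and> x ** \<gamma> \<in> X g)"
        proof (rule ccontr)
          assume "\<not> ?thesis"
          hence n: "\<And>h x \<gamma>. h \<in> H \<Longrightarrow> \<gamma> \<in> \<Gamma> \<Longrightarrow> x \<in> X g \<Longrightarrow> x ** \<gamma> \<notin> X h"
            "\<And>h x \<gamma>. h \<in> H \<Longrightarrow> \<gamma> \<in> \<Gamma> \<Longrightarrow> x \<in> X h \<Longrightarrow> x ** \<gamma> \<notin> X g" by blast+
          have "P (insert g H)" unfolding P_def
            using H(1)[unfolded P_def] g n by simp
          thus False using nP by contradiction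
        qed
        then obtain h where h: "h \<in> H" "(\<exists>x. \<exists>\<gamma>\<in>\<Gamma>. x \<in> X g \<and> x ** \<gamma> \<in> X h) \<or> (\<exists>x. \<exists>\<gamma>\<in>\<Gamma>. x \<in> X h \<and> x ** \<gamma> \<in> X g)"
          by blast
        thus ?thesis
        proof (elim disjE)
          assume "\<exists>x. \<exists>\<gamma>\<in>\<Gamma>. x \<in> X h \<and> x ** \<gamma> \<in> X g"
          then obtain x \<gamma> where x: "\<gamma> \<in> \<Gamma>" "x \<in> X h" "x ** \<gamma> \<in> X g" by auto
          hence "x ** \<gamma> ** iv \<gamma> \<in> X h" using \<Gamma>_SL2 by simp
          thus ?thesis using h(1) x \<Gamma>_iv by blast
        qed blast
      qed
      then obtain h x \<gamma> where h: "h \<in> H" "\<gamma> \<in> \<Gamma>" "x \<in> X g" "x ** \<gamma> \<in> X h" by auto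
      have hS: "h \<in> SL2" using h H by (auto simp: P_def)
      let ?b = "x ** iv g" and ?c = "x ** \<gamma> ** iv h"
      have b: "?b \<in> cell k 0 k" "?c \<in> cell k 0 k" using h by (auto simp: X_def)
      hence bS: "?b \<in> SL2" "?c \<in> SL2" using cell_SL2 by auto
      have xS: "x \<in> SL2" using bS(1) g by simp
      have eb: "ent (8 * (4 * k)) (iv ?b ** ?c - mat 1)"
        using k b by (intro small_quotient bS cell_ent) auto
      have "g = iv ?b ** ?c ** h ** iv \<gamma>"
        using xS g hS \<Gamma>_SL2[OF h(2)] by (simp add: iv_mult matrix_mul_assoc[symmetric])
      moreover have "ent e (iv ?b ** ?c - mat 1)" using k by (intro ent_mono[OF eb]) simp
      ultimately show "\<exists>h\<in>H. \<exists>\<gamma>\<in>\<Gamma>. \<exists>b\<in>SL2. ent e (b - mat 1) \<and> g = b ** h ** \<gamma>"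
        using h(1) \<Gamma>_iv[OF h(2)] SL2_mult[OF iv_SL2[OF bS(1)] bS(2)] by blast
    qed
  qed (auto intro!: exI[of _ "{}"])
qed

end

section \<open>Returns of nonperiodic orbits\<close>

lemma commute_iff:
  "A ** B = B ** A \<longleftrightarrow>
     A $ 1 $ 2 * B $ 2 $ 1 = B $ 1 $ 2 * A $ 2 $ 1 \<and>
     A $ 1 $ 2 * (B $ 1 $ 1 - B $ 2 $ 2) = B $ 1 $ 2 * (A $ 1 $ 1 - A $ 2 $ 2) \<and>
     A $ 2 $ 1 * (B $ 1 $ 1 - B $ 2 $ 2) = B $ 2 $ 1 * (A $ 1 $ 1 - A $ 2 $ 2)" for A B :: "real^2^2"
  by (cases A rule: mat2_cases, cases B rule: mat2_cases) (auto simp: algebra_simps)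

text \<open>Commutation says that the vectors (a - d, b, c) of the two matrices have vanishing cross
  product; hence they are proportional.\<close>

lemma commute_linear:
  assumes "A ** B = B ** A" "nX A > 0"
  shows "\<exists>l m. B = l *\<^sub>R A + m *\<^sub>R mat 1"
proof -
  obtain a b c d where A: "A = mat2 a b c d" by (rule mat2_cases)
  obtain a' b' c' d' where B: "B = mat2 a' b' c' d'" by (rule mat2_cases)
  have h: "b * c' = b' * c" "b * (a' - d') = b' * (a - d)" "c * (a' - d') = c' * (a - d)"
    using assms(1) unfolding commute_iff by (simp_all add: A B)
  have "a \<noteq> d \<or> b \<noteq> 0 \<or> c \<noteq> 0" using assms(2) by (auto simp: A)
  then obtain l where l: "a' - d' = l * (a - d)" "b' = l * b" "c' = l * c"
  proof (elim disjE)
    assume "a \<noteq> d" thus ?thesis using h by (intro that[of "(a' - d') / (a - d)"]) (simp_all add: field_simps)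
  next
    assume "b \<noteq> 0" thus ?thesis using h by (intro that[of "b' / b"]) (simp_all add: field_simps)
  next
    assume "c \<noteq> 0" thus ?thesis using h by (intro that[of "c' / c"]) (simp_all add: field_simps)
  qed
  hence "B = l *\<^sub>R A + (d' - l * d) *\<^sub>R mat 1"
    by (intro mat2_eqI) (auto simp: A B mat_1_mat2 algebra_simps)
  thus ?thesis by blast
qed

lemma nX_linear: "nX (l *\<^sub>R A + m *\<^sub>R mat 1) = \<bar>l\<bar> * nX A"
proof -
  obtain a b c d where A: "A = mat2 a b c d" by (rule mat2_cases)
  have "l *\<^sub>R A + m *\<^sub>R mat 1 = mat2 (l * a + m) (l * b) (l * c) (l * d + m)"
    by (rule mat2_eqI) (auto simp: A mat_1_mat2)
  moreover have "(l * a + m) - (l * d + m) = l * (a - d)" by (simp add: algebra_simps)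
  ultimately show ?thesis by (simp add: A abs_mult max_mult_distrib_left)
qed

lemma linear_commute: "(l *\<^sub>R A + m *\<^sub>R mat 1) ** (l' *\<^sub>R A + m' *\<^sub>R mat 1) =
    (l' *\<^sub>R A + m' *\<^sub>R mat 1) ** (l *\<^sub>R A + m *\<^sub>R (mat 1 :: real^2^2))"
  by (cases A rule: mat2_cases) (rule mat2_eqI; simp add: mat_1_mat2 algebra_simps)

lemma commute_trans:
  assumes "A ** B = B ** A" "B ** C = C ** B" "nX B > 0" shows "A ** C = C ** A"
  using commute_linear[OF assms(1)[symmetric] assms(3)] commute_linear[OF assms(2,3)] linear_commute by metis

text \<open>A B - B A is bilinear and ignores the scalar parts of A and B, so it is quadratic in the
  sizes modulo scalars.\<close>

lemma ent_comm: "ent (2 * nX A * nX B) (A ** B - B ** A)"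
proof -
  obtain a b c d where A: "A = mat2 a b c d" by (rule mat2_cases)
  obtain a' b' c' d' where B: "B = mat2 a' b' c' d'" by (rule mat2_cases)
  define m where "m = nX A"
  define n where "n = nX B"
  have m: "\<bar>a - d\<bar> \<le> m" "\<bar>b\<bar> \<le> m" "\<bar>c\<bar> \<le> m" "0 \<le> m" by (auto simp: m_def A)
  have n: "\<bar>a' - d'\<bar> \<le> n" "\<bar>b'\<bar> \<le> n" "\<bar>c'\<bar> \<le> n" "0 \<le> n" by (auto simp: n_def B)
  have *: "\<bar>x * y - z * w\<bar> \<le> 2 * m * n" if "\<bar>x\<bar> \<le> m" "\<bar>y\<bar> \<le> n" "\<bar>z\<bar> \<le> m" "\<bar>w\<bar> \<le> n" for x y z w
  proof -
    have "\<bar>x * y\<bar> \<le> m * n" "\<bar>z * w\<bar> \<le> m * n"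
      unfolding abs_mult using mult_mono[OF that(1,2)] mult_mono[OF that(3,4)] m(4) n(4) by auto
    thus ?thesis using abs_triangle_ineq4[of "x * y" "z * w"] by linarith
  qed
  have e: "A ** B - B ** A = mat2 (b * c' - c * b') ((a - d) * b' - b * (a' - d'))
     (c * (a' - d') - (a - d) * c') (c * b' - b * c')"
    by (simp add: A B algebra_simps)
  show ?thesis unfolding e ent_mat2 m_def[symmetric] n_def[symmetric]
    using *[OF m(2) n(3) m(3) n(2)] *[OF m(1) n(2) m(2) n(1)] *[OF m(3) n(1) m(1) n(3)] *[OF m(3) n(2) m(2) n(3)]
    by blast
qed

context lattice
begin

text \<open>The stabiliser of the coset of g. That coset is periodic under \<open>uu\<close> exactly
  when some \<open>uu t\<close> with t \<noteq> 0 belongs to it.\<close>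

definition conj_grp :: "real^2^2 \<Rightarrow> (real^2^2) set" where
  "conj_grp g = (\<lambda>\<gamma>. g ** \<gamma> ** iv g) ` \<Gamma>"

lemma conj_grp:
  assumes "g \<in> SL2"
  shows "A \<in> conj_grp g \<Longrightarrow> A \<in> SL2" "A \<in> conj_grp g \<Longrightarrow> B \<in> conj_grp g \<Longrightarrow> A ** B \<in> conj_grp g"
    "A \<in> conj_grp g \<Longrightarrow> iv A \<in> conj_grp g" "A \<in> conj_grp g \<Longrightarrow> - A \<in> conj_grp g"
proof -
  show "A \<in> conj_grp g \<Longrightarrow> A \<in> SL2" using assms \<Gamma>_SL2 by (auto simp: conj_grp_def)
  show "A ** B \<in> conj_grp g" if "A \<in> conj_grp g" "B \<in> conj_grp g"
  proof -
    obtain x y where x: "x \<in> \<Gamma>" "A = g ** x ** iv g" "y \<in> \<Gamma>" "B = g ** y ** iv g"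
      using \<open>A \<in> _\<close> \<open>B \<in> _\<close> by (auto simp: conj_grp_def)
    have "A ** B = g ** (x ** y) ** iv g" using assms by (simp add: x matrix_mul_assoc[symmetric])
    thus ?thesis using x \<Gamma>_mult by (auto simp: conj_grp_def)
  qed
  show "iv A \<in> conj_grp g" if "A \<in> conj_grp g"
  proof -
    obtain x where x: "x \<in> \<Gamma>" "A = g ** x ** iv g" using \<open>A \<in> _\<close> by (auto simp: conj_grp_def)
    have "iv A = g ** iv x ** iv g" by (simp add: x iv_mult matrix_mul_assoc)
    thus ?thesis using x \<Gamma>_iv by (auto simp: conj_grp_def)
  qed
  show "- A \<in> conj_grp g" if "A \<in> conj_grp g"
  proof -
    obtain x where x: "x \<in> \<Gamma>" "A = g ** x ** iv g" using \<open>A \<in> _\<close> by (auto simp: conj_grp_def)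
    have "- A = g ** (- x) ** iv g" by (rule mat2_eqI) (auto simp: x algebra_simps)
    thus ?thesis using x \<Gamma>_uminus by (auto simp: conj_grp_def)
  qed
qed

lemma thick_conj_grp:
  assumes "g \<in> SL2"
  shows "thick \<rho> g \<longleftrightarrow> (\<forall>A\<in>conj_grp g. nX A > 0 \<longrightarrow> \<rho> \<le> nX A)"
proof -
  have "nX (g ** \<gamma> ** iv g) > 0 \<longleftrightarrow> \<gamma> \<noteq> mat 1 \<and> \<gamma> \<noteq> - mat 1" if "\<gamma> \<in> \<Gamma>" for \<gamma>
  proof -
    have "g ** (- mat 1) ** iv g = - (g ** iv g)" by (rule mat2_eqI) (auto simp: mat_1_mat2)
    moreover have "nX (mat 1) = 0" "nX (- mat 1) = 0" by (simp_all add: mat_1_mat2)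
    ultimately have "nX (g ** \<gamma> ** iv g) = 0" if "\<gamma> = mat 1 \<or> \<gamma> = - mat 1"
      using that assms by (elim disjE) simp_all
    thus ?thesis using conj_eq_cases[OF assms \<Gamma>_SL2[OF that]] nX_nonneg[of "g ** \<gamma> ** iv g"] by force
  qed
  thus ?thesis unfolding thick_def conj_grp_def by auto
qed

text \<open>By \<open>ent_comm\<close>, commutators of small elements are smaller still; so a non-commuting pair minimising
  \<open>nX\<close> cannot exist.\<close>

lemma conj_grp_commute_small:
  assumes g: "g \<in> SL2" and AB: "A \<in> conj_grp g" "B \<in> conj_grp g" "nX A < 1/300" "nX B < 1/300"
  shows "A ** B = B ** A"
proof (rule ccontr)
  assume nc: "A ** B \<noteq> B ** A"
  define S where "S = {A \<in> conj_grp g. nX A < 1/300}"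
  define P where "P = {(A, B). A \<in> S \<and> B \<in> S \<and> A ** B \<noteq> B ** A}"
  have "S \<subseteq> (\<lambda>\<gamma>. g ** \<gamma> ** iv g) ` {\<gamma> \<in> \<Gamma>. nX (g ** \<gamma> ** iv g) \<le> 1}"
    by (auto simp: S_def conj_grp_def)
  hence "finite S" using finite_\<Gamma>_conj[OF g] by (meson finite_imageI finite_subset)
  hence "finite (S \<times> S)" by simp
  moreover have "P \<subseteq> S \<times> S" by (auto simp: P_def)
  ultimately have "finite P" by (rule finite_subset[rotated])
  moreover have "P \<noteq> {}" using nc AB by (auto simp: P_def S_def)
  ultimately obtain p where p: "p \<in> P" "\<And>q. q \<in> P \<Longrightarrow> nX (fst p) + nX (snd p) \<le> nX (fst q) + nX (snd q)"
    using ex_is_arg_min_if_finite[of P "\<lambda>q. nX (fst q) + nX (snd q)"]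
    unfolding is_arg_min_linorder by blast
  obtain A B where pAB: "p = (A, B)" by (cases p)
  have A: "A \<in> S" and B: "B \<in> S" and nc: "A ** B \<noteq> B ** A" using p(1) by (auto simp: pAB P_def)
  have min: "A' ** B' = B' ** A'" if "A' \<in> S" "B' \<in> S" "nX A' + nX B' < nX A + nX B" for A' B'
  proof (rule ccontr)
    assume "A' ** B' \<noteq> B' ** A'"
    hence "(A', B') \<in> P" using that by (auto simp: P_def)
    from p(2)[OF this] show False using that(3) by (simp add: pAB)
  qed
  have cg: "A \<in> conj_grp g" "B \<in> conj_grp g" and nn: "nX A < 1/300" "nX B < 1/300" using A B by (auto simp: S_def)
  have SL: "A \<in> SL2" "B \<in> SL2" using cg conj_grp(1)[OF g] by auto
  have e3: "ent 3 A" "ent 3 B" using nn SL by (auto intro!: nX_bound)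
  have pos: "nX A > 0" "nX B > 0"
  proof -
    have "nX A \<noteq> 0"
    proof
      assume "nX A = 0" hence "A = mat 1 \<or> A = - mat 1" using SL by (intro SL2_nX_0)
      thus False using nc unfolding commute_iff by (auto simp: mat_1_mat2)
    qed
    thus "nX A > 0" using nX_nonneg[of A] by simp
    have "nX B \<noteq> 0"
    proof
      assume "nX B = 0" hence "B = mat 1 \<or> B = - mat 1" using SL by (intro SL2_nX_0)
      thus False using nc unfolding commute_iff by (auto simp: mat_1_mat2)
    qed
    thus "nX B > 0" using nX_nonneg[of B] by simp
  qed
  \<comment> \<open>C is the group commutator, of size at most 144 times \<open>nX A * nX B\<close>;
    sizes below 1/300 make it smaller than B, so by minimality it commutes with A. Then so does E,
    the conjugate of A by B, which is therefore a combination of A and 1.\<close>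
  define C where "C = A ** B ** iv A ** iv B"
  define E where "E = B ** A ** iv B"
  have small: "nX A * nX B \<le> (1/300) * nX B" "nX A * nX B \<le> nX A * (1/300)"
    using nn pos by (intro mult_right_mono mult_left_mono; simp)+
  have "C - mat 1 = (A ** B - B ** A) ** (iv A ** iv B)"
  proof -
    have "B ** A ** (iv A ** iv B) = mat 1" using SL by (simp add: matrix_mul_assoc)
    moreover have "(A ** B - B ** A) ** (iv A ** iv B) = A ** B ** (iv A ** iv B) - B ** A ** (iv A ** iv B)"
      by (rule mat2_eqI) (auto simp: algebra_simps)
    ultimately show ?thesis by (simp add: C_def matrix_mul_assoc)
  qed
  moreover have "ent (2 * 3 * 3) (iv A ** iv B)" using e3 by (intro ent_mult) (auto simp: ent_iv)
  ultimately have "ent (2 * (2 * nX A * nX B) * (2 * 3 * 3)) (C - mat 1)"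
    using ent_mult[OF ent_comm[of A B]] by metis
  hence "nX C \<le> 2 * (2 * (2 * nX A * nX B) * (2 * 3 * 3))" by (rule nX_ent)
  hence "nX C \<le> 144 * (nX A * nX B)" by simp
  hence nC: "nX C < nX B" using small(1) pos by linarith
  have "C \<in> conj_grp g" unfolding C_def by (intro conj_grp(2,3)[OF g] cg)
  hence "C \<in> S" using nC nn by (simp add: S_def)
  hence AC: "A ** C = C ** A" using A nC by (intro min) auto
  have CE: "C = A ** iv E" by (simp add: C_def E_def iv_mult matrix_mul_assoc)
  have ES: "E \<in> SL2" using SL by (simp add: E_def)
  have "iv A ** (A ** C) ** E = iv A ** (C ** A) ** E" using AC by simp
  hence "A = iv E ** A ** E" using SL ES by (simp add: CE matrix_mul_assoc[symmetric])
  hence "E ** A = E ** (iv E ** A ** E)" by simp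
  hence EA: "A ** E = E ** A" using ES by (simp add: matrix_mul_assoc)
  obtain l m where lm: "E = l *\<^sub>R A + m *\<^sub>R mat 1" using commute_linear[OF EA pos(1)] by auto
  have nE: "nX E = \<bar>l\<bar> * nX A" unfolding lm by (rule nX_linear)
  have EB: "E ** B \<noteq> B ** E"
  proof
    assume "E ** B = B ** E"
    hence "iv B ** (B ** A) = iv B ** (B ** E)" using SL by (simp add: E_def matrix_mul_assoc)
    hence "A = E" using SL by simp
    hence "A ** B = B ** A ** iv B ** B" by (simp add: E_def)
    thus False using nc SL by simp
  qed
  have "E - A = (B ** A - A ** B) ** iv B"
  proof -
    have "(B ** A - A ** B) ** iv B = B ** A ** iv B - A ** B ** iv B"
      by (rule mat2_eqI) (auto simp: algebra_simps)
    thus ?thesis using SL by (simp add: E_def)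
  qed
  hence "ent (2 * (2 * nX B * nX A) * 3) (E - A)" using ent_mult[OF ent_comm[of B A], of 3 "iv B"] e3 by (simp add: ent_iv)
  moreover have "E - A = (E - A + mat 1) - mat 1" by simp
  ultimately have "nX (E - A + mat 1) \<le> 2 * (2 * (2 * nX B * nX A) * 3)" by (intro nX_ent) simp
  moreover have "E - A + mat 1 = (l - 1) *\<^sub>R A + (m + 1) *\<^sub>R mat 1"
    unfolding lm by (simp add: algebra_simps)
  ultimately have "\<bar>l - 1\<bar> * nX A \<le> 24 * (nX A * nX B)" by (simp add: nX_linear mult.commute)
  hence "\<bar>l - 1\<bar> * nX A < 1 * nX A" using small(2) pos by linarith
  hence l1: "\<bar>l - 1\<bar> < 1" using pos(1) by (simp add: mult_less_cancel_right)
  \<comment> \<open>For l < 1 the conjugate E is smaller than A and still does not commute with B.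
    For l > 1 the conjugate F in the opposite direction is smaller than A, so it commutes with B and
    equals A, which is absurd. For l = 1 equal traces give E = A.\<close>
  consider "l < 1" | "l = 1" | "l > 1" by linarith
  thus False
  proof cases
    case 1
    hence "\<bar>l\<bar> < 1" using l1 by linarith
    hence "nX E < nX A" using pos nE by simp
    moreover have "E \<in> conj_grp g" unfolding E_def by (intro conj_grp(2,3)[OF g] cg)
    ultimately show False using min[of E B] B EB nn by (simp add: S_def)
  next
    case 2
    have "E $ 1 $ 1 + E $ 2 $ 2 = A $ 1 $ 1 + A $ 2 $ 2"
    proof -
      have "E $ 1 $ 1 + E $ 2 $ 2 = (A $ 1 $ 1 + A $ 2 $ 2) * (B $ 1 $ 1 * B $ 2 $ 2 - B $ 1 $ 2 * B $ 2 $ 1)"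
        by (simp add: E_def algebra_simps)
      thus ?thesis using SL(2) by (simp add: SL2_nth)
    qed
    hence "m = 0" using 2 by (simp add: lm mat_1_mat2)
    hence "E = A" using 2 by (simp add: lm)
    hence "B ** A = A ** B" using SL by (metis E_def mult_iv_cancel')
    thus False using nc by simp
  next
    case 3
    define F where "F = iv B ** A ** B"
    have "iv B ** E ** B = A" using SL by (simp add: E_def matrix_mul_assoc)
    moreover have "iv B ** E ** B = l *\<^sub>R F + m *\<^sub>R (iv B ** B)"
      unfolding lm F_def by (rule mat2_eqI) (auto simp: mat_1_mat2 algebra_simps)
    ultimately have "A = l *\<^sub>R F + m *\<^sub>R mat 1" using SL by simp
    hence "nX A = \<bar>l\<bar> * nX F" by (metis nX_linear)
    hence "nX A = l * nX F" using 3 by simp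
    moreover have "nX F \<noteq> 0" using calculation pos by auto
    hence "nX F > 0" using nX_nonneg[of F] by simp
    hence "1 * nX F < l * nX F" using 3 by (intro mult_strict_right_mono)
    ultimately have nF: "nX F < nX A" by simp
    moreover have "F \<in> conj_grp g" unfolding F_def by (intro conj_grp(2,3)[OF g] cg)
    ultimately have "F ** B = B ** F" using B nn by (intro min) (auto simp: S_def)
    hence "B ** F = A ** B" "F ** B = B ** F" using SL by (simp_all add: F_def matrix_mul_assoc)
    hence "F ** B ** iv B = A ** B ** iv B" by simp
    hence "F = A" using SL by simp
    thus False using nF by simp
  qed
qed

lemma dg_conj_grp:
  assumes "g \<in> SL2" "l > 0"
  shows "conj_grp (dg l ** g) = (\<lambda>A. dg l ** A ** dg (1/l)) ` conj_grp g"
  by (auto simp: conj_grp_def iv_mult matrix_mul_assoc image_image)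

lemma nX_dg_conj:
  assumes "R > 0"
  shows "nX (dg (1 / sqrt R) ** A ** dg (1 / (1 / sqrt R))) = max \<bar>A $ 1 $ 1 - A $ 2 $ 2\<bar> (max (\<bar>A $ 1 $ 2\<bar> / R) (R * \<bar>A $ 2 $ 1\<bar>))"
proof -
  have "sqrt R \<noteq> 0" "sqrt R * sqrt R = R" using assms by auto
  hence "dg (1 / sqrt R) ** A ** dg (1 / (1 / sqrt R)) = mat2 (A $ 1 $ 1) (A $ 1 $ 2 / R) (R * A $ 2 $ 1) (A $ 2 $ 2)"
    by (intro mat2_eqI) (auto simp: dg_def field_simps)
  thus ?thesis using assms by (simp add: abs_mult)
qed

lemma not_thick_dg:
  assumes "g \<in> SL2" "R > 0" "\<not> thick \<rho> (dg (1 / sqrt R) ** g)"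
  shows "\<exists>A\<in>conj_grp g. nX A > 0 \<and> \<bar>A $ 1 $ 1 - A $ 2 $ 2\<bar> < \<rho> \<and> \<bar>A $ 1 $ 2\<bar> < \<rho> * R \<and> R * \<bar>A $ 2 $ 1\<bar> < \<rho>"
proof -
  have "dg (1 / sqrt R) ** g \<in> SL2" using assms by (simp add: dg_SL2)
  then obtain A where A: "A \<in> conj_grp g" "nX (dg (1 / sqrt R) ** A ** dg (1 / (1 / sqrt R))) > 0"
     "nX (dg (1 / sqrt R) ** A ** dg (1 / (1 / sqrt R))) < \<rho>"
    using assms dg_conj_grp[of g "1 / sqrt R"] by (auto simp: thick_conj_grp not_le)
  hence h: "\<bar>A $ 1 $ 1 - A $ 2 $ 2\<bar> < \<rho>" "\<bar>A $ 1 $ 2\<bar> / R < \<rho>" "R * \<bar>A $ 2 $ 1\<bar> < \<rho>"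
    unfolding nX_dg_conj[OF assms(2)] by auto
  have "nX A > 0"
  proof (rule ccontr)
    assume "\<not> nX A > 0"
    hence "nX A = 0" using nX_nonneg[of A] by simp
    hence "\<bar>A $ 1 $ 1 - A $ 2 $ 2\<bar> = 0 \<and> \<bar>A $ 1 $ 2\<bar> = 0 \<and> \<bar>A $ 2 $ 1\<bar> = 0"
      unfolding nX_def by (auto simp: max_def split: if_splits)
    thus False using A(2) unfolding nX_dg_conj[OF assms(2)] by simp
  qed
  thus ?thesis using h A(1) assms(2) by (intro bexI[of _ A]) (auto simp: pos_divide_less_eq)
qed

text \<open>\<open>conj_grp_commute_small\<close> at the renormalised point
  \<open>dg (1 / sqrt R) ** g\<close>, conjugated back.\<close>

lemma commute_dg:
  assumes g: "g \<in> SL2" and R: "R > 0" and A: "A \<in> conj_grp g" "B \<in> conj_grp g"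
    and a: "\<bar>A $ 1 $ 1 - A $ 2 $ 2\<bar> < 1/300" "\<bar>A $ 1 $ 2\<bar> < R / 300" "R * \<bar>A $ 2 $ 1\<bar> < 1/300"
    and b: "\<bar>B $ 1 $ 1 - B $ 2 $ 2\<bar> < 1/300" "\<bar>B $ 1 $ 2\<bar> < R / 300" "R * \<bar>B $ 2 $ 1\<bar> < 1/300"
  shows "A ** B = B ** A"
proof -
  let ?l = "1 / sqrt R"
  let ?c = "\<lambda>A. dg ?l ** A ** dg (1 / ?l)"
  have l: "?l > 0" "?l \<noteq> 0" using R by auto
  have s: "dg (1 / ?l) \<in> SL2" "dg ?l \<in> SL2" using l by (auto intro!: dg_SL2)
  have "nX (?c A) < 1/300" "nX (?c B) < 1/300"
    unfolding nX_dg_conj[OF R] max_less_iff_conj using a b R by (auto simp: pos_divide_less_eq)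
  hence "?c A ** ?c B = ?c B ** ?c A"
    using A dg_conj_grp[OF g l(1)] g s by (intro conj_grp_commute_small[of "dg ?l ** g"]) auto
  moreover have "?c A ** ?c B = ?c (A ** B)" for A B
  proof -
    have "?c A ** ?c B = dg ?l ** A ** (dg (1 / ?l) ** dg ?l) ** B ** dg (1 / ?l)"
      by (simp only: matrix_mul_assoc)
    moreover have "dg (1 / ?l) ** dg ?l = mat 1" using l by (simp add: dg_mult)
    ultimately have "?c A ** ?c B = dg ?l ** A ** mat 1 ** B ** dg (1 / ?l)" by (simp only:)
    thus ?thesis by (simp only: matrix_mul_assoc matrix_mul_rid)
  qed
  ultimately have "?c (A ** B) = ?c (B ** A)" by simp
  hence "dg (1 / ?l) ** ?c (A ** B) ** dg ?l = dg (1 / ?l) ** ?c (B ** A) ** dg ?l" by simp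
  moreover have "dg (1 / ?l) ** ?c M ** dg ?l = M" for M
  proof -
    have "dg (1 / ?l) ** ?c M ** dg ?l = (dg (1 / ?l) ** dg ?l) ** M ** (dg (1 / ?l) ** dg ?l)"
      by (simp only: matrix_mul_assoc)
    moreover have "dg (1 / ?l) ** dg ?l = mat 1" using l by (simp add: dg_mult)
    ultimately show ?thesis by simp
  qed
  ultimately show ?thesis by simp
qed

text \<open>If no \<open>R\<close> works, the short elements at the scales \<open>R\<close> and \<open>2 R\<close> commute, hence they all commute with
  the first one, whose lower left entry must therefore vanish.\<close>

lemma upper_triangular_exists:
  assumes g: "g \<in> SL2" and \<rho>: "0 < \<rho>" "\<rho> \<le> 1/300"
    and nt: "\<And>R. R \<ge> R0 \<Longrightarrow> R > 0 \<Longrightarrow> \<not> thick (\<rho> / 4) (dg (1 / sqrt R) ** g)"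
  shows "\<exists>A\<in>conj_grp g. nX A > 0 \<and> A $ 2 $ 1 = 0 \<and> \<bar>A $ 1 $ 1 - A $ 2 $ 2\<bar> < \<rho>"
proof -
  define R where "R n = max 1 R0 * 2 ^ n" for n :: nat
  have R: "R n > 0" "R n \<ge> R0" "R (Suc n) = 2 * R n" for n
  proof -
    show "R n > 0" by (simp add: R_def)
    have "max 1 R0 * 1 \<le> max 1 R0 * 2 ^ n" by (intro mult_left_mono) auto
    thus "R n \<ge> R0" by (simp add: R_def)
  qed (simp add: R_def)
  have "\<exists>A\<in>conj_grp g. nX A > 0 \<and> \<bar>A $ 1 $ 1 - A $ 2 $ 2\<bar> < \<rho> / 4 \<and> \<bar>A $ 1 $ 2\<bar> < \<rho> / 4 * R n \<and> R n * \<bar>A $ 2 $ 1\<bar> < \<rho> / 4" for n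
    by (intro not_thick_dg g R nt)
  then obtain A where A: "\<And>n. A n \<in> conj_grp g" "\<And>n. nX (A n) > 0" "\<And>n. \<bar>A n $ 1 $ 1 - A n $ 2 $ 2\<bar> < \<rho> / 4"
    "\<And>n. \<bar>A n $ 1 $ 2\<bar> < \<rho> / 4 * R n" "\<And>n. R n * \<bar>A n $ 2 $ 1\<bar> < \<rho> / 4" by metis
  \<comment> \<open>At scale \<open>R (Suc n)\<close> the element found at scale \<open>R n\<close>
    is off by a factor of at most 2, for which \<rho> / 4 in place of \<rho> leaves room.\<close>
  have step: "A n ** A (Suc n) = A (Suc n) ** A n" for n
  proof (rule commute_dg[OF g R(1)[of "Suc n"] A(1) A(1)])
    show "\<bar>A n $ 1 $ 1 - A n $ 2 $ 2\<bar> < 1/300" "\<bar>A (Suc n) $ 1 $ 1 - A (Suc n) $ 2 $ 2\<bar> < 1/300"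
      using A(3)[of n] A(3)[of "Suc n"] \<rho> by linarith+
    have "\<rho> * R (Suc n) \<le> 1/300 * R (Suc n)" using \<rho> R(1)[of "Suc n"] by (intro mult_right_mono) auto
    moreover have "0 < \<rho> * R n" using \<rho> R by simp
    ultimately show "\<bar>A n $ 1 $ 2\<bar> < R (Suc n) / 300" "\<bar>A (Suc n) $ 1 $ 2\<bar> < R (Suc n) / 300"
      using A(4)[of n] A(4)[of "Suc n"] R(3)[of n] by (simp_all add: algebra_simps)
    show "R (Suc n) * \<bar>A n $ 2 $ 1\<bar> < 1/300" "R (Suc n) * \<bar>A (Suc n) $ 2 $ 1\<bar> < 1/300"
      using A(5)[of n] A(5)[of "Suc n"] R(3)[of n] \<rho> by simp_all
  qed
  have comm: "A 0 ** A n = A n ** A 0" for n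
  proof (induction n)
    case (Suc n)
    show ?case by (rule commute_trans[OF Suc step A(2)])
  qed simp
  obtain r where r: "r > 0" "thick r g" using thick_exists[OF g] by auto
  \<comment> \<open>Every \<open>A n\<close> is l times \<open>A 0\<close> plus a scalar, with a
    lower left entry that tends to 0. Were that of \<open>A 0\<close> not 0, then l and with it
    \<open>nX (A n)\<close> would tend to 0, against the thickness r of g.\<close>
  have "A 0 $ 2 $ 1 = 0"
  proof (rule ccontr)
    assume c: "A 0 $ 2 $ 1 \<noteq> 0"
    obtain n where n: "nX (A 0) * \<rho> / (r * \<bar>A 0 $ 2 $ 1\<bar>) < 2 ^ n" using real_arch_pow[of 2] by auto
    have "2 ^ n \<le> R n" by (simp add: R_def mult_le_cancel_right1)
    hence "2 ^ n * (r * \<bar>A 0 $ 2 $ 1\<bar>) \<le> R n * (r * \<bar>A 0 $ 2 $ 1\<bar>)" using r by (intro mult_right_mono) auto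
    moreover have "nX (A 0) * \<rho> < 2 ^ n * (r * \<bar>A 0 $ 2 $ 1\<bar>)" using n c r by (subst (asm) pos_divide_less_eq) auto
    ultimately have n: "nX (A 0) * \<rho> < r * \<bar>A 0 $ 2 $ 1\<bar> * R n" by (simp add: mult_ac)
    obtain l m where lm: "A n = l *\<^sub>R A 0 + m *\<^sub>R mat 1" using commute_linear[OF comm A(2)] by blast
    have "A n $ 2 $ 1 = l * A 0 $ 2 $ 1" by (simp add: lm mat_1_mat2)
    hence "R n * (\<bar>l\<bar> * \<bar>A 0 $ 2 $ 1\<bar>) < \<rho>" using A(5)[of n] \<rho> by (simp add: abs_mult)
    moreover have "r \<le> \<bar>l\<bar> * nX (A 0)"
    proof -
      have "nX (A n) = \<bar>l\<bar> * nX (A 0)" unfolding lm by (rule nX_linear)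
      thus ?thesis using r(2) A(1,2)[of n] by (auto simp: thick_conj_grp[OF g])
    qed
    hence "r * (\<bar>A 0 $ 2 $ 1\<bar> * R n) \<le> \<bar>l\<bar> * nX (A 0) * (\<bar>A 0 $ 2 $ 1\<bar> * R n)"
      using R(1)[of n] by (intro mult_right_mono) auto
    ultimately have "r * (\<bar>A 0 $ 2 $ 1\<bar> * R n) \<le> nX (A 0) * \<rho>"
      using mult_left_mono[of "R n * (\<bar>l\<bar> * \<bar>A 0 $ 2 $ 1\<bar>)" \<rho> "nX (A 0)"] nX_nonneg[of "A 0"]
      by (simp add: mult_ac)
    thus False using n by (simp add: mult_ac)
  qed
  thus ?thesis using A(1-3)[of 0] \<rho> by (intro bexI[of _ "A 0"]) auto
qed

text \<open>Otherwise the stabiliser contains upper triangular elements whose diagonal entries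
  differ, but by as little as desired. The commutator of two of them is unipotent, hence trivial by
  nonperiodicity; so they commute and are linearly related, and the one with the much smaller
  diagonal difference is too small altogether for the thickness of g.\<close>

lemma thick_return:
  assumes g: "g \<in> SL2" and np: "\<And>t. t \<noteq> 0 \<Longrightarrow> uu t \<notin> conj_grp g"
  shows "\<exists>\<rho>>0. \<forall>R0. \<exists>R\<ge>R0. R > 0 \<and> thick \<rho> (dg (1 / sqrt R) ** g)"
proof (rule ccontr)
  assume "\<not> ?thesis"
  hence nt: "\<exists>R0. \<forall>R\<ge>R0. R > 0 \<longrightarrow> \<not> thick \<rho> (dg (1 / sqrt R) ** g)" if "\<rho> > 0" for \<rho>
    using that by blast
  have ex: "\<exists>A\<in>conj_grp g. nX A > 0 \<and> A $ 2 $ 1 = 0 \<and> A $ 1 $ 1 \<noteq> A $ 2 $ 2 \<and> \<bar>A $ 1 $ 1 - A $ 2 $ 2\<bar> < \<rho>"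
    if \<rho>: "\<rho> > 0" "\<rho> \<le> 1/300" for \<rho>
  proof -
    obtain R0 where "\<forall>R\<ge>R0. R > 0 \<longrightarrow> \<not> thick (\<rho> / 4) (dg (1 / sqrt R) ** g)" using nt[of "\<rho> / 4"] \<rho> by auto
    then obtain A where A: "A \<in> conj_grp g" "nX A > 0" "A $ 2 $ 1 = 0" "\<bar>A $ 1 $ 1 - A $ 2 $ 2\<bar> < \<rho>"
      using upper_triangular_exists[OF g \<rho>, of R0] by auto
    have "A $ 1 $ 1 \<noteq> A $ 2 $ 2"
    proof
      assume e: "A $ 1 $ 1 = A $ 2 $ 2"
      have "A \<in> SL2" using A conj_grp[OF g] by auto
      hence "A $ 2 $ 2 * A $ 2 $ 2 = 1" using A(3) e by (simp add: SL2_nth)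
      hence s: "A $ 2 $ 2 = 1 \<or> A $ 2 $ 2 = -1" using square_eq_1_iff by blast
      have b: "A $ 1 $ 2 \<noteq> 0" using A(2,3) e by (auto simp: nX_def)
      show False using s
      proof
        assume "A $ 2 $ 2 = 1"
        hence "A = uu (A $ 1 $ 2)" using e A(3) by (intro mat2_eqI) (auto simp: uu_def)
        thus False using np[OF b] A(1) by simp
      next
        assume "A $ 2 $ 2 = -1"
        hence "- A = uu (- (A $ 1 $ 2))" using e A(3) by (intro mat2_eqI) (auto simp: uu_def)
        thus False using np[of "- (A $ 1 $ 2)"] b conj_grp(4)[OF g A(1)] by simp
      qed
    qed
    thus ?thesis using A by blast
  qed
  obtain r where r: "r > 0" "thick r g" using thick_exists[OF g] by auto
  obtain A where A: "A \<in> conj_grp g" "nX A > 0" "A $ 2 $ 1 = 0" "A $ 1 $ 1 \<noteq> A $ 2 $ 2"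
    using ex[of "1/300"] by auto
  define e where "e = \<bar>A $ 1 $ 1 - A $ 2 $ 2\<bar>"
  have e: "e > 0" using A by (simp add: e_def)
  have "0 < min (1/300) (r * e / nX A)" using r e A(2) by simp
  moreover have "min (1/300) (r * e / nX A) \<le> 1/300" by (rule min.cobounded1)
  moreover note ex
  ultimately have "\<exists>B\<in>conj_grp g. nX B > 0 \<and> B $ 2 $ 1 = 0 \<and> B $ 1 $ 1 \<noteq> B $ 2 $ 2 \<and>
    \<bar>B $ 1 $ 1 - B $ 2 $ 2\<bar> < min (1/300) (r * e / nX A)" by blast
  then obtain B where B: "B \<in> conj_grp g" "nX B > 0" "B $ 2 $ 1 = 0" "B $ 1 $ 1 \<noteq> B $ 2 $ 2"
      "\<bar>B $ 1 $ 1 - B $ 2 $ 2\<bar> < min (1/300) (r * e / nX A)"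
    by blast
  have SL: "A \<in> SL2" "B \<in> SL2" using A B conj_grp[OF g] by auto
  have d: "A $ 1 $ 1 * A $ 2 $ 2 = 1" "B $ 1 $ 1 * B $ 2 $ 2 = 1" using SL A(3) B(3) by (auto simp: SL2_nth)
  define C where "C = A ** B ** (iv A ** iv B)"
  have C: "C = uu (C $ 1 $ 2)"
  proof (rule mat2_eqI)
    have "C $ 1 $ 1 = (A $ 1 $ 1 * A $ 2 $ 2) * (B $ 1 $ 1 * B $ 2 $ 2)"
      "C $ 2 $ 2 = (A $ 1 $ 1 * A $ 2 $ 2) * (B $ 1 $ 1 * B $ 2 $ 2)"
      using A(3) B(3) by (simp_all add: C_def)
    thus "C $ 1 $ 1 = uu (C $ 1 $ 2) $ 1 $ 1" "C $ 2 $ 2 = uu (C $ 1 $ 2) $ 2 $ 2" using d by (simp_all add: uu_def)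
    show "C $ 2 $ 1 = uu (C $ 1 $ 2) $ 2 $ 1" using A(3) B(3) by (simp add: C_def uu_def)
  qed (simp add: uu_def)
  have "C \<in> conj_grp g" unfolding C_def by (intro conj_grp(2,3)[OF g] A B)
  hence "C $ 1 $ 2 = 0" using np C by metis
  hence "C = mat 1" using C by simp
  hence "C ** (B ** A) = B ** A" by simp
  moreover have "C ** (B ** A) = A ** B" using SL by (simp add: C_def matrix_mul_assoc[symmetric])
  ultimately have "A ** B = B ** A" by simp
  then obtain l m where lm: "B = l *\<^sub>R A + m *\<^sub>R mat 1" using commute_linear[OF _ A(2)] by blast
  have "B $ 1 $ 1 - B $ 2 $ 2 = l * (A $ 1 $ 1 - A $ 2 $ 2)" by (simp add: lm mat_1_mat2 algebra_simps)
  hence "\<bar>l\<bar> * e < r * e / nX A" using B(5) by (simp add: e_def abs_mult)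
  hence "\<bar>l\<bar> * nX A < r" using e A(2) by (simp add: field_simps)
  moreover have "nX B = \<bar>l\<bar> * nX A" unfolding lm by (rule nX_linear)
  moreover have "r \<le> nX B" using r(2) B(1,2) by (auto simp: thick_conj_grp[OF g])
  ultimately show False by simp
qed

end

section \<open>Pairs of returns with nearly equal frames\<close>

text \<open>The lower left entries c1 and c2 may be huge. They enter the quotient only through their
  products with the small upper right entries and through a1 c2 - c1 a2, and these are assumed
  small.\<close>

lemma quot_near_one:
  fixes k :: real
  assumes k: "0 \<le> k" "k \<le> 1/100"
    and a: "\<bar>a1 - 1\<bar> \<le> 2 * k" "\<bar>a2 - 1\<bar> \<le> 2 * k" and d: "\<bar>d1 - 1\<bar> \<le> 3 * k" "\<bar>d2 - 1\<bar> \<le> 3 * k"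
    and b: "\<bar>b1\<bar> \<le> 3 * k" "\<bar>b2\<bar> \<le> 3 * k" and bc: "\<bar>b1 * c2\<bar> \<le> 3 * k" "\<bar>c1 * b2\<bar> \<le> 3 * k"
    and c: "\<bar>a1 * c2 - c1 * a2\<bar> \<le> 2 * k"
  shows "ent (12 * k) (iv (mat2 a1 b1 c1 d1) ** mat2 a2 b2 c2 d2 - mat 1)"
proof -
  have ad: "\<bar>x * y - 1\<bar> \<le> 6 * k" if "\<bar>x - 1\<bar> \<le> 2 * k" "\<bar>y - 1\<bar> \<le> 3 * k" for x y
  proof -
    have "\<bar>(x - 1) * (y - 1)\<bar> \<le> 2 * k * (3 * k)" unfolding abs_mult using that k by (intro mult_mono) auto
    also have "\<dots> \<le> 2 * k * (1/2)" using k by (intro mult_left_mono) auto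
    finally have 1: "\<bar>(x - 1) * (y - 1)\<bar> \<le> k" by simp
    have "x * y - 1 = (x - 1) * (y - 1) + (x - 1) + (y - 1)" by (simp add: algebra_simps)
    moreover have "\<bar>u + v + t\<bar> \<le> \<bar>u\<bar> + \<bar>v\<bar> + \<bar>t\<bar>" for u v t :: real by linarith
    ultimately have "\<bar>x * y - 1\<bar> \<le> \<bar>(x - 1) * (y - 1)\<bar> + \<bar>x - 1\<bar> + \<bar>y - 1\<bar>" by metis
    thus ?thesis using 1 that by linarith
  qed
  have db: "\<bar>y * w\<bar> \<le> 6 * k" if "\<bar>y - 1\<bar> \<le> 3 * k" "\<bar>w\<bar> \<le> 3 * k" for y w
  proof -
    have "\<bar>y\<bar> \<le> 2" using that(1) k by linarith
    hence "\<bar>y * w\<bar> \<le> 2 * (3 * k)" unfolding abs_mult using that k by (intro mult_mono) auto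
    thus ?thesis by simp
  qed
  have e: "iv (mat2 a1 b1 c1 d1) ** mat2 a2 b2 c2 d2 - mat 1 =
      mat2 (a2 * d1 - 1 - b1 * c2) (d1 * b2 - d2 * b1) (a1 * c2 - c1 * a2) (a1 * d2 - 1 - c1 * b2)"
    by (simp add: mat_1_mat2 algebra_simps)
  show ?thesis unfolding e ent_mat2
  proof (intro conjI)
    show "\<bar>a2 * d1 - 1 - b1 * c2\<bar> \<le> 12 * k" using ad[OF a(2) d(1)] bc(1) k by linarith
    show "\<bar>d1 * b2 - d2 * b1\<bar> \<le> 12 * k" using db[OF d(1) b(2)] db[OF d(2) b(1)] k by linarith
    show "\<bar>a1 * c2 - c1 * a2\<bar> \<le> 12 * k" using c k by linarith
    show "\<bar>a1 * d2 - 1 - c1 * b2\<bar> \<le> 12 * k" using ad[OF a(1) d(2)] bc(2) k by linarith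
  qed
qed

text \<open>As c may be as large as R, the shift D and the entry b are measured against 1 / R; the
  determinant then keeps d near 1.\<close>

lemma pair_data:
  fixes k :: real
  assumes k: "0 \<le> k" "k \<le> 1/100" and R: "R \<ge> 1" and a: "\<bar>a - 1\<bar> \<le> k" and c: "\<bar>c\<bar> \<le> R"
    and b: "\<bar>b\<bar> * R \<le> k" and det: "a * d - b * c = 1" and D: "\<bar>D\<bar> * R \<le> k"
  shows "\<bar>a + D * c - 1\<bar> \<le> 2 * k" "\<bar>d - 1\<bar> \<le> 3 * k" "\<bar>b + D * d\<bar> * R \<le> 3 * k"
proof -
  have "\<bar>D * c\<bar> \<le> \<bar>D\<bar> * R" unfolding abs_mult using c by (intro mult_left_mono) auto
  thus "\<bar>a + D * c - 1\<bar> \<le> 2 * k" using D a by linarith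
  have bc: "\<bar>b * c\<bar> \<le> k"
  proof -
    have "\<bar>b * c\<bar> \<le> \<bar>b\<bar> * R" unfolding abs_mult using c by (intro mult_left_mono) auto
    thus ?thesis using b by linarith
  qed
  have "a * (d - 1) = 1 + b * c - a" using det by (simp add: algebra_simps)
  hence 1: "\<bar>a\<bar> * \<bar>d - 1\<bar> \<le> 2 * k" using bc a by (simp add: abs_mult[symmetric])
  have "2/3 \<le> \<bar>a\<bar>" using a k by linarith
  hence "2/3 * \<bar>d - 1\<bar> \<le> \<bar>a\<bar> * \<bar>d - 1\<bar>" by (intro mult_right_mono) auto
  hence "2/3 * \<bar>d - 1\<bar> \<le> 2 * k" using 1 by (rule order_trans)
  thus d: "\<bar>d - 1\<bar> \<le> 3 * k" by (simp add: field_simps)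
  have "\<bar>d\<bar> \<le> 2" using d k by linarith
  hence "\<bar>D\<bar> * R * \<bar>d\<bar> \<le> k * 2" using D k R by (intro mult_mono) auto
  hence "\<bar>D * d\<bar> * R \<le> 2 * k" by (simp add: abs_mult mult_ac)
  moreover have "\<bar>b + D * d\<bar> * R \<le> (\<bar>b\<bar> + \<bar>D * d\<bar>) * R" using R by (intro mult_right_mono) auto
  ultimately show "\<bar>b + D * d\<bar> * R \<le> 3 * k" using b by (simp add: distrib_right)
qed

lemma floor_eq_diff: "\<lfloor>x / k\<rfloor> = \<lfloor>y / k\<rfloor> \<Longrightarrow> k > 0 \<Longrightarrow> \<bar>x - y\<bar> \<le> (k::real)"
proof -
  assume a: "\<lfloor>x / k\<rfloor> = \<lfloor>y / k\<rfloor>" and k: "k > 0"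
  have "\<bar>x / k - y / k\<bar> \<le> 1" using a by linarith
  hence "\<bar>(x - y) / k\<bar> \<le> 1" by (simp add: diff_divide_distrib)
  thus ?thesis using k by (simp add: abs_divide pos_divide_le_eq)
qed

lemma card_le_int_box:
  fixes f :: "'a \<Rightarrow> int"
  assumes "\<And>x. x \<in> A \<Longrightarrow> \<bar>real_of_int (f x)\<bar> \<le> B" "0 \<le> B"
  shows "f ` A \<subseteq> {- \<lfloor>B\<rfloor>..\<lfloor>B\<rfloor>} \<and> real (card {- \<lfloor>B\<rfloor>..\<lfloor>B\<rfloor>}) \<le> 2 * B + 1"
proof
  show "f ` A \<subseteq> {- \<lfloor>B\<rfloor>..\<lfloor>B\<rfloor>}"
  proof
    fix y assume "y \<in> f ` A"
    then obtain x where "x \<in> A" "y = f x" by auto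
    hence "\<bar>real_of_int y\<bar> \<le> B" using assms by auto
    hence "real_of_int y \<le> B" "real_of_int (- y) \<le> B" by auto
    hence "y \<le> \<lfloor>B\<rfloor>" "- y \<le> \<lfloor>B\<rfloor>" by (simp_all only: le_floor_iff)
    thus "y \<in> {- \<lfloor>B\<rfloor>..\<lfloor>B\<rfloor>}" by auto
  qed
  have "\<lfloor>B\<rfloor> \<ge> 0" using assms(2) by simp
  hence "real (card {- \<lfloor>B\<rfloor>..\<lfloor>B\<rfloor>}) = 2 * real_of_int \<lfloor>B\<rfloor> + 1" by simp
  thus "real (card {- \<lfloor>B\<rfloor>..\<lfloor>B\<rfloor>}) \<le> 2 * B + 1" by linarith
qed

context lattice
begin

text \<open>A close pair \<open>(k, k')\<close> gives an element \<open>\<sigma> = u(-k'/K) G' u(k/K)\<close> of the discrete group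
  \<open>z \<Gamma> z\<^sup>-\<^sup>1\<close>. The rounded parameters \<open>(k'/K, r, k/K)\<close> determine \<open>\<sigma>\<close>, and \<open>\<sigma>\<close> together with
  \<open>k'\<close> determines \<open>k\<close>; moreover \<open>k'\<close> varies little when the lower left entry of \<open>\<sigma>\<close> is not small.
  The shift of \<open>k'/K\<close> to a grid point in the definition of \<open>r\<close> absorbs the shear by that entry.\<close>

lemma close_pairs_card:
  fixes K :: nat
  assumes z: "z \<in> SL2" "thick \<rho> z" and k: "0 < k" "k \<le> 1/100" "100 * k \<le> \<rho>"
    and xi: "0 \<le> xi" "xi \<le> k" and M: "M \<ge> 1" and R: "R = real K / M" and R1: "R \<ge> 1"
    and be: "0 < be" "be * R \<ge> 1" and P: "P \<subseteq> {..<K} \<times> {..<K}"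
    and G: "\<And>p. p \<in> P \<Longrightarrow> \<exists>G \<gamma>. G \<in> SL2 \<and> \<gamma> \<in> \<Gamma> \<and>
       G ** (uu (real (fst p)) ** (dg (sqrt K) ** z)) = uu (real (snd p)) ** (dg (sqrt K) ** z) ** \<gamma> \<and>
       \<bar>G $ 2 $ 1\<bar> \<le> 1 / M \<and> \<bar>G $ 1 $ 1 - 1\<bar> \<le> xi \<and> \<bar>G $ 1 $ 2\<bar> \<le> k"
  shows "real (card P) \<le> 35 * real K * be * R / k\<^sup>2 + 175 * R\<^sup>2 / k ^ 3 * (2 * xi * M / be + 1)"
proof -
  have K: "real K \<ge> 1" "real K > 0"
  proof -
    have "real K = R * M" using R M by simp
    moreover have "1 * 1 \<le> R * M" using R1 M by (intro mult_mono) auto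
    ultimately show "real K \<ge> 1" by simp
    thus "real K > 0" by simp
  qed
  obtain G where G: "\<And>p. p \<in> P \<Longrightarrow> \<exists>\<gamma>. G p \<in> SL2 \<and> \<gamma> \<in> \<Gamma> \<and>
       G p ** (uu (real (fst p)) ** (dg (sqrt K) ** z)) = uu (real (snd p)) ** (dg (sqrt K) ** z) ** \<gamma> \<and>
       \<bar>G p $ 2 $ 1\<bar> \<le> 1 / M \<and> \<bar>G p $ 1 $ 1 - 1\<bar> \<le> xi \<and> \<bar>G p $ 1 $ 2\<bar> \<le> k"
    using bchoice[of P "\<lambda>p G. \<exists>\<gamma>. G \<in> SL2 \<and> \<gamma> \<in> \<Gamma> \<and>
       G ** (uu (real (fst p)) ** (dg (sqrt K) ** z)) = uu (real (snd p)) ** (dg (sqrt K) ** z) ** \<gamma> \<and>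
       \<bar>G $ 2 $ 1\<bar> \<le> 1 / M \<and> \<bar>G $ 1 $ 1 - 1\<bar> \<le> xi \<and> \<bar>G $ 1 $ 2\<bar> \<le> k"] assms(14) by blast
  define s where "s p = real (fst p) / real K" for p :: "nat \<times> nat"
  define s' where "s' p = real (snd p) / real K" for p :: "nat \<times> nat"
  define al where "al p = G p $ 1 $ 1" for p
  define b where "b p = G p $ 1 $ 2 / real K" for p
  define c where "c p = real K * G p $ 2 $ 1" for p
  define d where "d p = G p $ 2 $ 2" for p
  define G' where "G' p = mat2 (al p) (b p) (c p) (d p)" for p
  define sg where "sg p = uu (- s' p) ** G' p ** uu (s p)" for p
  \<comment> \<open>The grid for s' is finer than the grid for s by the factor R: the shift D by the
    rounding error is multiplied by the lower left entry, which may be as large as R.\<close>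
  define i1 where "i1 p = \<lfloor>s' p / (k / R)\<rfloor>" for p
  define D where "D p = real_of_int (i1 p) * (k / R) - s' p" for p
  define a where "a p = al p + D p * c p" for p
  define r where "r p = c p / a p" for p
  define i2 where "i2 p = \<lfloor>r p / k\<rfloor>" for p
  define i3 where "i3 p = \<lfloor>s p / k\<rfloor>" for p
  define A where "A p = mat2 (a p) (b p + D p * d p) (c p) (d p)" for p
  have sK: "sqrt (real K) \<noteq> 0" "(sqrt (real K))\<^sup>2 = real K" "sqrt (real K) * sqrt (real K) = real K" using K by auto
  have kR: "k / R > 0" using k(1) R1 by (intro divide_pos_pos) linarith+
  have sbd: "0 \<le> s p" "s p \<le> 1" "0 \<le> s' p" "s' p \<le> 1" if "p \<in> P" for p
    using P that K by (auto simp: s_def s'_def field_simps)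
  have Gb: "\<bar>al p - 1\<bar> \<le> xi" "\<bar>c p\<bar> \<le> R" "\<bar>b p\<bar> * R \<le> k" "al p * d p - b p * c p = 1" "\<bar>b p\<bar> \<le> k / real K" if p: "p \<in> P" for p
  proof -
    obtain g where g: "G p \<in> SL2" "\<bar>G p $ 2 $ 1\<bar> \<le> 1 / M" "\<bar>G p $ 1 $ 1 - 1\<bar> \<le> xi" "\<bar>G p $ 1 $ 2\<bar> \<le> k" using G[OF p] by auto
    show "\<bar>al p - 1\<bar> \<le> xi" using g by (simp add: al_def)
    have "\<bar>c p\<bar> = real K * \<bar>G p $ 2 $ 1\<bar>" using K by (simp add: c_def abs_mult)
    also have "\<dots> \<le> real K * (1 / M)" using g K by (intro mult_left_mono) auto
    finally show "\<bar>c p\<bar> \<le> R" by (simp add: R)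
    show b: "\<bar>b p\<bar> \<le> k / real K" using g(4) K by (simp add: b_def abs_divide divide_right_mono)
    hence "\<bar>b p\<bar> * R \<le> k / real K * R" using R1 by (intro mult_right_mono) auto
    also have "\<dots> = k / M" using K by (simp add: R)
    also have "\<dots> \<le> k / 1" using M k by (intro divide_left_mono) auto
    finally show "\<bar>b p\<bar> * R \<le> k" by simp
    show "al p * d p - b p * c p = 1" using g(1) K by (simp add: al_def b_def c_def d_def SL2_nth)
  qed
  have Db: "\<bar>D p\<bar> * R \<le> k" for p
  proof -
    have "\<bar>D p\<bar> \<le> k / R"
    proof -
      define y where "y = s' p / (k / R)"
      have "k > 0" "R > 0" using k R1 by linarith+
      hence "s' p = y * (k / R)" by (simp add: y_def)
      hence "D p = (real_of_int \<lfloor>y\<rfloor> - y) * (k / R)" by (simp add: D_def i1_def y_def algebra_simps)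
      moreover have "\<bar>real_of_int \<lfloor>y\<rfloor> - y\<bar> \<le> 1" by linarith
      hence "\<bar>real_of_int \<lfloor>y\<rfloor> - y\<bar> * (k / R) \<le> 1 * (k / R)" using kR by (intro mult_right_mono) auto
      ultimately show ?thesis using \<open>k > 0\<close> \<open>R > 0\<close> by (simp add: abs_mult)
    qed
    thus ?thesis using R1 by (simp add: pos_le_divide_eq)
  qed
  have pd: "\<bar>a p - 1\<bar> \<le> 2 * k" "\<bar>d p - 1\<bar> \<le> 3 * k" "\<bar>b p + D p * d p\<bar> * R \<le> 3 * k" if p: "p \<in> P" for p
    using pair_data[of k R "al p" "c p" "b p" "d p" "D p"] Gb[OF p] Db[of p] k xi R1 by (auto simp: a_def)
  have a2: "1/2 \<le> a p" "a p \<le> 2" if "p \<in> P" for p using pd(1)[OF that] k unfolding abs_le_iff by linarith+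
  have sgA: "sg p = uu (- (real_of_int (i1 p) * (k / R))) ** A p ** uu (s p)" for p
  proof -
    have "uu (- s' p) = uu (- (real_of_int (i1 p) * (k / R))) ** uu (D p)" by (simp add: uu_add D_def)
    moreover have "uu (D p) ** G' p = A p" by (simp add: G'_def A_def a_def uu_def)
    ultimately show ?thesis by (simp add: sg_def matrix_mul_assoc[symmetric])
  qed
  have sgz: "\<exists>\<gamma>\<in>\<Gamma>. sg p ** z = z ** \<gamma>" if p: "p \<in> P" for p
  proof -
    obtain \<gamma> where g: "\<gamma> \<in> \<Gamma>" "G p ** (uu (real (fst p)) ** (dg (sqrt K) ** z)) = uu (real (snd p)) ** (dg (sqrt K) ** z) ** \<gamma>"
      using G[OF p] by auto
    have 1: "uu (real (fst p)) ** dg (sqrt K) = dg (sqrt K) ** uu (s p)"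
      using dg_uu[OF sK(1), of "s p"] sK(2) K by (simp add: s_def)
    have 2: "uu (real (snd p)) ** dg (sqrt K) = dg (sqrt K) ** uu (s' p)"
      using dg_uu[OF sK(1), of "s' p"] sK(2) K by (simp add: s'_def)
    have 3: "G p ** dg (sqrt K) = dg (sqrt K) ** G' p"
      using K sK by (intro mat2_eqI) (auto simp: dg_def G'_def al_def b_def c_def d_def field_simps)
    have dS: "dg (sqrt K) \<in> SL2" using sK by (intro dg_SL2) auto
    have "dg (sqrt K) ** (G' p ** uu (s p) ** z) = G p ** dg (sqrt K) ** uu (s p) ** z" by (simp add: 3 matrix_mul_assoc)
    also have "\<dots> = G p ** (uu (real (fst p)) ** (dg (sqrt K) ** z))" by (simp add: matrix_mul_assoc[symmetric] 1[symmetric])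
    also have "\<dots> = uu (real (snd p)) ** (dg (sqrt K) ** z) ** \<gamma>" by (rule g(2))
    also have "\<dots> = (uu (real (snd p)) ** dg (sqrt K)) ** z ** \<gamma>" by (simp only: matrix_mul_assoc)
    also have "\<dots> = dg (sqrt K) ** (uu (s' p) ** z ** \<gamma>)" unfolding 2 by (simp only: matrix_mul_assoc)
    finally have "iv (dg (sqrt K)) ** (dg (sqrt K) ** (G' p ** uu (s p) ** z)) = iv (dg (sqrt K)) ** (dg (sqrt K) ** (uu (s' p) ** z ** \<gamma>))"
      by simp
    hence "G' p ** uu (s p) ** z = uu (s' p) ** z ** \<gamma>" by (simp only: iv_left_assoc[OF dS])
    hence "uu (- s' p) ** (G' p ** uu (s p) ** z) = uu (- s' p) ** (uu (s' p) ** (z ** \<gamma>))" by (simp add: matrix_mul_assoc)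
    also have "\<dots> = z ** \<gamma>" by (simp add: matrix_mul_assoc uu_add)
    finally show ?thesis using g(1) by (auto simp: sg_def matrix_mul_assoc)
  qed
  have AS: "A p \<in> SL2" "sg p \<in> SL2" "G' p \<in> SL2" if p: "p \<in> P" for p
  proof -
    show G: "G' p \<in> SL2" using Gb(4)[OF p] by (simp add: G'_def)
    have "A p = uu (D p) ** G' p" by (simp add: G'_def A_def a_def uu_def)
    thus "A p \<in> SL2" using G by simp
    show "sg p \<in> SL2" using G by (simp add: sg_def)
  qed
  \<comment> \<open>Equal rounded parameters make the two group elements differ by a matrix within
    49 k of 1; as 98 k < \<rho>, thickness makes them equal.\<close>
  have same: "sg p = sg q" if p: "p \<in> P" and q: "q \<in> P" and e: "i1 p = i1 q" "i2 p = i2 q" "i3 p = i3 q" for p q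
  proof -
    have rr: "\<bar>r p - r q\<bar> \<le> k" using e(2) k floor_eq_diff by (simp add: i2_def)
    have ss: "\<bar>s p - s q\<bar> \<le> k" using e(3) k floor_eq_diff by (simp add: i3_def)
    have "a p \<noteq> 0" "a q \<noteq> 0" using a2[OF p] a2[OF q] by auto
    hence cr: "c p = a p * r p" "c q = a q * r q" by (simp_all add: r_def)
    have ac0: "a p * c q - c p * a q = a p * a q * (r q - r p)" by (simp add: cr algebra_simps)
    have "\<bar>a p * a q * (r q - r p)\<bar> \<le> (1 + 2 * k) * (1 + 2 * k) * k" unfolding abs_mult
      using pd(1)[OF p] pd(1)[OF q] rr k a2[OF p] a2[OF q] by (intro mult_mono) (auto simp: abs_minus_commute abs_le_iff)
    also have "\<dots> \<le> 2 * k"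
    proof (rule mult_right_mono)
      have "k * k \<le> 1/100 * k" using k by (intro mult_right_mono) auto
      moreover have "(1 + 2 * k) * (1 + 2 * k) = 1 + 4 * k + 4 * (k * k)" by (simp add: algebra_simps)
      ultimately show "(1 + 2 * k) * (1 + 2 * k) \<le> 2" using k by linarith
    qed (use k in simp)
    finally have ac: "\<bar>a p * c q - c p * a q\<bar> \<le> 2 * k" unfolding ac0 .
    have bb: "\<bar>b x + D x * d x\<bar> \<le> 3 * k" "\<bar>(b x + D x * d x) * c y\<bar> \<le> 3 * k" if "x \<in> P" "y \<in> P" for x y
    proof -
      have "\<bar>b x + D x * d x\<bar> * 1 \<le> \<bar>b x + D x * d x\<bar> * R" using R1 by (intro mult_left_mono) auto
      from order_trans[OF this pd(3)[OF that(1)]] show "\<bar>b x + D x * d x\<bar> \<le> 3 * k" by simp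
      have "\<bar>(b x + D x * d x) * c y\<bar> \<le> \<bar>b x + D x * d x\<bar> * R" unfolding abs_mult using Gb(2)[OF that(2)] by (intro mult_left_mono) auto
      from order_trans[OF this pd(3)[OF that(1)]] show "\<bar>(b x + D x * d x) * c y\<bar> \<le> 3 * k" .
    qed
    have "ent (12 * k) (iv (A p) ** A q - mat 1)" unfolding A_def
    proof (rule quot_near_one[OF _ k(2) pd(1)[OF p] pd(1)[OF q] pd(2)[OF p] pd(2)[OF q] bb(1)[OF p q] bb(1)[OF q p] bb(2)[OF p q] _ ac])
      show "0 \<le> k" using k by simp
      show "\<bar>c p * (b q + D q * d q)\<bar> \<le> 3 * k" using bb(2)[OF q p] by (simp only: mult.commute)
    qed
    hence "ent (2 * (2 * 1 * (12 * k)) * 1) (uu (- s p) ** (iv (A p) ** A q - mat 1) ** uu (s q))"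
      using sbd[OF p] sbd[OF q] by (intro ent_mult) (auto simp: uu_def ent_mat2)
    moreover have "ent k (mat 1 - uu (s p - s q))" using ss k by (auto simp: uu_def ent_mat2 mat_1_mat2)
    ultimately have "ent (2 * (2 * 1 * (12 * k)) * 1 + k) (uu (- s p) ** (iv (A p) ** A q - mat 1) ** uu (s q) - (mat 1 - uu (s q - s p)))"
      using ss by (intro ent_triangle[where C = 0]) (auto simp: uu_def ent_mat2 mat_1_mat2 abs_minus_commute)
    moreover have "uu (- s p) ** (iv (A p) ** A q - mat 1) ** uu (s q) - (mat 1 - uu (s q - s p)) = iv (sg p) ** sg q - mat 1"
    proof -
      have "iv (sg p) ** sg q = uu (- s p) ** (iv (A p) ** A q) ** uu (s q)"
        unfolding sgA e(1) by (simp add: iv_mult matrix_mul_assoc[symmetric]) (simp add: matrix_mul_assoc uu_add)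
      moreover have "uu (- s p) ** (iv (A p) ** A q - mat 1) ** uu (s q) =
          uu (- s p) ** (iv (A p) ** A q) ** uu (s q) - uu (s q - s p)"
        by (rule mat2_eqI) (auto simp: uu_def mat_1_mat2 algebra_simps)
      ultimately show ?thesis by simp
    qed
    ultimately have en: "ent (49 * k) (iv (sg p) ** sg q - mat 1)" by simp
    obtain \<gamma> \<gamma>' where g: "\<gamma> \<in> \<Gamma>" "sg p ** z = z ** \<gamma>" "\<gamma>' \<in> \<Gamma>" "sg q ** z = z ** \<gamma>'" using sgz p q by blast
    have "sg p ** (z ** iv \<gamma>) = z" using g \<Gamma>_SL2 by (simp add: matrix_mul_assoc)
    hence "iv (sg p) ** (sg p ** (z ** iv \<gamma>)) = iv (sg p) ** z" by simp
    hence "z ** iv \<gamma> = iv (sg p) ** z" using AS(2)[OF p] by simp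
    hence "iv (sg p) ** sg q ** z = z ** (iv \<gamma> ** \<gamma>')" by (simp add: matrix_mul_assoc[symmetric] g(4)) (simp add: matrix_mul_assoc)
    moreover have "iv \<gamma> ** \<gamma>' \<in> \<Gamma>" using g \<Gamma>_iv \<Gamma>_mult by blast
    moreover have "iv (sg p) ** sg q \<in> SL2" by (intro SL2_mult iv_SL2 AS p q)
    ultimately have "iv (sg p) ** sg q = mat 1"
      using thick_small_eq[OF z(2,1) _ _ en] k by auto
    hence "sg p ** (iv (sg p) ** sg q) = sg p" by simp
    thus ?thesis using AS(2)[OF p] by simp
  qed
  have sgc: "sg p $ 2 $ 1 = c p" "sg p $ 1 $ 1 = al p - s' p * c p" for p
    by (simp_all add: sg_def G'_def uu_def)
  \<comment> \<open>\<open>sg\<close> and k' give \<open>G' ** uu s\<close>, whose first row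
    determines s up to 4 k / K, while s is a multiple of 1 / K.\<close>
  have inj0: "fst p = fst q" if p: "p \<in> P" and q: "q \<in> P" and e: "sg p = sg q" "snd p = snd q" for p q
  proof -
    have "uu (s' p) ** sg p = uu (s' q) ** sg q" using e by (simp add: s'_def)
    hence "G' p ** uu (s p) = G' q ** uu (s q)" by (simp add: sg_def matrix_mul_assoc uu_add)
    hence e2: "al p = al q \<and> al p * s p + b p = al q * s q + b q" unfolding G'_def uu_def mat2_mult mat2_inject by auto
    hence "al p * (s p - s q) = b q - b p" unfolding right_diff_distrib by auto
    moreover have "\<bar>b q - b p\<bar> \<le> k / real K + k / real K" using Gb(5)[OF p] Gb(5)[OF q] by linarith
    ultimately have "\<bar>al p\<bar> * \<bar>s p - s q\<bar> \<le> 2 * k / real K"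
      unfolding abs_mult[symmetric] by simp
    moreover have "1/2 \<le> \<bar>al p\<bar>" using Gb(1)[OF p] xi k by linarith
    hence "1/2 * \<bar>s p - s q\<bar> \<le> \<bar>al p\<bar> * \<bar>s p - s q\<bar>" by (intro mult_right_mono) auto
    ultimately have "\<bar>s p - s q\<bar> \<le> 4 * k / real K" by simp
    hence "\<bar>real (fst p) - real (fst q)\<bar> / real K \<le> 4 * k / real K" using K by (simp add: s_def diff_divide_distrib[symmetric] abs_divide)
    hence "\<bar>real (fst p) - real (fst q)\<bar> \<le> 4 * k" using K by (simp add: divide_le_cancel)
    hence "\<bar>real (fst p) - real (fst q)\<bar> < 1" using k by linarith
    thus ?thesis by linarith
  qed
  have rb: "\<bar>r p\<bar> \<le> 2 * \<bar>c p\<bar>" if "p \<in> P" for p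
  proof -
    have "\<bar>r p\<bar> = \<bar>c p\<bar> / a p" using a2[OF that] by (simp add: r_def abs_divide)
    also have "\<dots> \<le> \<bar>c p\<bar> / (1/2)" using a2[OF that] by (intro divide_left_mono) auto
    finally show ?thesis by simp
  qed
  have flb: "\<bar>real_of_int \<lfloor>x / y\<rfloor>\<bar> \<le> B / y + 1" if "\<bar>x\<bar> \<le> B" "y > 0" for x y B :: real
  proof -
    have "\<bar>x / y\<bar> \<le> B / y" using that by (simp add: abs_divide divide_right_mono)
    thus ?thesis by linarith
  qed
  have i1b: "\<bar>real_of_int (i1 p)\<bar> \<le> R / k + 1" if "p \<in> P" for p
    using flb[of "s' p" 1 "k / R"] sbd[OF that] kR by (simp add: i1_def)
  have i3b: "\<bar>real_of_int (i3 p)\<bar> \<le> 1 / k + 1" if "p \<in> P" for p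
    using flb[of "s p" 1 k] sbd[OF that] k by (simp add: i3_def)
  have i2b: "\<bar>real_of_int (i2 p)\<bar> \<le> 2 * B / k + 1" if "p \<in> P" "\<bar>c p\<bar> \<le> B" for p B
    using flb[of "r p" "2 * B" k] rb[OF that(1)] that(2) k by (simp add: i2_def)
  have finP: "finite P" using P by (rule finite_subset) auto
  have k1: "1 \<le> 1 / k" using k by simp
  have c3: "2 * (1 / k + 1) + 1 \<le> 5 / k" using k1 by simp
  have c1: "2 * (R / k + 1) + 1 \<le> 5 * R / k"
  proof -
    have "1 \<le> R / k" using R1 k by (simp add: pos_le_divide_eq)
    thus ?thesis by simp
  qed
  have c2: "2 * (2 * B / k + 1) + 1 \<le> 7 * B / k" if "B \<ge> 1" for B
  proof -
    have "1 \<le> B / k" using that k by (simp add: pos_le_divide_eq)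
    thus ?thesis by simp
  qed
  \<comment> \<open>If the lower left entry is small, the rounded slope takes few values and k' can
    be recorded in full. If it is large, \<open>sg\<close> nearly determines k', and a residue of k'
    suffices.\<close>
  define Ps where "Ps = {p \<in> P. \<bar>c p\<bar> \<le> be * R}"
  define Pl where "Pl = {p \<in> P. \<bar>c p\<bar> > be * R}"
  note b3 = card_le_int_box[of P i3 "1 / k + 1", OF i3b]
  define I3 where "I3 = {- \<lfloor>1 / k + 1\<rfloor>..\<lfloor>1 / k + 1\<rfloor>}"
  have I3: "i3 ` P \<subseteq> I3" "real (card I3) \<le> 5 / k" using b3 k c3 by (auto simp: I3_def)
  have s: "real (card Ps) \<le> 35 * real K * be * R / k\<^sup>2"
  proof -
    let ?f = "\<lambda>p. (snd p, i2 p, i3 p)"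
    define I2 where "I2 = {- \<lfloor>2 * (be * R) / k + 1\<rfloor>..\<lfloor>2 * (be * R) / k + 1\<rfloor>}"
    have I2: "i2 ` Ps \<subseteq> I2" "real (card I2) \<le> 7 * (be * R) / k"
      using card_le_int_box[of Ps i2 "2 * (be * R) / k + 1"] i2b[of _ "be * R"] be k c2[OF be(2)]
      by (auto simp: I2_def Ps_def)
    have "inj_on ?f Ps"
    proof (rule inj_onI)
      fix p q assume p: "p \<in> Ps" and q: "q \<in> Ps" and e: "?f p = ?f q"
      have "i1 p = i1 q" using e by (simp add: i1_def s'_def)
      hence "sg p = sg q" using same[of p q] p q e by (simp add: Ps_def)
      hence "fst p = fst q" using inj0[of p q] p q e by (simp add: Ps_def)
      thus "p = q" using e by (simp add: prod_eq_iff)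
    qed
    hence "card Ps = card (?f ` Ps)" by (simp add: card_image)
    also have "\<dots> \<le> card ({..<K} \<times> I2 \<times> I3)"
      using I2(1) I3(1) P by (intro card_mono) (auto simp: I2_def I3_def Ps_def image_subset_iff)
    finally have "real (card Ps) \<le> real K * (real (card I2) * real (card I3))"
      by (simp add: card_cartesian_product flip: of_nat_mult)
    also have "\<dots> \<le> real K * ((7 * (be * R) / k) * (5 / k))"
      using I2(2) I3(2) k be R1 by (intro mult_left_mono mult_mono) auto
    also have "\<dots> = 35 * real K * be * R / k\<^sup>2" by (simp add: power2_eq_square)
    finally show ?thesis .
  qed
  have l: "real (card Pl) \<le> 175 * R\<^sup>2 / k ^ 3 * (2 * xi * M / be + 1)"
  proof -
    \<comment> \<open>For equal \<open>sg\<close> and a lower left entry above be R, the upper left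
      entry of \<open>sg\<close> confines k' to an interval of length w, in which its residue modulo
      m > w fixes it.\<close>
    define w where "w = 2 * xi * M / be"
    define m where "m = nat \<lfloor>w\<rfloor> + 1"
    have w: "w \<ge> 0" using xi M be by (simp add: w_def)
    have "w < real m" "real m \<le> w + 1" using w unfolding m_def by linarith+
    hence m: "w < real m" "real m \<le> w + 1" "m > 0" by (auto simp: m_def)
    let ?f = "\<lambda>p. (i1 p, i2 p, i3 p, snd p mod m)"
    define I1 where "I1 = {- \<lfloor>R / k + 1\<rfloor>..\<lfloor>R / k + 1\<rfloor>}"
    define I2 where "I2 = {- \<lfloor>2 * R / k + 1\<rfloor>..\<lfloor>2 * R / k + 1\<rfloor>}"
    have I1: "i1 ` P \<subseteq> I1" "real (card I1) \<le> 5 * R / k"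
      using card_le_int_box[of P i1 "R / k + 1", OF i1b] R k c1 by (auto simp: I1_def)
    have I2: "i2 ` P \<subseteq> I2" "real (card I2) \<le> 7 * R / k"
      using card_le_int_box[of P i2 "2 * R / k + 1"] i2b[OF _ Gb(2)] R k c2[OF R1] by (auto simp: I2_def)
    have "inj_on ?f Pl"
    proof (rule inj_onI)
      fix p q assume p: "p \<in> Pl" and q: "q \<in> Pl" and e: "?f p = ?f q"
      have pP: "p \<in> P" "q \<in> P" and cp: "\<bar>c p\<bar> > be * R" using p q by (auto simp: Pl_def)
      have sg: "sg p = sg q" using same[OF pP] e by simp
      have cc: "c p = c q" using sg sgc(1) by metis
      have "al p - s' p * c p = al q - s' q * c p" using sg sgc(2) cc by metis
      hence "(s' p - s' q) * c p = al p - al q" by (simp add: algebra_simps)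
      moreover have "\<bar>al p - al q\<bar> \<le> xi + xi" using Gb(1)[OF pP(1)] Gb(1)[OF pP(2)] by linarith
      ultimately have "\<bar>s' p - s' q\<bar> * \<bar>c p\<bar> \<le> 2 * xi" unfolding abs_mult[symmetric] by simp
      moreover have "\<bar>s' p - s' q\<bar> * (be * R) \<le> \<bar>s' p - s' q\<bar> * \<bar>c p\<bar>" using cp by (intro mult_left_mono) auto
      ultimately have "\<bar>s' p - s' q\<bar> * (be * R) \<le> 2 * xi" by linarith
      moreover have "\<bar>s' p - s' q\<bar> = \<bar>real (snd p) - real (snd q)\<bar> / real K"
        using K by (simp add: s'_def diff_divide_distrib[symmetric] abs_divide)
      ultimately have "\<bar>real (snd p) - real (snd q)\<bar> * (be / M) \<le> 2 * xi" using K by (simp add: R)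
      hence "\<bar>real (snd p) - real (snd q)\<bar> \<le> w" using be M by (simp add: w_def field_simps)
      hence lt: "\<bar>int (snd p) - int (snd q)\<bar> < int m" using m(1) by linarith
      have "int (snd p) mod int m = int (snd q) mod int m" using e by (simp flip: zmod_int)
      hence "int m dvd int (snd p) - int (snd q)" by (simp add: mod_eq_dvd_iff)
      hence "int (snd p) - int (snd q) = 0" using lt dvd_imp_le_int[of "int (snd p) - int (snd q)" "int m"] by fastforce
      hence "snd p = snd q" by simp
      moreover from this have "fst p = fst q" using inj0[OF pP sg] by simp
      ultimately show "p = q" by (simp add: prod_eq_iff)
    qed
    hence "card Pl = card (?f ` Pl)" by (simp add: card_image)
    also have "\<dots> \<le> card (I1 \<times> I2 \<times> I3 \<times> {..<m})"
      using I1(1) I2(1) I3(1) m(3) by (intro card_mono) (auto simp: I1_def I2_def I3_def Pl_def image_subset_iff)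
    finally have "real (card Pl) \<le> real (card I1) * (real (card I2) * (real (card I3) * real m))"
      by (simp add: card_cartesian_product flip: of_nat_mult)
    also have "\<dots> \<le> (5 * R / k) * ((7 * R / k) * ((5 / k) * (w + 1)))"
      using I1(2) I2(2) I3(2) k R1 m(2) w by (intro mult_mono) auto
    also have "(5 * R / k) * ((7 * R / k) * ((5 / k) * y)) = 175 * R\<^sup>2 / k ^ 3 * y" for y
      by (simp add: power2_eq_square power3_eq_cube)
    also note w_def
    finally show ?thesis .
  qed
  have "P = Ps \<union> Pl" by (auto simp: Ps_def Pl_def)
  hence "card P \<le> card Ps + card Pl" using card_Un_le by metis
  thus ?thesis using s l by linarith
qed

end

section \<open>Overlaps of arithmetic progressions\<close>

lemma card_int_le:
  fixes S :: "int set"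
  assumes "finite S" "0 \<le> L" "\<And>i j. i \<in> S \<Longrightarrow> j \<in> S \<Longrightarrow> \<bar>real_of_int i - real_of_int j\<bar> \<le> L"
  shows "real (card S) \<le> L + 1"
proof (cases "S = {}")
  case False
  define m where "m = Min S"
  have m: "m \<in> S" using assms(1) False by (simp add: m_def)
  have "S \<subseteq> {m..m + \<lfloor>L\<rfloor>}"
  proof
    fix i assume i: "i \<in> S"
    have "m \<le> i" using assms(1) i by (simp add: m_def)
    moreover have "real_of_int (i - m) \<le> L" using assms(3)[OF i m] by simp
    hence "i - m \<le> \<lfloor>L\<rfloor>" by (simp only: le_floor_iff)
    ultimately show "i \<in> {m..m + \<lfloor>L\<rfloor>}" by auto
  qed
  hence "card S \<le> card {m..m + \<lfloor>L\<rfloor>}" by (intro card_mono) auto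
  also have "\<dots> = nat (\<lfloor>L\<rfloor> + 1)" by simp
  finally have "real (card S) \<le> real (nat (\<lfloor>L\<rfloor> + 1))" by simp
  also have "\<dots> \<le> L + 1" using assms(2) by linarith
  finally show ?thesis .
qed (use assms in simp)

lemma card_progression:
  fixes s :: real
  assumes s: "s > 0" and J: "J = {j::int. lo \<le> p + s * real_of_int j \<and> p + s * real_of_int j \<le> hi}"
  shows "finite J" "(hi - lo) / s - 1 \<le> real (card J)" "lo \<le> hi \<Longrightarrow> real (card J) \<le> (hi - lo) / s + 1"
proof -
  have e: "J = {\<lceil>(lo - p) / s\<rceil>..\<lfloor>(hi - p) / s\<rfloor>}"
    using s by (auto simp: J ceiling_le_iff le_floor_iff pos_divide_le_eq pos_le_divide_eq algebra_simps)
  show "finite J" by (simp add: e)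
  have d: "(hi - lo) / s = (hi - p) / s - (lo - p) / s" by (simp add: diff_divide_distrib[symmetric])
  have c: "real (card J) = real (nat (\<lfloor>(hi - p) / s\<rfloor> - \<lceil>(lo - p) / s\<rceil> + 1))" by (simp add: e add.commute)
  show "(hi - lo) / s - 1 \<le> real (card J)" unfolding c d by linarith
  show "real (card J) \<le> (hi - lo) / s + 1" if "lo \<le> hi"
  proof -
    have "(hi - lo) / s \<ge> 0" using that s by simp
    thus ?thesis unfolding c d by linarith
  qed
qed

definition tooth :: "real \<Rightarrow> real \<Rightarrow> real set" where "tooth e a = {a - e..a + e}"

lemma measure_tooth: "e \<ge> 0 \<Longrightarrow> measure lborel (tooth e a) = 2 * e"
  by (simp add: tooth_def)

lemma measure_tooth_Int: "measure lborel (tooth e a \<inter> tooth e b) = max 0 (2 * e - \<bar>a - b\<bar>)"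
proof -
  have "tooth e a \<inter> tooth e b = {max (a - e) (b - e)..min (a + e) (b + e)}" by (auto simp: tooth_def)
  moreover have "measure lborel {l..u} = (if l \<le> u then u - l else 0)" for l u :: real
    by (simp add: measure_def emeasure_lborel_Icc_eq)
  ultimately show ?thesis by (auto simp: max_def min_def abs_if)
qed

lemma integrable_tooth: "integrable lborel (indicator (tooth e a) :: real \<Rightarrow> real)"
  and integrable_tooth_Int: "integrable lborel (indicator (tooth e a \<inter> tooth e b) :: real \<Rightarrow> real)"
proof -
  show "integrable lborel (indicator (tooth e a) :: real \<Rightarrow> real)"
    by (simp add: tooth_def integrable_indicator_iff emeasure_lborel_Icc_eq)
  have "tooth e a \<inter> tooth e b = {max (a - e) (b - e)..min (a + e) (b + e)}" by (auto simp: tooth_def)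
  thus "integrable lborel (indicator (tooth e a \<inter> tooth e b) :: real \<Rightarrow> real)"
    by (simp add: integrable_indicator_iff emeasure_lborel_Icc_eq)
qed

text \<open>Integrates, over r in the fixed tooth, the number of teeth of the progression that
  contain r; their indices lie within 2 e / |d| of each other.\<close>

lemma sum_tooth_overlap:
  assumes e: "e > 0" and d: "d \<noteq> 0" and J: "finite J"
  shows "(\<Sum>j\<in>J. measure lborel (tooth e a \<inter> tooth e (b + d * real_of_int j))) \<le> 2 * e * (2 * e / \<bar>d\<bar> + 1)"
proof -
  have "(\<Sum>j\<in>J. measure lborel (tooth e a \<inter> tooth e (b + d * real_of_int j))) =
      (\<Sum>j\<in>J. (\<integral>r. indicator (tooth e a \<inter> tooth e (b + d * real_of_int j)) r \<partial>lborel))" by simp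
  also have "\<dots> = (\<integral>r. (\<Sum>j\<in>J. indicator (tooth e a \<inter> tooth e (b + d * real_of_int j)) r) \<partial>lborel)"
    by (intro Bochner_Integration.integral_sum[symmetric] integrable_tooth_Int)
  also have "\<dots> \<le> (\<integral>r. (2 * e / \<bar>d\<bar> + 1) * indicator (tooth e a) r \<partial>lborel)"
  proof (rule integral_mono)
    show "integrable lborel (\<lambda>r. (\<Sum>j\<in>J. indicator (tooth e a \<inter> tooth e (b + d * real_of_int j)) r) :: real)"
      by (intro Bochner_Integration.integrable_sum integrable_tooth_Int)
    show "integrable lborel (\<lambda>r. (2 * e / \<bar>d\<bar> + 1) * indicator (tooth e a) r)"
      by (intro integrable_mult_right integrable_tooth)
    fix r :: real
    define S where "S = {j \<in> J. r \<in> tooth e (b + d * real_of_int j)}"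
    have "real (card S) \<le> 2 * e / \<bar>d\<bar> + 1"
    proof (rule card_int_le)
      show "finite S" using J by (simp add: S_def)
      show "0 \<le> 2 * e / \<bar>d\<bar>" using e by simp
      fix i j assume "i \<in> S" "j \<in> S"
      hence "\<bar>r - (b + d * real_of_int i)\<bar> \<le> e" "\<bar>r - (b + d * real_of_int j)\<bar> \<le> e" by (auto simp: S_def tooth_def abs_le_iff)
      hence "\<bar>d * real_of_int i - d * real_of_int j\<bar> \<le> 2 * e" by linarith
      hence "\<bar>d\<bar> * \<bar>real_of_int i - real_of_int j\<bar> \<le> 2 * e" by (simp add: abs_mult[symmetric] right_diff_distrib)
      thus "\<bar>real_of_int i - real_of_int j\<bar> \<le> 2 * e / \<bar>d\<bar>" using d by (simp add: pos_le_divide_eq mult.commute)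
    qed
    moreover have "(\<Sum>j\<in>J. indicator (tooth e a \<inter> tooth e (b + d * real_of_int j)) r) = indicator (tooth e a) r * real (card S)"
    proof -
      have "(\<Sum>j\<in>J. indicator (tooth e a \<inter> tooth e (b + d * real_of_int j)) r) =
          (\<Sum>j\<in>J. indicator (tooth e a) r * (if r \<in> tooth e (b + d * real_of_int j) then 1 else 0 :: real))"
        by (intro sum.cong) (auto simp: indicator_def)
      also have "\<dots> = indicator (tooth e a) r * (\<Sum>j\<in>J. if r \<in> tooth e (b + d * real_of_int j) then 1 else 0)"
        by (simp add: sum_distrib_left)
      also have "(\<Sum>j\<in>J. if r \<in> tooth e (b + d * real_of_int j) then 1 else 0 :: real) = real (card S)"
        using J by (simp add: S_def sum.If_cases Int_def)
      finally show ?thesis .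
    qed
    ultimately show "(\<Sum>j\<in>J. indicator (tooth e a \<inter> tooth e (b + d * real_of_int j)) r) \<le> (2 * e / \<bar>d\<bar> + 1) * indicator (tooth e a) r"
      by (simp add: indicator_def)
  qed
  also have "\<dots> = (2 * e / \<bar>d\<bar> + 1) * (2 * e)" using e by (simp add: measure_tooth)
  finally show ?thesis by (simp add: mult.commute)
qed

text \<open>Pairs are grouped by m = j - j'. For fixed m the distance of the two teeth is itself a
  progression in j, with the small step s - s', so \<open>sum_tooth_overlap\<close> applies with
  that step. The number of m that occur is bounded by the total drift, counted in steps s'.\<close>

lemma sum_overlap_two_progressions:
  fixes J J' :: "int set"
  assumes e: "e > 0" and s: "s > 0" "s' > 0" "s \<noteq> s'" and J: "finite J" "finite J'" and L: "0 \<le> L"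
    and JL: "\<And>i j. i \<in> J \<Longrightarrow> j \<in> J \<Longrightarrow> \<bar>real_of_int i - real_of_int j\<bar> \<le> L"
  shows "(\<Sum>j\<in>J. \<Sum>j'\<in>J'. measure lborel (tooth e (p + s * real_of_int j) \<inter> tooth e (p' + s' * real_of_int j')))
     \<le> ((4 * e + \<bar>s - s'\<bar> * L) / s' + 1) * (2 * e * (2 * e / \<bar>s - s'\<bar> + 1))"
proof -
  let ?ov = "\<lambda>j j'. measure lborel (tooth e (p + s * real_of_int j) \<inter> tooth e (p' + s' * real_of_int j'))"
  define Q where "Q = {(j, j') \<in> J \<times> J'. ?ov j j' > 0}"
  define M where "M = (\<lambda>(j, j'). j - j') ` Q"
  have finQ: "finite Q" by (rule finite_subset[of _ "J \<times> J'"]) (use J in \<open>auto simp: Q_def\<close>)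
  hence finM: "finite M" by (simp add: M_def)
  have "(\<Sum>j\<in>J. \<Sum>j'\<in>J'. ?ov j j') = (\<Sum>q\<in>J \<times> J'. ?ov (fst q) (snd q))"
    by (simp add: sum.cartesian_product case_prod_beta)
  also have "\<dots> = (\<Sum>q\<in>Q. ?ov (fst q) (snd q))"
  proof (rule sum.mono_neutral_right)
    show "\<forall>q\<in>J \<times> J' - Q. ?ov (fst q) (snd q) = 0"
      by (auto simp: Q_def not_less intro: antisym)
  qed (use J in \<open>auto simp: Q_def\<close>)
  also have "\<dots> = (\<Sum>q\<in>(\<lambda>q. (fst q - snd q, fst q)) ` Q. ?ov (snd q) (snd q - fst q))"
    by (subst sum.reindex) (auto simp: inj_on_def)
  also have "\<dots> \<le> (\<Sum>q\<in>M \<times> J. ?ov (snd q) (snd q - fst q))"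
  proof (rule sum_mono2)
    show "(\<lambda>q. (fst q - snd q, fst q)) ` Q \<subseteq> M \<times> J" by (force simp: M_def Q_def)
  qed (use J finM in auto)
  also have "\<dots> = (\<Sum>m\<in>M. \<Sum>j\<in>J. ?ov j (j - m))"
    by (simp add: sum.cartesian_product case_prod_beta)
  also have "\<dots> \<le> (\<Sum>m\<in>M. 2 * e * (2 * e / \<bar>s - s'\<bar> + 1))"
  proof (rule sum_mono)
    fix m assume "m \<in> M"
    have "?ov j (j - m) = measure lborel (tooth e 0 \<inter> tooth e ((p - p' + s' * real_of_int m) + (s - s') * real_of_int j))" for j
      unfolding measure_tooth_Int by (simp add: algebra_simps)
    hence "(\<Sum>j\<in>J. ?ov j (j - m)) = (\<Sum>j\<in>J. measure lborel (tooth e 0 \<inter> tooth e ((p - p' + s' * real_of_int m) + (s - s') * real_of_int j)))"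
      by simp
    also have "\<dots> \<le> 2 * e * (2 * e / \<bar>s - s'\<bar> + 1)" by (rule sum_tooth_overlap[OF e _ J(1)]) (use s in simp)
    finally show "(\<Sum>j\<in>J. ?ov j (j - m)) \<le> 2 * e * (2 * e / \<bar>s - s'\<bar> + 1)" .
  qed
  also have "\<dots> = real (card M) * (2 * e * (2 * e / \<bar>s - s'\<bar> + 1))" by simp
  also have "\<dots> \<le> ((4 * e + \<bar>s - s'\<bar> * L) / s' + 1) * (2 * e * (2 * e / \<bar>s - s'\<bar> + 1))"
  proof (rule mult_right_mono)
    show "real (card M) \<le> (4 * e + \<bar>s - s'\<bar> * L) / s' + 1"
    proof (rule card_int_le[OF finM])
      show "0 \<le> (4 * e + \<bar>s - s'\<bar> * L) / s'" using e s L by simp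
      have *: "\<exists>j\<in>J. \<bar>p - p' + s' * real_of_int m + (s - s') * real_of_int j\<bar> \<le> 2 * e" if mM: "m \<in> M" for m
      proof -
        obtain x where x: "x \<in> Q" "m = fst x - snd x" using mM by (force simp: M_def)
        define j j' where "j = fst x" and "j' = snd x"
        have j: "j \<in> J" "?ov j j' > 0" "m = j - j'" using x by (auto simp: Q_def j_def j'_def)
        have "\<bar>p + s * real_of_int j - (p' + s' * real_of_int j')\<bar> < 2 * e"
          using j(2) unfolding measure_tooth_Int by (simp add: less_max_iff_disj)
        thus ?thesis using j by (intro bexI[of _ j]) (auto simp: algebra_simps)
      qed
      fix m n assume "m \<in> M" "n \<in> M"
      then obtain i j where i: "i \<in> J" "\<bar>p - p' + s' * real_of_int m + (s - s') * real_of_int i\<bar> \<le> 2 * e"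
        and j: "j \<in> J" "\<bar>p - p' + s' * real_of_int n + (s - s') * real_of_int j\<bar> \<le> 2 * e" using * by blast
      have "\<bar>(s - s') * (real_of_int i - real_of_int j)\<bar> \<le> \<bar>s - s'\<bar> * L"
        unfolding abs_mult using JL[OF i(1) j(1)] by (intro mult_left_mono) auto
      hence "\<bar>(s - s') * real_of_int i - (s - s') * real_of_int j\<bar> \<le> \<bar>s - s'\<bar> * L" by (simp only: right_diff_distrib)
      hence "\<bar>s' * real_of_int m - s' * real_of_int n\<bar> \<le> 4 * e + \<bar>s - s'\<bar> * L" using i(2) j(2) by linarith
      hence "s' * \<bar>real_of_int m - real_of_int n\<bar> \<le> 4 * e + \<bar>s - s'\<bar> * L"
        using s by (simp add: abs_mult right_diff_distrib[symmetric])
      thus "\<bar>real_of_int m - real_of_int n\<bar> \<le> (4 * e + \<bar>s - s'\<bar> * L) / s'" using s by (simp add: pos_le_divide_eq mult.commute)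
    qed
    show "0 \<le> 2 * e * (2 * e / \<bar>s - s'\<bar> + 1)" using e by simp
  qed
  finally show ?thesis .
qed

text \<open>The discriminant of a nonnegative quadratic; for V = 0 the function is affine and has to
  be treated apart.\<close>

lemma quadratic_nonneg:
  fixes V Q I :: real
  assumes "\<And>x. 0 \<le> Q - 2 * x * I + x\<^sup>2 * V" "0 \<le> V" "0 \<le> I"
  shows "I\<^sup>2 \<le> V * Q"
proof (cases "V = 0")
  case True
  have "I = 0"
  proof (rule ccontr)
    assume "I \<noteq> 0"
    thus False using assms(1)[of "(Q + 1) / (2 * I)"] True by (simp add: field_simps)
  qed
  thus ?thesis using True by simp
next
  case False
  hence V: "V > 0" using assms(2) by simp
  have "0 \<le> Q - 2 * (I / V) * I + (I / V)\<^sup>2 * V" by (rule assms(1))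
  also have "\<dots> = Q - I\<^sup>2 / V" using V by (simp add: field_simps power2_eq_square)
  finally show ?thesis using V by (simp add: field_simps)
qed

text \<open>Cauchy-Schwarz for the counting function of the teeth, which is supported off \<open>A\<close>.\<close>

lemma second_moment_avoid:
  assumes T: "finite T" and e: "e > 0" and W: "\<And>x. x \<in> T \<Longrightarrow> tooth e (q x) \<subseteq> {u..v}" and uv: "u \<le> v"
    and A: "A \<in> sets borel" "A \<subseteq> {u..v}" "\<And>x. x \<in> T \<Longrightarrow> A \<inter> tooth e (q x) = {}"
  shows "(real (card T) * (2 * e))\<^sup>2 \<le> (v - u - measure lborel A) *
     (\<Sum>x\<in>T. \<Sum>y\<in>T. measure lborel (tooth e (q x) \<inter> tooth e (q y)))"
proof (rule quadratic_nonneg)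
  define V where "V = {u..v} - A"
  define Z where "Z r = (\<Sum>x\<in>T. indicator (tooth e (q x)) r :: real)" for r
  have fA: "emeasure lborel A < \<infinity>"
    using emeasure_mono[OF A(2), of lborel] by (simp add: emeasure_lborel_Icc_eq less_top[symmetric] top_unique)
      (metis ennreal_neq_top infinity_ennreal_def less_top top_unique emeasure_mono)
  have mV: "measure lborel V = v - u - measure lborel A" unfolding V_def
    using A uv fA by (subst measure_Diff) auto
  show "0 \<le> v - u - measure lborel A" unfolding mV[symmetric] by simp
  show "0 \<le> real (card T) * (2 * e)" using e by simp
  fix x :: real
  have Vm: "V \<in> sets lborel" "emeasure lborel V < \<infinity>"
  proof -
    show "V \<in> sets lborel" using A by (simp add: V_def)
    have "emeasure lborel V \<le> emeasure lborel {u..v}" by (rule emeasure_mono) (auto simp: V_def)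
    also have "\<dots> < \<infinity>" using uv by simp
    finally show "emeasure lborel V < \<infinity>" .
  qed
  have iV: "integrable lborel (indicator V :: real \<Rightarrow> real)" using Vm by (intro integrable_real_indicator) auto
  have iZ: "integrable lborel Z" unfolding Z_def by (intro Bochner_Integration.integrable_sum integrable_tooth)
  have ZV: "Z r * indicator V r = Z r" for r
  proof (cases "r \<in> V")
    case False
    have "r \<notin> tooth e (q x)" if "x \<in> T" for x using W[OF that] A(3)[OF that] False by (auto simp: V_def)
    hence "Z r = 0" by (simp add: Z_def)
    thus ?thesis by simp
  qed simp
  have ZZ: "Z r * Z r = (\<Sum>x\<in>T. \<Sum>y\<in>T. indicator (tooth e (q x) \<inter> tooth e (q y)) r)" for r
    by (simp add: Z_def sum_product indicator_inter_arith)
  have iZZ: "integrable lborel (\<lambda>r. Z r * Z r)" unfolding ZZ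
    by (intro Bochner_Integration.integrable_sum integrable_tooth_Int)
  have "0 \<le> (\<integral>r. (Z r - x * indicator V r)\<^sup>2 \<partial>lborel)" by (rule Bochner_Integration.integral_nonneg) simp
  also have "(\<lambda>r. (Z r - x * indicator V r)\<^sup>2) = (\<lambda>r. Z r * Z r - 2 * x * Z r + x\<^sup>2 * indicator V r)"
  proof
    fix r
    have "(indicator V r)\<^sup>2 = (indicator V r :: real)" by (simp add: indicator_def)
    moreover have "(Z r - x * indicator V r)\<^sup>2 = Z r * Z r - 2 * x * (Z r * indicator V r) + x\<^sup>2 * (indicator V r)\<^sup>2"
      by (simp add: power2_eq_square algebra_simps)
    ultimately show "(Z r - x * indicator V r)\<^sup>2 = Z r * Z r - 2 * x * Z r + x\<^sup>2 * indicator V r" by (simp add: ZV)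
  qed
  also have "(\<integral>r. Z r * Z r - 2 * x * Z r + x\<^sup>2 * indicator V r \<partial>lborel) =
      (\<integral>r. Z r * Z r \<partial>lborel) - 2 * x * (\<integral>r. Z r \<partial>lborel) + x\<^sup>2 * (\<integral>r. indicator V r \<partial>lborel)"
    using iZ iV iZZ by simp
  also have "(\<integral>r. Z r \<partial>lborel) = real (card T) * (2 * e)"
    unfolding Z_def using e by (subst Bochner_Integration.integral_sum) (auto simp: integrable_tooth measure_tooth)
  also have "(\<integral>r. Z r * Z r \<partial>lborel) = (\<Sum>x\<in>T. \<Sum>y\<in>T. measure lborel (tooth e (q x) \<inter> tooth e (q y)))"
    unfolding ZZ by (subst Bochner_Integration.integral_sum, simp add: integrable_tooth_Int, intro sum.cong refl,
        subst Bochner_Integration.integral_sum) (auto simp: integrable_tooth_Int)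
  also have "(\<integral>r. indicator V r \<partial>lborel) = v - u - measure lborel A" using mV by simp
  finally show "0 \<le> (\<Sum>x\<in>T. \<Sum>y\<in>T. measure lborel (tooth e (q x) \<inter> tooth e (q y))) - 2 * x * (real (card T) * (2 * e)) + x\<^sup>2 * (v - u - measure lborel A)" .
qed

text \<open>4 e^2 w / s0^2 is the overlap of two independent progressions of step s0 on length w. It
  is approached when the total drift d w / s0 contains many steps, which is the last assumption, and
  when the drift d per term is small against e, which follows from the closeness of both steps to
  s0.\<close>

lemma comb_estimate:
  fixes s0 s s' d w e \<theta> :: real
  assumes th: "0 < \<theta>" "\<theta> \<le> 1/8" and e: "0 < e" "8 * e \<le> s0"
    and s: "\<bar>s - s0\<bar> \<le> e * \<theta> / 8" "\<bar>s' - s0\<bar> \<le> e * \<theta> / 8" and d: "d = \<bar>s - s'\<bar>" "d > 0"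
    and w: "w > 0" "24 * s0\<^sup>2 \<le> \<theta> * d * w"
  shows "((4 * e + d * (w / s)) / s' + 1) * (2 * e * (2 * e / d + 1)) \<le> 4 * e\<^sup>2 * w / s0\<^sup>2 * (1 + \<theta>)"
proof -
  have s0: "s0 > 0" using e by linarith
  have "e * \<theta> \<le> (s0 / 8) * \<theta>" using e th by (intro mult_right_mono) auto
  hence et: "e * \<theta> / 8 \<le> s0 * (\<theta> / 64)" by (simp add: mult_ac)
  have lo: "s0 * (1 - \<theta> / 64) \<le> s" "s0 * (1 - \<theta> / 64) \<le> s'" and hi: "s \<le> s0 * (1 + \<theta> / 64)" "s' \<le> s0 * (1 + \<theta> / 64)"
    using s et unfolding abs_le_iff by (simp_all add: algebra_simps)
  have "s0 * (1/2) \<le> s0 * (1 - \<theta> / 64)" using s0 th by (intro mult_left_mono) auto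
  hence p: "s0 / 2 \<le> s" "s0 / 2 \<le> s'" using lo by auto
  have sp: "s > 0" "s' > 0" using p s0 by auto
  have ss: "s * s' > 0" using sp by simp
  have ssl: "s0\<^sup>2 * (1 - \<theta> / 32) \<le> s * s'"
  proof -
    have "s0\<^sup>2 * (1 - \<theta> / 32) \<le> s0\<^sup>2 * ((1 - \<theta> / 64) * (1 - \<theta> / 64))"
      by (intro mult_left_mono) (auto simp: algebra_simps)
    also have "\<dots> = (s0 * (1 - \<theta> / 64)) * (s0 * (1 - \<theta> / 64))" by (simp add: power2_eq_square)
    also have "\<dots> \<le> s * s'" using lo s0 th sp by (intro mult_mono) auto
    finally show ?thesis .
  qed
  have ssu: "2 * (s * s') \<le> 3 * s0\<^sup>2"
  proof -
    have "s * s' \<le> (s0 * (1 + \<theta> / 64)) * (s0 * (1 + \<theta> / 64))" using hi sp s0 th by (intro mult_mono) auto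
    also have "\<dots> = s0\<^sup>2 * ((1 + \<theta> / 64) * (1 + \<theta> / 64))" by (simp add: power2_eq_square)
    also have "\<dots> \<le> s0\<^sup>2 * (1.1 * 1.1)" using th by (intro mult_left_mono mult_mono) auto
    also have "\<dots> \<le> s0\<^sup>2 * (3/2)" by (intro mult_left_mono) auto
    finally show ?thesis by simp
  qed
  have inv: "1 / (s * s') \<le> (1 + \<theta> / 16) / s0\<^sup>2"
  proof -
    have "1 \<le> (1 + \<theta> / 16) * (1 - \<theta> / 32)"
    proof -
      have "\<theta> * \<theta> \<le> 1 * \<theta>" using th by (intro mult_right_mono) auto
      moreover have "(1 + \<theta> / 16) * (1 - \<theta> / 32) = 1 + \<theta> / 32 - \<theta> * \<theta> / 512" by (simp add: algebra_simps)
      ultimately show ?thesis using th by linarith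
    qed
    hence "s0\<^sup>2 * 1 \<le> s0\<^sup>2 * ((1 + \<theta> / 16) * (1 - \<theta> / 32))" by (intro mult_left_mono) auto
    also have "\<dots> = (1 + \<theta> / 16) * (s0\<^sup>2 * (1 - \<theta> / 32))" by simp
    also have "\<dots> \<le> (1 + \<theta> / 16) * (s * s')" using ssl th by (intro mult_left_mono) auto
    finally show ?thesis using ss s0 by (simp add: pos_divide_le_eq pos_le_divide_eq)
  qed
  \<comment> \<open>The total drift d w / s, counted in steps s': the main term for the number of
    values of m.\<close>
  define P where "P = d * w / (s * s')"
  have Pp: "P > 0" using d(2) w ss by (simp add: P_def)
  have f1: "(4 * e + d * (w / s)) / s' + 1 \<le> P * (1 + \<theta> / 8)"
  proof -
    have "4 * e / s' \<le> 1" using e p sp by simp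
    moreover have "(4 * e + d * (w / s)) / s' = P + 4 * e / s'" using sp by (simp add: P_def add_divide_distrib)
    moreover have "2 \<le> P * (\<theta> / 8)"
    proof -
      have "2 * (s * s') * 8 \<le> \<theta> * d * w" using ssu w(2) by linarith
      thus ?thesis using ss by (simp add: P_def pos_le_divide_eq mult_ac)
    qed
    ultimately show ?thesis by (simp add: distrib_left)
  qed
  have f2: "2 * e * (2 * e / d + 1) \<le> 4 * e\<^sup>2 / d * (1 + \<theta> / 8)"
  proof -
    have "d \<le> e * \<theta> / 4" using s d(1) by linarith
    hence "2 * e * d \<le> 2 * e * (e * \<theta> / 4)" using e by (intro mult_left_mono) auto
    hence "2 * e * d \<le> e * e * \<theta> / 2" by (simp add: mult_ac)
    hence "2 * e \<le> (e * e * \<theta> / 2) / d" using d(2) pos_le_divide_eq by blast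
    moreover have "2 * e * (2 * e / d + 1) = 4 * e\<^sup>2 / d + 2 * e" by (simp add: power2_eq_square distrib_left)
    moreover have "4 * e\<^sup>2 / d * (1 + \<theta> / 8) = 4 * e\<^sup>2 / d + (e * e * \<theta> / 2) / d"
      using d(2) by (simp add: power2_eq_square field_simps)
    ultimately show ?thesis by linarith
  qed
  have "((4 * e + d * (w / s)) / s' + 1) * (2 * e * (2 * e / d + 1)) \<le> (P * (1 + \<theta> / 8)) * (4 * e\<^sup>2 / d * (1 + \<theta> / 8))"
  proof (rule mult_mono[OF f1 f2])
    show "0 \<le> P * (1 + \<theta> / 8)" using Pp th by simp
    show "0 \<le> 2 * e * (2 * e / d + 1)" using e d(2) by simp
  qed
  also have "\<dots> = 4 * e\<^sup>2 * w * (1 / (s * s')) * ((1 + \<theta> / 8) * (1 + \<theta> / 8))" using d(2) by (simp add: P_def)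
  also have "\<dots> \<le> 4 * e\<^sup>2 * w * ((1 + \<theta> / 16) / s0\<^sup>2) * ((1 + \<theta> / 8) * (1 + \<theta> / 8))"
    using inv w th by (intro mult_right_mono mult_left_mono) auto
  also have "\<dots> = 4 * e\<^sup>2 * w / s0\<^sup>2 * ((1 + \<theta> / 16) * ((1 + \<theta> / 8) * (1 + \<theta> / 8)))" by simp
  also have "\<dots> \<le> 4 * e\<^sup>2 * w / s0\<^sup>2 * (1 + \<theta>)"
  proof (rule mult_left_mono)
    have t2: "\<theta> * \<theta> \<le> \<theta> * 1" using th by (intro mult_left_mono) auto
    have "\<theta> * \<theta> \<le> 1" using t2 th by linarith
    hence t3: "\<theta> * (\<theta> * \<theta>) \<le> \<theta> * 1" using th by (intro mult_left_mono) auto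
    have "(1 + \<theta> / 16) * ((1 + \<theta> / 8) * (1 + \<theta> / 8)) = 1 + 5/16 * \<theta> + \<theta> * \<theta> / 32 + \<theta> * (\<theta> * \<theta>) / 1024"
      by (simp add: field_simps)
    thus "(1 + \<theta> / 16) * ((1 + \<theta> / 8) * (1 + \<theta> / 8)) \<le> 1 + \<theta>" using t2 t3 th by linarith
  qed (use w in simp)
  finally show ?thesis .
qed

text \<open>The teeth have total mass about 2 e n w / s0, where n is the size of B, and nearly the
  second moment of independent progressions. Cauchy-Schwarz forces their union to fill almost all of
  [0, w], which leaves no room for A.\<close>

lemma comb_contradiction:
  fixes B :: "'a set" and sp ph :: "'a \<Rightarrow> real" and bad :: "('a \<times> 'a) set"
  assumes B: "finite B" "B \<noteq> {}" and c: "0 < c" "c \<le> 1" and e: "0 < e" "8 * e \<le> s0"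
    and sp: "\<And>k. k \<in> B \<Longrightarrow> \<bar>sp k - s0\<bar> \<le> e * (c / 8) / 8"
    and w: "w \<ge> 64 * s0 / (c / 8)" and dl: "dl > 0" "24 * s0\<^sup>2 \<le> c / 8 * dl * w"
    and sep: "\<And>k k'. k \<in> B \<Longrightarrow> k' \<in> B \<Longrightarrow> (k, k') \<notin> bad \<Longrightarrow> dl \<le> \<bar>sp k - sp k'\<bar>"
    and bad: "bad \<subseteq> B \<times> B" "real (card bad) \<le> (real (card B))\<^sup>2 * (e * (c / 8) / (2 * s0))"
    and A: "A \<in> sets borel" "A \<subseteq> {0..w}" "c * w \<le> measure lborel A"
    and av: "\<And>k j. k \<in> B \<Longrightarrow> e \<le> ph k + sp k * real_of_int j \<Longrightarrow> ph k + sp k * real_of_int j \<le> w - e \<Longrightarrow>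
       A \<inter> tooth e (ph k + sp k * real_of_int j) = {}"
  shows False
proof -
  \<comment> \<open>With c = 8 \<theta> the contradiction is (1 - 8 \<theta>) (1 + 5/2 \<theta>) < 1
    - 2 \<theta>.\<close>
  define \<theta> where "\<theta> = c / 8"
  have th: "0 < \<theta>" "\<theta> \<le> 1/8" "c = 8 * \<theta>" using c by (auto simp: \<theta>_def)
  note sp = sp[folded \<theta>_def] and w = w[folded \<theta>_def] and dl = dl[folded \<theta>_def] and bad = bad[folded \<theta>_def]
  have s0: "s0 > 0" using e by linarith
  have ws: "64 * s0 \<le> \<theta> * w" using w th by (simp add: pos_divide_le_eq mult.commute)
  have "\<theta> * w > 0" using ws s0 by linarith
  hence wp: "w > 0" using th by (simp add: zero_less_mult_iff)
  have "\<theta> * w \<le> 1/8 * w" using wp th by (intro mult_right_mono) auto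
  hence w512: "512 * s0 \<le> w" using ws by linarith
  have "e * \<theta> \<le> (s0 / 8) * \<theta>" using e th by (intro mult_right_mono) auto
  hence et: "e * \<theta> / 8 \<le> s0 * (\<theta> / 64)" by (simp add: mult_ac)
  have spb: "s0 * (1 - \<theta> / 64) \<le> sp k" "sp k \<le> s0 * (1 + \<theta> / 64)" "s0 / 2 \<le> sp k" "sp k > 0" if "k \<in> B" for k
  proof -
    show 1: "s0 * (1 - \<theta> / 64) \<le> sp k" "sp k \<le> s0 * (1 + \<theta> / 64)"
      using sp[OF that] et unfolding abs_le_iff by (simp_all add: algebra_simps)
    have "s0 * (1/2) \<le> s0 * (1 - \<theta> / 64)" using s0 th by (intro mult_left_mono) auto
    thus "s0 / 2 \<le> sp k" using 1 by simp
    thus "sp k > 0" using s0 by linarith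
  qed
  define J where "J k = {j::int. e \<le> ph k + sp k * real_of_int j \<and> ph k + sp k * real_of_int j \<le> w - e}" for k
  have ew: "e \<le> w - e" using e w512 s0 by linarith
  have J: "finite (J k)" "(w - e - e) / sp k - 1 \<le> real (card (J k))" "real (card (J k)) \<le> (w - e - e) / sp k + 1"
    if "k \<in> B" for k
    using card_progression[OF spb(4)[OF that] J_def] ew by auto
  have Jlo: "w / s0 * (1 - \<theta>) \<le> real (card (J k))" if k: "k \<in> B" for k
  proof -
    have "w / s0 * (1 - \<theta> / 64) * sp k \<le> w / s0 * (1 - \<theta> / 64) * (s0 * (1 + \<theta> / 64))"
      using spb(2)[OF k] wp s0 th by (intro mult_left_mono) auto
    also have "\<dots> = w * ((1 - \<theta> / 64) * (1 + \<theta> / 64))" using s0 by simp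
    also have "\<dots> \<le> w * 1" using wp by (intro mult_left_mono) (auto simp: algebra_simps)
    finally have "w / s0 * (1 - \<theta> / 64) \<le> w / sp k" using spb(4)[OF k] by (simp add: pos_le_divide_eq)
    moreover have "2 * e / sp k \<le> 1" using e spb(3,4)[OF k] by simp
    moreover have "(w - e - e) / sp k = w / sp k - 2 * e / sp k" by (simp add: diff_divide_distrib[symmetric])
    moreover have "64 \<le> w / s0 * \<theta>" using ws s0 by (simp add: pos_le_divide_eq mult.commute)
    moreover have "w / s0 * (1 - \<theta> / 64) = w / s0 - (w / s0 * \<theta>) / 64"
      by (simp only: right_diff_distrib mult_1_right times_divide_eq_right)
    ultimately have "w / s0 - w / s0 * \<theta> \<le> real (card (J k))" using J(2)[OF k] by argo
    thus ?thesis by (simp only: right_diff_distrib mult_1_right)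
  qed
  have Jhi: "real (card (J k)) \<le> 3 * w / s0" if k: "k \<in> B" for k
  proof -
    have "(w - e - e) / sp k \<le> w / (s0 / 2)" using spb(3,4)[OF k] e s0 wp by (intro frac_le) auto
    also have "\<dots> = 2 * w / s0" by simp
    finally have "real (card (J k)) \<le> 2 * w / s0 + 1" using J(3)[OF k] by linarith
    moreover have "1 \<le> w / s0" using w512 s0 by (simp add: pos_le_divide_eq)
    ultimately show ?thesis by simp
  qed
  define T where "T = Sigma B J"
  define q where "q x = ph (fst x) + sp (fst x) * real_of_int (snd x)" for x :: "'a \<times> int"
  have finT: "finite T" using B J by (auto simp: T_def)
  define n where "n = real (card B)"
  have n: "n > 0" using B by (simp add: n_def card_gt_0_iff)
  have cT: "n * (w / s0 * (1 - \<theta>)) \<le> real (card T)"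
  proof -
    have "n * (w / s0 * (1 - \<theta>)) = (\<Sum>k\<in>B. w / s0 * (1 - \<theta>))" by (simp add: n_def)
    also have "\<dots> \<le> (\<Sum>k\<in>B. real (card (J k)))" by (intro sum_mono Jlo)
    also have "\<dots> = real (card T)" using B J by (simp add: T_def)
    finally show ?thesis .
  qed
  define ov where "ov x y = measure lborel (tooth e (q x) \<inter> tooth e (q y))" for x y
  have sm: "(real (card T) * (2 * e))\<^sup>2 \<le> (w - 0 - measure lborel A) * (\<Sum>x\<in>T. \<Sum>y\<in>T. ov x y)"
    unfolding ov_def
  proof (rule second_moment_avoid[OF finT e(1) _ _ A(1,2)])
    fix x assume "x \<in> T"
    then obtain k j where x: "x = (k, j)" "k \<in> B" "j \<in> J k" by (auto simp: T_def)
    thus "A \<inter> tooth e (q x) = {}" "tooth e (q x) \<subseteq> {0..w}"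
      using av[of k j] e by (auto simp: q_def J_def tooth_def)
  qed (use wp in simp)
  define X where "X = 4 * e\<^sup>2 * w / s0\<^sup>2"
  have Xp: "X > 0" using e wp s0 by (simp add: X_def)
  have pair: "(\<Sum>j\<in>J k. \<Sum>j'\<in>J k'. ov (k, j) (k', j')) \<le> X * (1 + \<theta>) + (if (k, k') \<in> bad then 12 * e * w / s0 else 0)"
    if k: "k \<in> B" and k': "k' \<in> B" for k k'
  proof (cases "(k, k') \<in> bad")
    case True
    have "(\<Sum>j'\<in>J k'. ov (k, j) (k', j')) \<le> 4 * e" for j
    proof -
      have "(\<Sum>j'\<in>J k'. ov (k, j) (k', j')) \<le> 2 * e * (2 * e / \<bar>sp k'\<bar> + 1)"
        unfolding ov_def q_def fst_conv snd_conv
        by (rule sum_tooth_overlap[OF e(1)]) (use spb(4)[OF k'] J k' in auto)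
      also have "\<dots> \<le> 2 * e * (1 + 1)" using e spb(3,4)[OF k'] by (intro mult_left_mono add_mono) auto
      finally show ?thesis by simp
    qed
    hence "(\<Sum>j\<in>J k. \<Sum>j'\<in>J k'. ov (k, j) (k', j')) \<le> real (card (J k)) * (4 * e)"
      using sum_mono[of "J k" _ "\<lambda>j. 4 * e"] by simp
    also have "\<dots> \<le> (3 * w / s0) * (4 * e)" using Jhi[OF k] e by (intro mult_right_mono) auto
    also have "\<dots> = 12 * e * w / s0" by (simp add: mult_ac)
    also have "\<dots> \<le> X * (1 + \<theta>) + 12 * e * w / s0" using Xp th by simp
    finally show ?thesis using True by simp
  next
    case False
    have d: "dl \<le> \<bar>sp k - sp k'\<bar>" by (rule sep[OF k k' False])
    have JL: "\<bar>real_of_int i - real_of_int j\<bar> \<le> w / sp k" if "i \<in> J k" "j \<in> J k" for i j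
    proof -
      have "\<bar>sp k * real_of_int i - sp k * real_of_int j\<bar> \<le> w" using that e unfolding J_def abs_le_iff by auto
      hence "sp k * \<bar>real_of_int i - real_of_int j\<bar> \<le> w" using spb(4)[OF k] by (simp add: abs_mult right_diff_distrib[symmetric])
      thus ?thesis using spb(4)[OF k] by (simp add: pos_le_divide_eq mult.commute)
    qed
    have "(\<Sum>j\<in>J k. \<Sum>j'\<in>J k'. ov (k, j) (k', j')) \<le>
       ((4 * e + \<bar>sp k - sp k'\<bar> * (w / sp k)) / sp k' + 1) * (2 * e * (2 * e / \<bar>sp k - sp k'\<bar> + 1))"
      unfolding ov_def q_def fst_conv snd_conv
    proof (rule sum_overlap_two_progressions[OF e(1) spb(4)[OF k] spb(4)[OF k'] _ J(1)[OF k] J(1)[OF k'] _ JL])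
      show "sp k \<noteq> sp k'" using d dl by auto
      show "0 \<le> w / sp k" using wp spb(4)[OF k] by simp
    qed
    also have "\<dots> \<le> 4 * e\<^sup>2 * w / s0\<^sup>2 * (1 + \<theta>)"
    proof (rule comb_estimate[OF th(1,2) e sp[OF k] sp[OF k'] refl _ wp])
      show "0 < \<bar>sp k - sp k'\<bar>" using d dl by auto
      have "\<theta> * dl * w \<le> \<theta> * \<bar>sp k - sp k'\<bar> * w" using d th wp by (intro mult_right_mono mult_left_mono) auto
      thus "24 * s0\<^sup>2 \<le> \<theta> * \<bar>sp k - sp k'\<bar> * w" using dl by linarith
    qed
    finally show ?thesis using False by (simp add: X_def)
  qed
  have "(\<Sum>x\<in>T. \<Sum>y\<in>T. ov x y) = (\<Sum>k\<in>B. \<Sum>j\<in>J k. \<Sum>k'\<in>B. \<Sum>j'\<in>J k'. ov (k, j) (k', j'))"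
  proof -
    have "sum g (Sigma B J) = (\<Sum>k\<in>B. \<Sum>j\<in>J k. g (k, j))" for g :: "'a \<times> int \<Rightarrow> real"
      using B J by (subst sum.Sigma) auto
    thus ?thesis by (simp add: T_def)
  qed
  also have "\<dots> = (\<Sum>k\<in>B. \<Sum>k'\<in>B. \<Sum>j\<in>J k. \<Sum>j'\<in>J k'. ov (k, j) (k', j'))"
    by (intro sum.cong refl sum.swap)
  also have "\<dots> \<le> (\<Sum>k\<in>B. \<Sum>k'\<in>B. X * (1 + \<theta>) + (if (k, k') \<in> bad then 12 * e * w / s0 else 0))"
    by (intro sum_mono pair)
  also have "\<dots> = n\<^sup>2 * (X * (1 + \<theta>)) + (\<Sum>k\<in>B. \<Sum>k'\<in>B. if (k, k') \<in> bad then 12 * e * w / s0 else 0)"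
    by (simp add: sum.distrib n_def power2_eq_square)
  also have "(\<Sum>k\<in>B. \<Sum>k'\<in>B. if (k, k') \<in> bad then 12 * e * w / s0 else 0) = real (card bad) * (12 * e * w / s0)"
  proof -
    have "(\<Sum>k\<in>B. \<Sum>k'\<in>B. if (k, k') \<in> bad then 12 * e * w / s0 else 0) =
        (\<Sum>x\<in>B \<times> B. if x \<in> bad then 12 * e * w / s0 else 0)" by (simp add: sum.cartesian_product case_prod_beta)
    also have "\<dots> = (\<Sum>x\<in>bad. 12 * e * w / s0)" using B bad(1)
      by (simp add: sum.If_cases Int_absorb1)
    finally show ?thesis by simp
  qed
  \<comment> \<open>The bound 12 e w / s0 for a bad pair is 3 s0 / e times the independent value X;
    the assumed bound on their number reduces their total to 3/2 \<theta> of the main term.\<close>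
  also have "real (card bad) * (12 * e * w / s0) \<le> n\<^sup>2 * (e * \<theta> / (2 * s0)) * (12 * e * w / s0)"
    using bad(2) e wp s0 unfolding n_def by (intro mult_right_mono) auto
  also have "\<dots> = n\<^sup>2 * (X * (3/2 * \<theta>))" using s0 by (simp add: X_def power2_eq_square)
  finally have S: "(\<Sum>x\<in>T. \<Sum>y\<in>T. ov x y) \<le> n\<^sup>2 * X * (1 + 5/2 * \<theta>)" by (simp add: algebra_simps)
  have mA: "measure lborel A \<le> w"
  proof -
    have "measure lborel A \<le> measure lborel {0..w}" using A by (intro measure_mono_fmeasurable) (auto simp: fmeasurable_def emeasure_lborel_Icc_eq)
    thus ?thesis using wp by simp
  qed
  have "n\<^sup>2 * X * (w * (1 - 2 * \<theta>)) \<le> n\<^sup>2 * X * (w * (1 - \<theta>)\<^sup>2)"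
    using Xp wp by (intro mult_left_mono) (auto simp: power2_eq_square algebra_simps)
  also have "\<dots> = (n * (w / s0 * (1 - \<theta>)) * (2 * e))\<^sup>2" using s0 by (simp add: X_def power2_eq_square)
  also have "\<dots> \<le> (real (card T) * (2 * e))\<^sup>2"
    using cT e n wp s0 th by (intro power_mono mult_right_mono) auto
  also have "\<dots> \<le> (w - measure lborel A) * (\<Sum>x\<in>T. \<Sum>y\<in>T. ov x y)" using sm by simp
  also have "\<dots> \<le> (w - measure lborel A) * (n\<^sup>2 * X * (1 + 5/2 * \<theta>))" using S mA by (intro mult_left_mono) auto
  also have "\<dots> \<le> (w - c * w) * (n\<^sup>2 * X * (1 + 5/2 * \<theta>))" using A(3) Xp th by (intro mult_right_mono) auto
  also have "\<dots> = n\<^sup>2 * X * (w * ((1 - 8 * \<theta>) * (1 + 5/2 * \<theta>)))" by (simp add: th(3) algebra_simps)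
  also have "\<dots> < n\<^sup>2 * X * (w * (1 - 2 * \<theta>))"
  proof (intro mult_strict_left_mono)
    have "0 \<le> \<theta> * \<theta>" by simp
    moreover have "(1 - 8 * \<theta>) * (1 + 5/2 * \<theta>) = 1 - 11/2 * \<theta> - 20 * (\<theta> * \<theta>)" by (simp add: field_simps)
    ultimately show "(1 - 8 * \<theta>) * (1 + 5/2 * \<theta>) < 1 - 2 * \<theta>" using th by linarith
  qed (use n Xp wp in auto)
  finally show False by simp
qed

text \<open>Otherwise P is too dense in every class. The squares of the class sizes add up to at
  least |C|^2 / N by Cauchy-Schwarz, so summing over the classes would give P too many
  elements.\<close>

lemma select_class:
  fixes f :: "'a \<Rightarrow> 'b"
  assumes C: "finite C" "C \<noteq> {}" and N: "real (card (f ` C)) \<le> N" and x: "x > 0"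
    and P: "P \<subseteq> C \<times> C" and big: "N * real (card P) < x * (real (card C))\<^sup>2"
  shows "\<exists>k0\<in>C. real (card (P \<inter> {k\<in>C. f k = f k0} \<times> {k\<in>C. f k = f k0})) \<le> (real (card {k\<in>C. f k = f k0}))\<^sup>2 * x"
proof (rule ccontr)
  assume n: "\<not> ?thesis"
  define b where "b v = {k\<in>C. f k = v}" for v
  have fin: "finite (f ` C)" "finite P" using C P finite_subset[OF P] by auto
  have gt: "(real (card (b v)))\<^sup>2 * x \<le> real (card (P \<inter> b v \<times> b v))" if v: "v \<in> f ` C" for v
    using n v by (force simp: b_def not_le)
  have Np: "N \<ge> 0" using N by linarith
  have "real (card C) = (\<Sum>v\<in>f ` C. real (card (b v)))"
  proof -
    have "C = (\<Union>v\<in>f ` C. b v)" by (auto simp: b_def)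
    hence "card C = card (\<Union>v\<in>f ` C. b v)" by simp
    also have "\<dots> = (\<Sum>v\<in>f ` C. card (b v))" using C by (intro card_UN_disjoint) (auto simp: b_def)
    finally show ?thesis by simp
  qed
  hence "(real (card C))\<^sup>2 = (\<Sum>v\<in>f ` C. 1 * real (card (b v)))\<^sup>2" by simp
  also have "\<dots> \<le> (\<Sum>v\<in>f ` C. 1\<^sup>2) * (\<Sum>v\<in>f ` C. (real (card (b v)))\<^sup>2)" by (rule Cauchy_Schwarz_ineq_sum)
  also have "\<dots> \<le> N * (\<Sum>v\<in>f ` C. (real (card (b v)))\<^sup>2)" using N by (intro mult_right_mono sum_nonneg) auto
  finally have "x * (real (card C))\<^sup>2 \<le> x * (N * (\<Sum>v\<in>f ` C. (real (card (b v)))\<^sup>2))" using x by (intro mult_left_mono) auto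
  also have "\<dots> = N * (\<Sum>v\<in>f ` C. (real (card (b v)))\<^sup>2 * x)" by (simp add: sum_distrib_left sum_distrib_right mult_ac)
  also have "\<dots> \<le> N * (\<Sum>v\<in>f ` C. real (card (P \<inter> b v \<times> b v)))" by (intro mult_left_mono sum_mono gt Np)
  also have "(\<Sum>v\<in>f ` C. real (card (P \<inter> b v \<times> b v))) = real (card (\<Union>v\<in>f ` C. P \<inter> b v \<times> b v))"
    using C fin by (subst card_UN_disjoint) (auto simp: b_def)
  also have "\<dots> \<le> real (card P)" using fin by (intro of_nat_mono card_mono) auto
  finally show False using big Np by (simp add: mult_left_mono)
qed

section \<open>Progressions seen from a common frame\<close>

text \<open>The lower left entry of G is d d' times the difference of the slopes s' / d' and s / d
  of the lower rows. Equal slopes make G upper triangular with diagonal d / d', d' / d, and a small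
  difference perturbs this little; hence slopes are what has to be matched.\<close>

lemma frame_pair:
  fixes b b' :: "real^2^2"
  assumes b: "b \<in> SL2" "b' \<in> SL2" "ent e (b - mat 1)" "ent e (b' - mat 1)" "e \<le> 1/100" and M: "M > 0"
    and r: "\<bar>b $ 2 $ 1 / b $ 2 $ 2 - b' $ 2 $ 1 / b' $ 2 $ 2\<bar> \<le> 1 / (2 * M)" and G: "G = b' ** iv b"
  shows "\<bar>G $ 2 $ 1\<bar> \<le> 1 / M" "\<bar>G $ 1 $ 1 - b $ 2 $ 2 / b' $ 2 $ 2\<bar> \<le> 1 / M"
    "\<bar>G $ 2 $ 2 - b' $ 2 $ 2 / b $ 2 $ 2\<bar> \<le> 1 / M" "\<bar>G $ 1 $ 2\<bar> \<le> 8 * e"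
proof -
  obtain p q s d where m: "b = mat2 p q s d" "p * d - q * s = 1" using b SL2_cases by blast
  obtain p' q' s' d' where m': "b' = mat2 p' q' s' d'" "p' * d' - q' * s' = 1" using b SL2_cases by blast
  have e0: "\<bar>q\<bar> \<le> 1/100" "\<bar>d - 1\<bar> \<le> 1/100" "\<bar>q'\<bar> \<le> 1/100" "\<bar>d' - 1\<bar> \<le> 1/100"
    using b(3-5) by (auto simp: m m' ent_mat2 mat_1_mat2)
  have dp: "99/100 \<le> d" "d \<le> 101/100" "99/100 \<le> d'" "d' \<le> 101/100" using e0 by linarith+
  have r': "\<bar>s / d - s' / d'\<bar> \<le> 1 / (2 * M)" using r by (simp add: m m')
  have Mi: "0 \<le> 1 / (2 * M)" using M by simp
  have g: "G = mat2 (p' * d - q' * s) (q' * p - p' * q) (s' * d - d' * s) (d' * p - s' * q)"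
    by (simp add: G m m' algebra_simps)
  have "s' * d - d' * s = (d * d') * (s' / d' - s / d)" using dp by (simp add: field_simps)
  hence "\<bar>s' * d - d' * s\<bar> = (d * d') * \<bar>s / d - s' / d'\<bar>" using dp by (simp add: abs_mult abs_minus_commute)
  also have "\<dots> \<le> 2 * (1 / (2 * M))"
  proof (intro mult_mono r')
    have "d * d' \<le> (101/100) * (101/100)" using dp by (intro mult_mono) auto
    thus "d * d' \<le> 2" by simp
  qed auto
  finally show "\<bar>G $ 2 $ 1\<bar> \<le> 1 / M" by (simp add: g)
  have bd: "\<bar>x * y * t\<bar> \<le> 1 / M" if "\<bar>x\<bar> \<le> 2" "\<bar>y\<bar> \<le> 1" "\<bar>t\<bar> \<le> 1 / (2 * M)" for x y t
  proof -
    have "\<bar>x * y * t\<bar> \<le> 2 * 1 * (1 / (2 * M))" unfolding abs_mult using that Mi by (intro mult_mono) auto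
    thus ?thesis by simp
  qed
  have pe: "p' = (1 + q' * s') / d'" using m'(2) dp by (simp add: field_simps)
  have "p' * d - q' * s - d / d' = d * q' * (s' / d' - s / d)" unfolding pe using dp by (simp add: field_simps)
  thus "\<bar>G $ 1 $ 1 - b $ 2 $ 2 / b' $ 2 $ 2\<bar> \<le> 1 / M"
    using bd[of d q' "s' / d' - s / d"] dp e0 r' by (simp add: g m m' abs_minus_commute)
  have pe': "p = (1 + q * s) / d" using m(2) dp by (simp add: field_simps)
  have "d' * p - s' * q - d' / d = d' * q * (s / d - s' / d')" unfolding pe' using dp by (simp add: field_simps)
  thus "\<bar>G $ 2 $ 2 - b' $ 2 $ 2 / b $ 2 $ 2\<bar> \<le> 1 / M"
    using bd[of d' q "s / d - s' / d'"] dp e0 r' by (simp add: g m m')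
  have "ent e (iv b - mat 1)" "ent e (iv b' - mat 1)" using b(3,4) by (auto simp: m m' ent_mat2 mat_1_mat2)
  hence "ent (8 * e) (iv (iv b') ** iv b - mat 1)" using b by (intro small_quotient) auto
  thus "\<bar>G $ 1 $ 2\<bar> \<le> 8 * e" by (simp add: G ent_iff mat_1_mat2)
qed

text \<open>Exchanging \<open>uu t\<close> with the renormalised G reparametrises time by a Moebius
  map of t, which stays within 10 L / M of an affine map of slope q^2. This is the origin of the
  steps s q^2.\<close>

lemma shear_position:
  assumes G: "\<alpha> * \<delta> - \<beta> * \<nu> = 1" and q: "\<bar>q - 1\<bar> \<le> 1/10" and M: "M \<ge> 100"
    and b: "\<bar>\<alpha> - 1 / q\<bar> \<le> 1 / M" "\<bar>\<delta> - q\<bar> \<le> 1 / M" "\<bar>\<nu>\<bar> \<le> 1 / M" "\<bar>\<beta>\<bar> \<le> 1/10"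
    and L: "L \<ge> 1" and t: "0 \<le> t" "t \<le> L" and a: "a = \<alpha> + t * \<nu> / L"
  shows "\<bar>a - 1 / q\<bar> \<le> 2 / M" "a > 0"
    "uu t ** mat2 \<alpha> (L * \<beta>) (\<nu> / L) \<delta> = mat2 a 0 (\<nu> / L) (1 / a) ** uu ((L * \<beta> + t * \<delta>) / a)"
    "\<bar>(L * \<beta> + t * \<delta>) / a - q * (L * \<beta> + t * q)\<bar> \<le> 10 * L / M"
proof -
  have qb: "9/10 \<le> q" "q \<le> 11/10" using q by linarith+
  have Mi: "1 / M \<le> 1/100" "0 < 1 / M" using M by (auto simp: field_simps)
  have "\<bar>t * \<nu> / L\<bar> \<le> 1 / M"
  proof -
    have "\<bar>t * \<nu>\<bar> \<le> L * (1 / M)" unfolding abs_mult using t b by (intro mult_mono) auto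
    thus ?thesis using L by (simp add: abs_divide pos_divide_le_eq mult.commute)
  qed
  hence "\<bar>\<alpha> - 1 / q\<bar> + \<bar>t * \<nu> / L\<bar> \<le> 1 / M + 1 / M" using b(1) by (rule add_mono[rotated])
  hence "\<bar>\<alpha> - 1 / q + t * \<nu> / L\<bar> \<le> 1 / M + 1 / M" using abs_triangle_ineq order_trans by blast
  moreover have "a - 1 / q = \<alpha> - 1 / q + t * \<nu> / L" by (simp add: a)
  ultimately show a1: "\<bar>a - 1 / q\<bar> \<le> 2 / M" by simp
  have "1 / q \<ge> 9/10" using qb by (simp add: field_simps)
  hence ab: "a \<ge> 88/100" using a1 Mi by linarith
  thus ap: "a > 0" by simp
  have "\<delta> = \<nu> / L * ((L * \<beta> + t * \<delta>) / a) + 1 / a"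
  proof -
    have "a * \<delta> = 1 + \<beta> * \<nu> + t * \<nu> / L * \<delta>" using G by (simp add: a algebra_simps)
    also have "\<dots> = \<nu> / L * (L * \<beta> + t * \<delta>) + 1" using L by (simp add: field_simps)
    finally have "a * \<delta> = \<nu> / L * (L * \<beta> + t * \<delta>) + 1" .
    moreover have "\<delta> = (a * \<delta>) / a" using ap by simp
    ultimately have "\<delta> = (\<nu> / L * (L * \<beta> + t * \<delta>) + 1) / a" by simp
    thus ?thesis by (simp only: add_divide_distrib[of "\<nu> / L * (L * \<beta> + t * \<delta>)"] times_divide_eq_right)
  qed
  thus "uu t ** mat2 \<alpha> (L * \<beta>) (\<nu> / L) \<delta> = mat2 a 0 (\<nu> / L) (1 / a) ** uu ((L * \<beta> + t * \<delta>) / a)"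
    using ap by (simp add: uu_def a)
  have db: "\<bar>\<delta>\<bar> \<le> 12/10" using b(2) qb Mi by linarith
  have X: "\<bar>L * \<beta> + t * \<delta>\<bar> \<le> 2 * L"
  proof -
    have "\<bar>L * \<beta>\<bar> \<le> L * (1/10)" unfolding abs_mult using L b by (intro mult_mono) auto
    moreover have "\<bar>t * \<delta>\<bar> \<le> L * (12/10)" unfolding abs_mult using t db by (intro mult_mono) auto
    moreover have "\<bar>L * \<beta> + t * \<delta>\<bar> \<le> \<bar>L * \<beta>\<bar> + \<bar>t * \<delta>\<bar>" by (rule abs_triangle_ineq)
    ultimately show ?thesis using L by linarith
  qed
  have Y: "\<bar>1 / a - q\<bar> \<le> 3 / M"
  proof -
    have "1 / a - q = (1 / q - a) * (q / a)" using ap qb by (simp add: field_simps)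
    moreover have "\<bar>q / a\<bar> \<le> 3/2" using qb ab by (simp add: abs_divide pos_divide_le_eq)
    hence "\<bar>(1 / q - a) * (q / a)\<bar> \<le> (2 / M) * (3/2)" unfolding abs_mult[of "1 / q - a"]
      using a1 M by (intro mult_mono) (auto simp: abs_minus_commute)
    ultimately show ?thesis by simp
  qed
  have "(L * \<beta> + t * \<delta>) / a - q * (L * \<beta> + t * q) = (L * \<beta> + t * \<delta>) * (1 / a - q) + q * t * (\<delta> - q)"
    by (simp add: algebra_simps add_divide_distrib)
  moreover have "\<bar>(L * \<beta> + t * \<delta>) * (1 / a - q)\<bar> \<le> (2 * L) * (3 / M)"
    unfolding abs_mult using X Y L by (intro mult_mono) auto
  moreover have "\<bar>q * t * (\<delta> - q)\<bar> \<le> (2 * L) * (1 / M)"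
    unfolding abs_mult using qb t b(2) L by (intro mult_mono) auto
  moreover have "\<bar>z\<bar> \<le> A + B" if "z = x + y" "\<bar>x\<bar> \<le> A" "\<bar>y\<bar> \<le> B" for x y z A B :: real
    using that by linarith
  ultimately have "\<bar>(L * \<beta> + t * \<delta>) / a - q * (L * \<beta> + t * q)\<bar> \<le> (2 * L) * (3 / M) + (2 * L) * (1 / M)"
    by blast
  also have "\<dots> \<le> 10 * L / M" using L M by (simp add: field_simps)
  finally show "\<bar>(L * \<beta> + t * \<delta>) / a - q * (L * \<beta> + t * q)\<bar> \<le> 10 * L / M" .
qed

lemma near_one_prod:
  assumes "\<bar>x\<bar> \<le> t" "\<bar>y\<bar> \<le> t" "\<bar>a - 1\<bar> \<le> t" "\<bar>n\<bar> \<le> t" "t \<le> 1/10"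
  shows "ent (6 * t) (uu x ** mat2 a 0 n (1 / a) ** uu y - mat 1)"
proof -
  have a: "9/10 \<le> a" "a \<le> 11/10" using assms(3,5) by linarith+
  have t: "0 \<le> t" using assms(1) by linarith
  have ny: "\<bar>n * y\<bar> \<le> t * (1/10)" unfolding abs_mult using assms t by (intro mult_mono) auto
  have xn: "\<bar>x * n\<bar> \<le> t * (1/10)" unfolding abs_mult using assms t by (intro mult_mono) auto
  have i: "\<bar>1 / a - 1\<bar> \<le> 2 * t"
  proof -
    have "1 / a - 1 = (1 - a) / a" using a by (simp add: field_simps)
    moreover have "\<bar>(1 - a) / a\<bar> \<le> t / (1/2)" unfolding abs_divide using assms a by (intro frac_le) auto
    ultimately show ?thesis by simp
  qed
  have w: "\<bar>n * y + 1 / a - 1\<bar> \<le> 3 * t" using ny i by linarith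
  have w2: "\<bar>n * y + 1 / a\<bar> \<le> 2" using w assms(5) by linarith
  have xw: "\<bar>x * (n * y + 1 / a)\<bar> \<le> t * 2" unfolding abs_mult using assms w2 t by (intro mult_mono) auto
  have ay: "\<bar>a * y\<bar> \<le> 2 * t" unfolding abs_mult using assms a t by (intro mult_mono) auto
  have e: "uu x ** mat2 a 0 n (1 / a) ** uu y - mat 1 =
      mat2 (a - 1 + x * n) (a * y + x * (n * y + 1 / a)) n (n * y + 1 / a - 1)"
    by (simp add: uu_def mat_1_mat2 algebra_simps)
  show ?thesis unfolding e ent_mat2
  proof (intro conjI)
    show "\<bar>a - 1 + x * n\<bar> \<le> 6 * t" using assms(3) xn t by linarith
    show "\<bar>a * y + x * (n * y + 1 / a)\<bar> \<le> 6 * t" using ay xw t by linarith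
    show "\<bar>n\<bar> \<le> 6 * t" using assms(4) t by linarith
    show "\<bar>n * y + 1 / a - 1\<bar> \<le> 6 * t" using w t by linarith
  qed
qed

lemma class_count:
  fixes r d :: "'a \<Rightarrow> real"
  assumes H: "finite H" "\<And>k. k \<in> C \<Longrightarrow> h k \<in> H" and m: "m \<ge> 1" "n \<ge> 1"
    and r: "\<And>k. k \<in> C \<Longrightarrow> \<bar>r k\<bar> \<le> real m" and d: "\<And>k. k \<in> C \<Longrightarrow> \<bar>d k\<bar> \<le> real n"
  shows "real (card ((\<lambda>k. (h k, \<lfloor>r k\<rfloor>, \<lfloor>d k\<rfloor>)) ` C)) \<le> real (card H) * (3 * real m) * (3 * real n)"
proof -
  have fl: "\<lfloor>x\<rfloor> \<in> {- int k..int k}" if "\<bar>x\<bar> \<le> real k" for x k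
    using that by (auto simp: le_floor_iff floor_le_iff abs_le_iff)
  have "(\<lambda>k. (h k, \<lfloor>r k\<rfloor>, \<lfloor>d k\<rfloor>)) ` C \<subseteq> H \<times> {- int m..int m} \<times> {- int n..int n}"
    using H(2) fl[OF r] fl[OF d] by blast
  hence "card ((\<lambda>k. (h k, \<lfloor>r k\<rfloor>, \<lfloor>d k\<rfloor>)) ` C) \<le> card (H \<times> {- int m..int m} \<times> {- int n..int n})"
    using H(1) by (intro card_mono) auto
  also have "\<dots> = card H * ((2 * m + 1) * (2 * n + 1))"
  proof -
    have "card {- int k..int k} = 2 * k + 1" for k by (simp add: nat_add_distrib)
    thus ?thesis by (simp add: card_cartesian_product)
  qed
  also have "\<dots> \<le> card H * ((3 * m) * (3 * n))" using m by (intro mult_le_mono) auto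
  finally have "real (card ((\<lambda>k. (h k, \<lfloor>r k\<rfloor>, \<lfloor>d k\<rfloor>)) ` C)) \<le> real (card H * ((3 * m) * (3 * n)))"
    by (rule of_nat_mono)
  thus ?thesis by (simp add: mult_ac)
qed

context lattice
begin

text \<open>G identifies the window at time T with the common segment of g0. A visit of the segment
  to U1, at a time r that matches t after reparametrisation, becomes a visit of the orbit of y to U
  near time T + t, because all errors are collected in one matrix B near 1.\<close>

lemma window_hit:
  assumes rU: "rinv U" and sh: "\<And>b x. b \<in> SL2 \<Longrightarrow> ent eU (b - mat 1) \<Longrightarrow> x \<in> U1 \<Longrightarrow> b ** x \<in> U"
    and tau: "\<tau> \<le> 1/10" "6 * \<tau> \<le> eU"
    and g: "g0 \<in> SL2" "y \<in> SL2" "\<gamma> \<in> \<Gamma>" and G: "G \<in> SL2" "G ** g0 = gk ** \<gamma>"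
    and gk: "dg (sqrt L) ** gk = uu T ** y" and M: "M \<ge> 100" and L: "L \<ge> 1"
    and q: "\<bar>q - 1\<bar> \<le> 1/10"
    and b: "\<bar>G $ 1 $ 1 - 1 / q\<bar> \<le> 1 / M" "\<bar>G $ 2 $ 2 - q\<bar> \<le> 1 / M" "\<bar>G $ 2 $ 1\<bar> \<le> 1 / M" "\<bar>G $ 1 $ 2\<bar> \<le> 1/10"
    and t: "0 \<le> t" "t \<le> L"
    and r: "\<bar>r - q * (L * G $ 1 $ 2 + t * q)\<bar> \<le> e" "uu r ** (dg (sqrt L) ** g0) \<in> U1"
    and p: "\<bar>p - (T + t)\<bar> \<le> \<tau>"
    and small: "10 * L / M + e \<le> \<tau>" "2 / M + \<bar>1 / q - 1\<bar> \<le> \<tau>" "1 / M \<le> \<tau>"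
  shows "uu p ** y \<in> U"
proof -
  obtain \<alpha> \<beta> \<nu> \<delta> where m: "G = mat2 \<alpha> \<beta> \<nu> \<delta>" "\<alpha> * \<delta> - \<beta> * \<nu> = 1" using G(1) SL2_cases by blast
  define a where "a = \<alpha> + t * \<nu> / L"
  have b': "\<bar>\<alpha> - 1 / q\<bar> \<le> 1 / M" "\<bar>\<delta> - q\<bar> \<le> 1 / M" "\<bar>\<nu>\<bar> \<le> 1 / M" "\<bar>\<beta>\<bar> \<le> 1/10" using b by (auto simp: m)
  note sp = shear_position[OF m(2) q M b' L t a_def]
  define X where "X = (L * \<beta> + t * \<delta>) / a"
  define N where "N = mat2 a 0 (\<nu> / L) (1 / a)"
  define B where "B = uu (p - T - t) ** N ** uu (X - r)"
  have "ent (6 * \<tau>) (B - mat 1)" unfolding B_def N_def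
  proof (rule near_one_prod[OF _ _ _ _ tau(1)])
    show "\<bar>p - T - t\<bar> \<le> \<tau>" using p by (simp add: algebra_simps)
    have "\<bar>X - q * (L * \<beta> + t * q)\<bar> \<le> 10 * L / M" using sp(4) by (simp add: X_def)
    thus "\<bar>X - r\<bar> \<le> \<tau>" using r(1) small(1) unfolding m mat2_nth by linarith
    show "\<bar>a - 1\<bar> \<le> \<tau>" using sp(1) small(2) by linarith
    have "\<bar>\<nu>\<bar> / L \<le> \<bar>\<nu>\<bar> / 1" using L by (intro divide_left_mono) auto
    hence "\<bar>\<nu> / L\<bar> \<le> \<bar>\<nu>\<bar>" using L by (simp add: abs_divide)
    thus "\<bar>\<nu> / L\<bar> \<le> \<tau>" using b'(3) small(3) by linarith
  qed
  hence eB: "ent eU (B - mat 1)" using tau(2) ent_mono by blast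
  have NS: "N \<in> SL2" using sp(2) by (simp add: N_def)
  have BS: "B \<in> SL2" using NS by (simp add: B_def)
  have dG: "dg (sqrt L) ** G = mat2 \<alpha> (L * \<beta>) (\<nu> / L) \<delta> ** dg (sqrt L)"
  proof -
    define l where "l = sqrt L"
    have "l > 0" "L = l * l" using L by (auto simp: l_def)
    thus ?thesis by (simp add: m dg_def l_def[symmetric])
  qed
  have "B ** (uu r ** (dg (sqrt L) ** g0)) = uu (p - T - t) ** (N ** (uu (X - r) ** uu r)) ** (dg (sqrt L) ** g0)"
    by (simp add: B_def matrix_mul_assoc)
  also have "N ** (uu (X - r) ** uu r) = uu t ** mat2 \<alpha> (L * \<beta>) (\<nu> / L) \<delta>"
    using sp(3) by (simp add: uu_add N_def X_def)
  also have "uu (p - T - t) ** (uu t ** mat2 \<alpha> (L * \<beta>) (\<nu> / L) \<delta>) ** (dg (sqrt L) ** g0) =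
      (uu (p - T - t) ** uu t) ** (mat2 \<alpha> (L * \<beta>) (\<nu> / L) \<delta> ** dg (sqrt L)) ** g0"
    by (simp only: matrix_mul_assoc)
  also have "\<dots> = uu (p - T) ** dg (sqrt L) ** (G ** g0)" by (simp only: dG[symmetric] uu_add) (simp add: matrix_mul_assoc)
  also have "\<dots> = uu (p - T) ** (dg (sqrt L) ** gk) ** \<gamma>" by (simp only: G matrix_mul_assoc)
  also have "\<dots> = uu p ** y ** \<gamma>" unfolding gk by (simp add: matrix_mul_assoc uu_add)
  finally have "uu p ** y ** \<gamma> \<in> U" using sh[OF BS eB r(2)] by simp
  thus ?thesis using rinv_iff[OF rU g(3)] by simp
qed

text \<open>The windows of a class share the cover element, the slope of the lower row of the frame up to \<open>S\<^sup>-\<^sup>2\<^sup>0\<close>,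
  and its lower right entry up to \<open>S\<^sup>-\<^sup>2\<close>; \<open>bad\<close> collects the pairs with nearly equal lower right entries.\<close>

lemma core_class:
  assumes \<rho>: "\<rho> > 0"
  shows "\<exists>\<rho>1>0. \<forall>\<eta>>0. \<exists>S0::nat. \<forall>S z. S \<ge> S0 \<longrightarrow> z \<in> SL2 \<longrightarrow> thick \<rho> z \<longrightarrow>
    (\<exists>k0 B G q bad. k0 \<in> B \<and> B \<subseteq> {..<S ^ 30} \<and> thick \<rho>1 (uu (real k0) ** (dg (sqrt (real S ^ 30)) ** z)) \<and>
      (\<forall>k\<in>B. \<bar>q k - 1\<bar> \<le> 2 / (real S)\<^sup>2 \<and> G k \<in> SL2 \<and>
        (\<exists>\<gamma>\<in>\<Gamma>. G k ** (uu (real k0) ** (dg (sqrt (real S ^ 30)) ** z)) = uu (real k) ** (dg (sqrt (real S ^ 30)) ** z) ** \<gamma>) \<and>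
        \<bar>G k $ 1 $ 1 - 1 / q k\<bar> \<le> 1 / real S ^ 20 \<and> \<bar>G k $ 2 $ 2 - q k\<bar> \<le> 1 / real S ^ 20 \<and>
        \<bar>G k $ 2 $ 1\<bar> \<le> 1 / real S ^ 20 \<and> \<bar>G k $ 1 $ 2\<bar> \<le> 1 / 100) \<and>
      bad \<subseteq> B \<times> B \<and> real (card bad) \<le> (real (card B))\<^sup>2 * (\<eta> / real S) \<and>
      (\<forall>k\<in>B. \<forall>k'\<in>B. (k, k') \<notin> bad \<longrightarrow> 1 / (2 * real S ^ 8) \<le> \<bar>q k - q k'\<bar>))"
proof -
  obtain \<rho>1 T0 where \<rho>1: "\<rho>1 > 0" and nd: "\<And>z T. z \<in> SL2 \<Longrightarrow> thick \<rho> z \<Longrightarrow> T \<ge> T0 \<Longrightarrow>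
     real (card {k::nat. real k \<le> T \<and> \<not> thick \<rho>1 (uu (real k) ** (dg (sqrt T) ** z))}) \<le> 1/2 * T"
    using nondivergence[OF \<rho>, of "1/2"] by auto
  define \<kappa> where "\<kappa> = min (1/100) (\<rho> / 100)"
  have \<kappa>: "0 < \<kappa>" "\<kappa> \<le> 1/100" "100 * \<kappa> \<le> \<rho>" using \<rho> by (auto simp: \<kappa>_def)
  have "\<kappa> / 8 > 0" using \<kappa> by simp
  from thick_cover[OF \<rho>1 this] obtain H where H: "finite H" "H \<subseteq> SL2" and cov: "\<forall>g\<in>SL2. thick \<rho>1 g \<longrightarrow>
     (\<exists>h\<in>H. \<exists>\<gamma>\<in>\<Gamma>. \<exists>b\<in>SL2. ent (\<kappa> / 8) (b - mat 1) \<and> g = b ** h ** \<gamma>)" by blast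
  define C1 where "C1 = 35 / \<kappa>\<^sup>2 + 1225 / \<kappa> ^ 3"
  have C1: "C1 > 0" using \<kappa> by (simp add: C1_def add_pos_pos)
  show ?thesis
  proof (intro exI[of _ \<rho>1] conjI \<rho>1 allI impI)
    fix \<eta> :: real assume \<eta>: "\<eta> > 0"
    define S0 where "S0 = nat \<lceil>10 + \<bar>T0\<bar> + 3 / \<kappa> + 72 * real (card H) * C1 / \<eta> + 1\<rceil>"
    show "\<exists>S0::nat. \<forall>S z. S \<ge> S0 \<longrightarrow> z \<in> SL2 \<longrightarrow> thick \<rho> z \<longrightarrow>
    (\<exists>k0 B G q bad. k0 \<in> B \<and> B \<subseteq> {..<S ^ 30} \<and> thick \<rho>1 (uu (real k0) ** (dg (sqrt (real S ^ 30)) ** z)) \<and>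
      (\<forall>k\<in>B. \<bar>q k - 1\<bar> \<le> 2 / (real S)\<^sup>2 \<and> G k \<in> SL2 \<and>
        (\<exists>\<gamma>\<in>\<Gamma>. G k ** (uu (real k0) ** (dg (sqrt (real S ^ 30)) ** z)) = uu (real k) ** (dg (sqrt (real S ^ 30)) ** z) ** \<gamma>) \<and>
        \<bar>G k $ 1 $ 1 - 1 / q k\<bar> \<le> 1 / real S ^ 20 \<and> \<bar>G k $ 2 $ 2 - q k\<bar> \<le> 1 / real S ^ 20 \<and>
        \<bar>G k $ 2 $ 1\<bar> \<le> 1 / real S ^ 20 \<and> \<bar>G k $ 1 $ 2\<bar> \<le> 1 / 100) \<and>
      bad \<subseteq> B \<times> B \<and> real (card bad) \<le> (real (card B))\<^sup>2 * (\<eta> / real S) \<and>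
      (\<forall>k\<in>B. \<forall>k'\<in>B. (k, k') \<notin> bad \<longrightarrow> 1 / (2 * real S ^ 8) \<le> \<bar>q k - q k'\<bar>))"
    proof (rule exI[of _ S0], intro allI impI)
      fix S :: nat and z :: "real^2^2" assume SS: "S \<ge> S0" and z: "z \<in> SL2" "thick \<rho> z"
      define w where "w = real S"
      have nn: "0 \<le> 3 / \<kappa>" "0 \<le> 72 * real (card H) * C1 / \<eta>" "0 \<le> \<bar>T0\<bar>" using \<kappa> C1 \<eta> by auto
      have "10 + \<bar>T0\<bar> + 3 / \<kappa> + 72 * real (card H) * C1 / \<eta> + 1 \<le> w"
        using SS unfolding S0_def w_def by linarith
      hence w: "w \<ge> 10" "T0 \<le> w" "3 / \<kappa> \<le> w" "72 * real (card H) * C1 / \<eta> < w" using nn by linarith+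
      have w1: "w ^ i \<le> w ^ j" if "i \<le> j" for i j using w(1) that by (intro power_increasing) auto
      have wp: "w ^ i > 0" for i using w by simp
      have wd: "a * w ^ i / w ^ i = a" for a i using w(1) by simp
      have S1: "S \<ge> 1" using w by (simp add: w_def)
      define K where "K = S ^ 30"
      have K: "real K = w ^ 30" by (simp add: K_def w_def)
      define x where "x = dg (sqrt (real K)) ** z"
      have xS: "x \<in> SL2" using z wp[of 30] K by (simp add: x_def dg_SL2)
      define C where "C = {k. k < K \<and> thick \<rho>1 (uu (real k) ** x)}"
      have C: "finite C" "C \<subseteq> {..<K}" by (auto simp: C_def)
      have cC: "w ^ 30 / 2 \<le> real (card C)"
      proof -
        define D where "D = {k::nat. real k \<le> real K \<and> \<not> thick \<rho>1 (uu (real k) ** x)}"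
        have "D \<subseteq> {..K}" by (auto simp: D_def)
        hence "finite D" using finite_subset by blast
        hence "card {..<K} \<le> card (C \<union> D)" using C(1) by (intro card_mono) (auto simp: C_def D_def)
        also have "\<dots> \<le> card C + card D" by (rule card_Un_le)
        finally have "real K \<le> real (card C) + real (card D)" by simp
        moreover have "real (card D) \<le> 1/2 * real K" unfolding D_def x_def
        proof (rule nd[OF z])
          show "T0 \<le> real K" using w(2) w1[of 1 30] K by simp
        qed
        ultimately show ?thesis using K by simp
      qed
      have C0: "C \<noteq> {}" using cC wp[of 30] by auto
      have "\<forall>k\<in>C. \<exists>v. fst v \<in> H \<and> fst (snd v) \<in> \<Gamma> \<and> snd (snd v) \<in> SL2 \<and> ent (\<kappa> / 8) (snd (snd v) - mat 1) \<and>
          uu (real k) ** x = snd (snd v) ** fst v ** fst (snd v)"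
      proof
        fix k assume "k \<in> C"
        hence "thick \<rho>1 (uu (real k) ** x)" "uu (real k) ** x \<in> SL2" using xS by (auto simp: C_def)
        then obtain h \<gamma> b where "h \<in> H" "\<gamma> \<in> \<Gamma>" "b \<in> SL2" "ent (\<kappa> / 8) (b - mat 1)" "uu (real k) ** x = b ** h ** \<gamma>"
          using cov by blast
        thus "\<exists>v. fst v \<in> H \<and> fst (snd v) \<in> \<Gamma> \<and> snd (snd v) \<in> SL2 \<and> ent (\<kappa> / 8) (snd (snd v) - mat 1) \<and>
          uu (real k) ** x = snd (snd v) ** fst v ** fst (snd v)" by (intro exI[of _ "(h, \<gamma>, b)"]) simp
      qed
      from bchoice[OF this] obtain F where F: "\<forall>k\<in>C. fst (F k) \<in> H \<and> fst (snd (F k)) \<in> \<Gamma> \<and> snd (snd (F k)) \<in> SL2 \<and>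
          ent (\<kappa> / 8) (snd (snd (F k)) - mat 1) \<and> uu (real k) ** x = snd (snd (F k)) ** fst (F k) ** fst (snd (F k))" by blast
      define h where "h k = fst (F k)" for k
      define \<gamma> where "\<gamma> k = fst (snd (F k))" for k
      define b where "b k = snd (snd (F k))" for k
      have hk: "h k \<in> H" "\<gamma> k \<in> \<Gamma>" "b k \<in> SL2" "ent (\<kappa> / 8) (b k - mat 1)" "uu (real k) ** x = b k ** h k ** \<gamma> k"
        if "k \<in> C" for k using F that by (auto simp: h_def \<gamma>_def b_def)
      define \<delta> where "\<delta> k = b k $ 2 $ 2" for k
      define r where "r k = b k $ 2 $ 1 / b k $ 2 $ 2" for k
      have \<delta>: "99/100 \<le> \<delta> k" "\<delta> k \<le> 101/100" "\<bar>r k\<bar> \<le> 1/2" if "k \<in> C" for k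
      proof -
        have e: "\<bar>b k $ 2 $ 2 - 1\<bar> \<le> 1/100" "\<bar>b k $ 2 $ 1\<bar> \<le> 1/100" using hk(4)[OF that] \<kappa> by (auto simp: ent_iff mat_1_mat2)
        show d: "99/100 \<le> \<delta> k" "\<delta> k \<le> 101/100" using e unfolding \<delta>_def by linarith+
        have "\<bar>b k $ 2 $ 1\<bar> \<le> 1/2 * \<bar>\<delta> k\<bar>" using e d by linarith
        moreover have "\<bar>\<delta> k\<bar> > 0" using d by linarith
        ultimately show "\<bar>r k\<bar> \<le> 1/2" by (simp add: r_def \<delta>_def[symmetric] abs_divide pos_divide_le_eq)
      qed
      \<comment> \<open>Rounding the slope at scale 1 / (2 w^20) is what \<open>frame_pair\<close>
        asks for with M = w^20; rounding the lower right entry at scale 1 / w^2 keeps the ratios q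
        near 1.\<close>
      define f where "f k = (h k, \<lfloor>r k / (1 / (2 * w ^ 20))\<rfloor>, \<lfloor>\<delta> k / (1 / w\<^sup>2)\<rfloor>)" for k
      have cf: "real (card (f ` C)) \<le> real (card H) * (3 * real (S ^ 20)) * (3 * real (2 * S\<^sup>2))"
        unfolding f_def
      proof (rule class_count[OF H(1) hk(1)])
        fix k assume k: "k \<in> C"
        have "\<bar>r k\<bar> * (2 * w ^ 20) \<le> 1/2 * (2 * w ^ 20)" using \<delta>(3)[OF k] wp[of 20] by (intro mult_right_mono) auto
        thus "\<bar>r k / (1 / (2 * w ^ 20))\<bar> \<le> real (S ^ 20)" using wp[of 20] by (simp add: abs_mult w_def)
        have "\<bar>\<delta> k\<bar> * w\<^sup>2 \<le> 2 * w\<^sup>2" using \<delta>[OF k] by (intro mult_right_mono) auto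
        thus "\<bar>\<delta> k / (1 / w\<^sup>2)\<bar> \<le> real (2 * S\<^sup>2)" by (simp add: abs_mult w_def)
      qed (use S1 in auto)
      have pr: "b k' ** iv (b k) \<in> SL2" "\<exists>g\<in>\<Gamma>. (b k' ** iv (b k)) ** (uu (real k) ** x) = uu (real k') ** x ** g"
          "\<bar>(b k' ** iv (b k)) $ 2 $ 1\<bar> \<le> 1 / w ^ 20" "\<bar>(b k' ** iv (b k)) $ 1 $ 1 - \<delta> k / \<delta> k'\<bar> \<le> 1 / w ^ 20"
          "\<bar>(b k' ** iv (b k)) $ 2 $ 2 - \<delta> k' / \<delta> k\<bar> \<le> 1 / w ^ 20" "\<bar>(b k' ** iv (b k)) $ 1 $ 2\<bar> \<le> \<kappa>"
          "\<bar>\<delta> k - \<delta> k'\<bar> \<le> 1 / w\<^sup>2"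
        if k: "k \<in> C" "k' \<in> C" "f k = f k'" for k k'
      proof -
        show "b k' ** iv (b k) \<in> SL2" using hk(3)[OF k(1)] hk(3)[OF k(2)] by simp
        have hh: "h k = h k'" and rr: "\<lfloor>r k / (1 / (2 * w ^ 20))\<rfloor> = \<lfloor>r k' / (1 / (2 * w ^ 20))\<rfloor>"
          and dd: "\<lfloor>\<delta> k / (1 / w\<^sup>2)\<rfloor> = \<lfloor>\<delta> k' / (1 / w\<^sup>2)\<rfloor>" using k(3) by (auto simp: f_def)
        have "uu (real k') ** x ** (iv (\<gamma> k') ** \<gamma> k) = b k' ** h k' ** (\<gamma> k' ** (iv (\<gamma> k') ** \<gamma> k))"
          by (simp only: hk(5)[OF k(2)] matrix_mul_assoc)
        also have "\<dots> = b k' ** h k ** \<gamma> k" using hk(2)[OF k(2)] \<Gamma>_SL2 hh by simp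
        also have "\<dots> = (b k' ** iv (b k)) ** (uu (real k) ** x)"
          using hk(3)[OF k(1)] by (simp add: hk(5)[OF k(1)] matrix_mul_assoc)
        finally show "\<exists>g\<in>\<Gamma>. (b k' ** iv (b k)) ** (uu (real k) ** x) = uu (real k') ** x ** g"
          using \<Gamma>_mult[OF \<Gamma>_iv[OF hk(2)[OF k(2)]] hk(2)[OF k(1)]] by (intro bexI[of _ "iv (\<gamma> k') ** \<gamma> k"]) auto
        have "\<bar>r k - r k'\<bar> \<le> 1 / (2 * w ^ 20)" using floor_eq_diff[OF rr] w(1) by simp
        moreover have "\<kappa> / 8 \<le> 1/100" using \<kappa> by simp
        ultimately show "\<bar>(b k' ** iv (b k)) $ 2 $ 1\<bar> \<le> 1 / w ^ 20" "\<bar>(b k' ** iv (b k)) $ 1 $ 1 - \<delta> k / \<delta> k'\<bar> \<le> 1 / w ^ 20"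
          "\<bar>(b k' ** iv (b k)) $ 2 $ 2 - \<delta> k' / \<delta> k\<bar> \<le> 1 / w ^ 20" "\<bar>(b k' ** iv (b k)) $ 1 $ 2\<bar> \<le> \<kappa>"
          using frame_pair[OF hk(3)[OF k(1)] hk(3)[OF k(2)] hk(4)[OF k(1)] hk(4)[OF k(2)] _ wp[of 20] _ refl]
          unfolding r_def \<delta>_def by auto
        show "\<bar>\<delta> k - \<delta> k'\<bar> \<le> 1 / w\<^sup>2" using floor_eq_diff[OF dd] w(1) by simp
      qed
      define P where "P = {p \<in> C \<times> C. f (fst p) = f (snd p) \<and> \<bar>\<delta> (fst p) - \<delta> (snd p)\<bar> \<le> 1 / w ^ 8}"
      have cP: "real (card P) \<le> C1 * w ^ 36"
      proof -
        \<comment> \<open>\<open>close_pairs_card\<close> with M = w^20, R = w^10, xi = 3 / w^8 and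
          be = 1 / w^4. This choice of be balances both terms at w^36.\<close>
        have "real (card P) \<le> 35 * real K * (1 / w ^ 4) * w ^ 10 / \<kappa>\<^sup>2 +
            175 * (w ^ 10)\<^sup>2 / \<kappa> ^ 3 * (2 * (3 / w ^ 8) * w ^ 20 / (1 / w ^ 4) + 1)"
        proof (rule close_pairs_card[OF z \<kappa>])
          show "0 \<le> 3 / w ^ 8" "1 \<le> w ^ 20" "1 \<le> w ^ 10" "0 < 1 / w ^ 4" using w by auto
          have "3 \<le> w * \<kappa>" using w(3) \<kappa> by (simp add: pos_divide_le_eq)
          also have "\<dots> \<le> w ^ 8 * \<kappa>" using w1[of 1 8] \<kappa> by (intro mult_right_mono) auto
          finally show "3 / w ^ 8 \<le> \<kappa>" using wp[of 8] by (simp add: pos_divide_le_eq mult.commute)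
          have "w ^ 30 = w ^ 10 * w ^ 20" by (simp add: power_add[symmetric])
          thus "w ^ 10 = real K / w ^ 20" using wp[of 20] K by (simp add: field_simps)
          have "w ^ 10 = w ^ 4 * w ^ 6" by (simp add: power_add[symmetric])
          thus "1 \<le> 1 / w ^ 4 * w ^ 10" using wp[of 4] w by simp
          show "P \<subseteq> {..<K} \<times> {..<K}" using C by (auto simp: P_def)
          fix p assume "p \<in> P"
          hence p: "fst p \<in> C" "snd p \<in> C" "f (fst p) = f (snd p)" "\<bar>\<delta> (fst p) - \<delta> (snd p)\<bar> \<le> 1 / w ^ 8" by (auto simp: P_def)
          define G where "G = b (snd p) ** iv (b (fst p))"
          note pr' = pr[OF p(1-3), folded G_def]
          have "\<delta> (fst p) / \<delta> (snd p) - 1 = (\<delta> (fst p) - \<delta> (snd p)) / \<delta> (snd p)"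
            using \<delta>(1)[OF p(2)] by (simp add: field_simps)
          also have "\<bar>\<dots>\<bar> \<le> (1 / w ^ 8) / (1/2)" unfolding abs_divide
            using p(4) \<delta>(1)[OF p(2)] w(1) by (intro frac_le) auto
          finally have "\<bar>\<delta> (fst p) / \<delta> (snd p) - 1\<bar> \<le> 2 / w ^ 8" by simp
          moreover have "1 / w ^ 20 \<le> 1 / w ^ 8" using w1[of 8 20] w(1) by (intro divide_left_mono) auto
          moreover have "3 / w ^ 8 = 2 / w ^ 8 + 1 / w ^ 8" by (simp add: add_divide_distrib[symmetric])
          ultimately have "\<bar>G $ 1 $ 1 - 1\<bar> \<le> 3 / w ^ 8" using pr'(4) by linarith
          thus "\<exists>G \<gamma>. G \<in> SL2 \<and> \<gamma> \<in> \<Gamma> \<and>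
             G ** (uu (real (fst p)) ** (dg (sqrt (real K)) ** z)) = uu (real (snd p)) ** (dg (sqrt (real K)) ** z) ** \<gamma> \<and>
             \<bar>G $ 2 $ 1\<bar> \<le> 1 / w ^ 20 \<and> \<bar>G $ 1 $ 1 - 1\<bar> \<le> 3 / w ^ 8 \<and> \<bar>G $ 1 $ 2\<bar> \<le> \<kappa>"
            using pr' unfolding x_def by blast
        qed
        also have "35 * real K * (1 / w ^ 4) * w ^ 10 / \<kappa>\<^sup>2 = 35 / \<kappa>\<^sup>2 * w ^ 36"
        proof -
          have "w ^ 30 * w ^ 10 = w ^ 36 * w ^ 4" by (simp add: power_add[symmetric])
          hence "(w ^ 30 * w ^ 10) / w ^ 4 = w ^ 36" by (simp only: wd)
          moreover have "35 * real K * (1 / w ^ 4) * w ^ 10 / \<kappa>\<^sup>2 = 35 / \<kappa>\<^sup>2 * ((w ^ 30 * w ^ 10) / w ^ 4)"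
            unfolding K by (simp only: times_divide_eq_left times_divide_eq_right mult_1_right mult_ac divide_divide_eq_left)
          ultimately show ?thesis by (simp only:)
        qed
        also have "175 * (w ^ 10)\<^sup>2 / \<kappa> ^ 3 * (2 * (3 / w ^ 8) * w ^ 20 / (1 / w ^ 4) + 1) \<le> 1225 / \<kappa> ^ 3 * w ^ 36"
        proof -
          have "w ^ 20 * w ^ 4 = w ^ 16 * w ^ 8" by (simp add: power_add[symmetric])
          hence "(w ^ 20 * w ^ 4) / w ^ 8 = w ^ 16" by (simp only: wd)
          moreover have "2 * (3 / w ^ 8) * w ^ 20 / (1 / w ^ 4) = 6 * ((w ^ 20 * w ^ 4) / w ^ 8)" by simp
          ultimately have "2 * (3 / w ^ 8) * w ^ 20 / (1 / w ^ 4) = 6 * w ^ 16" by (simp only:)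
          moreover have "1 \<le> w ^ 16" using w by auto
          ultimately have "175 * (w ^ 10)\<^sup>2 / \<kappa> ^ 3 * (2 * (3 / w ^ 8) * w ^ 20 / (1 / w ^ 4) + 1) \<le>
              175 * (w ^ 10)\<^sup>2 / \<kappa> ^ 3 * (7 * w ^ 16)" using \<kappa> by (intro mult_left_mono) auto
          also have "\<dots> = 1225 / \<kappa> ^ 3 * ((w ^ 10)\<^sup>2 * w ^ 16)" by simp
          also have "(w ^ 10)\<^sup>2 * w ^ 16 = w ^ 36" by (simp add: power_add[symmetric] power_mult[symmetric])
          finally show ?thesis .
        qed
        finally show ?thesis by (simp add: C1_def distrib_right)
      qed
      define N where "N = real (card H) * (3 * real (S ^ 20)) * (3 * real (2 * S\<^sup>2))"
      have Ne: "N = 18 * real (card H) * w ^ 22"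
      proof -
        have "w ^ 22 = w ^ 20 * w\<^sup>2" by (simp add: power_add[symmetric])
        thus ?thesis by (simp add: N_def w_def)
      qed
      \<comment> \<open>About w^22 classes times w^36 close pairs is w^58, while \<eta> / w times
        the square of at least w^30 / 2 windows has order w^59; the extra factor w pays for the
        constants.\<close>
      have "\<exists>k0\<in>C. real (card (P \<inter> {k\<in>C. f k = f k0} \<times> {k\<in>C. f k = f k0})) \<le> (real (card {k\<in>C. f k = f k0}))\<^sup>2 * (\<eta> / w)"
      proof (rule select_class[OF C(1) C0 cf[folded N_def]])
        show "0 < \<eta> / w" using \<eta> w by simp
        show "P \<subseteq> C \<times> C" by (auto simp: P_def)
        have "N * real (card P) \<le> N * (C1 * w ^ 36)" using cP by (intro mult_left_mono) (auto simp: N_def)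
        also have "\<dots> = (72 * real (card H) * C1) * (w ^ 58 / 4)"
        proof -
          have "w ^ 22 * w ^ 36 = w ^ 58" by (simp add: power_add[symmetric])
          thus ?thesis by (simp add: Ne mult_ac)
        qed
        also have "\<dots> < (\<eta> * w) * (w ^ 58 / 4)"
          using w(4) \<eta> wp[of 58] by (intro mult_strict_right_mono) (auto simp: pos_divide_less_eq mult.commute)
        also have "\<dots> = (\<eta> / w) * (w ^ 30 / 2)\<^sup>2"
        proof -
          have "w * w ^ 58 * w = w ^ 30 * w ^ 30" by (simp add: power_add[symmetric] power_Suc[symmetric] power_Suc2[symmetric] del: power_Suc)
          hence "\<eta> * w * (w ^ 58 / 4) * w = \<eta> * (w ^ 30 / 2)\<^sup>2" by (simp add: power2_eq_square mult_ac)
          hence "\<eta> / w * (w ^ 30 / 2)\<^sup>2 = (\<eta> * w * (w ^ 58 / 4)) * w ^ 1 / w ^ 1"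
            by (simp only: power_one_right times_divide_eq_left)
          thus ?thesis by (simp only: wd)
        qed
        also have "\<dots> \<le> (\<eta> / w) * (real (card C))\<^sup>2"
          using cC \<eta> w wp[of 30] by (intro mult_left_mono power_mono) auto
        finally show "N * real (card P) < \<eta> / w * (real (card C))\<^sup>2" .
      qed
      then obtain k0 where k0: "k0 \<in> C" and small: "real (card (P \<inter> {k\<in>C. f k = f k0} \<times> {k\<in>C. f k = f k0})) \<le>
        (real (card {k\<in>C. f k = f k0}))\<^sup>2 * (\<eta> / w)" by blast
      define B where "B = {k\<in>C. f k = f k0}"
      define bad where "bad = P \<inter> B \<times> B"
      define q where "q k = \<delta> k / \<delta> k0" for k
      define G where "G k = b k ** iv (b k0)" for k
      have d0: "99/100 \<le> \<delta> k0" "\<delta> k0 \<le> 101/100" using \<delta> k0 by auto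
      have qd: "q k - q k' = (\<delta> k - \<delta> k') / \<delta> k0" for k k' by (simp add: q_def diff_divide_distrib)
      have "\<bar>q k - 1\<bar> \<le> 2 / w\<^sup>2 \<and> G k \<in> SL2 \<and> (\<exists>\<gamma>\<in>\<Gamma>. G k ** (uu (real k0) ** x) = uu (real k) ** x ** \<gamma>) \<and>
        \<bar>G k $ 1 $ 1 - 1 / q k\<bar> \<le> 1 / w ^ 20 \<and> \<bar>G k $ 2 $ 2 - q k\<bar> \<le> 1 / w ^ 20 \<and>
        \<bar>G k $ 2 $ 1\<bar> \<le> 1 / w ^ 20 \<and> \<bar>G k $ 1 $ 2\<bar> \<le> 1 / 100" if "k \<in> B" for k
      proof -
        have k: "k0 \<in> C" "k \<in> C" "f k0 = f k" using that k0 by (auto simp: B_def)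
        note pr' = pr[OF k, folded G_def]
        have "q k0 = 1" using d0 by (simp add: q_def)
        hence "\<bar>q k - 1\<bar> = \<bar>\<delta> k0 - \<delta> k\<bar> / \<delta> k0" using qd[of k k0] d0 by (simp add: abs_divide abs_minus_commute)
        also have "\<dots> \<le> (1 / w\<^sup>2) / (1/2)" using pr'(7) d0 by (intro frac_le) auto
        finally have "\<bar>q k - 1\<bar> \<le> 2 / w\<^sup>2" by simp
        moreover have "1 / q k = \<delta> k0 / \<delta> k" by (simp add: q_def)
        ultimately show ?thesis using pr' \<kappa>(2) by (simp add: q_def)
      qed
      moreover have "1 / (2 * w ^ 8) \<le> \<bar>q k - q k'\<bar>" if k: "k \<in> B" "k' \<in> B" "(k, k') \<notin> bad" for k k'
      proof -
        have "1 / w ^ 8 < \<bar>\<delta> k - \<delta> k'\<bar>" using k by (auto simp: bad_def P_def B_def)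
        hence "(1 / w ^ 8) / 2 \<le> \<bar>\<delta> k - \<delta> k'\<bar> / \<delta> k0" using d0 wp by (intro frac_le) auto
        thus ?thesis using d0 by (simp add: qd abs_divide)
      qed
      moreover have "k0 \<in> B" "B \<subseteq> {..<K}" "thick \<rho>1 (uu (real k0) ** x)" using k0 C by (auto simp: B_def C_def)
      moreover have "bad \<subseteq> B \<times> B" "real (card bad) \<le> (real (card B))\<^sup>2 * (\<eta> / w)" using small by (auto simp: bad_def B_def)
      ultimately show "\<exists>k0 B G q bad. k0 \<in> B \<and> B \<subseteq> {..<S ^ 30} \<and> thick \<rho>1 (uu (real k0) ** (dg (sqrt (real S ^ 30)) ** z)) \<and>
      (\<forall>k\<in>B. \<bar>q k - 1\<bar> \<le> 2 / (real S)\<^sup>2 \<and> G k \<in> SL2 \<and>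
        (\<exists>\<gamma>\<in>\<Gamma>. G k ** (uu (real k0) ** (dg (sqrt (real S ^ 30)) ** z)) = uu (real k) ** (dg (sqrt (real S ^ 30)) ** z) ** \<gamma>) \<and>
        \<bar>G k $ 1 $ 1 - 1 / q k\<bar> \<le> 1 / real S ^ 20 \<and> \<bar>G k $ 2 $ 2 - q k\<bar> \<le> 1 / real S ^ 20 \<and>
        \<bar>G k $ 2 $ 1\<bar> \<le> 1 / real S ^ 20 \<and> \<bar>G k $ 1 $ 2\<bar> \<le> 1 / 100) \<and>
      bad \<subseteq> B \<times> B \<and> real (card bad) \<le> (real (card B))\<^sup>2 * (\<eta> / real S) \<and>
      (\<forall>k\<in>B. \<forall>k'\<in>B. (k, k') \<notin> bad \<longrightarrow> 1 / (2 * real S ^ 8) \<le> \<bar>q k - q k'\<bar>)"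
        unfolding w_def[symmetric] K[symmetric] K_def[symmetric] x_def[symmetric]
        by (intro exI[of _ k0] exI[of _ B] exI[of _ G] exI[of _ q] exI[of _ bad]) blast
    qed
  qed
qed

text \<open>If all the points missed U, then, seen from one window of the class, the times of visits
  to U1 would avoid the teeth of every progression of the class, against
  \<open>comb_contradiction\<close>.\<close>

lemma almost_progression_hits:
  assumes W: "open W" "U = SL2 \<inter> W" and U: "rinv U" "U \<noteq> {}" and \<rho>: "\<rho> > 0"
  shows "\<exists>e0>0. \<exists>S0::nat. \<forall>S y s \<phi> p. S \<ge> S0 \<longrightarrow> y \<in> SL2 \<longrightarrow> thick \<rho> (dg (1 / sqrt (real S ^ 40)) ** y) \<longrightarrow>
    real S / 10 \<le> s \<longrightarrow> s \<le> 10 * real S \<longrightarrow>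
    (\<forall>j::int. 0 \<le> \<phi> + s * of_int j \<longrightarrow> \<phi> + s * of_int j \<le> real S ^ 40 \<longrightarrow> \<bar>p j - (\<phi> + s * of_int j)\<bar> \<le> e0) \<longrightarrow>
    (\<exists>j::int. 0 \<le> \<phi> + s * of_int j \<and> \<phi> + s * of_int j \<le> real S ^ 40 \<and> uu (p j) ** y \<in> U)"
proof -
  obtain U1 W1 eU where U1: "open W1" "U1 = SL2 \<inter> W1" "rinv U1" "U1 \<noteq> {}" and eU: "0 < eU" "eU \<le> 1"
    and sh: "\<And>b x. b \<in> SL2 \<Longrightarrow> ent eU (b - mat 1) \<Longrightarrow> x \<in> U1 \<Longrightarrow> b ** x \<in> U"
    using shrink_open[OF W U] by metis
  obtain \<rho>1 where \<rho>1: "\<rho>1 > 0" and cc: "\<forall>\<eta>>0. \<exists>S0::nat. \<forall>S z. S \<ge> S0 \<longrightarrow> z \<in> SL2 \<longrightarrow> thick \<rho> z \<longrightarrow>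
    (\<exists>k0 B G q bad. k0 \<in> B \<and> B \<subseteq> {..<S ^ 30} \<and> thick \<rho>1 (uu (real k0) ** (dg (sqrt (real S ^ 30)) ** z)) \<and>
      (\<forall>k\<in>B. \<bar>q k - 1\<bar> \<le> 2 / (real S)\<^sup>2 \<and> G k \<in> SL2 \<and>
        (\<exists>\<gamma>\<in>\<Gamma>. G k ** (uu (real k0) ** (dg (sqrt (real S ^ 30)) ** z)) = uu (real k) ** (dg (sqrt (real S ^ 30)) ** z) ** \<gamma>) \<and>
        \<bar>G k $ 1 $ 1 - 1 / q k\<bar> \<le> 1 / real S ^ 20 \<and> \<bar>G k $ 2 $ 2 - q k\<bar> \<le> 1 / real S ^ 20 \<and>
        \<bar>G k $ 2 $ 1\<bar> \<le> 1 / real S ^ 20 \<and> \<bar>G k $ 1 $ 2\<bar> \<le> 1 / 100) \<and>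
      bad \<subseteq> B \<times> B \<and> real (card bad) \<le> (real (card B))\<^sup>2 * (\<eta> / real S) \<and>
      (\<forall>k\<in>B. \<forall>k'\<in>B. (k, k') \<notin> bad \<longrightarrow> 1 / (2 * real S ^ 8) \<le> \<bar>q k - q k'\<bar>))"
    using core_class[OF \<rho>] by blast
  have "\<rho>1 / 1024 > 0" using \<rho>1 by simp
  from orbit_hits[OF U1 this] obtain c0 T0 where c0: "c0 > 0" and oh: "\<And>z T. z \<in> SL2 \<Longrightarrow> thick (\<rho>1 / 1024) z \<Longrightarrow>
     T \<ge> T0 \<Longrightarrow> c0 * T \<le> measure lborel {t \<in> {0..T}. uu t ** (dg (sqrt T) ** z) \<in> U1}" by blast
  define c where "c = min c0 1"
  have c: "0 < c" "c \<le> 1" "c \<le> c0" using c0 by (auto simp: c_def)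
  define \<tau> where "\<tau> = min (1/10) (eU / 6)"
  have \<tau>: "0 < \<tau>" "\<tau> \<le> 1/10" "6 * \<tau> \<le> eU" using eU by (auto simp: \<tau>_def)
  \<comment> \<open>One half of the tolerance \<tau> is the half-width of the teeth; the other half
    pays for the errors of the frames.\<close>
  define e where "e = \<tau> / 2"
  have e: "0 < e" "e \<le> 1/20" "2 * e = \<tau>" using \<tau> by (auto simp: e_def)
  \<comment> \<open>This \<eta> gives the bound on bad pairs that \<open>comb_contradiction\<close>
    requires, since 2 s \<le> 20 S.\<close>
  have "e * (c / 8) / 20 > 0" using e c by simp
  note cc' = mp[OF spec[OF cc] this]
  then obtain S1 :: nat where S1: "\<forall>S z. S \<ge> S1 \<longrightarrow> z \<in> SL2 \<longrightarrow> thick \<rho> z \<longrightarrow>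
    (\<exists>k0 B G q bad. k0 \<in> B \<and> B \<subseteq> {..<S ^ 30} \<and> thick \<rho>1 (uu (real k0) ** (dg (sqrt (real S ^ 30)) ** z)) \<and>
      (\<forall>k\<in>B. \<bar>q k - 1\<bar> \<le> 2 / (real S)\<^sup>2 \<and> G k \<in> SL2 \<and>
        (\<exists>\<gamma>\<in>\<Gamma>. G k ** (uu (real k0) ** (dg (sqrt (real S ^ 30)) ** z)) = uu (real k) ** (dg (sqrt (real S ^ 30)) ** z) ** \<gamma>) \<and>
        \<bar>G k $ 1 $ 1 - 1 / q k\<bar> \<le> 1 / real S ^ 20 \<and> \<bar>G k $ 2 $ 2 - q k\<bar> \<le> 1 / real S ^ 20 \<and>
        \<bar>G k $ 2 $ 1\<bar> \<le> 1 / real S ^ 20 \<and> \<bar>G k $ 1 $ 2\<bar> \<le> 1 / 100) \<and>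
      bad \<subseteq> B \<times> B \<and> real (card bad) \<le> (real (card B))\<^sup>2 * (e * (c / 8) / 20 / real S) \<and>
      (\<forall>k\<in>B. \<forall>k'\<in>B. (k, k') \<notin> bad \<longrightarrow> 1 / (2 * real S ^ 8) \<le> \<bar>q k - q k'\<bar>))"
    by (rule exE)
  define S0 where "S0 = nat \<lceil>100 + real S1 + \<bar>T0\<bar> + 10 / e + 480 / (e * (c / 8)) + 1280 / (c / 8)\<rceil>"
  show ?thesis
  proof (intro exI[of _ \<tau>] conjI \<tau>(1) exI[of _ S0] allI impI)
    fix S :: nat and y :: "real^2^2" and s \<phi> :: real and p :: "int \<Rightarrow> real"
    assume SS: "S \<ge> S0" and y: "y \<in> SL2" "thick \<rho> (dg (1 / sqrt (real S ^ 40)) ** y)" and s: "real S / 10 \<le> s" "s \<le> 10 * real S"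
      and p: "\<forall>j::int. 0 \<le> \<phi> + s * of_int j \<longrightarrow> \<phi> + s * of_int j \<le> real S ^ 40 \<longrightarrow> \<bar>p j - (\<phi> + s * of_int j)\<bar> \<le> \<tau>"
    define w where "w = real S"
    have "0 \<le> \<bar>T0\<bar>" "0 \<le> 10 / e" "0 \<le> 480 / (e * (c / 8))" "0 \<le> 1280 / (c / 8)" using e c by auto
    moreover have "100 + real S1 + \<bar>T0\<bar> + 10 / e + 480 / (e * (c / 8)) + 1280 / (c / 8) \<le> w"
      using SS unfolding S0_def w_def by linarith
    ultimately have w: "w \<ge> 100" "real S1 \<le> w" "T0 \<le> w" "10 / e \<le> w" "480 / (e * (c / 8)) \<le> w" "1280 / (c / 8) \<le> w"
      by linarith+
    have w1: "w ^ i \<le> w ^ j" if "i \<le> j" for i j using w(1) that by (intro power_increasing) auto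
    have wp: "w ^ i > 0" for i using w by simp
    have s: "w / 10 \<le> s" "s \<le> 10 * w" "s > 0" using s w by (auto simp: w_def)
    have we: "10 \<le> e * w" "480 \<le> e * (c / 8) * w" "1280 \<le> c / 8 * w"
      using w(4-6) e c by (simp_all add: pos_divide_le_eq mult_ac)
    define L where "L = w ^ 10"
    have L: "100 \<le> L" "L > 0" using w1[of 1 10] w by (auto simp: L_def)
    define z where "z = dg (1 / sqrt (w ^ 40)) ** y"
    have zS: "z \<in> SL2" "thick \<rho> z" using y wp[of 40] w by (auto simp: z_def dg_SL2 w_def)
    define x where "x = dg (sqrt (w ^ 30)) ** z"
    have "S1 \<le> S" using w(2) by (simp add: w_def)
    note S1' = spec[OF spec[OF S1, of S], of z, THEN mp, OF this, THEN mp, OF zS(1), THEN mp, OF zS(2), folded w_def, folded x_def]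
    from S1'
    obtain k0 B G q bad where k0: "k0 \<in> B" "B \<subseteq> {..<S ^ 30}" "thick \<rho>1 (uu (real k0) ** x)"
      and B: "\<forall>k\<in>B. \<bar>q k - 1\<bar> \<le> 2 / w\<^sup>2 \<and> G k \<in> SL2 \<and>
        (\<exists>\<gamma>\<in>\<Gamma>. G k ** (uu (real k0) ** x) = uu (real k) ** x ** \<gamma>) \<and>
        \<bar>G k $ 1 $ 1 - 1 / q k\<bar> \<le> 1 / w ^ 20 \<and> \<bar>G k $ 2 $ 2 - q k\<bar> \<le> 1 / w ^ 20 \<and>
        \<bar>G k $ 2 $ 1\<bar> \<le> 1 / w ^ 20 \<and> \<bar>G k $ 1 $ 2\<bar> \<le> 1 / 100"
      and bad: "bad \<subseteq> B \<times> B" "real (card bad) \<le> (real (card B))\<^sup>2 * (e * (c / 8) / 20 / w)"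
      and sep: "\<forall>k\<in>B. \<forall>k'\<in>B. (k, k') \<notin> bad \<longrightarrow> 1 / (2 * w ^ 8) \<le> \<bar>q k - q k'\<bar>" by blast
    have xS: "x \<in> SL2" using zS wp[of 30] w by (simp add: x_def dg_SL2)
    have Lx: "dg (sqrt L) ** x = y"
    proof -
      have "sqrt L * sqrt (w ^ 30) = sqrt (w ^ 40)" by (simp add: L_def real_sqrt_mult[symmetric] power_add[symmetric])
      moreover have "sqrt (w ^ 40) * (1 / sqrt (w ^ 40)) = 1" using w by simp
      ultimately show ?thesis by (simp only: x_def z_def matrix_mul_assoc dg_mult) simp
    qed
    have Lk: "dg (sqrt L) ** (uu t ** x) = uu (L * t) ** y" for t
    proof -
      have "dg (sqrt L) ** (uu t ** x) = dg (sqrt L) ** uu t ** x" by (simp add: matrix_mul_assoc)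
      also have "dg (sqrt L) ** uu t = uu (L * t) ** dg (sqrt L)" using dg_uu[of "sqrt L" t] L by simp
      also have "uu (L * t) ** dg (sqrt L) ** x = uu (L * t) ** (dg (sqrt L) ** x)" by (simp add: matrix_mul_assoc)
      finally show ?thesis by (simp only: Lx)
    qed
    define g0 where "g0 = uu (real k0) ** x"
    have g0: "g0 \<in> SL2" "thick \<rho>1 g0" using k0 xS by (auto simp: g0_def)
    \<comment> \<open>Only the middle half of the segment is used: the frames shift and stretch time
      by a few percent of L, and the corresponding t must stay within [0, L].\<close>
    define A where "A = {t \<in> {0..L / 2}. uu t ** (uu (L / 4) ** (dg (sqrt L) ** g0)) \<in> U1}"
    define y0 where "y0 = uu (L / 4) ** (dg (sqrt L) ** g0)"
    have y0: "y0 \<in> SL2" using g0 L by (simp add: y0_def dg_SL2)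
    have mA: "c * (L / 2) \<le> measure lborel A"
    proof -
      \<comment> \<open>\<open>orbit_hits\<close> wants a segment whose length equals its
        renormalisation. Starting at time L / 4 and passing to length L / 2 costs a factor 32 of
        thickness each, hence 1024.\<close>
      define z' where "z' = dg (sqrt 2) ** (uu (1/4) ** g0)"
      have z'S: "z' \<in> SL2" using g0 by (simp add: z'_def dg_SL2)
      have "thick (\<rho>1 / 32 / (8 * 2\<^sup>2)) z'" unfolding z'_def
      proof (rule thick_conj)
        show "thick (\<rho>1 / 32) (uu (1/4) ** g0)" using thick_uu[OF g0] by simp
        have "sqrt 2 \<ge> 1" "sqrt 2 \<le> 2" by (auto simp: real_le_lsqrt)
        hence "1 / sqrt 2 \<le> 1 / 1" by (intro divide_left_mono) auto
        moreover have "0 < 1 / sqrt 2" by simp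
        ultimately have "\<bar>1 / sqrt 2\<bar> \<le> 2" "\<bar>sqrt 2\<bar> \<le> 2" using \<open>sqrt 2 \<le> 2\<close> \<open>sqrt 2 \<ge> 1\<close> by linarith+
        thus "ent 2 (dg (sqrt 2))" unfolding dg_def ent_mat2 by (intro conjI) (assumption | simp)+
      qed (use g0 in \<open>auto simp: dg_SL2\<close>)
      hence "thick (\<rho>1 / 1024) z'" by simp
      moreover have "T0 \<le> L / 2" using w(1,3) w1[of 2 10] unfolding L_def power2_eq_square
        using mult_right_mono[of 2 w w] by linarith
      ultimately have "c0 * (L / 2) \<le> measure lborel {t \<in> {0..L / 2}. uu t ** (dg (sqrt (L / 2)) ** z') \<in> U1}"
        using oh[OF z'S] by blast
      moreover have "dg (sqrt (L / 2)) ** z' = y0"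
      proof -
        have "sqrt (L / 2) * sqrt 2 = sqrt L" by (simp add: real_sqrt_mult[symmetric])
        hence "dg (sqrt (L / 2)) ** z' = dg (sqrt L) ** uu (1/4) ** g0"
          by (simp only: z'_def matrix_mul_assoc dg_mult)
        also have "dg (sqrt L) ** uu (1/4) = uu (L / 4) ** dg (sqrt L)" using dg_uu[of "sqrt L" "1/4"] L by simp
        finally show ?thesis by (simp add: y0_def matrix_mul_assoc)
      qed
      moreover have "c * (L / 2) \<le> c0 * (L / 2)" using c L by (intro mult_right_mono) auto
      ultimately show ?thesis unfolding A_def y0_def[symmetric] by simp
    qed
    have Ab: "A \<in> sets borel"
    proof -
      have "continuous_on UNIV (\<lambda>t. uu t ** y0)" unfolding uu_def by (intro continuous_intros)
      hence "open ((\<lambda>t. uu t ** y0) -` W1)" using U1 by (simp add: continuous_on_open_vimage)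
      moreover have "A = {0..L / 2} \<inter> ((\<lambda>t. uu t ** y0) -` W1)" using U1 y0 by (auto simp: A_def y0_def[symmetric])
      ultimately show ?thesis by auto
    qed
    show "\<exists>j::int. 0 \<le> \<phi> + s * of_int j \<and> \<phi> + s * of_int j \<le> real S ^ 40 \<and> uu (p j) ** y \<in> U"
    proof (rule ccontr)
      assume no: "\<not> (\<exists>j::int. 0 \<le> \<phi> + s * of_int j \<and> \<phi> + s * of_int j \<le> real S ^ 40 \<and> uu (p j) ** y \<in> U)"
      \<comment> \<open>The affine time of \<open>shear_position\<close> at t = \<phi> + s j - L k,
        with origin moved to L / 4, is \<open>ph k\<close> plus j times \<open>sp k\<close>.\<close>
      define ph where "ph k = q k * (L * G k $ 1 $ 2 + q k * (\<phi> - L * real k)) - L / 4" for k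
      define sp where "sp k = s * (q k)\<^sup>2" for k
      have q: "\<bar>q k - 1\<bar> \<le> 2 / w\<^sup>2" "\<bar>q k - 1\<bar> \<le> 2/100" "98/100 \<le> q k" "q k \<le> 102/100" if "k \<in> B" for k
      proof -
        show 1: "\<bar>q k - 1\<bar> \<le> 2 / w\<^sup>2" using B that by blast
        have "2 / w\<^sup>2 \<le> 2 / 100" using w1[of 1 2] w by (intro divide_left_mono) auto
        thus "\<bar>q k - 1\<bar> \<le> 2/100" using 1 by linarith
        thus "98/100 \<le> q k" "q k \<le> 102/100" by linarith+
      qed
      show False
      proof (rule comb_contradiction[of B c e s sp "L / 2" "s / (2 * w ^ 8)" bad A ph])
        show "finite B" using k0(2) finite_subset by blast
        show "B \<noteq> {}" using k0 by auto
        show "8 * e \<le> s" using e s w by linarith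
        show "\<bar>sp k - s\<bar> \<le> e * (c / 8) / 8" if k: "k \<in> B" for k
        proof -
          have "sp k - s = s * ((q k - 1) * (q k + 1))" by (simp add: sp_def power2_eq_square algebra_simps)
          hence "\<bar>sp k - s\<bar> = s * (\<bar>q k - 1\<bar> * \<bar>q k + 1\<bar>)" using s by (simp add: abs_mult)
          also have "\<dots> \<le> (10 * w) * ((2 / w\<^sup>2) * 3)" using s q[OF k] w by (intro mult_mono) auto
          also have "\<dots> = 60 / w" using w by (simp add: power2_eq_square)
          also have "\<dots> \<le> e * (c / 8) / 8" using we(2) w by (simp add: pos_divide_le_eq)
          finally show ?thesis .
        qed
        have cw: "1280 * w \<le> c / 8 * w\<^sup>2" using mult_right_mono[OF we(3), of w] w by (simp add: power2_eq_square mult_ac)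
        show "64 * s / (c / 8) \<le> L / 2"
        proof -
          have "c / 8 * w\<^sup>2 \<le> c / 8 * L" unfolding L_def using c w1[of 2 10] by (intro mult_left_mono) auto
          hence "64 * s \<le> (c / 8 * L) / 2" using cw s(2) w(1) by linarith
          hence "64 * s \<le> L / 2 * (c / 8)" by (simp add: mult.commute)
          thus ?thesis using c by (simp add: pos_divide_le_eq)
        qed
        show "0 < s / (2 * w ^ 8)" using s w by simp
        show "24 * s\<^sup>2 \<le> c / 8 * (s / (2 * w ^ 8)) * (L / 2)"
        proof -
          have "L = w\<^sup>2 * w ^ 8" by (simp add: L_def power_add[symmetric])
          hence "L / w ^ 8 = w\<^sup>2" using wp[of 8] by (metis less_irrefl nonzero_mult_div_cancel_right)
          moreover have "c / 8 * (s / (2 * w ^ 8)) * (L / 2) = s * (c / 8 * (L / w ^ 8) / 4)" by simp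
          ultimately have "c / 8 * (s / (2 * w ^ 8)) * (L / 2) = s * (c / 8 * w\<^sup>2 / 4)" by (simp only:)
          moreover have "24 * s \<le> c / 8 * w\<^sup>2 / 4" using cw s(2) w by linarith
          hence "s * (24 * s) \<le> s * (c / 8 * w\<^sup>2 / 4)" using s by (intro mult_left_mono) auto
          moreover have "24 * s\<^sup>2 = s * (24 * s)" by (simp add: power2_eq_square)
          ultimately show ?thesis by (simp only:)
        qed
        show "s / (2 * w ^ 8) \<le> \<bar>sp k - sp k'\<bar>" if k: "k \<in> B" "k' \<in> B" "(k, k') \<notin> bad" for k k'
        proof -
          have "sp k - sp k' = s * ((q k - q k') * (q k + q k'))" by (simp add: sp_def power2_eq_square algebra_simps)
          hence "\<bar>sp k - sp k'\<bar> = s * (\<bar>q k - q k'\<bar> * \<bar>q k + q k'\<bar>)" using s by (simp add: abs_mult)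
          moreover have "s * ((1 / (2 * w ^ 8)) * 1) \<le> s * (\<bar>q k - q k'\<bar> * \<bar>q k + q k'\<bar>)"
            using s sep k q(3)[OF k(1)] q(3)[OF k(2)] by (intro mult_left_mono mult_mono) auto
          ultimately show ?thesis by simp
        qed
        show "real (card bad) \<le> (real (card B))\<^sup>2 * (e * (c / 8) / (2 * s))"
        proof -
          have "e * (c / 8) / 20 / w = e * (c / 8) / (20 * w)" by simp
          also have "\<dots> \<le> e * (c / 8) / (2 * s)" using s e c w by (intro divide_left_mono) auto
          finally have "(real (card B))\<^sup>2 * (e * (c / 8) / 20 / w) \<le> (real (card B))\<^sup>2 * (e * (c / 8) / (2 * s))"
            by (intro mult_left_mono) auto
          thus ?thesis using bad(2) by linarith
        qed
        show "A \<subseteq> {0..L / 2}" by (auto simp: A_def)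
        show "A \<inter> tooth e (ph k + sp k * real_of_int j) = {}"
          if k: "k \<in> B" and lo: "e \<le> ph k + sp k * real_of_int j" and hi: "ph k + sp k * real_of_int j \<le> L / 2 - e" for k j
        proof (rule ccontr)
          assume "A \<inter> tooth e (ph k + sp k * real_of_int j) \<noteq> {}"
          then obtain r where r: "r \<in> A" "\<bar>r - (ph k + sp k * real_of_int j)\<bar> \<le> e" by (force simp: tooth_def abs_le_iff)
          define t where "t = \<phi> + s * real_of_int j - L * real k"
          define v where "v = L * G k $ 1 $ 2 + t * q k"
          have pv: "ph k + sp k * real_of_int j = q k * v - L / 4"
            by (simp add: ph_def sp_def v_def t_def power2_eq_square algebra_simps)
          have qv: "L / 4 \<le> q k * v" "q k * v \<le> 3/4 * L" using lo hi e unfolding pv by linarith+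
          obtain \<gamma> where g: "\<gamma> \<in> \<Gamma>" "G k ** g0 = uu (real k) ** x ** \<gamma>" using B k unfolding g0_def by blast
          have GB: "G k \<in> SL2" "\<bar>G k $ 1 $ 1 - 1 / q k\<bar> \<le> 1 / w ^ 20" "\<bar>G k $ 2 $ 2 - q k\<bar> \<le> 1 / w ^ 20"
            "\<bar>G k $ 2 $ 1\<bar> \<le> 1 / w ^ 20" "\<bar>G k $ 1 $ 2\<bar> \<le> 1/100" using B k by auto
          have "\<bar>L * G k $ 1 $ 2\<bar> \<le> L * (1/100)" unfolding abs_mult using L GB(5) by (intro mult_mono) auto
          hence Lb: "v - t * q k \<le> L / 100" "t * q k - v \<le> L / 100" unfolding v_def by linarith+
          have "q k * v > 0" using qv L by linarith
          hence vp: "v > 0" using q(3)[OF k] by (simp add: zero_less_mult_iff)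
          have v1: "q k * v \<le> 102/100 * v" "98/100 * v \<le> q k * v" using q(3,4)[OF k] vp by (intro mult_right_mono; simp)+
          have tq: "0 < t * q k" "t * q k \<le> 79/100 * L" using v1 qv Lb L by linarith+
          have tp: "t > 0" using tq(1) q(3)[OF k] by (simp add: zero_less_mult_iff)
          have "t * (98/100) \<le> t * q k" using tp q(3)[OF k] by (intro mult_left_mono) auto
          hence tL: "t \<le> L" using tq(2) L by linarith
          have te: "\<phi> + s * real_of_int j = L * real k + t" by (simp add: t_def)
          have rng: "0 \<le> \<phi> + s * real_of_int j" "\<phi> + s * real_of_int j \<le> real S ^ 40"
          proof -
            show "0 \<le> \<phi> + s * real_of_int j" unfolding te using tp L by simp
            have "k + 1 \<le> S ^ 30" using k k0(2) by auto
            hence "real (k + 1) \<le> real (S ^ 30)" by (rule of_nat_mono)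
            hence "real k + 1 \<le> w ^ 30" by (simp add: w_def)
            hence "L * (real k + 1) \<le> L * w ^ 30" using L by (intro mult_left_mono) auto
            also have "\<dots> = w ^ 40" by (simp add: L_def power_add[symmetric])
            finally show "\<phi> + s * real_of_int j \<le> real S ^ 40" unfolding te using tL by (simp add: w_def algebra_simps)
          qed
          have M1: "1 / w ^ 20 \<le> 1 / w" using w1[of 1 20] w by (intro divide_left_mono) auto
          have we1: "10 / w \<le> e" using we(1) w by (simp add: pos_divide_le_eq)
          have "uu (p j) ** y \<in> U"
          proof (rule window_hit[OF U(1) sh \<tau>(2,3) g0(1) y(1) g(1) GB(1) g(2) Lk _ _ _ GB(2-4) _ _ tL, where r = "r + L / 4" and e = e and p = "p j"])
            show "100 \<le> w ^ 20" "1 \<le> L" using w1[of 1 20] w L by auto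
            show "\<bar>q k - 1\<bar> \<le> 1/10" using q(2)[OF k] by linarith
            show "\<bar>G k $ 1 $ 2\<bar> \<le> 1/10" using GB(5) by linarith
            show "0 \<le> t" using tp by simp
            show "\<bar>r + L / 4 - q k * (L * G k $ 1 $ 2 + t * q k)\<bar> \<le> e" using r(2) unfolding pv v_def by (simp add: algebra_simps)
            show "uu (r + L / 4) ** (dg (sqrt L) ** g0) \<in> U1" using r(1) by (simp add: A_def matrix_mul_assoc uu_add)
            show "\<bar>p j - (L * real k + t)\<bar> \<le> \<tau>" using p[rule_format, OF rng] unfolding te .
            have "w ^ 20 = L * L" by (simp add: L_def power_add[symmetric])
            hence "10 * L / w ^ 20 = 10 / L" using L by simp
            also have "\<dots> \<le> 10 / w" unfolding L_def using w1[of 1 10] w by (intro divide_left_mono) auto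
            finally show "10 * L / w ^ 20 + e \<le> \<tau>" using we1 e by linarith
            have "1 / q k - 1 = (1 - q k) / q k" using q(3)[OF k] by (simp add: field_simps)
            also have "\<bar>\<dots>\<bar> \<le> (2 / w\<^sup>2) / (1/2)" unfolding abs_divide using q[OF k] by (intro frac_le) (auto simp: abs_minus_commute)
            also have "\<dots> = 4 / w\<^sup>2" by simp
            also have "\<dots> \<le> 4 / w" using w1[of 1 2] w by (intro divide_left_mono) auto
            finally have "\<bar>1 / q k - 1\<bar> \<le> 4 / w" .
            moreover have "2 / w ^ 20 = 2 * (1 / w ^ 20)" "4 / w = 4 * (1 / w)" "10 / w = 10 * (1 / w)" by simp_all
            moreover have "1 / w > 0" using w by simp
            ultimately show "2 / w ^ 20 + \<bar>1 / q k - 1\<bar> \<le> \<tau>" "1 / w ^ 20 \<le> \<tau>" using M1 we1 e by linarith+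
          qed
          thus False using no rng by blast
        qed
      qed (use e c mA Ab bad in auto)
    qed
  qed
qed

end

section \<open>The times \<open>n powr (1 + \<gamma>)\<close>\<close>

text \<open>Taylor to second order: for g \<le> 1/2 the second derivative beyond m \<ge> 1 is at
  most 2 / sqrt m.\<close>

lemma powr_taylor:
  fixes g m x y :: real
  assumes g: "0 < g" "g \<le> 1/2" and m: "m \<ge> 1" "m \<le> x" "m \<le> y"
  shows "\<bar>y powr (1 + g) - x powr (1 + g) - (1 + g) * x powr g * (y - x)\<bar> \<le> (y - x)\<^sup>2 / sqrt m"
proof (cases "y = x")
  case True thus ?thesis by simp
next
  case False
  define d where "d i = (if i = 0 then (\<lambda>t. t powr (1 + g)) else if i = 1 then (\<lambda>t. (1 + g) * t powr g)
     else (\<lambda>t. (1 + g) * g * t powr (g - 1)))" for i :: nat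
  have "\<exists>t. (if y < x then y < t \<and> t < x else x < t \<and> t < y) \<and>
     y powr (1 + g) = (\<Sum>i<2. d i x / fact i * (y - x) ^ i) + d 2 t / fact 2 * (y - x) ^ 2"
  proof (rule Taylor)
    show "d 0 = (\<lambda>y. y powr (1 + g))" by (simp add: d_def)
    show "\<forall>i t. i < 2 \<and> m \<le> t \<and> t \<le> max x y \<longrightarrow> DERIV (d i) t :> d (Suc i) t"
    proof (intro allI impI)
      fix i :: nat and t assume h: "i < 2 \<and> m \<le> t \<and> t \<le> max x y"
      hence t: "t > 0" using m by auto
      have "((\<lambda>t. t powr (1 + g)) has_real_derivative (1 + g) * t powr g) (at t)"
        using has_real_derivative_powr[OF t, of "1 + g"] by simp
      moreover have "((\<lambda>t. (1 + g) * t powr g) has_real_derivative (1 + g) * (g * t powr (g - 1))) (at t)"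
        by (intro DERIV_cmult has_real_derivative_powr t)
      moreover have "i = 0 \<or> i = 1" using h by auto
      ultimately show "DERIV (d i) t :> d (Suc i) t" by (auto simp: d_def mult.assoc)
    qed
  qed (use m False in auto)
  then obtain t where t: "if y < x then y < t \<and> t < x else x < t \<and> t < y"
    and e: "y powr (1 + g) = (\<Sum>i<2. d i x / fact i * (y - x) ^ i) + d 2 t / fact 2 * (y - x) ^ 2" by blast
  have tm: "m \<le> t" "t \<ge> 1" using t m by (auto split: if_splits)
  have "t powr (g - 1) \<le> t powr (- (1/2))" using g tm by (intro powr_mono) auto
  also have "\<dots> = inverse (t powr (1/2))" by (rule powr_minus)
  also have "\<dots> = 1 / sqrt t" using tm by (simp add: powr_half_sqrt inverse_eq_divide)
  also have "\<dots> \<le> 1 / sqrt m" using tm m by (intro divide_left_mono) auto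
  finally have b: "t powr (g - 1) \<le> 1 / sqrt m" .
  have eq: "y powr (1 + g) - x powr (1 + g) - (1 + g) * x powr g * (y - x) = ((1 + g) * g / 2) * (t powr (g - 1) * (y - x)\<^sup>2)"
    unfolding e by (simp add: d_def numeral_2_eq_2 sum.lessThan_Suc)
  have "(1 + g) * g \<le> 2 * 1" using g by (intro mult_mono) auto
  hence "((1 + g) * g / 2) * (t powr (g - 1) * (y - x)\<^sup>2) \<le> 1 * (1 / sqrt m * (y - x)\<^sup>2)"
    using b g m by (intro mult_mono mult_nonneg_nonneg) auto
  moreover have "0 \<le> ((1 + g) * g / 2) * (t powr (g - 1) * (y - x)\<^sup>2)" using g by simp
  ultimately show ?thesis unfolding eq by (simp add: abs_of_nonneg)
qed

text \<open>The progression is the tangent at the first integer beyond \<alpha>^(1/(1+g)). Indices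
  up to 2 S^40 occur, and the curvature costs their square over sqrt (N / 9), at most 12 / S^20
  because N \<ge> S^200.\<close>

lemma powers_almost_progression:
  fixes g N \<alpha> \<sigma> :: real and S :: nat
  assumes g: "0 < g" "g \<le> 1/2" and \<sigma>: "\<sigma> = 1 \<or> \<sigma> = -1" and S: "S \<ge> 100" "real S ^ 200 \<le> N"
    and SN: "N powr g \<le> real S" "real S \<le> 2 * N powr g" and \<alpha>: "N powr (1 + g) / 4 \<le> \<alpha>" "\<alpha> \<le> N powr (1 + g)"
  shows "\<exists>s \<phi>. \<exists>n::int \<Rightarrow> nat. real S / 10 \<le> s \<and> s \<le> 10 * real S \<and>
     (\<forall>j. 0 \<le> \<phi> + s * of_int j \<longrightarrow> \<phi> + s * of_int j \<le> real S ^ 40 \<longrightarrow>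
        n j \<ge> 1 \<and> \<bar>\<sigma> * (real (n j) powr (1 + g) - \<alpha>) - (\<phi> + s * of_int j)\<bar> \<le> 12 / real S)"
proof -
  define w where "w = real S"
  have w: "w \<ge> 100" using S by (simp add: w_def)
  have w1: "w ^ i \<le> w ^ j" if "i \<le> j" for i j using w that by (intro power_increasing) auto
  have NS: "w ^ 200 \<le> N" using S by (simp add: w_def)
  have w2: "100 * w ^ 40 \<le> w ^ 41"
    using mult_right_mono[OF w, of "w ^ 40"] w power_Suc[of w 40] by simp
  have w41: "w ^ 41 \<le> N" using NS w1[of 41 200] by linarith
  have wN: "100 * w ^ 40 \<le> N" using w2 w41 by linarith
  have w40: "w ^ 40 \<ge> 100" using w1[of 1 40] w by simp
  have N: "N \<ge> 1" "N \<ge> 10000" using wN w40 by linarith+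
  define A where "A = \<alpha> powr (1 / (1 + g))"
  have ap: "\<alpha> > 0" 
  proof -
    have "N powr (1 + g) > 0" using N by simp
    thus ?thesis using \<alpha>(1) by linarith
  qed
  have Ag: "A powr (1 + g) = \<alpha>" using ap g by (simp add: A_def powr_powr)
  have AN: "N / 4 \<le> A" "A \<le> N"
  proof -
    have "(N powr (1 + g)) powr (1 / (1 + g)) = N" using N g by (simp add: powr_powr)
    moreover have "\<alpha> powr (1 / (1 + g)) \<le> (N powr (1 + g)) powr (1 / (1 + g))" using \<alpha> ap g by (intro powr_mono2) auto
    ultimately show "A \<le> N" by (simp add: A_def)
    have "(1/4::real) powr (1 + g) \<le> (1/4) powr 1" using g by (intro powr_mono') auto
    hence "(1/4) powr (1 + g) * N powr (1 + g) \<le> (1/4) powr 1 * N powr (1 + g)" by (intro mult_right_mono) auto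
    moreover have "(1/4 * N) powr (1 + g) = (1/4) powr (1 + g) * N powr (1 + g)" by (rule powr_mult)
    ultimately have "(N / 4) powr (1 + g) \<le> N powr (1 + g) / 4" by simp
    hence "((N / 4) powr (1 + g)) powr (1 / (1 + g)) \<le> \<alpha> powr (1 / (1 + g))" using \<alpha> g N by (intro powr_mono2) auto
    thus "N / 4 \<le> A" using N g by (simp add: A_def powr_powr)
  qed
  define n0 where "n0 = \<lceil>A\<rceil>"
  define x where "x = real_of_int n0"
  have x: "A \<le> x" "x \<le> A + 1" by (simp_all add: x_def n0_def)
  hence xN: "N / 4 \<le> x" "x \<le> 2 * N" using AN N by linarith+
  define s where "s = (1 + g) * x powr g"
  define \<phi> where "\<phi> = \<sigma> * (x powr (1 + g) - \<alpha>)"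
  have s: "w / 8 \<le> s" "s \<le> 4 * w"
  proof -
    have "N powr g / 4 \<le> (N / 4) powr g"
    proof -
      have "(1/4::real) powr 1 \<le> (1/4) powr g" using g by (intro powr_mono') auto
      hence "(1/4) powr 1 * N powr g \<le> (1/4) powr g * N powr g" by (intro mult_right_mono) auto
      moreover have "(1/4 * N) powr g = (1/4) powr g * N powr g" by (rule powr_mult)
      ultimately show ?thesis by simp
    qed
    also have "\<dots> \<le> x powr g" using xN N g by (intro powr_mono2) auto
    also have "\<dots> \<le> s" using g mult_right_mono[of 1 "1 + g" "x powr g"] by (simp add: s_def)
    finally show "w / 8 \<le> s" using SN by (simp add: w_def)
    have "x powr g \<le> (2 * N) powr g" using xN N g by (intro powr_mono2) auto
    also have "\<dots> = 2 powr g * N powr g" using N by (simp add: powr_mult)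
    also have "\<dots> \<le> 2 powr 1 * w" using SN g by (intro mult_mono powr_mono) (auto simp: w_def)
    finally have "x powr g \<le> 2 * w" by simp
    hence "s \<le> 2 * (2 * w)" unfolding s_def using g by (intro mult_mono) auto
    thus "s \<le> 4 * w" by simp
  qed
  have s1: "s \<ge> 1" using s w by linarith
  have ph: "\<bar>\<phi>\<bar> \<le> 2 * s"
  proof -
    have "\<bar>A powr (1 + g) - x powr (1 + g) - (1 + g) * x powr g * (A - x)\<bar> \<le> (A - x)\<^sup>2 / sqrt 1"
      using g AN N x by (intro powr_taylor) auto
    moreover have "\<bar>A - x\<bar> \<le> 1" using x by linarith
    hence "(A - x)\<^sup>2 \<le> 1" using abs_square_le_1 by blast
    moreover have "\<bar>s * (A - x)\<bar> \<le> s * 1" unfolding abs_mult using x s1 by (intro mult_mono) auto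
    ultimately have "\<bar>A powr (1 + g) - x powr (1 + g)\<bar> \<le> 2 * s" unfolding s_def[symmetric] using s1 by simp
    thus ?thesis unfolding \<phi>_def Ag using \<sigma> by (auto simp: abs_mult abs_minus_commute)
  qed
  \<comment> \<open>For \<sigma> = -1 larger n lie further back, so the index is reversed to keep
    the step positive.\<close>
  define k where "k j = (if \<sigma> = 1 then n0 + j else n0 - j)" for j
  define n where "n j = nat (k j)" for j
  have main: "n j \<ge> 1 \<and> \<bar>\<sigma> * (real (n j) powr (1 + g) - \<alpha>) - (\<phi> + s * of_int j)\<bar> \<le> 12 / w"
    if j: "0 \<le> \<phi> + s * of_int j" "\<phi> + s * of_int j \<le> w ^ 40" for j
  proof -
    define J where "J = real_of_int j"
    have "\<bar>s * J\<bar> \<le> w ^ 40 + 2 * s" using j ph unfolding J_def by linarith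
    also have "\<dots> \<le> s * (w ^ 40 + 2)" using s1 w40 mult_right_mono[of 1 s "w ^ 40"] by (simp add: algebra_simps)
    finally have "\<bar>J\<bar> \<le> w ^ 40 + 2" using s1 by (simp add: abs_mult)
    hence J: "\<bar>J\<bar> \<le> 2 * w ^ 40" using w40 by linarith
    have kx: "real_of_int (k j) = x + \<sigma> * J" using \<sigma> by (auto simp: k_def x_def J_def)
    have "\<bar>\<sigma> * J\<bar> \<le> 2 * w ^ 40" using J \<sigma> by auto
    hence k: "N / 9 \<le> real_of_int (k j)" using kx xN wN by linarith
    hence kp: "k j \<ge> 1" using N by linarith
    hence nk: "real (n j) = real_of_int (k j)" "n j \<ge> 1" by (auto simp: n_def)
    have "\<bar>real (n j) powr (1 + g) - x powr (1 + g) - (1 + g) * x powr g * (real (n j) - x)\<bar> \<le> (real (n j) - x)\<^sup>2 / sqrt (N / 9)"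
      using g N xN k nk by (intro powr_taylor) auto
    also have "(real (n j) - x)\<^sup>2 = J\<^sup>2" using \<sigma> kx nk by auto
    also have "J\<^sup>2 / sqrt (N / 9) \<le> (2 * w ^ 40)\<^sup>2 / (w ^ 100 / 3)"
    proof (rule frac_le)
      show "J\<^sup>2 \<le> (2 * w ^ 40)\<^sup>2" using power_mono[OF J, of 2] by simp
      have "(w ^ 100)\<^sup>2 \<le> N" using NS by (simp add: power_mult[symmetric])
      hence "w ^ 100 \<le> sqrt N" by (rule real_le_rsqrt)
      thus "w ^ 100 / 3 \<le> sqrt (N / 9)" by (simp add: real_sqrt_divide)
    qed (use w in auto)
    also have "\<dots> = 12 * (w ^ 80 / w ^ 100)" by (simp add: power_mult_distrib power_mult[symmetric])
    also have "w ^ 80 / w ^ 100 = 1 / w ^ 20"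
    proof -
      have "w ^ 100 = w ^ 80 * w ^ 20" by (simp add: power_add[symmetric])
      thus ?thesis using w by (simp only: divide_divide_eq_left[symmetric]) simp
    qed
    also have "12 * (1 / w ^ 20) \<le> 12 * (1 / w)" using w w1[of 1 20] by (intro mult_left_mono divide_left_mono) auto
    finally have "\<bar>real (n j) powr (1 + g) - x powr (1 + g) - s * (real (n j) - x)\<bar> \<le> 12 / w" by (simp add: s_def)
    moreover have "\<sigma> * (real (n j) powr (1 + g) - \<alpha>) - (\<phi> + s * J) =
       \<sigma> * (real (n j) powr (1 + g) - x powr (1 + g) - s * (real (n j) - x))"
      using \<sigma> unfolding nk kx \<phi>_def by (auto simp: algebra_simps)
    ultimately show ?thesis using nk(2) \<sigma> unfolding J_def by (auto simp: abs_mult)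
  qed
  show ?thesis using main s w unfolding w_def by (intro exI[of _ s] exI[of _ \<phi>] exI[of _ n]) auto
qed

context lattice
begin

text \<open>R is taken from the scales at which g returns to the thick part, N is defined by
  N^(1+\<gamma>) = R and S is N^\<gamma> rounded up. The window is sought at times comparable to R,
  where consecutive times differ by an amount comparable to S.\<close>

lemma sparse_orbit_hits:
  assumes g: "g \<in> SL2" "\<And>t. t \<noteq> 0 \<Longrightarrow> uu t \<notin> conj_grp g"
    and W: "open W" "U = SL2 \<inter> W" and U: "rinv U" "U \<noteq> {}"
    and \<sigma>: "\<sigma> = 1 \<or> \<sigma> = -1" and \<gamma>: "0 < \<gamma>" "\<gamma> < 1/1000"
  shows "\<exists>n::nat. n \<ge> 1 \<and> uu (\<sigma> * real n powr (1 + \<gamma>)) ** g \<in> U"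
proof -
  obtain \<rho> where \<rho>: "\<rho> > 0" and ret: "\<forall>R0. \<exists>R\<ge>R0. R > 0 \<and> thick \<rho> (dg (1 / sqrt R) ** g)"
    using thick_return[OF g] by blast
  have \<rho>': "\<rho> / 32 > 0" using \<rho> by simp
  from nondivergence[OF this, of "1/8"] obtain \<epsilon> T0 where \<epsilon>: "\<epsilon> > 0" and nd: "\<forall>z T. z \<in> SL2 \<longrightarrow> thick (\<rho> / 32) z \<longrightarrow> T \<ge> T0 \<longrightarrow>
     real (card {k::nat. real k \<le> T \<and> \<not> thick \<epsilon> (uu (real k) ** (dg (sqrt T) ** z))}) \<le> 1/8 * T" by auto
  obtain e0 S0 where e0: "e0 > 0" and S0: "\<forall>S y s \<phi> p. S \<ge> S0 \<longrightarrow> y \<in> SL2 \<longrightarrow> thick \<epsilon> (dg (1 / sqrt (real S ^ 40)) ** y) \<longrightarrow>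
    real S / 10 \<le> s \<longrightarrow> s \<le> 10 * real S \<longrightarrow>
    (\<forall>j::int. 0 \<le> \<phi> + s * of_int j \<longrightarrow> \<phi> + s * of_int j \<le> real S ^ 40 \<longrightarrow> \<bar>p j - (\<phi> + s * of_int j)\<bar> \<le> e0) \<longrightarrow>
    (\<exists>j::int. 0 \<le> \<phi> + s * of_int j \<and> \<phi> + s * of_int j \<le> real S ^ 40 \<and> uu (p j) ** y \<in> U)"
    using almost_progression_hits[OF W U \<epsilon>] by metis
  define Q where "Q = 100 + real S0 + 12 / e0 + \<bar>T0\<bar>"
  have Q: "Q \<ge> 100" "Q \<ge> real S0" "Q \<ge> 12 / e0" "Q \<ge> T0"
  proof -
    have "12 / e0 \<ge> 0" "\<bar>T0\<bar> \<ge> 0" "T0 \<le> \<bar>T0\<bar>" using e0 by auto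
    thus "Q \<ge> 100" "Q \<ge> real S0" "Q \<ge> 12 / e0" "Q \<ge> T0" unfolding Q_def by linarith+
  qed
  \<comment> \<open>The first entry makes N^\<gamma> at least Q. The second, together with \<gamma>
    < 1/1000, gives S^200 \<le> 2^200 N^(1/5) \<le> N.\<close>
  define N0 where "N0 = max (Q powr (1 / \<gamma>)) (2 ^ 1000)"
  obtain R where R: "R \<ge> N0 powr (1 + \<gamma>)" "R > 0" "thick \<rho> (dg (1 / sqrt R) ** g)" using ret by blast
  define N where "N = R powr (1 / (1 + \<gamma>))"
  have RN: "N powr (1 + \<gamma>) = R" using R \<gamma> by (simp add: N_def powr_powr)
  have N0: "N0 \<ge> 2 ^ 1000" "N0 > 0" by (auto simp: N0_def less_max_iff_disj)
  have NN0: "N \<ge> N0"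
  proof -
    have "(N0 powr (1 + \<gamma>)) powr (1 / (1 + \<gamma>)) \<le> R powr (1 / (1 + \<gamma>))" using R \<gamma> by (intro powr_mono2) auto
    thus ?thesis using N0(2) \<gamma> by (simp add: N_def powr_powr)
  qed
  have N2: "N \<ge> 2 ^ 1000" using NN0 N0 by linarith
  have N1: "N \<ge> 1" using N2 one_le_power[of "2::real" 1000] by linarith
  have Ng: "Q \<le> N powr \<gamma>"
  proof -
    have "Q = (Q powr (1 / \<gamma>)) powr \<gamma>" using Q \<gamma> by (simp add: powr_powr)
    also have "\<dots> \<le> N powr \<gamma>" using NN0 \<gamma> by (intro powr_mono2) (auto simp: N0_def)
    finally show ?thesis .
  qed
  define S where "S = nat \<lceil>N powr \<gamma>\<rceil>"
  define w where "w = real S"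
  have Sw: "N powr \<gamma> \<le> w" "w \<le> N powr \<gamma> + 1" using Ng Q by (auto simp: w_def S_def)
  have w: "w \<ge> 100" "real S0 \<le> w" "12 / e0 \<le> w" "T0 \<le> w" "w \<le> 2 * N powr \<gamma>" using Sw Ng Q by linarith+
  have w1: "w ^ i \<le> w ^ j" if "i \<le> j" for i j using w(1) that by (intro power_increasing) auto
  have w200: "w ^ 200 \<le> N"
  proof -
    have "w ^ 200 \<le> (2 * N powr (1/1000)) ^ 200"
    proof (rule power_mono)
      have "N powr \<gamma> \<le> N powr (1/1000)" using N1 \<gamma> by (intro powr_mono) auto
      thus "w \<le> 2 * N powr (1/1000)" using w by linarith
    qed (use w in simp)
    also have "\<dots> = 2 ^ 200 * N powr (1/5)"
      using N1 by (simp only: power_mult_distrib) (simp add: powr_realpow[symmetric] powr_powr powr_power)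
    also have "2 ^ 200 \<le> N powr (1/5)"
    proof -
      have "(2::real) ^ 200 = 2 powr 200" by (rule powr_numeral[symmetric]) simp
      also have "2 powr 200 = (2 powr 1000) powr (1/5::real)" unfolding powr_powr by (rule arg_cong[where f = "\<lambda>x. 2 powr x"]) simp
      also have "2 powr 1000 = (2::real) ^ 1000" by (rule powr_numeral) simp
      also have "((2::real) ^ 1000) powr (1/5) \<le> N powr (1/5)" using N2 by (intro powr_mono2) auto
      finally show ?thesis .
    qed
    also have "N powr (1/5) * N powr (1/5) = N powr (2/5)" by (simp add: powr_add[symmetric])
    also have "\<dots> \<le> N powr 1" using N1 by (intro powr_mono) auto
    finally show ?thesis using N1 by simp
  qed
  define T where "T = w ^ 40"
  have T: "T > 0" "w \<le> T" using w w1[of 1 40] by (auto simp: T_def)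
  have RR: "R \<ge> N" using RN N1 \<gamma> powr_mono[of 1 "1 + \<gamma>" N] by simp
  define X where "X = R / T"
  have X: "w \<le> X"
  proof -
    have "w * T = w ^ 41" using power_Suc[of w 40] by (simp add: T_def)
    also have "\<dots> \<le> R" using w1[of 41 200] w200 RR by linarith
    finally show ?thesis using T by (simp add: X_def pos_le_divide_eq)
  qed
  \<comment> \<open>For \<sigma> = -1 the segment is traversed forwards from its far end, since the
    lemmas on segments speak of positive times.\<close>
  define y0 where "y0 = (if \<sigma> = 1 then g else uu (- R) ** g)"
  define z where "z = dg (1 / sqrt R) ** y0"
  have y0: "y0 \<in> SL2" using g by (simp add: y0_def)
  have zS: "z \<in> SL2" using y0 R by (simp add: z_def dg_SL2)
  have zt: "thick (\<rho> / 32) z"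
  proof (cases "\<sigma> = 1")
    case True
    thus ?thesis using R(3) \<rho> thick_mono[OF R(3), of "\<rho> / 32"] by (simp add: z_def y0_def)
  next
    case False
    have "dg (1 / sqrt R) ** uu (- R) = uu (-1) ** dg (1 / sqrt R)"
      using dg_uu[of "1 / sqrt R" "- R"] R(2) by (simp add: power_divide)
    hence "z = uu (-1) ** (dg (1 / sqrt R) ** g)" using False by (simp add: z_def y0_def matrix_mul_assoc)
    moreover have "thick (\<rho> / (8 * 2\<^sup>2)) (uu (-1) ** (dg (1 / sqrt R) ** g))"
      using R g by (intro thick_conj) (auto simp: dg_SL2 uu_def ent_mat2)
    ultimately show ?thesis by simp
  qed
  have dz: "uu t ** (dg (sqrt X) ** z) = dg (1 / sqrt T) ** (uu (t * T) ** y0)" for t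
  proof -
    have "sqrt X * (1 / sqrt R) = 1 / sqrt T" using R(2) by (simp add: X_def real_sqrt_divide)
    hence "dg (sqrt X) ** z = dg (1 / sqrt T) ** y0" by (simp only: z_def matrix_mul_assoc dg_mult)
    moreover have "dg (1 / sqrt T) ** uu (t * T) = uu t ** dg (1 / sqrt T)"
      using dg_uu[of "1 / sqrt T" "t * T"] T by (simp add: power_divide)
    ultimately show ?thesis by (simp add: matrix_mul_assoc)
  qed
  \<comment> \<open>At most X / 8 integers are bad, while the middle half contains about X / 2. The
    middle keeps both k T and R - k T comparable to R, as either sign needs.\<close>
  have "\<exists>k::nat. X / 4 \<le> real k \<and> real k \<le> 3/4 * X \<and> thick \<epsilon> (uu (real k) ** (dg (sqrt X) ** z))"
  proof (rule ccontr)
    assume n: "\<not> ?thesis"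
    define D where "D = {k::nat. real k \<le> X \<and> \<not> thick \<epsilon> (uu (real k) ** (dg (sqrt X) ** z))}"
    have fD: "finite D"
    proof (rule finite_subset)
      show "D \<subseteq> {..nat \<lfloor>X\<rfloor>}" by (auto simp: D_def le_nat_floor)
    qed simp
    define I where "I = {nat \<lceil>X / 4\<rceil>..nat \<lfloor>3/4 * X\<rfloor>}"
    have "I \<subseteq> D"
    proof
      fix k assume "k \<in> I"
      hence "nat \<lceil>X / 4\<rceil> \<le> k" "k \<le> nat \<lfloor>3/4 * X\<rfloor>" by (auto simp: I_def)
      hence "X / 4 \<le> real k" "real k \<le> 3/4 * X" using X w by linarith+
      thus "k \<in> D" using n X w by (auto simp: D_def)
    qed
    hence "card I \<le> card D" using fD by (intro card_mono)
    moreover have "real (card I) \<ge> 3/4 * X - X / 4 - 1" unfolding I_def card_atLeastAtMost using X w by linarith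
    moreover have "real (card D) \<le> 1/8 * X" unfolding D_def using nd zS zt X w by auto
    ultimately show False using X w by linarith
  qed
  then obtain k :: nat where k: "X / 4 \<le> real k" "real k \<le> 3/4 * X" "thick \<epsilon> (dg (1 / sqrt T) ** (uu (real k * T) ** y0))"
    unfolding dz by blast
  define y where "y = uu (real k * T) ** y0"
  define \<alpha> where "\<alpha> = (if \<sigma> = 1 then real k * T else R - real k * T)"
  have XT: "X * T = R" using T by (simp add: X_def)
  have kT: "R / 4 \<le> real k * T" "real k * T \<le> 3/4 * R"
    using mult_right_mono[OF k(1), of T] mult_right_mono[OF k(2), of T] T XT by (auto simp: mult.assoc)
  have \<alpha>: "R / 4 \<le> \<alpha>" "\<alpha> \<le> R" using kT R(2) by (auto simp: \<alpha>_def)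
  have y\<alpha>: "y = uu (\<sigma> * \<alpha>) ** g" using \<sigma> by (auto simp: y_def y0_def \<alpha>_def matrix_mul_assoc uu_add)
  have "\<exists>s \<phi>. \<exists>n::int \<Rightarrow> nat. real S / 10 \<le> s \<and> s \<le> 10 * real S \<and>
     (\<forall>j. 0 \<le> \<phi> + s * of_int j \<longrightarrow> \<phi> + s * of_int j \<le> real S ^ 40 \<longrightarrow>
        n j \<ge> 1 \<and> \<bar>\<sigma> * (real (n j) powr (1 + \<gamma>) - \<alpha>) - (\<phi> + s * of_int j)\<bar> \<le> 12 / real S)"
    using \<gamma> \<sigma> w w200 Sw \<alpha> RN unfolding w_def by (intro powers_almost_progression[where N = N]) auto
  then obtain s \<phi> and n :: "int \<Rightarrow> nat" where s: "real S / 10 \<le> s" "s \<le> 10 * real S"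
    and n: "\<And>j. 0 \<le> \<phi> + s * of_int j \<Longrightarrow> \<phi> + s * of_int j \<le> real S ^ 40 \<Longrightarrow>
        n j \<ge> 1 \<and> \<bar>\<sigma> * (real (n j) powr (1 + \<gamma>) - \<alpha>) - (\<phi> + s * of_int j)\<bar> \<le> 12 / real S" by blast
  define p where "p j = \<sigma> * (real (n j) powr (1 + \<gamma>) - \<alpha>)" for j
  have "12 \<le> w * e0" using w(3) e0 by (simp add: pos_divide_le_eq)
  hence we: "12 / real S \<le> e0" using w(1) by (simp add: w_def pos_divide_le_eq mult.commute)
  have "\<exists>j::int. 0 \<le> \<phi> + s * of_int j \<and> \<phi> + s * of_int j \<le> real S ^ 40 \<and> uu (p j) ** y \<in> U"
  proof (rule S0[rule_format])
    show "S0 \<le> S" using w(2) by (simp add: w_def)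
    show "y \<in> SL2" using y0 by (simp add: y_def)
    show "thick \<epsilon> (dg (1 / sqrt (real S ^ 40)) ** y)" using k(3) by (simp add: y_def T_def w_def)
    show "\<bar>p j - (\<phi> + s * real_of_int j)\<bar> \<le> e0" if "0 \<le> \<phi> + s * real_of_int j" "\<phi> + s * real_of_int j \<le> real S ^ 40" for j
      using n[OF that] we unfolding p_def by linarith
  qed (use s in auto)
  then obtain j :: int where j: "0 \<le> \<phi> + s * of_int j" "\<phi> + s * of_int j \<le> real S ^ 40" "uu (p j) ** y \<in> U" by blast
  have "uu (p j) ** y = uu (\<sigma> * real (n j) powr (1 + \<gamma>)) ** g"
    by (simp add: y\<alpha> p_def matrix_mul_assoc uu_add algebra_simps)
  thus ?thesis using j(3) n[OF j(1,2)] by (intro exI[of _ "n j"]) auto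
qed

end

section \<open>One-parameter unipotent subgroups and the coset space\<close>

lemma additive_continuous_real_linear:
  fixes f :: "real \<Rightarrow> real"
  assumes add: "\<And>x y. f (x + y) = f x + f y" and cont: "continuous_on UNIV f"
  shows "f t = t * f 1"
proof -
  have f0: "f 0 = 0" using add[of 0 0] by simp
  have neg: "f (- x) = - f x" for x using add[of x "- x"] f0 by simp
  have nat: "f (real n * x) = real n * f x" for n x
    by (induction n) (simp_all add: f0 add distrib_right)
  have int: "f (of_int a * x) = of_int a * f x" for a x
    by (cases a rule: int_cases2) (simp_all add: nat neg)
  have rat: "f x = x * f 1" if "x \<in> \<rat>" for x
    using that
  proof (cases rule: Rats_cases')
    case (1 a b)
    have bx: "of_int b * x = of_int a * 1" using 1 by simp
    have "of_int b * f x = f (of_int b * x)" by (rule int[symmetric])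
    also have "\<dots> = of_int b * x * f 1" unfolding bx by (subst int) simp
    finally have "of_int b * f x = of_int b * (x * f 1)" by (simp only: mult.assoc)
    moreover have "(of_int b :: real) \<noteq> 0" using 1 by simp
    ultimately show ?thesis using mult_left_cancel by blast
  qed
  have "closed {t. f t = t * f 1}" using cont by (intro closed_Collect_eq continuous_intros) auto
  moreover have "\<rat> \<subseteq> {t. f t = t * f 1}" using rat by blast
  ultimately have "closure \<rat> \<subseteq> {t. f t = t * f 1}" using closure_minimal by blast
  moreover have "t \<in> closure \<rat>" by (simp add: Rats_closure_real)
  ultimately show ?thesis by blast
qed

text \<open>A complex root of the characteristic polynomial z^2 - t z + 1 exists and must be 1,
  which says t = 2.\<close>

lemma unipotent_trace:
  assumes "A \<in> SL2" "unipotent A" shows "A $ 1 $ 1 + A $ 2 $ 2 = 2"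
proof -
  obtain a b c d where A: "A = mat2 a b c d" "a * d - b * c = 1" using assms(1) SL2_cases by blast
  define t where "t = complex_of_real (a + d)"
  define z where "z = (t + csqrt (t\<^sup>2 - 4)) / 2"
  have "2 * z = t + csqrt (t\<^sup>2 - 4)" by (simp add: z_def)
  hence "2 * z - t = csqrt (t\<^sup>2 - 4)" by simp
  hence "(2 * z - t)\<^sup>2 - (t\<^sup>2 - 4) = 0" by simp
  moreover have "(2 * z - t)\<^sup>2 - (t\<^sup>2 - 4) = 4 * (z * z - t * z + 1)" by (simp add: power2_eq_square algebra_simps)
  ultimately have "4 * (z * z - t * z + 1) = 0" by (simp only:)
  hence z2: "z * z - t * z + 1 = 0" by (metis mult_eq_0_iff zero_neq_numeral)
  have det1: "complex_of_real a * complex_of_real d - complex_of_real b * complex_of_real c = 1"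
    using A(2) by (metis of_real_1 of_real_diff of_real_mult)
  have "det ((\<chi> i j. (if i = j then z else 0) - complex_of_real (A $ i $ j)) :: complex^2^2) =
      (z - a) * (z - d) - (- complex_of_real b) * (- complex_of_real c)"
    by (simp add: det_2 A)
  also have "\<dots> = z * z - t * z + (complex_of_real a * complex_of_real d - complex_of_real b * complex_of_real c)"
    by (simp add: t_def algebra_simps)
  also have "\<dots> = 0" using z2 by (simp only: det1)
  finally have "z = 1" using assms(2) unfolding unipotent_def by blast
  hence "t = 2" using z2 by simp
  hence "a + d = 2" unfolding t_def by (metis of_real_eq_iff of_real_numeral)
  thus ?thesis by (simp add: A)
qed

text \<open>The matrices \<open>u t - 1\<close> are nilpotent, and since \<open>u s ** u t\<close> has trace 2 too, the products
  \<open>(u s - 1) ** (u t - 1)\<close> vanish; hence \<open>u t - 1\<close> is additive, so linear, in \<open>t\<close>.\<close>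

lemma one_param_unipotent_linear:
  assumes u: "one_param_unipotent u"
  obtains \<alpha> \<beta> \<kappa> where "\<And>t. u t = mat2 (1 + t * \<alpha>) (t * \<beta>) (t * \<kappa>) (1 - t * \<alpha>)" "\<alpha> * \<alpha> + \<beta> * \<kappa> = 0"
proof -
  have c: "continuous_on UNIV u" and S: "\<And>t. u t \<in> SL2" and m: "\<And>s t. u (s + t) = u s ** u t"
    and up: "\<And>t. unipotent (u t)" using u by (auto simp: one_param_unipotent_def)
  define a where "a t = u t $ 1 $ 1 - 1" for t
  define b where "b t = u t $ 1 $ 2" for t
  define k where "k t = u t $ 2 $ 1" for t
  have e: "u t = mat2 (1 + a t) (b t) (k t) (1 - a t)" for t
    using unipotent_trace[OF S up, of t] by (intro mat2_eqI) (auto simp: a_def b_def k_def)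
  have d: "a t * a t = - (b t * k t)" for t using S[of t] by (simp add: e[of t] algebra_simps)
  have ms: "1 + a (s + t) = (1 + a s) * (1 + a t) + b s * k t" "b (s + t) = (1 + a s) * b t + b s * (1 - a t)"
    "k (s + t) = k s * (1 + a t) + (1 - a s) * k t" "1 - a (s + t) = k s * b t + (1 - a s) * (1 - a t)" for s t
    using m[of s t] by (simp_all add: e)
  have tr: "2 * (a s * a t) + b s * k t + k s * b t = 0" for s t
    using ms(1)[of s t] ms(4)[of s t] by (simp add: algebra_simps)
  have z1: "a s * b t = b s * a t" for s t
  proof -
    have "(a s * b t - b s * a t)\<^sup>2 = (a s * a s) * (b t)\<^sup>2 - (2 * (a s * a t)) * (b s * b t) + (b s)\<^sup>2 * (a t * a t)"
      by (simp add: power2_eq_square algebra_simps)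
    also have "2 * (a s * a t) = - (b s * k t + k s * b t)" using tr[of s t] by linarith
    also have "(a s * a s) * (b t)\<^sup>2 - - (b s * k t + k s * b t) * (b s * b t) + (b s)\<^sup>2 * (a t * a t) = 0"
      unfolding d by (simp add: power2_eq_square algebra_simps)
    finally show ?thesis by simp
  qed
  have z2: "k s * a t = a s * k t" for s t
  proof -
    have "(k s * a t - a s * k t)\<^sup>2 = (a s * a s) * (k t)\<^sup>2 - (2 * (a s * a t)) * (k s * k t) + (k s)\<^sup>2 * (a t * a t)"
      by (simp add: power2_eq_square algebra_simps)
    also have "2 * (a s * a t) = - (b s * k t + k s * b t)" using tr[of s t] by linarith
    also have "(a s * a s) * (k t)\<^sup>2 - - (b s * k t + k s * b t) * (k s * k t) + (k s)\<^sup>2 * (a t * a t) = 0"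
      unfolding d by (simp add: power2_eq_square algebra_simps)
    finally show ?thesis by simp
  qed
  have z3: "a s * a t + b s * k t = 0" for s t
  proof -
    define x where "x = a s * a t + b s * k t"
    have x2: "x = - (a s * a t + k s * b t)" using tr[of s t] unfolding x_def by linarith
    have "x * x = - ((a s * a t + b s * k t) * (a s * a t + k s * b t))"
      by (subst (2) x2) (simp add: x_def algebra_simps)
    also have "\<dots> = - ((a s * a s) * (a t * a t) + a s * a t * (b s * k t + k s * b t) + (b s * k s) * (b t * k t))"
      by (simp add: algebra_simps)
    also have "b s * k t + k s * b t = - (2 * (a s * a t))" using tr[of s t] by linarith
    also have "- ((a s * a s) * (a t * a t) + a s * a t * (- (2 * (a s * a t))) + (b s * k s) * (b t * k t)) =
        (a s * a s) * (a t * a t) - (b s * k s) * (b t * k t)" by (simp add: algebra_simps)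
    also have "\<dots> = 0" unfolding d by simp
    finally show ?thesis by (simp add: x_def)
  qed
  have add: "a (s + t) = a s + a t" "b (s + t) = b s + b t" "k (s + t) = k s + k t" for s t
    using ms(1,2,3)[of s t] z1[of s t] z2[of s t] z3[of s t] by (simp_all add: algebra_simps)
  have "continuous_on UNIV a" "continuous_on UNIV b" "continuous_on UNIV k"
    unfolding a_def b_def k_def by (intro continuous_intros c)+
  hence l: "a t = t * a 1" "b t = t * b 1" "k t = t * k 1" for t
    using additive_continuous_real_linear add by metis+
  show ?thesis
  proof (rule that)
    show "u t = mat2 (1 + t * a 1) (t * b 1) (t * k 1) (1 - t * a 1)" for t
      using e[of t] l[of t] by simp
    show "a 1 * a 1 + b 1 * k 1 = 0" using d[of 1] by simp
  qed
qed

text \<open>The generator is nilpotent of rank one; scaled suitably, a kernel vector (p, r) gives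
  its entries as products of p and r up to one common sign, and becomes the first column of h.
  Conjugation in \<open>SL2\<close> cannot remove that sign, hence \<sigma>.\<close>

lemma one_param_unipotent_conj:
  assumes u: "one_param_unipotent u" and n: "u 1 \<noteq> mat 1"
  obtains h \<sigma> where "h \<in> SL2" "\<sigma> = 1 \<or> \<sigma> = -1" "\<And>t. u t = h ** uu (\<sigma> * t) ** iv h"
proof -
  obtain \<alpha> \<beta> \<kappa> where e: "\<And>t. u t = mat2 (1 + t * \<alpha>) (t * \<beta>) (t * \<kappa>) (1 - t * \<alpha>)" and d: "\<alpha> * \<alpha> + \<beta> * \<kappa> = 0"
    using one_param_unipotent_linear[OF u] by blast
  have main: "u t = mat2 p q r w ** uu (\<sigma> * t) ** iv (mat2 p q r w)"
    if "p * w - q * r = 1" "\<sigma> * (p * p) = \<beta>" "\<sigma> * (r * r) = - \<kappa>" "\<sigma> * (p * r) = - \<alpha>" for p q r w \<sigma> t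
  proof -
    have "mat2 p q r w ** uu (\<sigma> * t) ** iv (mat2 p q r w) =
        mat2 ((p * w - q * r) - t * (\<sigma> * (p * r))) (t * (\<sigma> * (p * p))) (- t * (\<sigma> * (r * r))) ((p * w - q * r) + t * (\<sigma> * (p * r)))"
      by (simp add: uu_def algebra_simps)
    thus ?thesis unfolding that e by simp
  qed
  show ?thesis
  proof (cases "\<beta> = 0")
    case True
    hence a: "\<alpha> = 0" using d by simp
    hence k: "\<kappa> \<noteq> 0" using n True by (auto simp: e mat_1_mat2)
    define r where "r = sqrt \<bar>\<kappa>\<bar>"
    have r: "r > 0" "r * r = \<bar>\<kappa>\<bar>" using k by (auto simp: r_def)
    show ?thesis
      by (rule that[OF _ _ main[of 0 0 "- 1 / r" r "- sgn \<kappa>"]])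
        (use r k True a in \<open>auto simp: sgn_if\<close>)
  next
    case False
    define p where "p = sqrt \<bar>\<beta>\<bar>"
    have p: "p > 0" "p * p = \<bar>\<beta>\<bar>" using False by (auto simp: p_def)
    define \<sigma> where "\<sigma> = sgn \<beta>"
    have \<sigma>: "\<sigma> = 1 \<or> \<sigma> = -1" "\<sigma> * \<bar>\<beta>\<bar> = \<beta>" "\<sigma> * \<sigma> = 1" using False by (auto simp: \<sigma>_def sgn_if)
    define r where "r = - \<sigma> * \<alpha> / p"
    have pr: "\<sigma> * (p * r) = - \<alpha>" using p(1) \<sigma>(3) by (simp add: r_def mult.assoc[symmetric])
    have "\<sigma> * (r * r) * (p * p) = \<sigma> * ((p * r) * (p * r))" by (simp add: algebra_simps)
    also have "\<dots> = \<sigma> * ((\<sigma> * (p * r)) * (\<sigma> * (p * r)))" using \<sigma>(1) by auto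
    also have "\<dots> = \<sigma> * (\<alpha> * \<alpha>)" unfolding pr by simp
    also have "\<alpha> * \<alpha> = - (\<beta> * \<kappa>)" using d by linarith
    also have "\<sigma> * - (\<beta> * \<kappa>) = - \<kappa> * (p * p)" using \<sigma>(1,2) unfolding p(2) by auto
    finally have "\<sigma> * (r * r) * (p * p) = - \<kappa> * (p * p)" .
    hence rr: "\<sigma> * (r * r) = - \<kappa>" by (subst (asm) mult_right_cancel) (use p(1) in auto)
    show ?thesis
      by (rule that[OF _ \<sigma>(1) main[of p "1 / p" 0 r \<sigma>]])
        (use p \<sigma> pr rr in auto)
  qed
qed

context lattice
begin

section \<open>The coset space and density\<close>

lemma lcoset_rmult: "\<gamma> \<in> \<Gamma> \<Longrightarrow> lcoset (x ** \<gamma>) \<Gamma> = lcoset x \<Gamma>"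
proof -
  assume g: "\<gamma> \<in> \<Gamma>"
  have "lcoset x \<Gamma> \<subseteq> lcoset (x ** \<gamma>) \<Gamma>"
  proof
    fix y assume "y \<in> lcoset x \<Gamma>"
    then obtain h where h: "h \<in> \<Gamma>" "y = x ** h" by (auto simp: lcoset_def)
    have "y = x ** \<gamma> ** (iv \<gamma> ** h)" using h g \<Gamma>_SL2 by (simp add: matrix_mul_assoc[symmetric])
    thus "y \<in> lcoset (x ** \<gamma>) \<Gamma>" using \<Gamma>_mult[OF \<Gamma>_iv[OF g] h(1)] by (auto simp: lcoset_def)
  qed
  moreover have "lcoset (x ** \<gamma>) \<Gamma> \<subseteq> lcoset x \<Gamma>"
    using \<Gamma>_mult[OF g] by (auto simp: lcoset_def matrix_mul_assoc[symmetric])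
  ultimately show ?thesis by blast
qed

lemma act_lcoset: "act A (lcoset g \<Gamma>) = lcoset (A ** g) \<Gamma>"
  by (simp add: act_def lcoset_def image_image matrix_mul_assoc)

text \<open>\<open>coset_top\<close> is made by the abstraction \<open>topology\<close>, so its open
  sets are known only once the quotient condition is shown to satisfy
  \<open>istopology\<close>.\<close>

lemma openin_coset_top:
  "openin (coset_top \<Gamma>) U \<longleftrightarrow> U \<subseteq> cosets \<Gamma> \<and> openin (top_of_set SL2) {g \<in> SL2. lcoset g \<Gamma> \<in> U}"
proof -
  have "istopology (\<lambda>U. U \<subseteq> cosets \<Gamma> \<and> openin (top_of_set SL2) {g \<in> SL2. lcoset g \<Gamma> \<in> U})"
    unfolding istopology_def
  proof (intro conjI allI impI)
    fix A B assume "A \<subseteq> cosets \<Gamma> \<and> openin (top_of_set SL2) {g \<in> SL2. lcoset g \<Gamma> \<in> A}"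
      "B \<subseteq> cosets \<Gamma> \<and> openin (top_of_set SL2) {g \<in> SL2. lcoset g \<Gamma> \<in> B}"
    moreover have "{g \<in> SL2. lcoset g \<Gamma> \<in> A \<inter> B} = {g \<in> SL2. lcoset g \<Gamma> \<in> A} \<inter> {g \<in> SL2. lcoset g \<Gamma> \<in> B}" by auto
    ultimately show "A \<inter> B \<subseteq> cosets \<Gamma>" "openin (top_of_set SL2) {g \<in> SL2. lcoset g \<Gamma> \<in> A \<inter> B}"
      by (auto intro: openin_Int)
  next
    fix K assume K: "\<forall>A\<in>K. A \<subseteq> cosets \<Gamma> \<and> openin (top_of_set SL2) {g \<in> SL2. lcoset g \<Gamma> \<in> A}"
    have "{g \<in> SL2. lcoset g \<Gamma> \<in> \<Union>K} = (\<Union>A\<in>K. {g \<in> SL2. lcoset g \<Gamma> \<in> A})" by auto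
    thus "\<Union>K \<subseteq> cosets \<Gamma>" "openin (top_of_set SL2) {g \<in> SL2. lcoset g \<Gamma> \<in> \<Union>K}" using K by auto
  qed
  thus ?thesis unfolding coset_top_def by simp
qed

text \<open>Conjugation by h replaces u by \<open>uu\<close> with a sign and g by
  \<open>iv h ** g\<close>; nonperiodicity of p says that the new stabiliser contains no nontrivial
  \<open>uu t\<close>. An open set of cosets pulls back to an open right invariant set, which
  \<open>sparse_orbit_hits\<close> reaches.\<close>

lemma sparse_orbit_dense:
  assumes \<gamma>: "0 < \<gamma>" "\<gamma> < 1/1000" and u: "one_param_unipotent u" and p: "p \<in> cosets \<Gamma>" "\<not> periodic_pt u p"
  shows "(coset_top \<Gamma>) closure_of {act (u (real n powr (1 + \<gamma>))) p | n::nat. n \<ge> 1} = topspace (coset_top \<Gamma>)"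
proof -
  obtain g where g: "g \<in> SL2" "p = lcoset g \<Gamma>" using p(1) by (auto simp: cosets_def)
  have "u 1 \<noteq> mat 1"
  proof
    assume "u 1 = mat 1"
    hence "act (u 1) p = p" by (simp add: g(2) act_lcoset)
    thus False using p(2) unfolding periodic_pt_def by (metis zero_neq_one)
  qed
  then obtain h \<sigma> where h: "h \<in> SL2" and \<sigma>: "\<sigma> = 1 \<or> \<sigma> = -1" and uh: "\<And>t. u t = h ** uu (\<sigma> * t) ** iv h"
    using one_param_unipotent_conj[OF u] by metis
  define g' where "g' = iv h ** g"
  have g'S: "g' \<in> SL2" using g h by (simp add: g'_def)
  have hg: "h ** g' = g" using h by (simp add: g'_def)
  have np: "uu t \<notin> conj_grp g'" if t: "t \<noteq> 0" for t
  proof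
    assume "uu t \<in> conj_grp g'"
    then obtain \<delta> where \<delta>: "\<delta> \<in> \<Gamma>" "uu t = g' ** \<delta> ** iv g'" by (auto simp: conj_grp_def)
    have st: "\<sigma> * (\<sigma> * t) = t" using \<sigma> by auto
    have "u (\<sigma> * t) ** g = h ** uu t ** g'" unfolding uh st by (simp add: g'_def matrix_mul_assoc)
    also have "\<dots> = h ** (g' ** \<delta> ** iv g' ** g')" by (simp only: \<delta>(2) matrix_mul_assoc)
    also have "\<dots> = h ** g' ** \<delta>" using g'S by (simp add: matrix_mul_assoc)
    finally have "u (\<sigma> * t) ** g = g ** \<delta>" by (simp only: hg)
    hence "act (u (\<sigma> * t)) p = p" by (simp add: g(2) act_lcoset lcoset_rmult[OF \<delta>(1)])
    moreover have "\<sigma> * t \<noteq> 0" using t \<sigma> by auto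
    ultimately show False using p(2) unfolding periodic_pt_def by blast
  qed
  have hit: "\<exists>n::nat. n \<ge> 1 \<and> act (u (real n powr (1 + \<gamma>))) p \<in> V"
    if V: "openin (coset_top \<Gamma>) V" "x \<in> V" for V x
  proof -
    have Vo: "V \<subseteq> cosets \<Gamma>" "openin (top_of_set SL2) {g \<in> SL2. lcoset g \<Gamma> \<in> V}" using V openin_coset_top by auto
    obtain W where W: "open W" "{g \<in> SL2. lcoset g \<Gamma> \<in> V} = SL2 \<inter> W" using Vo(2) unfolding openin_open by (elim exE conjE)
    define W' where "W' = (\<lambda>y. h ** y) -` W"
    have "continuous_on UNIV (\<lambda>y::real^2^2. h ** y)" by (intro continuous_intros)
    hence W': "open W'" using W(1) by (simp add: W'_def continuous_on_open_vimage)
    define U where "U = SL2 \<inter> W'"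
    have Uiff: "y \<in> U \<longleftrightarrow> y \<in> SL2 \<and> lcoset (h ** y) \<Gamma> \<in> V" for y
    proof -
      have "z \<in> SL2 \<Longrightarrow> lcoset z \<Gamma> \<in> V \<longleftrightarrow> z \<in> W" for z using W(2) by blast
      from this[of "h ** y"] show ?thesis using h by (auto simp: U_def W'_def)
    qed
    have "rinv U" unfolding rinv_def
    proof (intro conjI ballI)
      fix y \<delta> assume y: "y \<in> U" "\<delta> \<in> \<Gamma>"
      have "lcoset (h ** (y ** \<delta>)) \<Gamma> = lcoset (h ** y) \<Gamma>" using lcoset_rmult[OF y(2)] by (simp only: matrix_mul_assoc)
      thus "y ** \<delta> \<in> U" using y \<Gamma>_SL2 by (simp add: Uiff)
    qed (simp add: U_def)
    moreover have "U \<noteq> {}"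
    proof -
      obtain y where y: "y \<in> SL2" "x = lcoset y \<Gamma>" using V(2) Vo(1) by (auto simp: cosets_def)
      hence "iv h ** y \<in> U" using h V(2) by (simp add: Uiff)
      thus ?thesis by blast
    qed
    ultimately obtain n :: nat where n: "n \<ge> 1" "uu (\<sigma> * real n powr (1 + \<gamma>)) ** g' \<in> U"
      using sparse_orbit_hits[OF g'S np W' U_def _ _ \<sigma> \<gamma>] by blast
    have "act (u (real n powr (1 + \<gamma>))) p = lcoset (h ** (uu (\<sigma> * real n powr (1 + \<gamma>)) ** g')) \<Gamma>"
      by (simp add: g(2) act_lcoset uh g'_def matrix_mul_assoc)
    thus ?thesis using n Uiff by auto
  qed
  show ?thesis
  proof (rule antisym[OF closure_of_subset_topspace], rule subsetI)
    fix x assume x: "x \<in> topspace (coset_top \<Gamma>)"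
    show "x \<in> (coset_top \<Gamma>) closure_of {act (u (real n powr (1 + \<gamma>))) p | n::nat. n \<ge> 1}"
      unfolding in_closure_of
    proof (intro conjI allI impI x)
      fix V assume "x \<in> V \<and> openin (coset_top \<Gamma>) V"
      then obtain n :: nat where "n \<ge> 1" "act (u (real n powr (1 + \<gamma>))) p \<in> V" using hit by blast
      thus "\<exists>y. y \<in> {act (u (real n powr (1 + \<gamma>))) p | n::nat. n \<ge> 1} \<and> y \<in> V" by blast
    qed
  qed
qed

end

theorem theorem1p1:
  fixes \<Gamma> :: "(real^2^2) set"
  assumes "nonuniform_lattice_PSL2 \<Gamma>"
  shows "\<exists>\<gamma>0>0. \<forall>\<gamma> u p. 0 < \<gamma> \<and> \<gamma> < \<gamma>0 \<and> one_param_unipotent u \<and>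
           p \<in> cosets \<Gamma> \<and> \<not> periodic_pt u p \<longrightarrow>
           (coset_top \<Gamma>) closure_of {act (u (real n powr (1 + \<gamma>))) p | n::nat. n \<ge> 1}
             = topspace (coset_top \<Gamma>)"
proof -
  interpret lattice \<Gamma> by standard (use assms in \<open>auto simp: nonuniform_lattice_PSL2_def\<close>)
  \<comment> \<open>The bound on \<gamma> under which \<open>sparse_orbit_hits\<close> obtains S^200
    \<le> N.\<close>
  have "(1/1000::real) > 0" by simp
  thus ?thesis using sparse_orbit_dense by blast
qed

end
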